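(* Let $p\ge q\ge0$. A nonsplitting MASA of $e(p,q)$ must contain a MANS of $o(p_0+k_0,q_0+k_0)$ with $1\le k_0\le q$, $\min(p_0+k_0,q_0+k_0)\ge1$. All nonsplitting MASAs of $e(p_0+k_0,q_0+k_0)$ for which the projection onto $o(p_0+k_0,q_0+k_0)$ is a free-rowed MANS $N$ with Kravchuk signature $(k_0\;\mu\;k_0)$, $\mu=p_0+q_0$, can be represented (up to $E(p_0+k_0,q_0+k_0)$-conjugation) by the matrix sets $\{X_e,K_e\}$, $$X_e=\begin{pmatrix}0_{k_0}&A&Y&z^T\\ 0&0&-K_{p_0,q_0}A^T&\beta^T\\ 0&0&0_{k_0}&\gamma^T\\ 0&0&0&0\end{pmatrix},\qquad K_e=\begin{pmatrix}&&I_{k_0}&\\ &K_{p_0,q_0}&&\\ I_{k_0}&&&\\ &&&0_1\end{pmatrix},$$ $$A=\begin{pmatrix}\alpha Q_1\\ \alpha Q_2\\ \vdots\\ \alpha Q_{k_0}\end{pmatrix},\qquad \alpha\in\mathbb R^{1\times\mu},\quad Y=-Y^T\in\mathbb R^{k_0\times k_0},\quad z\in\mathbb R^{1\times k_0},$$ where the entries of $\alpha$, $Y$, $z$ are free, $Q_1=I,Q_2,\dots,Q_{k_0}$ are the fixed matrices characterizing the free-rowed MANS $N$, and $\beta\in\mathbb R^{1\times\mu}$, $\gamma\in\mathbb R^{1\times k_0}$ are as follows. 1. $k_0\ge3$: $\beta=\alpha\Lambda$, $\gamma=0$, where $\Lambda\in\mathbb R^{\mu\times\mu}$ satisfies $$\Lambda=\Lambda^T,\qquad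 Q_j\Lambda K_{p_0,q_0}^{-1}=\Lambda K_{p_0,q_0}^{-1}Q_j\quad\text{for all } j. \qquad( * )$$ 2. $k_0=2$, $\mu\ge2$ (write $Q=Q_2$ and $Y=\begin{pmatrix}0&y\\ -y&0\end{pmatrix}$): $\Lambda$ satisfies $( * )$ for $j=2$, and $$\beta=\alpha\Lambda+y\rho,\qquad \gamma^T=\begin{pmatrix}0\\ \alpha\rho^T\end{pmatrix},\qquad \rho=(1,0,\dots,0)$$ when $$Q=\begin{pmatrix}0&1&&\\ &0&&\\ &&\ddots&\\ &&&0\end{pmatrix},\qquad K_{p_0,q_0}=\begin{pmatrix}0&1&\\ 1&0&\\ &&K_{p_0-1,q_0-1}\end{pmatrix}$$ (the only nonzero entry of $Q$ being $Q_{12}=1$); for all other $Q$, $$\beta=\alpha\Lambda,\qquad\gamma^T=\begin{pmatrix}0\\ 0\end{pmatrix}.$$ 3. $k_0=2$, $\mu=1$ (write $\alpha=a\in\mathbb R$, and $Y$ as in 2): $$\beta=y\rho,\qquad\gamma^T=\begin{pmatrix}0\\ a\rho+p_2y\end{pmatrix},$$ where $(\rho,p_2)\in\mathbb R^2$ is $(1,0)$, $(0,1)$ or $(1,1)$. 4. $k_0=2$, $\mu=0$ ($Y$ as in 2): there is no $\beta$ and $\gamma^T=\begin{pmatrix}y\\ 0\end{pmatrix}$. 5. $k_0=1$, $\mu\ge2$: $\beta=\alpha\Lambda$, $\Lambda=\Lambda^T\in\mathbb R^{\mu\times\mu}$, $\gamma=0$. 6. $k_0=1$, $\mu=1$ (write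 $\alpha=a\in\mathbb R$): $\beta=0$, $\gamma=a$. The case $k_0=1$, $\mu=0$ is not allowed. Moreover, in cases 1 and 5, two such nonsplitting MASAs $M(p_0,q_0,k_0,\Lambda)$ and $M'(p_0,q_0,k_0,\Lambda')$ (with the same $K_{p_0,q_0}$ and the same $Q_1,\dots,Q_{k_0}$) are $E(p_0+k_0,q_0+k_0)$-conjugate if $$\Lambda'=\frac1{g_1}\,G_2\Big(\Lambda-\sum_{k=1}^{k_0}\theta_kQ_kK_{p_0,q_0}\Big)G_2^T$$ for some nonzero $g_1,\dots,g_{k_0}\in\mathbb R$, some $\theta_1,\dots,\theta_{k_0}\in\mathbb R$ and some $G_2\in O(p_0,q_0)$ (i.e. $G_2K_{p_0,q_0}G_2^T=K_{p_0,q_0}$) such that $$Q_j=\frac{g_j}{g_1}\,G_2Q_jG_2^{-1}\qquad\text{for all } j.$$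
   Context: **The algebra and the group.** For an invertible symmetric real matrix $K$ of signature $(p,q)$ ($p$ positive and $q$ negative eigenvalues), $n=p+q$: - $o(p,q)=\{X\in\mathbb R^{n\times n}: XK+KX^T=0\}$ and $O(p,q)=\{G: GKG^T=K\}$. - $e(p,q)$ is the semidirect sum of $o(p,q)$ and the abelian ideal $T(n)$ of translations. It is realized by the matrices $\begin{pmatrix}X&\alpha^T\\ 0&0\end{pmatrix}$ with $X\in o(p,q)$, $\alpha\in\mathbb R^{1\times n}$; $T(n)$ consists of those with $X=0$. - $E(p,q)$ is the group of matrices $\begin{pmatrix}G&a^T\\ 0&1\end{pmatrix}$ with $G\in O(p,q)$, $a\in\mathbb R^{1\times n}$, acting on $e(p,q)$ by conjugation. Subalgebras are described by "matrix sets" $\{X_e,K_e\}$: a linear set of matrices together with the extended metric $K_e=\mathrm{diag}(K,0_1)$ used to realize $e(p,q)$. $0_m$ is the $m\times m$ zero matrix, and blank entries are zero. $K_{p_0,q_0}$ is a real symmetric matrix of signature $(p_0,q_0)$, of size $\mu=p_0+q_0$. **MASA.** A maximal abelian subalgebra of a Lie algebra $L$ is an abelian subalgebra equal to its own centralizer in $L$. **Splitting / nonsplitting.** An abelian subalgebra of $e(p,q)$ is splitting if it is (conjugate under $E(p,q)$ to) a direct sum $F_0\oplus N_0$ with $F_0\subseteq o(p,q)$, $N_0\subseteq T(n)$. Otherwise it is nonsplitting. **MANS.** A maximal abelian nilpotent subalgebra of $L$ is a MASA $M$ of $L$ such that $[[\dots[[L,M],M],\dots],M]=0$ for some finite number of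 brackets; it is represented by nilpotent matrices. **Kravchuk signature and normal form.** A MANS of $o(p',q')$ has Kravchuk signature $(\lambda\;\mu\;\lambda)$, $2\lambda+\mu=p'+q'$, where $\lambda$ is the dimension of its common kernel (equal to the codimension of its image). It can be brought to the form $$N=\begin{pmatrix}0&A&Y\\ 0&S&-\tilde KA^T\\ 0&0&0\end{pmatrix},\qquad K=\begin{pmatrix}&&I_\lambda\\ &\tilde K&\\ I_\lambda&&\end{pmatrix},$$ $A\in\mathbb R^{\lambda\times\mu}$, $Y=-Y^T$, $S$ nilpotent, $S\tilde K+\tilde KS^T=0$, $\tilde K=\tilde K^T$ of signature $(p'-\lambda,q'-\lambda)$. **Free-rowed MANS.** The MANS is free-rowed if the first row of $A$ has $\mu$ free real entries, all other entries of $A$ and $S$ depending linearly on them. A free-rowed MANS with signature $(\lambda\;\mu\;\lambda)$ can be represented with $S=0$, with the rows of $A$ equal to $\alpha Q_1,\dots,\alpha Q_\lambda$, with $\alpha\in\mathbb R^{1\times\mu}$ and $Y=-Y^T$ free, where the $Q_i\in\mathbb R^{\mu\times\mu}$ are fixed and satisfy $$Q_i\tilde K=\tilde KQ_i^T,\quad [Q_i,Q_j]=0,\quad Q_1=I,\quad \mathrm{Tr}\,Q_i=0\ (2\le i\le\lambda).$$ There is $\lambda_1$ with $1\le\lambda_1\le\lambda$ such that $Q_1,\dots,Q_{\lambda_1}$ are linearly independent and $Q_\nu=0$ for $\nu>\lambda_1$. For $\lambda=2$, $\mu\ge2$ one requires $Q_2\ne0$. For $\lambda=2$, $\mu=1$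 the "free-rowed MANS" is understood as the matrix set of this form with $A=\begin{pmatrix}a\\ 0\end{pmatrix}$ (no matrix $Q_2$). For $\lambda=2$, $\mu=0$ it is understood as the set with $Y$ only. **Canonical form of a MASA of $e(p,q)$.** A MASA of $e(p,q)$ is represented by matrices whose $o(p,q)$-part is block diagonal, $\mathrm{diag}(N,X_{p_1,q_1},\dots,X_{p_j,q_j},0_{k_+},0_{k_-})$, with metric $\mathrm{diag}(K_0,K_{p_1,q_1},\dots,K_{p_j,q_j},I_{k_+},-I_{k_-})$. Here: - $N$ is a MANS of $o(p_0+k_0,q_0+k_0)$ with Kravchuk signature $(k_0\;\,p_0+q_0\;\,k_0)$ (absent if $k_0=0$). - Each $X_{p_i,q_i}$ runs over a MASA of $o(p_i,q_i)$ that is not a MANS and is orthogonally indecomposable (i.e. it and its metric cannot be simultaneously block-diagonalized nontrivially). - $p=p_0+k_0+k_++\sum p_i$ and $q=q_0+k_0+k_-+\sum q_i$. "Contains a MANS of $o(p_0+k_0,q_0+k_0)$" means that the block $N$ is present.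
   Formalization: In case 2 the matrices Q, K are a suitably chosen pair characterizing N rather than fixed in advance (with Q=E12 fixed, γ=0 also occurs, so the dichotomy fails); the first claim is stated for MASAs that are given in the canonical form. *)

theory Defs
  imports
    "Jordan_Normal_Form.Char_Poly"
    "Jordan_Normal_Form.Gauss_Jordan_Elimination"
    "Jordan_Normal_Form.Matrix_Kernel"
begin

definition mat_inv :: "real mat \<Rightarrow> real mat" where
  "mat_inv A = the (mat_inverse A)"

text \<open>Eigenvalues are counted with algebraic multiplicity. As the size is \<open>p + q\<close>,
  zero is not an eigenvalue, so \<open>K\<close> is invertible.\<close>

definition has_signature :: "real mat \<Rightarrow> nat \<Rightarrow> nat \<Rightarrow> bool" where
  "has_signature K p q \<longleftrightarrow>
     K \<in> carrier_mat (p + q) (p + q) \<and> K\<^sup>T = K \<and>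
     (\<Sum>l | eigenvalue K l \<and> l > 0. Polynomial.order l (char_poly K)) = p \<and>
     (\<Sum>l | eigenvalue K l \<and> l < 0. Polynomial.order l (char_poly K)) = q"


subsection \<open>The algebras and groups\<close>

definition o_alg :: "real mat \<Rightarrow> real mat set" where
  "o_alg K = {X \<in> carrier_mat (dim_row K) (dim_row K).
                X * K + K * X\<^sup>T = 0\<^sub>m (dim_row K) (dim_row K)}"

definition O_grp :: "real mat \<Rightarrow> real mat set" where
  "O_grp K = {G \<in> carrier_mat (dim_row K) (dim_row K). G * K * G\<^sup>T = K}"

text \<open>The matrix with blocks \<open>X\<close>, \<open>a\<close> (as a column), \<open>0\<close>, \<open>c\<close>: \<open>c = 0\<close> for
  elements of the algebra, \<open>c = 1\<close> for elements of the group.\<close>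

definition ext_mat :: "real mat \<Rightarrow> real vec \<Rightarrow> real \<Rightarrow> real mat" where
  "ext_mat X a c =
     four_block_mat X (mat_of_cols (dim_vec a) [a]) (0\<^sub>m 1 (dim_col X)) (mat 1 1 (\<lambda>_. c))"

definition e_alg :: "real mat \<Rightarrow> real mat set" where
  "e_alg K = {ext_mat X a 0 | X a. X \<in> o_alg K \<and> a \<in> carrier_vec (dim_row K)}"

definition T_alg :: "nat \<Rightarrow> real mat set" where
  "T_alg n = {ext_mat (0\<^sub>m n n) a 0 | a. a \<in> carrier_vec n}"

definition E_grp :: "real mat \<Rightarrow> real mat set" where
  "E_grp K = {ext_mat G a 1 | G a. G \<in> O_grp K \<and> a \<in> carrier_vec (dim_row K)}"

definition conj_set :: "real mat \<Rightarrow> real mat set \<Rightarrow> real mat set" where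
  "conj_set P M = (\<lambda>X. P * X * mat_inv P) ` M"

definition E_conjugate :: "real mat \<Rightarrow> real mat set \<Rightarrow> real mat set \<Rightarrow> bool" where
  "E_conjugate K M M' \<longleftrightarrow> (\<exists>P\<in>E_grp K. M' = conj_set P M)"

definition o_proj :: "nat \<Rightarrow> real mat set \<Rightarrow> real mat set" where
  "o_proj n M = {X \<in> carrier_mat n n. \<exists>a\<in>carrier_vec n. ext_mat X a 0 \<in> M}"

text \<open>Equality of matrix sets (a linear set of matrices with its metric) up to a change of
  basis, which transforms the metric by congruence. If both metrics are \<open>K\<close>, then
  \<open>linearly_represented\<close> is conjugacy under \<open>O_grp K\<close> and \<open>represented\<close> is conjugacy
  under \<open>E_grp K\<close>.\<close>

definition linearly_represented ::
    "real mat \<Rightarrow> real mat set \<Rightarrow> real mat \<Rightarrow> real mat set \<Rightarrow> bool" where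
  "linearly_represented K N K' N' \<longleftrightarrow>
     (\<exists>G\<in>carrier_mat (dim_row K) (dim_row K).
        invertible_mat G \<and> K' = G * K * G\<^sup>T \<and> N' = conj_set G N)"

definition represented ::
    "real mat \<Rightarrow> real mat set \<Rightarrow> real mat \<Rightarrow> real mat set \<Rightarrow> bool" where
  "represented K M K' M' \<longleftrightarrow>
     (\<exists>G\<in>carrier_mat (dim_row K) (dim_row K). \<exists>a\<in>carrier_vec (dim_row K).
        invertible_mat G \<and> K' = G * K * G\<^sup>T \<and> M' = conj_set (ext_mat G a 1) M)"


subsection \<open>MASAs, splitting, MANSs\<close>

definition lie_bracket :: "real mat \<Rightarrow> real mat \<Rightarrow> real mat" where
  "lie_bracket A B = A * B - B * A"

definition mat_subspace :: "nat \<Rightarrow> real mat set \<Rightarrow> bool" where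
  "mat_subspace n M \<longleftrightarrow>
     M \<subseteq> carrier_mat n n \<and> 0\<^sub>m n n \<in> M \<and>
     (\<forall>A\<in>M. \<forall>B\<in>M. A + B \<in> M) \<and> (\<forall>c. \<forall>A\<in>M. c \<cdot>\<^sub>m A \<in> M)"

definition MASA :: "nat \<Rightarrow> real mat set \<Rightarrow> real mat set \<Rightarrow> bool" where
  "MASA n L M \<longleftrightarrow>
     mat_subspace n M \<and> M \<subseteq> L \<and> (\<forall>A\<in>M. \<forall>B\<in>M. lie_bracket A B = 0\<^sub>m n n) \<and>
     M = {X \<in> L. \<forall>A\<in>M. lie_bracket X A = 0\<^sub>m n n}"

definition e_MASA :: "real mat \<Rightarrow> real mat set \<Rightarrow> bool" where
  "e_MASA K M \<longleftrightarrow> MASA (dim_row K + 1) (e_alg K) M"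

definition splitting :: "real mat \<Rightarrow> real mat set \<Rightarrow> bool" where
  "splitting K M \<longleftrightarrow>
     (\<exists>F\<^sub>0 N\<^sub>0. mat_subspace (dim_row K + 1) F\<^sub>0 \<and> mat_subspace (dim_row K + 1) N\<^sub>0 \<and>
        F\<^sub>0 \<subseteq> {ext_mat X (0\<^sub>v (dim_row K)) 0 | X. X \<in> o_alg K} \<and>
        N\<^sub>0 \<subseteq> T_alg (dim_row K) \<and>
        E_conjugate K M {A + B | A B. A \<in> F\<^sub>0 \<and> B \<in> N\<^sub>0})"

definition nilpotent_mat :: "real mat \<Rightarrow> bool" where
  "nilpotent_mat A \<longleftrightarrow> (\<exists>m. A ^\<^sub>m m = 0\<^sub>m (dim_row A) (dim_row A))"

text \<open>Nilpotency of the matrices has to be required separately: \<open>o(2,0)\<close> and \<open>o(1,1)\<close> are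
  abelian, so the bracket condition holds for them, but their elements are not nilpotent.\<close>

definition MANS :: "nat \<Rightarrow> real mat set \<Rightarrow> real mat set \<Rightarrow> bool" where
  "MANS n L M \<longleftrightarrow>
     MASA n L M \<and>
     (\<exists>m. \<forall>X\<in>L. \<forall>As. set As \<subseteq> M \<and> length As = m \<longrightarrow> foldl lie_bracket X As = 0\<^sub>m n n) \<and>
     (\<forall>A\<in>M. nilpotent_mat A)"

definition common_kernel :: "nat \<Rightarrow> real mat set \<Rightarrow> real vec set" where
  "common_kernel n N = {v \<in> carrier_vec n. \<forall>X\<in>N. X *\<^sub>v v = 0\<^sub>v n}"

definition kravchuk_signature :: "nat \<Rightarrow> real mat set \<Rightarrow> nat \<Rightarrow> nat \<Rightarrow> bool" where
  "kravchuk_signature n N l m \<longleftrightarrow>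
     vectorspace.dim class_ring (module_vec TYPE(real) n\<lparr>carrier := common_kernel n N\<rparr>) = l \<and>
     2 * l + m = n"


subsection \<open>Kravchuk normal form and free-rowed MANSs\<close>

definition skew_mats :: "nat \<Rightarrow> real mat set" where
  "skew_mats k = {Y \<in> carrier_mat k k. Y\<^sup>T = - Y}"

definition kravchuk_mat :: "real mat \<Rightarrow> real mat \<Rightarrow> real mat \<Rightarrow> real mat \<Rightarrow> real mat" where
  "kravchuk_mat Kt A S Y =
     (let l = dim_row Y; m = dim_row Kt in
      four_block_mat
        (four_block_mat (0\<^sub>m l l) A (0\<^sub>m m l) S) (Y @\<^sub>r (- (Kt * A\<^sup>T)))
        (0\<^sub>m l (l + m)) (0\<^sub>m l l))"

definition kravchuk_metric :: "nat \<Rightarrow> real mat \<Rightarrow> real mat" where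
  "kravchuk_metric l Kt =
     (let m = dim_row Kt; J = 1\<^sub>m l @\<^sub>r 0\<^sub>m m l in
      four_block_mat (four_block_mat (0\<^sub>m l l) (0\<^sub>m l m) (0\<^sub>m m l) Kt) J J\<^sup>T (0\<^sub>m l l))"

text \<open>A row vector \<open>\<alpha> Q\<close> is written \<open>Q\<^sup>T *\<^sub>v \<alpha>\<close>. The matrices \<open>Q\<^sub>1, \<dots>, Q\<^sub>k\<close> are
  \<open>Q 0, \<dots>, Q (k - 1)\<close>; other values of \<open>Q\<close> are irrelevant.\<close>

definition row_mult :: "real vec \<Rightarrow> real mat \<Rightarrow> real vec" where
  "row_mult \<alpha> B = B\<^sup>T *\<^sub>v \<alpha>"

definition rows_mat :: "nat \<Rightarrow> (nat \<Rightarrow> real mat) \<Rightarrow> real vec \<Rightarrow> real mat" where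
  "rows_mat k Q \<alpha> = mat_of_rows (dim_vec \<alpha>) (map (\<lambda>i. row_mult \<alpha> (Q i)) [0..<k])"

definition lin_comb_mat :: "nat \<Rightarrow> nat \<Rightarrow> (nat \<Rightarrow> real) \<Rightarrow> (nat \<Rightarrow> real mat) \<Rightarrow> real mat" where
  "lin_comb_mat m k c B = mat m m (\<lambda>rs. \<Sum>i<k. c i * B i $$ rs)"

text \<open>In the normal form, \<open>Q\<close> and \<open>T\<close> express that \<open>A\<close> and \<open>S\<close> depend linearly on the first
  row \<open>\<alpha>\<close> of \<open>A\<close>; this row takes all values.\<close>

definition free_rowed_normal_form :: "nat \<Rightarrow> real mat \<Rightarrow> real mat set \<Rightarrow> bool" where
  "free_rowed_normal_form k Kt N \<longleftrightarrow>
     (\<exists>Q T. let m = dim_row Kt; S = (\<lambda>\<alpha>. lin_comb_mat m m (vec_index \<alpha>) T) in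
        (\<forall>i<k. Q i \<in> carrier_mat m m) \<and> Q 0 = 1\<^sub>m m \<and> (\<forall>j<m. T j \<in> carrier_mat m m) \<and>
        (\<forall>\<alpha>\<in>carrier_vec m. nilpotent_mat (S \<alpha>) \<and> S \<alpha> \<in> o_alg Kt) \<and>
        (\<forall>X\<in>N. \<exists>\<alpha>\<in>carrier_vec m. \<exists>Y\<in>skew_mats k.
           X = kravchuk_mat Kt (rows_mat k Q \<alpha>) (S \<alpha>) Y) \<and>
        (\<forall>\<alpha>\<in>carrier_vec m. \<exists>Y\<in>skew_mats k.
           kravchuk_mat Kt (rows_mat k Q \<alpha>) (S \<alpha>) Y \<in> N))"

text \<open>The sets that replace a free-rowed MANS for Kravchuk signatures \<open>(2 1 2)\<close> and
  \<open>(2 0 2)\<close>. They are not MASAs of \<open>o(p\<^sub>0 + 2, q\<^sub>0 + 2)\<close>.\<close>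

definition degenerate_MANS :: "real mat \<Rightarrow> real mat set \<Rightarrow> nat \<Rightarrow> nat \<Rightarrow> nat \<Rightarrow> bool" where
  "degenerate_MANS K N p\<^sub>0 q\<^sub>0 k \<longleftrightarrow>
     k = 2 \<and> p\<^sub>0 + q\<^sub>0 \<le> 1 \<and>
     (\<exists>Kt. has_signature Kt p\<^sub>0 q\<^sub>0 \<and>
        linearly_represented K N (kravchuk_metric 2 Kt)
          {kravchuk_mat Kt (mat 2 (p\<^sub>0 + q\<^sub>0) (\<lambda>(i, j). if i = 0 then a else 0))
             (0\<^sub>m (p\<^sub>0 + q\<^sub>0) (p\<^sub>0 + q\<^sub>0)) Y | a Y. Y \<in> skew_mats 2})"

definition free_rowed_MANS :: "real mat \<Rightarrow> real mat set \<Rightarrow> nat \<Rightarrow> nat \<Rightarrow> nat \<Rightarrow> bool" where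
  "free_rowed_MANS K N p\<^sub>0 q\<^sub>0 k \<longleftrightarrow>
     (if k = 2 \<and> p\<^sub>0 + q\<^sub>0 \<le> 1 then degenerate_MANS K N p\<^sub>0 q\<^sub>0 k
      else MANS (dim_row K) (o_alg K) N \<and> kravchuk_signature (dim_row K) N k (p\<^sub>0 + q\<^sub>0) \<and>
        (\<exists>Kt N'. has_signature Kt p\<^sub>0 q\<^sub>0 \<and>
           linearly_represented K N (kravchuk_metric k Kt) N' \<and>
           free_rowed_normal_form k Kt N'))"

text \<open>The conditions on the matrices characterizing a free-rowed MANS. For \<open>\<mu> = 0\<close> there are
  no such matrices, and linear independence of the empty matrix \<open>Q\<^sub>1\<close> would fail. For
  \<open>k = 2\<close>, \<open>\<mu> = 1\<close> the trace condition gives \<open>Q\<^sub>2 = 0\<close>.\<close>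

definition free_rowed_matrices :: "nat \<Rightarrow> real mat \<Rightarrow> (nat \<Rightarrow> real mat) \<Rightarrow> bool" where
  "free_rowed_matrices k Kt Q \<longleftrightarrow>
     (let m = dim_row Kt in
      (\<forall>i<k. Q i \<in> carrier_mat m m) \<and>
      (\<forall>i<k. Q i * Kt = Kt * (Q i)\<^sup>T) \<and>
      (\<forall>i<k. \<forall>j<k. lie_bracket (Q i) (Q j) = 0\<^sub>m m m) \<and>
      Q 0 = 1\<^sub>m m \<and>
      (\<forall>i. 1 \<le> i \<and> i < k \<longrightarrow> (\<Sum>r<m. Q i $$ (r, r)) = 0) \<and>
      (m \<ge> 1 \<longrightarrow> (\<exists>l. 1 \<le> l \<and> l \<le> k \<and>
         (\<forall>c. lin_comb_mat m l c Q = 0\<^sub>m m m \<longrightarrow> (\<forall>i<l. c i = 0)) \<and>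
         (\<forall>i. l \<le> i \<and> i < k \<longrightarrow> Q i = 0\<^sub>m m m))) \<and>
      (k = 2 \<and> m \<ge> 2 \<longrightarrow> Q 1 \<noteq> 0\<^sub>m m m))"

definition characterizes ::
    "real mat \<Rightarrow> real mat set \<Rightarrow> nat \<Rightarrow> nat \<Rightarrow> nat \<Rightarrow> real mat \<Rightarrow> (nat \<Rightarrow> real mat) \<Rightarrow> bool" where
  "characterizes K N p\<^sub>0 q\<^sub>0 k Kt Q \<longleftrightarrow>
     has_signature Kt p\<^sub>0 q\<^sub>0 \<and> free_rowed_matrices k Kt Q \<and>
     linearly_represented K N (kravchuk_metric k Kt)
       {kravchuk_mat Kt (rows_mat k Q \<alpha>) (0\<^sub>m (dim_row Kt) (dim_row Kt)) Y | \<alpha> Y.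
          \<alpha> \<in> carrier_vec (dim_row Kt) \<and> Y \<in> skew_mats k}"


subsection \<open>Canonical form of a MASA of \<open>e(p,q)\<close>\<close>

definition orth_indecomposable :: "real mat \<Rightarrow> real mat set \<Rightarrow> bool" where
  "orth_indecomposable K N \<longleftrightarrow>
     \<not> (\<exists>K\<^sub>1 K\<^sub>2 N' n\<^sub>1 n\<^sub>2. 1 \<le> n\<^sub>1 \<and> 1 \<le> n\<^sub>2 \<and>
          K\<^sub>1 \<in> carrier_mat n\<^sub>1 n\<^sub>1 \<and> K\<^sub>2 \<in> carrier_mat n\<^sub>2 n\<^sub>2 \<and>
          linearly_represented K N (diag_block_mat [K\<^sub>1, K\<^sub>2]) N' \<and>
          N' \<subseteq> {diag_block_mat [X\<^sub>1, X\<^sub>2] | X\<^sub>1 X\<^sub>2.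
                   X\<^sub>1 \<in> carrier_mat n\<^sub>1 n\<^sub>1 \<and> X\<^sub>2 \<in> carrier_mat n\<^sub>2 n\<^sub>2})"

text \<open>The block \<open>N\<close>, including the sets admitted in place of a MANS for Kravchuk signatures
  \<open>(2 1 2)\<close> and \<open>(2 0 2)\<close>.\<close>

definition MANS_block :: "real mat \<Rightarrow> real mat set \<Rightarrow> nat \<Rightarrow> nat \<Rightarrow> nat \<Rightarrow> bool" where
  "MANS_block K\<^sub>0 N p\<^sub>0 q\<^sub>0 k\<^sub>0 \<longleftrightarrow>
     has_signature K\<^sub>0 (p\<^sub>0 + k\<^sub>0) (q\<^sub>0 + k\<^sub>0) \<and>
     (MANS (dim_row K\<^sub>0) (o_alg K\<^sub>0) N \<and> kravchuk_signature (dim_row K\<^sub>0) N k\<^sub>0 (p\<^sub>0 + q\<^sub>0) \<or>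
      degenerate_MANS K\<^sub>0 N p\<^sub>0 q\<^sub>0 k\<^sub>0)"

text \<open>\<open>nb\<close> is the block \<open>N\<close> with its metric, \<open>None\<close> if absent; \<open>bs\<close> lists
  \<open>(p\<^sub>i, q\<^sub>i, K\<^sub>i, \<X>\<^sub>i)\<close>, where the block \<open>X\<^sub>i\<close> runs over \<open>\<X>\<^sub>i\<close>.\<close>

definition canonical_form ::
    "nat \<Rightarrow> nat \<Rightarrow> real mat \<Rightarrow> real mat set \<Rightarrow> nat \<Rightarrow> nat \<Rightarrow> nat \<Rightarrow>
     (real mat \<times> real mat set) option \<Rightarrow> (nat \<times> nat \<times> real mat \<times> real mat set) list \<Rightarrow>
     nat \<Rightarrow> nat \<Rightarrow> bool" where
  "canonical_form p q K M p\<^sub>0 q\<^sub>0 k\<^sub>0 nb bs kp km \<longleftrightarrow>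
     (case nb of
        None \<Rightarrow> k\<^sub>0 = 0 \<and> p\<^sub>0 = 0 \<and> q\<^sub>0 = 0
      | Some (K\<^sub>0, N) \<Rightarrow> 1 \<le> k\<^sub>0 \<and> MANS_block K\<^sub>0 N p\<^sub>0 q\<^sub>0 k\<^sub>0) \<and>
     (\<forall>(r, s, Kb, Xb) \<in> set bs.
        has_signature Kb r s \<and> MASA (r + s) (o_alg Kb) Xb \<and>
        \<not> MANS (r + s) (o_alg Kb) Xb \<and> orth_indecomposable Kb Xb) \<and>
     p = p\<^sub>0 + k\<^sub>0 + kp + (\<Sum>(r, s, Kb, Xb)\<leftarrow>bs. r) \<and>
     q = q\<^sub>0 + k\<^sub>0 + km + (\<Sum>(r, s, Kb, Xb)\<leftarrow>bs. s) \<and>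
     (let blocks = (case nb of None \<Rightarrow> [] | Some b \<Rightarrow> [b]) @ map (\<lambda>(r, s, b). b) bs in
      \<exists>M'. represented K M
             (diag_block_mat (map fst blocks @ [1\<^sub>m kp, - 1\<^sub>m km])) M' \<and>
           o_proj (p + q) M' =
             {diag_block_mat (Xs @ [0\<^sub>m kp kp, 0\<^sub>m km km]) | Xs.
                list_all2 (\<in>) Xs (map snd blocks)})"


subsection \<open>The matrix sets representing nonsplitting MASAs\<close>

text \<open>\<open>\<beta>\<close> and \<open>\<gamma>\<close> are given as functions of \<open>\<alpha>\<close> and \<open>Y\<close>.\<close>

definition nonsplit_set ::
    "nat \<Rightarrow> real mat \<Rightarrow> (nat \<Rightarrow> real mat) \<Rightarrow> (real vec \<Rightarrow> real mat \<Rightarrow> real vec) \<Rightarrow>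
     (real vec \<Rightarrow> real mat \<Rightarrow> real vec) \<Rightarrow> real mat set" where
  "nonsplit_set k Kt Q \<beta> \<gamma> =
     {ext_mat (kravchuk_mat Kt (rows_mat k Q \<alpha>) (0\<^sub>m (dim_row Kt) (dim_row Kt)) Y)
        (z @\<^sub>v \<beta> \<alpha> Y @\<^sub>v \<gamma> \<alpha> Y) 0
      | \<alpha> Y z. \<alpha> \<in> carrier_vec (dim_row Kt) \<and> Y \<in> skew_mats k \<and> z \<in> carrier_vec k}"

definition Lambda_set :: "nat \<Rightarrow> real mat \<Rightarrow> (nat \<Rightarrow> real mat) \<Rightarrow> real mat \<Rightarrow> real mat set" where
  "Lambda_set k Kt Q \<Lambda> = nonsplit_set k Kt Q (\<lambda>\<alpha> Y. row_mult \<alpha> \<Lambda>) (\<lambda>\<alpha> Y. 0\<^sub>v k)"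

definition Lambda_condition :: "nat \<Rightarrow> real mat \<Rightarrow> (nat \<Rightarrow> real mat) \<Rightarrow> real mat \<Rightarrow> bool" where
  "Lambda_condition k Kt Q \<Lambda> \<longleftrightarrow>
     \<Lambda> \<in> carrier_mat (dim_row Kt) (dim_row Kt) \<and> \<Lambda> = \<Lambda>\<^sup>T \<and>
     (\<forall>j<k. Q j * \<Lambda> * mat_inv Kt = \<Lambda> * mat_inv Kt * Q j)"

definition special_Q :: "nat \<Rightarrow> nat \<Rightarrow> real mat \<Rightarrow> real mat \<Rightarrow> bool" where
  "special_Q p\<^sub>0 q\<^sub>0 Kt Q \<longleftrightarrow>
     Q = mat (p\<^sub>0 + q\<^sub>0) (p\<^sub>0 + q\<^sub>0) (\<lambda>(i, j). if i = 0 \<and> j = 1 then 1 else 0) \<and>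
     (\<exists>p' q' K'. p\<^sub>0 = p' + 1 \<and> q\<^sub>0 = q' + 1 \<and> has_signature K' p' q' \<and>
        Kt = diag_block_mat [mat_of_rows_list 2 [[0, 1], [1, 0]], K'])"

end

theory Submission
  imports Defs
begin

text \<open>A MASA of \<open>e(p,q)\<close> is a maximal set of pairs \<open>(X, b)\<close> of a rotation and a translation part with
  \<open>X X' = X' X\<close> and \<open>X b' = X' b\<close>; it splits iff \<open>b\<close> can be removed modulo translations in the set by a
  conjugation \<open>b \<mapsto> b - X c\<close>. By Fitting's lemma an orthogonally indecomposable block that is not
  nilpotent contains an invertible matrix, which determines such a \<open>c\<close>; hence a nonsplitting MASA
  must have a nilpotent block.

  For a free-rowed nilpotent block, \<open>S = 0\<close> because \<open>(\<alpha>, \<alpha>', \<alpha>'') \<mapsto> \<alpha> S(\<alpha>') K \<alpha>''\<close> is symmetric in the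
  first two arguments and antisymmetric in the outer two. Maximality makes \<open>Y\<close> and \<open>z\<close> free, and
  \<open>\<beta>\<close>, \<open>\<gamma>\<close> become linear functions of \<open>(\<alpha>, Y)\<close> subject to \<open>A \<beta>' + Y \<gamma>' = A' \<beta> + Y' \<gamma>\<close> and
  \<open>A\<^sup>T \<gamma>' = A'\<^sup>T \<gamma>\<close>. These equations are solved with elementary matrices \<open>Y\<close>, and the
  solutions are normalized by conjugation with \<open>diag(G\<^sub>1, G\<^sub>2, G\<^sub>1\<close> inverse transposed\<open>)\<close> and a translation.\<close>

text \<open>The Fitting decomposition of a block has to be orthogonal, because indecomposability
  concerns a matrix set together with its metric. It is therefore taken for an even power: elements
  of \<open>o_alg K\<close> are skew-adjoint, so their even powers are self-adjoint. The delicate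
  case is k = 2 with m at least 2, where \<beta> may contain a term y v. If v is not 0, the equation
  for \<open>A\<^sup>T\<close> forces Q = c + v u^T with u v = 0. The trace condition removes c, and
  the symmetry of Q K makes K u proportional to v. So u is isotropic, and completing it to a
  hyperbolic plane produces the exceptional Q and metric. If v = 0 although Q already has the
  exceptional form, doubling the second row of A replaces Q by 2 Q, to which the other alternative
  applies. This is why metric and matrices are chosen anew in that case. Signatures are defined by
  eigenvalue multiplicities, so following them through changes of basis takes Sylvester's law of
  inertia. In the small signatures, nonsplitting excludes vanishing constants, and the remaining
  ones are scaled to 1.\<close>

abbreviation (input) sq_mats :: "nat \<Rightarrow> 'a mat set" where
  "sq_mats n \<equiv> carrier_mat n n"

subsection \<open>Matrix algebra with dimension side conditions\<close>

named_theorems mat_dim_simps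

text \<open>The side conditions are equations between dimensions, which simplification evaluates on
  concrete terms; carrier premises would contain dimensions that do not occur in the rewritten term.
  All rules collected in \<open>mat_dim_simps\<close> have this form.\<close>

lemma mult_assoc_dim [mat_dim_simps]:
  "dim_col A = dim_row B \<Longrightarrow> dim_col B = dim_row C \<Longrightarrow> (A * B) * C = A * (B * (C :: real mat))"
  by (rule assoc_mult_mat[of A "dim_row A" "dim_row B" B "dim_row C" C "dim_col C"]) auto

lemma mult_add_dim [mat_dim_simps]:
  "dim_col A = dim_row B \<Longrightarrow> dim_row B = dim_row C \<Longrightarrow> dim_col B = dim_col C \<Longrightarrow>
     A * (B + C) = A * B + A * (C :: real mat)"
  by (rule mult_add_distrib_mat[of A "dim_row A" "dim_row B" B "dim_col B" C]) auto

lemma add_mult_dim [mat_dim_simps]: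
  "dim_row A = dim_row B \<Longrightarrow> dim_col A = dim_col B \<Longrightarrow> dim_col A = dim_row C \<Longrightarrow>
     (A + B) * C = A * C + B * (C :: real mat)"
  by (rule add_mult_distrib_mat[of A "dim_row A" "dim_col A" B C "dim_col C"]) auto

lemma mult_zero_dim [mat_dim_simps]:
  "dim_col A = n \<Longrightarrow> A * 0\<^sub>m n m = (0\<^sub>m (dim_row A) m :: real mat)"
  "dim_row A = n \<Longrightarrow> 0\<^sub>m m n * A = (0\<^sub>m m (dim_col A) :: real mat)"
  by auto

lemma mult_one_dim [mat_dim_simps]:
  "dim_col A = n \<Longrightarrow> A * 1\<^sub>m n = (A :: real mat)"
  "dim_row A = n \<Longrightarrow> 1\<^sub>m n * A = (A :: real mat)"
  by auto

lemma add_zero_dim [mat_dim_simps]: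
  "dim_row A = n \<Longrightarrow> dim_col A = m \<Longrightarrow> A + 0\<^sub>m n m = (A :: real mat)"
  "dim_row A = n \<Longrightarrow> dim_col A = m \<Longrightarrow> 0\<^sub>m n m + A = (A :: real mat)"
  by (auto intro!: eq_matI)

lemma uminus_mult_dim [mat_dim_simps]:
  "dim_col A = dim_row B \<Longrightarrow> (- A) * B = - (A * (B :: real mat))"
  "dim_col A = dim_row B \<Longrightarrow> A * (- B) = - (A * (B :: real mat))"
  by (auto intro!: eq_matI simp: scalar_prod_def sum_negf)

lemma smult_mult_dim [mat_dim_simps]:
  "dim_col A = dim_row B \<Longrightarrow> (c \<cdot>\<^sub>m A) * B = c \<cdot>\<^sub>m (A * (B :: real mat))"
  "dim_col A = dim_row B \<Longrightarrow> A * (c \<cdot>\<^sub>m B) = c \<cdot>\<^sub>m (A * (B :: real mat))"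
  by (auto intro!: eq_matI simp: scalar_prod_def sum_distrib_left ac_simps)

lemma transpose_mult_dim [mat_dim_simps]:
  "dim_col A = dim_row B \<Longrightarrow> (A * B)\<^sup>T = B\<^sup>T * (A :: real mat)\<^sup>T"
  by (rule transpose_mult[of A "dim_row A" "dim_row B" B "dim_col B"]) auto

lemma transpose_add_dim [mat_dim_simps]:
  "dim_row A = dim_row B \<Longrightarrow> dim_col A = dim_col B \<Longrightarrow> (A + B)\<^sup>T = A\<^sup>T + (B :: real mat)\<^sup>T"
  by (auto intro!: eq_matI)

lemma transpose_misc [mat_dim_simps]:
  "(- A)\<^sup>T = - ((A :: real mat)\<^sup>T)" "(c \<cdot>\<^sub>m A)\<^sup>T = c \<cdot>\<^sub>m (A :: real mat)\<^sup>T"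
  "(0\<^sub>m n m)\<^sup>T = (0\<^sub>m m n :: real mat)" "(1\<^sub>m n)\<^sup>T = (1\<^sub>m n :: real mat)"
  "- (0\<^sub>m n m) = (0\<^sub>m n m :: real mat)" "- (- A) = (A :: real mat)"
  by (auto intro!: eq_matI)

lemma mult_vec_assoc_dim [mat_dim_simps]:
  "dim_col A = dim_row B \<Longrightarrow> dim_col B = dim_vec v \<Longrightarrow> (A * B) *\<^sub>v v = A *\<^sub>v (B *\<^sub>v (v :: real vec))"
  by (rule assoc_mult_mat_vec[of A "dim_row A" "dim_row B" B "dim_vec v" v]) auto

lemma mult_vec_add_dim [mat_dim_simps]:
  "dim_col A = dim_vec v \<Longrightarrow> dim_vec v = dim_vec w \<Longrightarrow> A *\<^sub>v (v + w) = A *\<^sub>v v + A *\<^sub>v (w :: real vec)"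
  by (rule mult_add_distrib_mat_vec[of A "dim_row A" "dim_vec v"]) (auto intro: carrier_vecI)

lemma mult_vec_diff_dim [mat_dim_simps]:
  "dim_col A = dim_vec v \<Longrightarrow> dim_vec v = dim_vec w \<Longrightarrow> A *\<^sub>v (v - w) = A *\<^sub>v v - A *\<^sub>v (w :: real vec)"
  by (rule mult_minus_distrib_mat_vec[of A "dim_row A" "dim_vec v"]) (auto intro: carrier_vecI)

lemma add_mult_vec_dim [mat_dim_simps]:
  "dim_col A = dim_vec v \<Longrightarrow> dim_row A = dim_row B \<Longrightarrow> dim_col A = dim_col B \<Longrightarrow>
    (A + B) *\<^sub>v v = A *\<^sub>v v + B *\<^sub>v (v :: real vec)"
  by (rule add_mult_distrib_mat_vec[of A "dim_row A" "dim_vec v"]) auto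

lemma mult_vec_misc_dim [mat_dim_simps]:
  "dim_vec v = n \<Longrightarrow> 1\<^sub>m n *\<^sub>v v = (v :: real vec)"
  "dim_vec v = n \<Longrightarrow> 0\<^sub>m m n *\<^sub>v v = (0\<^sub>v m :: real vec)"
  "dim_col A = n \<Longrightarrow> A *\<^sub>v 0\<^sub>v n = (0\<^sub>v (dim_row A) :: real vec)"
  "dim_col A = dim_vec v \<Longrightarrow> (- A) *\<^sub>v v = - (A *\<^sub>v (v :: real vec))"
  "dim_col A = dim_vec v \<Longrightarrow> A *\<^sub>v (- v) = - (A *\<^sub>v (v :: real vec))"
  "dim_col A = dim_vec v \<Longrightarrow> (c \<cdot>\<^sub>m A) *\<^sub>v v = c \<cdot>\<^sub>v (A *\<^sub>v (v :: real vec))"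
  "dim_col A = dim_vec v \<Longrightarrow> A *\<^sub>v (c \<cdot>\<^sub>v v) = c \<cdot>\<^sub>v (A *\<^sub>v (v :: real vec))"
  by (auto intro!: eq_vecI simp: scalar_prod_def sum_negf sum_distrib_left ac_simps)

lemma vec_zero_dim [mat_dim_simps]:
  "dim_vec v = n \<Longrightarrow> v + 0\<^sub>v n = (v :: real vec)"
  "dim_vec v = n \<Longrightarrow> 0\<^sub>v n + v = (v :: real vec)"
  "dim_vec v = n \<Longrightarrow> v - 0\<^sub>v n = (v :: real vec)"
  "- 0\<^sub>v n = (0\<^sub>v n :: real vec)"
  by (auto intro!: eq_vecI)

lemma dim_of_carrier:
  "A \<in> carrier_mat n m \<Longrightarrow> dim_row A = n" "A \<in> carrier_mat n m \<Longrightarrow> dim_col A = m"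
  "v \<in> carrier_vec n \<Longrightarrow> dim_vec v = n"
  by auto

lemmas mat_simps = mat_dim_simps dim_of_carrier

lemma mult_unit_vec:
  assumes "A \<in> carrier_mat n m" "j < m"
  shows "A *\<^sub>v unit_vec m j = col (A :: real mat) j"
  using assms by (intro eq_vecI) auto

lemma mat_eq_by_vec:
  assumes "A \<in> carrier_mat n m" "B \<in> carrier_mat n m"
    and "\<And>v. v \<in> carrier_vec m \<Longrightarrow> A *\<^sub>v v = B *\<^sub>v (v :: real vec)"
  shows "A = B"
proof (rule mat_col_eqI)
  fix j assume "j < dim_col B"
  then have j: "j < m" using assms(2) by simp
  show "col A j = col B j"
    using assms(3)[of "unit_vec m j"] mult_unit_vec[OF assms(1) j] mult_unit_vec[OF assms(2) j] by simp
qed (use assms in auto)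

lemma scalar_prod_mult_vec:
  assumes "A \<in> carrier_mat n m" "v \<in> carrier_vec n" "w \<in> carrier_vec m"
  shows "v \<bullet> (A *\<^sub>v w) = (A\<^sup>T *\<^sub>v v) \<bullet> (w :: real vec)"
  using transpose_vec_mult_scalar[OF assms(1) assms(3) assms(2)]
    comm_scalar_prod[of w m "A\<^sup>T *\<^sub>v v"] assms by auto

lemma vec_zero_iff_scalar_prods:
  assumes "v \<in> carrier_vec n" "\<And>w. w \<in> carrier_vec n \<Longrightarrow> w \<bullet> v = (0 :: real)"
  shows "v = 0\<^sub>v n"
proof (rule eq_vecI)
  fix i assume "i < dim_vec (0\<^sub>v n :: real vec)"
  then have i: "i < n" by simp
  have "unit_vec n i \<bullet> v = v $ i" using assms(1) i by simp
  then show "v $ i = 0\<^sub>v n $ i" using assms(2)[of "unit_vec n i"] i by simp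
qed (use assms in auto)

lemma vec_eqI_scalar_prods:
  assumes "u \<in> carrier_vec n" "v \<in> carrier_vec n"
    and "\<And>w. w \<in> carrier_vec n \<Longrightarrow> w \<bullet> u = w \<bullet> (v :: real vec)"
  shows "u = v"
proof (rule eq_vecI)
  fix i assume "i < dim_vec v"
  then have i: "i < n" using assms by auto
  have "unit_vec n i \<bullet> u = u $ i" "unit_vec n i \<bullet> v = v $ i" using assms(1,2) i by simp_all
  then show "u $ i = v $ i" using assms(3)[of "unit_vec n i"] by simp
qed (use assms in auto)

lemma mat_eqI_bilinear:
  assumes "A \<in> carrier_mat n m" "B \<in> carrier_mat n m"
    and "\<And>v w. v \<in> carrier_vec n \<Longrightarrow> w \<in> carrier_vec m \<Longrightarrow> v \<bullet> (A *\<^sub>v w) = v \<bullet> (B *\<^sub>v (w :: real vec))"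
  shows "A = B"
  by (rule mat_eq_by_vec[OF assms(1,2)], rule vec_eqI_scalar_prods[of _ n]) (use assms in auto)

subsection \<open>Inverses\<close>

text \<open>A two-sided inverse puts \<open>A\<close> into the unit group of the matrix ring, which
  is the condition under which \<open>mat_inverse\<close> returns a value; uniqueness of inverses
  identifies that value with \<open>B\<close>.\<close>

lemma mat_inv_eqI:
  assumes "A \<in> sq_mats n" "B \<in> sq_mats n" "A * B = 1\<^sub>m n" "B * A = 1\<^sub>m n"
  shows "mat_inv A = B"
proof -
  have U: "A \<in> Units (ring_mat TYPE(real) n ())"
    using assms by (auto simp: Units_def ring_mat_simps)
  then obtain C where C: "mat_inverse A = Some C"
    using mat_inverse(1)[OF assms(1)] by fastforce
  from mat_inverse(2)[OF assms(1) C] have C': "A * C = 1\<^sub>m n" "C * A = 1\<^sub>m n" "C \<in> sq_mats n" by auto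
  have "C = (B * A) * C" unfolding assms(4) using C' by simp
  also have "\<dots> = B * (A * C)" by (rule assoc_mult_mat[OF assms(2,1) C'(3)])
  also have "\<dots> = B" using assms(2) by (simp add: C'(1))
  finally show ?thesis by (simp add: mat_inv_def C)
qed

lemma invertible_matI:
  assumes "A \<in> sq_mats n" "B \<in> sq_mats n" "A * B = 1\<^sub>m n" "B * A = 1\<^sub>m n"
  shows "invertible_mat (A :: real mat)"
  using assms unfolding invertible_mat_def inverts_mat_def by auto

lemma left_inverse_imp_right_inverse:
  assumes "A \<in> sq_mats n" "B \<in> sq_mats n" "B * A = 1\<^sub>m n"
  shows "A * B = (1\<^sub>m n :: real mat)"
  using mat_mult_left_right_inverse[OF assms(2) assms(1) assms(3)] .

lemma invertible_matE:
  assumes "invertible_mat A" "A \<in> sq_mats n"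
  obtains B where "B \<in> sq_mats n" "A * B = 1\<^sub>m n" "B * A = 1\<^sub>m n" "mat_inv A = (B :: real mat)"
proof -
  from assms obtain B where B: "A * B = 1\<^sub>m n" "B * A = 1\<^sub>m (dim_row B)"
    unfolding invertible_mat_def inverts_mat_def by auto
  \<comment> \<open>\<open>invertible_mat\<close> does not fix the size of the inverse; its
    dimensions are read off from the two product equations.\<close>
  have "dim_col B = n" using arg_cong[OF B(1), of dim_col] by simp
  moreover have "dim_row B = n" using arg_cong[OF B(2), of dim_col] assms(2) by simp
  ultimately have "B \<in> sq_mats n" by auto
  with B assms(2) that[of B] mat_inv_eqI[of A n B] show ?thesis by auto
qed

lemma invertible_det_iff:
  assumes "A \<in> sq_mats n"
  shows "invertible_mat A \<longleftrightarrow> det A \<noteq> (0::real)"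
proof
  assume "invertible_mat A"
  then obtain B where B: "B \<in> sq_mats n" "A * B = 1\<^sub>m n" using assms by (auto elim: invertible_matE)
  from det_mult[OF assms B(1)] B(2) show "det A \<noteq> 0" by auto
next
  assume "det A \<noteq> 0"
  from det_non_zero_imp_unit[OF assms this, of "()"]
  obtain B where "B \<in> sq_mats n" "B * A = 1\<^sub>m n" "A * B = 1\<^sub>m n"
    by (auto simp: Units_def ring_mat_simps)
  with assms show "invertible_mat A" by (intro invertible_matI[of A n B]) auto
qed

lemma invertible_of_trivial_kernel:
  assumes A: "A \<in> sq_mats n"
    and ker: "\<And>v. v \<in> carrier_vec n \<Longrightarrow> A *\<^sub>v v = 0\<^sub>v n \<Longrightarrow> v = (0\<^sub>v n :: real vec)"
  shows "invertible_mat A"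
  using det_0_iff_vec_prod_zero_field[OF A] ker invertible_det_iff[OF A] by blast

text \<open>Simplification nests products to the right, so a cancelling pair appears as
  \<open>B * (A * C)\<close>. Instantiated with a known inverse, this rule contracts it.\<close>

lemma mult_cancel_left_inverse:
  assumes "B * A = 1\<^sub>m n" "dim_col B = dim_row A" "dim_col A = dim_row C" "dim_row C = n"
  shows "B * (A * C) = (C :: real mat)"
  using assms by (simp add: mult_assoc_dim[symmetric] mat_dim_simps)

lemma mult_vec_cancel_left_inverse:
  assumes "B * A = 1\<^sub>m n" "dim_col B = dim_row A" "dim_col A = dim_vec v" "dim_vec v = n"
  shows "B *\<^sub>v (A *\<^sub>v v) = (v :: real vec)"
  using assms by (simp add: mult_vec_assoc_dim[symmetric] mat_dim_simps)

subsection \<open>Extended matrices\<close>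

lemma ext_mat_carrier [simp]:
  "X \<in> sq_mats n \<Longrightarrow> ext_mat X a c \<in> sq_mats (n + 1)"
  "X \<in> sq_mats n \<Longrightarrow> ext_mat X a c \<in> sq_mats (Suc n)"
  unfolding ext_mat_def by auto

lemma ext_mat_eq_iff:
  assumes "X \<in> sq_mats n" "Y \<in> sq_mats n" "a \<in> carrier_vec n" "b \<in> carrier_vec n"
  shows "ext_mat X a c = ext_mat Y b d \<longleftrightarrow> X = Y \<and> a = b \<and> c = d"
proof
  assume eq: "ext_mat X a c = ext_mat Y b d"
  have "X $$ (i, j) = Y $$ (i, j)" if "i < n" "j < n" for i j
    using arg_cong[OF eq, of "\<lambda>M. M $$ (i, j)"] that assms unfolding ext_mat_def by auto
  moreover have "a $ i = b $ i" if "i < n" for i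
    using arg_cong[OF eq, of "\<lambda>M. M $$ (i, n)"] that assms unfolding ext_mat_def
    by (auto simp: mat_of_cols_def)
  moreover have "c = d"
    using arg_cong[OF eq, of "\<lambda>M. M $$ (n, n)"] assms unfolding ext_mat_def by auto
  ultimately show "X = Y \<and> a = b \<and> c = d" using assms by (auto intro!: eq_matI eq_vecI)
qed simp

lemma ext_mat_mult:
  assumes "X \<in> sq_mats n" "Y \<in> sq_mats n" "a \<in> carrier_vec n" "b \<in> carrier_vec n"
  shows "ext_mat X a c * ext_mat Y b d = ext_mat (X * Y) (X *\<^sub>v b + d \<cdot>\<^sub>v a) (c * d)"
proof -
  let ?C = "\<lambda>v. mat_of_cols (dim_vec v) [v] :: real mat"
  have "X * ?C b + ?C a * mat 1 1 (\<lambda>_. d) = ?C (X *\<^sub>v b + d \<cdot>\<^sub>v a)"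
    using assms
    by (intro eq_matI) (auto simp: mat_of_cols_def scalar_prod_def)
  moreover have "X * Y + ?C a * 0\<^sub>m 1 (dim_col Y) = X * Y" using assms by (simp add: mat_dim_simps)
  moreover have "0\<^sub>m 1 n * ?C b + mat 1 1 (\<lambda>_. c) * mat 1 1 (\<lambda>_. d) = mat 1 1 (\<lambda>_. c * d)"
    using assms by (intro eq_matI) (auto simp: scalar_prod_def)
  moreover have "0\<^sub>m 1 n * Y + mat 1 1 (\<lambda>_. c) * 0\<^sub>m 1 n = 0\<^sub>m 1 n"
    using assms by (intro eq_matI) (auto simp: scalar_prod_def)
  ultimately show ?thesis using assms unfolding ext_mat_def
    by (subst mult_four_block_mat[of _ n n _ 1 _ 1 _ _ n _ 1]) (auto simp: dim_of_carrier)
qed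

lemma ext_mat_add:
  assumes "X \<in> sq_mats n" "Y \<in> sq_mats n" "a \<in> carrier_vec n" "b \<in> carrier_vec n"
  shows "ext_mat X a c + ext_mat Y b d = ext_mat (X + Y) (a + b) (c + d)"
  using assms unfolding ext_mat_def by (intro eq_matI) (auto simp: mat_of_cols_def)

lemma ext_mat_smult:
  assumes "X \<in> sq_mats n" "a \<in> carrier_vec n"
  shows "r \<cdot>\<^sub>m ext_mat X a c = ext_mat (r \<cdot>\<^sub>m X) (r \<cdot>\<^sub>v a) (r * c)"
  using assms unfolding ext_mat_def by (intro eq_matI) (auto simp: mat_of_cols_def)

lemma ext_mat_minus:
  assumes "X \<in> sq_mats n" "Y \<in> sq_mats n" "a \<in> carrier_vec n" "b \<in> carrier_vec n"
  shows "ext_mat X a c - ext_mat Y b d = ext_mat (X - Y) (a - b) (c - d)"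
  using assms unfolding ext_mat_def by (intro eq_matI) (auto simp: mat_of_cols_def)

lemma ext_mat_zero: "ext_mat (0\<^sub>m n n) (0\<^sub>v n) 0 = 0\<^sub>m (n + 1) (n + 1)"
  unfolding ext_mat_def by (intro eq_matI) (auto simp: mat_of_cols_def)

lemma ext_mat_one: "ext_mat (1\<^sub>m n) (0\<^sub>v n) 1 = 1\<^sub>m (n + 1)"
  unfolding ext_mat_def by (intro eq_matI) (auto simp: mat_of_cols_def)

lemma ext_mat_bracket:
  assumes "X \<in> sq_mats n" "Y \<in> sq_mats n" "a \<in> carrier_vec n" "b \<in> carrier_vec n"
  shows "lie_bracket (ext_mat X a 0) (ext_mat Y b 0) = 0\<^sub>m (n + 1) (n + 1)
     \<longleftrightarrow> X * Y = Y * X \<and> X *\<^sub>v b = Y *\<^sub>v a"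
proof -
  have "lie_bracket (ext_mat X a 0) (ext_mat Y b 0) = ext_mat (X * Y - Y * X) (X *\<^sub>v b - Y *\<^sub>v a) 0"
  proof -
    have "X *\<^sub>v b + 0 \<cdot>\<^sub>v a = X *\<^sub>v b" "Y *\<^sub>v a + 0 \<cdot>\<^sub>v b = Y *\<^sub>v a" using assms by auto
    then show ?thesis using assms unfolding lie_bracket_def
      by (simp add: ext_mat_mult[of _ n] ext_mat_minus[of _ n])
  qed
  moreover have "ext_mat (X * Y - Y * X) (X *\<^sub>v b - Y *\<^sub>v a) 0 = ext_mat (0\<^sub>m n n) (0\<^sub>v n) 0
    \<longleftrightarrow> X * Y - Y * X = 0\<^sub>m n n \<and> X *\<^sub>v b - Y *\<^sub>v a = 0\<^sub>v n"
    using assms ext_mat_eq_iff[of "X * Y - Y * X" n "0\<^sub>m n n" "X *\<^sub>v b - Y *\<^sub>v a" "0\<^sub>v n" 0 0]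
    by (simp add: minus_carrier_mat[OF mult_carrier_mat[of _ n n]])
  moreover have "X * Y - Y * X = 0\<^sub>m n n \<longleftrightarrow> X * Y = Y * X"
    using assms by (auto simp: mat_eq_iff)
  moreover have "X *\<^sub>v b - Y *\<^sub>v a = 0\<^sub>v n \<longleftrightarrow> X *\<^sub>v b = Y *\<^sub>v a"
    using assms by (auto simp: vec_eq_iff)
  ultimately show ?thesis unfolding ext_mat_zero by simp
qed

lemma ext_mat_inv:
  assumes G: "G \<in> sq_mats n" and H: "H \<in> sq_mats n" and GH: "G * H = 1\<^sub>m n" and HG: "H * G = 1\<^sub>m n"
    and a: "a \<in> carrier_vec n"
  shows "ext_mat G a 1 * ext_mat H (- (H *\<^sub>v a)) 1 = 1\<^sub>m (n + 1)"
    and "ext_mat H (- (H *\<^sub>v a)) 1 * ext_mat G a 1 = 1\<^sub>m (n + 1)"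
    and "mat_inv (ext_mat G a 1) = ext_mat H (- (H *\<^sub>v a)) 1"
proof -
  have "G *\<^sub>v (H *\<^sub>v a) = a" using mult_vec_cancel_left_inverse[OF GH] assms by auto
  then have *: "G *\<^sub>v (- (H *\<^sub>v a)) + 1 \<cdot>\<^sub>v a = 0\<^sub>v n"
    using assms by (auto simp: mat_dim_simps)
  have **: "H *\<^sub>v a + 1 \<cdot>\<^sub>v (- (H *\<^sub>v a)) = 0\<^sub>v n" using assms by auto
  show 1: "ext_mat G a 1 * ext_mat H (- (H *\<^sub>v a)) 1 = 1\<^sub>m (n + 1)"
    using assms by (subst ext_mat_mult[of _ n]) (auto simp: *[simplified] ext_mat_one simp del: One_nat_def)
  show 2: "ext_mat H (- (H *\<^sub>v a)) 1 * ext_mat G a 1 = 1\<^sub>m (n + 1)"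
    using assms by (subst ext_mat_mult[of _ n]) (auto simp: **[simplified] ext_mat_one simp del: One_nat_def)
  show "mat_inv (ext_mat G a 1) = ext_mat H (- (H *\<^sub>v a)) 1"
    by (rule mat_inv_eqI[of _ "n + 1"]) (use assms 1 2 in auto)
qed

lemma ext_mat_conj:
  assumes "G \<in> sq_mats n" "H \<in> sq_mats n" "G * H = 1\<^sub>m n" "H * G = 1\<^sub>m n"
    and "a \<in> carrier_vec n" "X \<in> sq_mats n" "b \<in> carrier_vec n"
  shows "ext_mat G a 1 * ext_mat X b 0 * mat_inv (ext_mat G a 1)
     = ext_mat (G * X * H) (G *\<^sub>v b - G * X * H *\<^sub>v a) 0"
proof -
  have "0 \<cdot>\<^sub>v a = 0\<^sub>v n" using assms by auto
  then have "ext_mat G a 1 * ext_mat X b 0 = ext_mat (G * X) (G *\<^sub>v b) 0"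
    using assms by (simp add: ext_mat_mult[of _ n])
  moreover have "G * X *\<^sub>v (- (H *\<^sub>v a)) + 1 \<cdot>\<^sub>v (G *\<^sub>v b) = G *\<^sub>v b - G * X * H *\<^sub>v a"
    using assms by (intro eq_vecI) (auto simp: mat_dim_simps)
  ultimately show ?thesis
    using assms by (simp add: ext_mat_inv(3)[of G n H] ext_mat_mult[of _ n])
qed

subsection \<open>Conjugation of matrix sets\<close>

lemma mat_inv_mult:
  assumes "G \<in> sq_mats n" "H \<in> sq_mats n" "G * H = 1\<^sub>m n" "H * G = 1\<^sub>m n"
    and "G' \<in> sq_mats n" "H' \<in> sq_mats n" "G' * H' = 1\<^sub>m n" "H' * G' = 1\<^sub>m n"
  shows "(G * G') * (H' * H) = 1\<^sub>m n" "(H' * H) * (G * G') = 1\<^sub>m n"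
    "mat_inv (G * G') = H' * H"
proof -
  show 1: "(G * G') * (H' * H) = 1\<^sub>m n"
    using assms by (simp add: mat_dim_simps mult_cancel_left_inverse[OF assms(7)] dim_of_carrier)
  show 2: "(H' * H) * (G * G') = 1\<^sub>m n"
    using assms by (simp add: mat_dim_simps mult_cancel_left_inverse[OF assms(4)] dim_of_carrier)
  show "mat_inv (G * G') = H' * H" using assms 1 2 by (intro mat_inv_eqI[of _ n]) auto
qed

lemma invertible_mult:
  assumes "G \<in> sq_mats n" "invertible_mat G" "G' \<in> sq_mats n" "invertible_mat G'"
  shows "invertible_mat (G * G' :: real mat)"
proof -
  obtain H where H: "H \<in> sq_mats n" "G * H = 1\<^sub>m n" "H * G = 1\<^sub>m n" using assms by (auto elim: invertible_matE)
  obtain H' where H': "H' \<in> sq_mats n" "G' * H' = 1\<^sub>m n" "H' * G' = 1\<^sub>m n" using assms by (auto elim: invertible_matE)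
  show ?thesis using assms H H' mat_inv_mult[of G n H G' H'] by (intro invertible_matI[of _ n "H' * H"]) auto
qed

lemma transpose_inverse:
  assumes "G \<in> sq_mats n" "H \<in> sq_mats n" "G * H = 1\<^sub>m n"
  shows "H\<^sup>T * G\<^sup>T = (1\<^sub>m n :: real mat)"
  using assms by (metis carrier_matD transpose_mult transpose_one)

lemma conj_set_compose:
  assumes "G \<in> sq_mats n" "H \<in> sq_mats n" "G * H = 1\<^sub>m n" "H * G = 1\<^sub>m n"
    and "G' \<in> sq_mats n" "H' \<in> sq_mats n" "G' * H' = 1\<^sub>m n" "H' * G' = 1\<^sub>m n"
    and M: "M \<subseteq> sq_mats n"
  shows "conj_set G (conj_set G' M) = conj_set (G * G') M"
proof -
  have i: "mat_inv G = H" "mat_inv G' = H'" "mat_inv (G * G') = H' * H"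
    using mat_inv_eqI[of G n H] mat_inv_eqI[of G' n H'] mat_inv_mult[of G n H G' H'] assms by auto
  have "G * (G' * X * H') * H = G * G' * X * (H' * H)" if "X \<in> M" for X
  proof -
    have "X \<in> sq_mats n" using that M by auto
    then show ?thesis using assms by (simp add: mat_simps)
  qed
  then show ?thesis unfolding conj_set_def i image_image by (intro image_cong) auto
qed

lemma conj_mult_aux:
  assumes "G \<in> sq_mats n" "H \<in> sq_mats n" "H * G = 1\<^sub>m n"
    and "A \<in> sq_mats n" "B \<in> sq_mats n"
  shows "(G * A * H) * (G * B * H) = G * (A * B) * (H :: real mat)"
  using assms by (simp add: mat_dim_simps mult_cancel_left_inverse[OF assms(3)] dim_of_carrier)

lemma conj_cancel:
  assumes "G \<in> sq_mats n" "H \<in> sq_mats n" "G * H = 1\<^sub>m n" "H * G = 1\<^sub>m n"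
    and "A \<in> sq_mats n"
  shows "H * (G * A * H) * G = (A :: real mat)"
  using assms by (simp add: mat_dim_simps mult_cancel_left_inverse[OF assms(4)] dim_of_carrier)

lemma conj_inj:
  assumes "G \<in> sq_mats n" "H \<in> sq_mats n" "G * H = 1\<^sub>m n" "H * G = 1\<^sub>m n"
    and "A \<in> sq_mats n" "B \<in> sq_mats n" "G * A * H = G * B * (H :: real mat)"
  shows "A = B"
  using conj_cancel[OF assms(1-5)] conj_cancel[OF assms(1-4,6)] assms(7) by metis

lemma bracket_zero_iff:
  assumes "A \<in> sq_mats n" "B \<in> sq_mats n"
  shows "lie_bracket A B = 0\<^sub>m n n \<longleftrightarrow> A * B = B * A"
  using assms by (auto simp: lie_bracket_def mat_eq_iff)

text \<open>Conjugation is linear, multiplicative and injective, so it preserves and reflects the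
  vanishing of brackets and carries centralizers to centralizers.\<close>

lemma MASA_conj:
  assumes GH: "G \<in> sq_mats n" "H \<in> sq_mats n" "G * H = 1\<^sub>m n" "H * G = 1\<^sub>m n"
    and L: "L \<subseteq> sq_mats n" and M: "MASA n L M"
  shows "MASA n (conj_set G L) (conj_set G M)"
proof -
  have i: "mat_inv G = H" using mat_inv_eqI[of G n H] assms by auto
  define f where "f X = G * X * H" for X
  have cs: "conj_set G S = f ` S" for S unfolding conj_set_def i f_def ..
  note Md = M[unfolded MASA_def mat_subspace_def]
  have fc: "f X \<in> sq_mats n" if "X \<in> sq_mats n" for X using that GH unfolding f_def by auto
  have fadd: "f (A + B) = f A + f B" if "A \<in> sq_mats n" "B \<in> sq_mats n" for A B
    using that GH unfolding f_def by (simp add: mat_simps)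
  have fsm: "f (c \<cdot>\<^sub>m A) = c \<cdot>\<^sub>m f A" if "A \<in> sq_mats n" for A c
    using that GH unfolding f_def by (simp add: mat_simps)
  have f0: "f (0\<^sub>m n n) = 0\<^sub>m n n" using GH unfolding f_def by (simp add: mat_simps)
  have fm: "f A * f B = f (A * B)" if "A \<in> sq_mats n" "B \<in> sq_mats n" for A B
    using conj_mult_aux[of G n H A B] that GH unfolding f_def by auto
  have inj: "A = B" if "f A = f B" "A \<in> sq_mats n" "B \<in> sq_mats n" for A B
    using conj_inj[of G n H A B] that GH unfolding f_def by auto
  have br: "lie_bracket (f A) (f B) = 0\<^sub>m n n \<longleftrightarrow> lie_bracket A B = 0\<^sub>m n n"
    if "A \<in> sq_mats n" "B \<in> sq_mats n" for A B
    using that inj[of "A * B" "B * A"] by (auto simp: bracket_zero_iff[of _ n] fc fm)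
  have sub: "mat_subspace n (f ` M)"
    unfolding mat_subspace_def
  proof (intro conjI ballI allI)
    show "f ` M \<subseteq> sq_mats n" using Md fc by auto
    show "0\<^sub>m n n \<in> f ` M" using Md f0 by (metis imageI)
    fix A assume "A \<in> f ` M"
    then obtain A' where A': "A' \<in> M" "A = f A'" by auto
    have c: "A' \<in> sq_mats n" using A' Md by auto
    show "r \<cdot>\<^sub>m A \<in> f ` M" for r using A' c Md fsm[of A' r] by (metis imageI)
    fix B assume "B \<in> f ` M"
    then obtain B' where B': "B' \<in> M" "B = f B'" by auto
    have c': "B' \<in> sq_mats n" using B' Md by auto
    show "A + B \<in> f ` M" using A' B' c c' Md fadd[of A' B'] by (metis imageI)
  qed
  have "f ` M = {X \<in> f ` L. \<forall>A\<in>f ` M. lie_bracket X A = 0\<^sub>m n n}"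
  proof -
    have *: "(\<forall>A\<in>f ` M. lie_bracket (f X) A = 0\<^sub>m n n) \<longleftrightarrow> X \<in> M" if "X \<in> L" for X
    proof -
      have c: "X \<in> sq_mats n" "\<And>A. A \<in> M \<Longrightarrow> A \<in> sq_mats n" using that L Md by auto
      have "(\<forall>A\<in>f ` M. lie_bracket (f X) A = 0\<^sub>m n n) \<longleftrightarrow> (\<forall>A\<in>M. lie_bracket X A = 0\<^sub>m n n)"
        using c br by auto
      also have "\<dots> \<longleftrightarrow> X \<in> M" using that Md by blast
      finally show ?thesis .
    qed
    moreover have "M \<subseteq> L" using Md by blast
    ultimately show ?thesis
    proof (intro equalityI subsetI)
      fix x assume "x \<in> f ` M"
      then obtain X where "X \<in> M" "X \<in> L" "x = f X" using \<open>M \<subseteq> L\<close> by auto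
      then show "x \<in> {X \<in> f ` L. \<forall>A\<in>f ` M. lie_bracket X A = 0\<^sub>m n n}" using * by blast
    qed (use * in auto)
  qed
  moreover have "\<forall>A\<in>f ` M. \<forall>B\<in>f ` M. lie_bracket A B = 0\<^sub>m n n"
  proof (intro ballI)
    fix A B assume "A \<in> f ` M" "B \<in> f ` M"
    then obtain A' B' where "A' \<in> M" "A = f A'" "B' \<in> M" "B = f B'" by auto
    then show "lie_bracket A B = 0\<^sub>m n n" using Md br[of A' B'] by auto
  qed
  ultimately show ?thesis unfolding MASA_def cs using sub Md by blast
qed

lemma o_alg_carrier: "K \<in> sq_mats n \<Longrightarrow> X \<in> o_alg K \<Longrightarrow> X \<in> sq_mats n"
  unfolding o_alg_def by auto

lemma o_alg_iff:
  assumes "K \<in> sq_mats n"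
  shows "X \<in> o_alg K \<longleftrightarrow> X \<in> sq_mats n \<and> X * K = - (K * X\<^sup>T)"
proof -
  have "X * K + K * X\<^sup>T = 0\<^sub>m n n \<longleftrightarrow> X * K = - (K * X\<^sup>T)" if "X \<in> sq_mats n"
    using that assms by (auto simp: mat_eq_iff add_eq_0_iff2)
  then show ?thesis using assms unfolding o_alg_def by auto
qed

lemma o_alg_conj_mem:
  assumes K: "K \<in> sq_mats n"
    and GH: "G \<in> sq_mats n" "H \<in> sq_mats n" "G * H = 1\<^sub>m n" "H * G = 1\<^sub>m n"
    and X: "X \<in> o_alg K"
  shows "G * X * H \<in> o_alg (G * K * G\<^sup>T)"
proof -
  have Xc: "X \<in> sq_mats n" and XK: "X * K = - (K * X\<^sup>T)" using X K by (auto simp: o_alg_iff)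
  have "(G * X * H) * (G * K * G\<^sup>T) = G * (X * K) * G\<^sup>T"
    using K GH Xc by (simp add: mat_dim_simps mult_cancel_left_inverse[OF GH(4)] dim_of_carrier)
  also have "\<dots> = - (G * K * X\<^sup>T * G\<^sup>T)" unfolding XK using K GH Xc by (simp add: mat_simps)
  also have "G * K * X\<^sup>T * G\<^sup>T = (G * K * G\<^sup>T) * (G * X * H)\<^sup>T"
    using K GH Xc transpose_inverse[OF GH(2,1,4)]
    by (simp add: mat_dim_simps mult_cancel_left_inverse[of "G\<^sup>T" "H\<^sup>T" n] dim_of_carrier)
  finally show ?thesis using K GH Xc by (subst o_alg_iff[of _ n]) auto
qed

lemma congruence_back:
  assumes K: "K \<in> sq_mats n"
    and GH: "G \<in> sq_mats n" "H \<in> sq_mats n" "H * G = 1\<^sub>m n"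
  shows "H * (G * K * G\<^sup>T) * H\<^sup>T = (K :: real mat)"
  using K GH transpose_inverse[OF GH(2,1,3)]
  by (simp add: mat_dim_simps mult_cancel_left_inverse[OF GH(3)] dim_of_carrier)

lemma o_alg_conj:
  assumes K: "K \<in> sq_mats n"
    and GH: "G \<in> sq_mats n" "H \<in> sq_mats n" "G * H = 1\<^sub>m n" "H * G = 1\<^sub>m n"
  shows "conj_set G (o_alg K) = o_alg (G * K * G\<^sup>T)"
proof -
  have i: "mat_inv G = H" using mat_inv_eqI[of G n H] assms by auto
  have K': "G * K * G\<^sup>T \<in> sq_mats n" using K GH by auto
  have "X \<in> conj_set G (o_alg K)" if X: "X \<in> o_alg (G * K * G\<^sup>T)" for X
  proof -
    have Xc: "X \<in> sq_mats n" using o_alg_carrier[OF K' X] .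
    have "H * X * G \<in> o_alg K"
      using o_alg_conj_mem[OF K' GH(2,1,4,3) X] congruence_back[OF K GH(1,2,4)] by simp
    moreover have "X = G * (H * X * G) * H" using conj_cancel[OF GH(2,1,4,3) Xc] by simp
    ultimately show ?thesis unfolding conj_set_def i by blast
  qed
  then show ?thesis using o_alg_conj_mem[OF K GH] unfolding conj_set_def i by blast
qed

lemma e_alg_conj:
  assumes K: "K \<in> sq_mats n"
    and GH: "G \<in> sq_mats n" "H \<in> sq_mats n" "G * H = 1\<^sub>m n" "H * G = 1\<^sub>m n"
    and a: "a \<in> carrier_vec n"
  shows "conj_set (ext_mat G a 1) (e_alg K) = e_alg (G * K * G\<^sup>T)"
proof (intro equalityI subsetI)
  have K': "G * K * G\<^sup>T \<in> sq_mats n" using K GH by auto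
  fix Z assume "Z \<in> conj_set (ext_mat G a 1) (e_alg K)"
  then obtain X b where X: "X \<in> o_alg K" "b \<in> carrier_vec n"
    "Z = ext_mat G a 1 * ext_mat X b 0 * mat_inv (ext_mat G a 1)"
    unfolding conj_set_def e_alg_def using K by auto
  have Xc: "X \<in> sq_mats n" using o_alg_carrier[OF K X(1)] .
  have "Z = ext_mat (G * X * H) (G *\<^sub>v b - G * X * H *\<^sub>v a) 0"
    using X(3) ext_mat_conj[OF GH a Xc X(2)] by simp
  moreover have "G *\<^sub>v b - G * X * H *\<^sub>v a \<in> carrier_vec n" using GH by (intro carrier_vecI) auto
  moreover have "dim_row (G * K * G\<^sup>T) = n" using K' by auto
  ultimately show "Z \<in> e_alg (G * K * G\<^sup>T)" unfolding e_alg_def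
    using o_alg_conj_mem[OF K GH X(1)] by blast
next
  have K': "G * K * G\<^sup>T \<in> sq_mats n" using K GH by auto
  fix Z assume "Z \<in> e_alg (G * K * G\<^sup>T)"
  then obtain X b where X: "X \<in> o_alg (G * K * G\<^sup>T)" "b \<in> carrier_vec n" "Z = ext_mat X b 0"
    unfolding e_alg_def using K' by auto
  have Xc: "X \<in> sq_mats n" using o_alg_carrier[OF K' X(1)] .
  define Y where "Y = H * X * G"
  \<comment> \<open>The solution of G c - X a = b, which is the condition that
    \<open>ext_mat_conj\<close> imposes on the translation part of the preimage.\<close>
  define c where "c = H *\<^sub>v (b + X *\<^sub>v a)"
  have Y: "Y \<in> o_alg K" unfolding Y_def
    using o_alg_conj_mem[OF K' GH(2,1,4,3) X(1)] congruence_back[OF K GH(1,2,4)] by simp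
  have Yc: "Y \<in> sq_mats n" using o_alg_carrier[OF K Y] .
  have c: "c \<in> carrier_vec n" unfolding c_def using GH Xc X(2) a by auto
  have GY: "G * Y * H = X" unfolding Y_def using conj_cancel[OF GH(2,1,4,3) Xc] .
  have "G *\<^sub>v c = b + X *\<^sub>v a" unfolding c_def using GH Xc X(2) a
    by (simp add: mult_vec_cancel_left_inverse[OF GH(3)] dim_of_carrier)
  then have "G *\<^sub>v c - X *\<^sub>v a = b" using X(2) Xc a by auto
  then have "Z = ext_mat G a 1 * ext_mat Y c 0 * mat_inv (ext_mat G a 1)"
    using ext_mat_conj[OF GH a Yc c] GY X(3) by simp
  moreover have "ext_mat Y c 0 \<in> e_alg K" unfolding e_alg_def using Y c K by auto
  ultimately show "Z \<in> conj_set (ext_mat G a 1) (e_alg K)" unfolding conj_set_def by blast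
qed

subsection \<open>Maximal abelian subalgebras of \<open>e(p,q)\<close> as sets of pairs\<close>

definition pairs :: "nat \<Rightarrow> real mat set \<Rightarrow> (real mat \<times> real vec) set" where
  "pairs n M = {(X, a). X \<in> sq_mats n \<and> a \<in> carrier_vec n \<and> ext_mat X a 0 \<in> M}"

lemma o_proj_pairs: "o_proj n M = fst ` pairs n M"
  unfolding o_proj_def pairs_def by force

text \<open>Parts 3 to 5 are closure under linear combinations, part 6 is commutativity and part 7
  is maximality, with brackets read through \<open>ext_mat_bracket\<close>. Later arguments cite
  these parts by number and work with pairs instead of matrices of size n + 1.\<close>

lemma e_MASA_pairs:
  assumes K: "K \<in> sq_mats n" and M: "e_MASA K M"
  shows "M = (\<lambda>(X, a). ext_mat X a 0) ` pairs n M"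
    and "\<And>X a. (X, a) \<in> pairs n M \<Longrightarrow> X \<in> o_alg K \<and> X \<in> sq_mats n \<and> a \<in> carrier_vec n"
    and "(0\<^sub>m n n, 0\<^sub>v n) \<in> pairs n M"
    and "\<And>X a Y b. (X, a) \<in> pairs n M \<Longrightarrow> (Y, b) \<in> pairs n M \<Longrightarrow> (X + Y, a + b) \<in> pairs n M"
    and "\<And>X a r. (X, a) \<in> pairs n M \<Longrightarrow> (r \<cdot>\<^sub>m X, r \<cdot>\<^sub>v a) \<in> pairs n M"
    and "\<And>X a Y b. (X, a) \<in> pairs n M \<Longrightarrow> (Y, b) \<in> pairs n M \<Longrightarrow> X * Y = Y * X \<and> X *\<^sub>v b = Y *\<^sub>v a"
    and "\<And>X a. X \<in> o_alg K \<Longrightarrow> a \<in> carrier_vec n \<Longrightarrow>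
          (\<And>Y b. (Y, b) \<in> pairs n M \<Longrightarrow> X * Y = Y * X \<and> X *\<^sub>v b = Y *\<^sub>v a) \<Longrightarrow> (X, a) \<in> pairs n M"
proof -
  have dK: "dim_row K = n" using K by auto
  note Md = M[unfolded e_MASA_def MASA_def mat_subspace_def dK]
  have ME: "\<exists>X a. X \<in> o_alg K \<and> a \<in> carrier_vec n \<and> Z = ext_mat X a 0" if "Z \<in> M" for Z
    using that Md dK unfolding e_alg_def by blast
  have oc: "X \<in> sq_mats n" if "X \<in> o_alg K" for X using o_alg_carrier[OF K that] .
  show 1: "M = (\<lambda>(X, a). ext_mat X a 0) ` pairs n M"
    using ME oc unfolding pairs_def by fastforce
  show 2: "X \<in> o_alg K \<and> X \<in> sq_mats n \<and> a \<in> carrier_vec n" if "(X, a) \<in> pairs n M" for X a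
    using that ME[of "ext_mat X a 0"] oc ext_mat_eq_iff[of X n _ a _ 0 0] unfolding pairs_def by blast
  show "(0\<^sub>m n n, 0\<^sub>v n) \<in> pairs n M" using Md unfolding pairs_def ext_mat_zero[symmetric] by auto
  show "(X + Y, a + b) \<in> pairs n M" if "(X, a) \<in> pairs n M" "(Y, b) \<in> pairs n M" for X a Y b
  proof -
    have "ext_mat X a 0 + ext_mat Y b 0 \<in> M" using that Md unfolding pairs_def by blast
    then show ?thesis using that unfolding pairs_def by (auto simp: ext_mat_add[of _ n])
  qed
  show "(r \<cdot>\<^sub>m X, r \<cdot>\<^sub>v a) \<in> pairs n M" if "(X, a) \<in> pairs n M" for X a r
  proof -
    have "r \<cdot>\<^sub>m ext_mat X a 0 \<in> M" using that Md unfolding pairs_def by blast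
    then show ?thesis using that unfolding pairs_def by (auto simp: ext_mat_smult[of _ n])
  qed
  show "X * Y = Y * X \<and> X *\<^sub>v b = Y *\<^sub>v a" if "(X, a) \<in> pairs n M" "(Y, b) \<in> pairs n M" for X a Y b
    using that Md ext_mat_bracket[of X n Y a b] unfolding pairs_def by blast
  show "(X, a) \<in> pairs n M" if X: "X \<in> o_alg K" "a \<in> carrier_vec n"
    and c: "\<And>Y b. (Y, b) \<in> pairs n M \<Longrightarrow> X * Y = Y * X \<and> X *\<^sub>v b = Y *\<^sub>v a" for X a
  proof -
    have "ext_mat X a 0 \<in> e_alg K" unfolding e_alg_def using X dK by auto
    moreover have "lie_bracket (ext_mat X a 0) Z = 0\<^sub>m (n + 1) (n + 1)" if Z: "Z \<in> M" for Z
    proof -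
      have "Z \<in> (\<lambda>(X, a). ext_mat X a 0) ` pairs n M" using Z 1 by simp
      then obtain Y b where Y: "(Y, b) \<in> pairs n M" "Z = ext_mat Y b 0" by auto
      then show ?thesis using c[OF Y(1)] 2[OF Y(1)] X oc ext_mat_bracket[of X n Y a b] by auto
    qed
    ultimately have "ext_mat X a 0 \<in> M" using Md by blast
    then show ?thesis using X oc unfolding pairs_def by auto
  qed
qed

lemma e_MASA_conj:
  assumes K: "K \<in> sq_mats n" and M: "e_MASA K M"
    and GH: "G \<in> sq_mats n" "H \<in> sq_mats n" "G * H = 1\<^sub>m n" "H * G = 1\<^sub>m n"
    and a: "a \<in> carrier_vec n"
  shows "e_MASA (G * K * G\<^sup>T) (conj_set (ext_mat G a 1) M)"
proof -
  have "e_alg K \<subseteq> sq_mats (n + 1)"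
    unfolding e_alg_def using o_alg_carrier[OF K] by auto
  moreover have "MASA (n + 1) (e_alg K) M" using M K unfolding e_MASA_def by auto
  ultimately have "MASA (n + 1) (e_alg (G * K * G\<^sup>T)) (conj_set (ext_mat G a 1) M)"
    using MASA_conj[of "ext_mat G a 1" "n + 1" "ext_mat H (- (H *\<^sub>v a)) 1" "e_alg K" M]
      ext_mat_inv[OF GH a] e_alg_conj[OF K GH a] GH by auto
  then show ?thesis using K GH unfolding e_MASA_def by auto
qed

lemma pairs_conj:
  assumes ME: "M = (\<lambda>(X, a). ext_mat X a 0) ` pairs n M"
    and GH: "G \<in> sq_mats n" "H \<in> sq_mats n" "G * H = 1\<^sub>m n" "H * G = 1\<^sub>m n"
    and a: "a \<in> carrier_vec n"
  shows "pairs n (conj_set (ext_mat G a 1) M) =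
     (\<lambda>(X, b). (G * X * H, G *\<^sub>v b - G * X * H *\<^sub>v a)) ` pairs n M"
proof -
  have c: "conj_set (ext_mat G a 1) M =
     (\<lambda>(X, b). ext_mat (G * X * H) (G *\<^sub>v b - G * X * H *\<^sub>v a) 0) ` pairs n M"
    unfolding conj_set_def
    by (subst ME, unfold image_image, rule image_cong)
       (auto simp: pairs_def ext_mat_conj[OF GH a])
  have cc: "G * X * H \<in> sq_mats n" "G *\<^sub>v b - G * X * H *\<^sub>v a \<in> carrier_vec n"
    if "(X, b) \<in> pairs n M" for X b using that GH a unfolding pairs_def by (auto intro!: carrier_vecI)
  show ?thesis
  proof (intro equalityI subsetI)
    fix z assume "z \<in> pairs n (conj_set (ext_mat G a 1) M)"
    then obtain Y d where z: "z = (Y, d)" "Y \<in> sq_mats n" "d \<in> carrier_vec n"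
      "ext_mat Y d 0 \<in> conj_set (ext_mat G a 1) M" unfolding pairs_def by auto
    then obtain X b where X: "(X, b) \<in> pairs n M" 
      "ext_mat Y d 0 = ext_mat (G * X * H) (G *\<^sub>v b - G * X * H *\<^sub>v a) 0" unfolding c by auto
    then have "Y = G * X * H \<and> d = G *\<^sub>v b - G * X * H *\<^sub>v a"
      using ext_mat_eq_iff[OF z(2) cc(1)[OF X(1)] z(3) cc(2)[OF X(1)], of 0 0] by simp
    then show "z \<in> (\<lambda>(X, b). (G * X * H, G *\<^sub>v b - G * X * H *\<^sub>v a)) ` pairs n M"
      using X z(1) by auto
  next
    fix z assume "z \<in> (\<lambda>(X, b). (G * X * H, G *\<^sub>v b - G * X * H *\<^sub>v a)) ` pairs n M"
    then obtain X b where X: "(X, b) \<in> pairs n M" "z = (G * X * H, G *\<^sub>v b - G * X * H *\<^sub>v a)" by auto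
    then show "z \<in> pairs n (conj_set (ext_mat G a 1) M)"
    proof -
      have "ext_mat (G * X * H) (G *\<^sub>v b - G * X * H *\<^sub>v a) 0 \<in> conj_set (ext_mat G a 1) M"
        unfolding c using X(1) by force
      then show ?thesis using cc[OF X(1)] X(2) unfolding pairs_def[of n "conj_set _ _"] by simp
    qed
  qed
qed

lemma o_proj_conj:
  assumes ME: "M = (\<lambda>(X, a). ext_mat X a 0) ` pairs n M"
    and GH: "G \<in> sq_mats n" "H \<in> sq_mats n" "G * H = 1\<^sub>m n" "H * G = 1\<^sub>m n"
    and a: "a \<in> carrier_vec n"
  shows "o_proj n (conj_set (ext_mat G a 1) M) = conj_set G (o_proj n M)"
  unfolding o_proj_pairs pairs_conj[OF assms] unfolding conj_set_def mat_inv_eqI[OF GH] image_image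
  by (intro image_cong) auto

lemma represented_trans:
  assumes K: "K \<in> sq_mats n" and M: "M \<subseteq> sq_mats (n + 1)"
    and 1: "represented K M K' M'" and 2: "represented K' M' K'' M''"
  shows "represented K M K'' M''"
proof -
  have dK: "dim_row K = n" using K by auto
  obtain G a where G: "G \<in> sq_mats n" "a \<in> carrier_vec n" "invertible_mat G"
    "K' = G * K * G\<^sup>T" "M' = conj_set (ext_mat G a 1) M" using 1 dK unfolding represented_def by auto
  have dK': "dim_row K' = n" using G by auto
  obtain G' a' where G': "G' \<in> sq_mats n" "a' \<in> carrier_vec n" "invertible_mat G'"
    "K'' = G' * K' * G'\<^sup>T" "M'' = conj_set (ext_mat G' a' 1) M'" using 2 dK' unfolding represented_def by auto
  obtain H where H: "H \<in> sq_mats n" "G * H = 1\<^sub>m n" "H * G = 1\<^sub>m n" using G by (auto elim: invertible_matE)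
  obtain H' where H': "H' \<in> sq_mats n" "G' * H' = 1\<^sub>m n" "H' * G' = 1\<^sub>m n" using G' by (auto elim: invertible_matE)
  have "M'' = conj_set (ext_mat G' a' 1 * ext_mat G a 1) M"
    unfolding G' G(5)
    by (rule conj_set_compose[OF _ _ ext_mat_inv(1,2)[OF G'(1) H' G'(2)] _ _ ext_mat_inv(1,2)[OF G(1) H G(2)] M])
       (use G H G' H' in auto)
  also have "ext_mat G' a' 1 * ext_mat G a 1 = ext_mat (G' * G) (G' *\<^sub>v a + a') 1"
    using G G' by (simp add: ext_mat_mult[of _ n])
  finally have "M'' = conj_set (ext_mat (G' * G) (G' *\<^sub>v a + a') 1) M" .
  moreover have "K'' = (G' * G) * K * (G' * G)\<^sup>T"
    unfolding G'(4) G(4) using G(1) G'(1) K by (simp add: mat_simps)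
  moreover have "invertible_mat (G' * G)" by (rule invertible_mult) (use G G' in auto)
  ultimately show ?thesis unfolding represented_def dK using G(1,2) G'(1,2)
    by (intro bexI[of _ "G' * G"] bexI[of _ "G' *\<^sub>v a + a'"]) auto
qed

lemma e_MASA_subset: "K \<in> sq_mats n \<Longrightarrow> e_MASA K M \<Longrightarrow> M \<subseteq> sq_mats (n + 1)"
  unfolding e_MASA_def MASA_def mat_subspace_def by auto

lemma represented_e_MASA:
  assumes K: "K \<in> sq_mats n" and M: "e_MASA K M" and r: "represented K M K' M'"
  shows "e_MASA K' M'" "K' \<in> sq_mats n"
    "linearly_represented K (o_proj n M) K' (o_proj n M')"
proof -
  have dK: "dim_row K = n" using K by auto
  obtain G a where G: "G \<in> sq_mats n" "a \<in> carrier_vec n" "invertible_mat G"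
    "K' = G * K * G\<^sup>T" "M' = conj_set (ext_mat G a 1) M" using r dK unfolding represented_def by auto
  obtain H where H: "H \<in> sq_mats n" "G * H = 1\<^sub>m n" "H * G = 1\<^sub>m n" using G by (auto elim: invertible_matE)
  show "e_MASA K' M'" unfolding G using e_MASA_conj[OF K M G(1) H G(2)] .
  show "K' \<in> sq_mats n" unfolding G using G(1) K by auto
  have "o_proj n M' = conj_set G (o_proj n M)" unfolding G(5)
    by (rule o_proj_conj[OF e_MASA_pairs(1)[OF K M] G(1) H G(2)])
  then show "linearly_represented K (o_proj n M) K' (o_proj n M')"
    unfolding linearly_represented_def dK using G by auto
qed

text \<open>The translations of \<open>M\<close> serve as \<open>N\<^sub>0\<close> and its rotation
  parts as \<open>F\<^sub>0\<close>. Conjugation by the translation \<open>c\<close> sends (X, b) to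
  (X, b - X c), and b - X c is a translation of \<open>M\<close>, being the difference of two
  members with the same rotation part.\<close>

lemma splittingI:
  assumes K: "K \<in> sq_mats n" and M: "e_MASA K M" and c: "c \<in> carrier_vec n"
    and X: "\<And>X b. (X, b) \<in> pairs n M \<Longrightarrow> (X, X *\<^sub>v c) \<in> pairs n M"
  shows "splitting K M"
proof -
  have dK: "dim_row K = n" using K by auto
  note P = e_MASA_pairs[OF K M]
  define F where "F = {ext_mat X (0\<^sub>v n) 0 | X. \<exists>b. (X, b) \<in> pairs n M}"
  define N where "N = {ext_mat (0\<^sub>m n n) b 0 | b. (0\<^sub>m n n, b) \<in> pairs n M}"
  have "mat_subspace (n + 1) F"
    unfolding mat_subspace_def
  proof (intro conjI ballI allI)
    show "F \<subseteq> sq_mats (n + 1)" unfolding F_def using P(2) by auto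
    show "0\<^sub>m (n + 1) (n + 1) \<in> F" unfolding F_def ext_mat_zero[symmetric] using P(3) by blast
    fix A assume "A \<in> F"
    then obtain X b where A: "A = ext_mat X (0\<^sub>v n) 0" "(X, b) \<in> pairs n M" unfolding F_def by auto
    have Xc: "X \<in> sq_mats n" using P(2) A by auto
    have "r \<cdot>\<^sub>v 0\<^sub>v n = (0\<^sub>v n :: real vec)" for r by auto
    then have "r \<cdot>\<^sub>m A = ext_mat (r \<cdot>\<^sub>m X) (0\<^sub>v n) 0" for r using Xc A by (simp add: ext_mat_smult[of _ n])
    then show "r \<cdot>\<^sub>m A \<in> F" for r unfolding F_def using P(5)[OF A(2)] by blast
    fix B assume "B \<in> F"
    then obtain Y d where B: "B = ext_mat Y (0\<^sub>v n) 0" "(Y, d) \<in> pairs n M" unfolding F_def by auto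
    have Yc: "Y \<in> sq_mats n" using P(2) B by auto
    have "A + B = ext_mat (X + Y) (0\<^sub>v n) 0" using Xc Yc A B by (simp add: ext_mat_add[of _ n])
    then show "A + B \<in> F" unfolding F_def using P(4)[OF A(2) B(2)] by blast
  qed
  moreover have "mat_subspace (n + 1) N"
    unfolding mat_subspace_def
  proof (intro conjI ballI allI)
    show "N \<subseteq> sq_mats (n + 1)" unfolding N_def by auto
    show "0\<^sub>m (n + 1) (n + 1) \<in> N" unfolding N_def ext_mat_zero[symmetric] using P(3) by blast
    fix A assume "A \<in> N"
    then obtain b where A: "A = ext_mat (0\<^sub>m n n) b 0" "(0\<^sub>m n n, b) \<in> pairs n M" unfolding N_def by auto
    have Xc: "b \<in> carrier_vec n" using P(2) A by auto
    have "r \<cdot>\<^sub>m A = ext_mat (0\<^sub>m n n) (r \<cdot>\<^sub>v b) 0" for r using Xc A by (simp add: ext_mat_smult[of _ n])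
    moreover have "(0\<^sub>m n n, r \<cdot>\<^sub>v b) \<in> pairs n M" for r using P(5)[OF A(2), of r] by simp
    ultimately show "r \<cdot>\<^sub>m A \<in> N" for r unfolding N_def by blast
    fix B assume "B \<in> N"
    then obtain d where B: "B = ext_mat (0\<^sub>m n n) d 0" "(0\<^sub>m n n, d) \<in> pairs n M" unfolding N_def by auto
    have Yc: "d \<in> carrier_vec n" using P(2) B by auto
    have "A + B = ext_mat (0\<^sub>m n n) (b + d) 0" using Xc Yc A B by (simp add: ext_mat_add[of _ n])
    moreover have "(0\<^sub>m n n, b + d) \<in> pairs n M" using P(4)[OF A(2) B(2)] by simp
    ultimately show "A + B \<in> N" unfolding N_def by blast
  qed
  moreover have "F \<subseteq> {ext_mat X (0\<^sub>v n) 0 | X. X \<in> o_alg K}" unfolding F_def using P(2) by blast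
  moreover have "N \<subseteq> T_alg n" unfolding N_def T_alg_def using P(2) by blast
  moreover have "E_conjugate K M {A + B | A B. A \<in> F \<and> B \<in> N}"
    unfolding E_conjugate_def
  proof (intro bexI)
    let ?P = "ext_mat (1\<^sub>m n) c 1"
    have "1\<^sub>m n \<in> O_grp K" unfolding O_grp_def using K by auto
    then show "?P \<in> E_grp K" unfolding E_grp_def using c dK by auto
    have one: "(1\<^sub>m n :: real mat) \<in> sq_mats n" "1\<^sub>m n * 1\<^sub>m n = (1\<^sub>m n :: real mat)" by auto
    have "conj_set ?P M = (\<lambda>(X, b). ext_mat X (b - X *\<^sub>v c) 0) ` pairs n M"
      unfolding conj_set_def
      by (subst P(1), unfold image_image, rule image_cong)
         (auto simp: pairs_def ext_mat_conj[OF one(1,1,2,2) c])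
    also have "\<dots> = {A + B | A B. A \<in> F \<and> B \<in> N}"
    proof (intro equalityI subsetI)
      fix Z assume "Z \<in> (\<lambda>(X, b). ext_mat X (b - X *\<^sub>v c) 0) ` pairs n M"
      then obtain X b where Z: "(X, b) \<in> pairs n M" "Z = ext_mat X (b - X *\<^sub>v c) 0" by auto
      have car: "X \<in> sq_mats n" "b \<in> carrier_vec n" using P(2) Z by auto
      have "(X + - 1 \<cdot>\<^sub>m X, b + - 1 \<cdot>\<^sub>v (X *\<^sub>v c)) \<in> pairs n M" using P(4,5) X Z by blast
      moreover have "X + - 1 \<cdot>\<^sub>m X = 0\<^sub>m n n" using car by (auto intro!: eq_matI)
      moreover have "b + - 1 \<cdot>\<^sub>v (X *\<^sub>v c) = b - X *\<^sub>v c" using car c by (auto intro!: eq_vecI)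
      ultimately have "(0\<^sub>m n n, b - X *\<^sub>v c) \<in> pairs n M" by simp
      then have "ext_mat (0\<^sub>m n n) (b - X *\<^sub>v c) 0 \<in> N" unfolding N_def by auto
      moreover have "ext_mat X (0\<^sub>v n) 0 \<in> F" unfolding F_def using Z by auto
      moreover have "Z = ext_mat X (0\<^sub>v n) 0 + ext_mat (0\<^sub>m n n) (b - X *\<^sub>v c) 0"
        using Z car c by (simp add: ext_mat_add[of _ n] mat_dim_simps)
      ultimately show "Z \<in> {A + B | A B. A \<in> F \<and> B \<in> N}" by blast
    next
      fix Z assume "Z \<in> {A + B | A B. A \<in> F \<and> B \<in> N}"
      then obtain X b d where Z: "Z = ext_mat X (0\<^sub>v n) 0 + ext_mat (0\<^sub>m n n) d 0" "(X, b) \<in> pairs n M"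
        "(0\<^sub>m n n, d) \<in> pairs n M" unfolding F_def N_def by blast
      have car: "X \<in> sq_mats n" "d \<in> carrier_vec n" using P(2) Z by auto
      have "(X + 0\<^sub>m n n, X *\<^sub>v c + d) \<in> pairs n M" using P(4) X Z by blast
      then have "(X, X *\<^sub>v c + d) \<in> pairs n M" using car by simp
      moreover have "Z = ext_mat X (X *\<^sub>v c + d - X *\<^sub>v c) 0"
      proof -
        have "X *\<^sub>v c + d - X *\<^sub>v c = d" using car c by (intro eq_vecI) auto
        then show ?thesis using Z car by (simp add: ext_mat_add[of _ n] mat_dim_simps)
      qed
      ultimately show "Z \<in> (\<lambda>(X, b). ext_mat X (b - X *\<^sub>v c) 0) ` pairs n M" by force
    qed
    finally show "{A + B | A B. A \<in> F \<and> B \<in> N} = conj_set ?P M" by simp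
  qed
  ultimately show ?thesis unfolding splitting_def dK by blast
qed

lemma splitting_representedI:
  assumes K: "K \<in> sq_mats n" and M: "e_MASA K M" and r: "represented K M K' M'"
    and c: "c \<in> carrier_vec n"
    and X: "\<And>X b. (X, b) \<in> pairs n M' \<Longrightarrow> (X, X *\<^sub>v c) \<in> pairs n M'"
  shows "splitting K M"
proof -
  have dK: "dim_row K = n" using K by auto
  obtain G a where G: "G \<in> sq_mats n" "a \<in> carrier_vec n" "invertible_mat G"
    "K' = G * K * G\<^sup>T" "M' = conj_set (ext_mat G a 1) M" using r dK unfolding represented_def by auto
  obtain H where H: "H \<in> sq_mats n" "G * H = 1\<^sub>m n" "H * G = 1\<^sub>m n" using G by (auto elim: invertible_matE)
  note P = e_MASA_pairs[OF K M]
  note pc = pairs_conj[OF P(1) G(1) H G(2)]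
  show ?thesis
  proof (rule splittingI[OF K M])
    \<comment> \<open>The change of basis acts on translation parts by b |-> G b - G X H a, so the
      vector \<open>c\<close> that works for \<open>M'\<close> pulls back to this one.\<close>
    show "H *\<^sub>v (a + c) \<in> carrier_vec n" using H G c by auto
    fix X b assume Xb: "(X, b) \<in> pairs n M"
    have car: "X \<in> sq_mats n" using P(2)[OF Xb] by auto
    have "(G * X * H, G *\<^sub>v b - G * X * H *\<^sub>v a) \<in> pairs n M'" unfolding G(5) pc using Xb by force
    then have "(G * X * H, G * X * H *\<^sub>v c) \<in> pairs n M'" by (rule X)
    then obtain Y d where Y: "(Y, d) \<in> pairs n M" "G * X * H = G * Y * H" "G * X * H *\<^sub>v c = G *\<^sub>v d - G * Y * H *\<^sub>v a"
      unfolding G(5) pc by auto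
    have carY: "Y \<in> sq_mats n" "d \<in> carrier_vec n" using P(2)[OF Y(1)] by auto
    have XY: "X = Y" using conj_inj[OF G(1) H car carY(1) Y(2)] .
    have "G *\<^sub>v d = G * X * H *\<^sub>v c + G * X * H *\<^sub>v a" 
      unfolding Y(3) unfolding XY using carY G H by (intro eq_vecI) auto
    then have "H *\<^sub>v (G *\<^sub>v d) = H *\<^sub>v (G * X * H *\<^sub>v (a + c))"
      using G H car c by (simp add: mat_simps comm_add_vec[of _ n])
    then have "d = X *\<^sub>v (H *\<^sub>v (a + c))" using G H car carY c
      by (simp add: mat_simps mult_vec_cancel_left_inverse[OF H(3)])
    then show "(X, X *\<^sub>v (H *\<^sub>v (a + c))) \<in> pairs n M" using Y(1) XY by simp
  qed
qed

subsection \<open>Rank normal form and Fitting decomposition\<close>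

lemma mult_four_block_dim:
  assumes "dim_row B1 = dim_row A1" "dim_col C1 = dim_col A1" "dim_row D1 = dim_row C1" "dim_col D1 = dim_col B1"
    and "dim_row A2 = dim_col A1" "dim_row B2 = dim_row A2" "dim_col C2 = dim_col A2"
    and "dim_row C2 = dim_col B1" "dim_row D2 = dim_row C2" "dim_col D2 = dim_col B2"
  shows "four_block_mat A1 B1 C1 D1 * four_block_mat A2 B2 C2 D2 =
     four_block_mat (A1 * A2 + B1 * C2) (A1 * B2 + B1 * D2) (C1 * A2 + D1 * C2) (C1 * B2 + D1 * (D2 :: real mat))"
  by (rule mult_four_block_mat[of _ "dim_row A1" "dim_col A1" _ "dim_col B1" _ "dim_row C1" _ _ "dim_col A2" _ "dim_col B2"])
     (use assms in auto)

lemma four_block_one: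
  "four_block_mat (1\<^sub>m n) (0\<^sub>m n m) (0\<^sub>m m n) (1\<^sub>m m) = (1\<^sub>m (n + m) :: real mat)"
  by (intro eq_matI) auto

lemma four_block_eq_iff:
  assumes "A \<in> carrier_mat n m" "B \<in> carrier_mat n m'" "C \<in> carrier_mat n' m" "D \<in> carrier_mat n' m'"
    and "A' \<in> carrier_mat n m" "B' \<in> carrier_mat n m'" "C' \<in> carrier_mat n' m" "D' \<in> carrier_mat n' m'"
  shows "four_block_mat A B C D = four_block_mat A' B' C' (D' :: real mat) \<longleftrightarrow> A = A' \<and> B = B' \<and> C = C' \<and> D = D'"
proof
  assume eq: "four_block_mat A B C D = four_block_mat A' B' C' D'"
  have e: "four_block_mat A B C D $$ (i, j) = four_block_mat A' B' C' D' $$ (i, j)" for i j using eq by simp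
  have "A $$ (i, j) = A' $$ (i, j)" if "i < n" "j < m" for i j using e[of i j] that assms by simp
  moreover have "B $$ (i, j) = B' $$ (i, j)" if "i < n" "j < m'" for i j using e[of i "m + j"] that assms by simp
  moreover have "C $$ (i, j) = C' $$ (i, j)" if "i < n'" "j < m" for i j using e[of "n + i" j] that assms by simp
  moreover have "D $$ (i, j) = D' $$ (i, j)" if "i < n'" "j < m'" for i j using e[of "n + i" "m + j"] that assms by simp
  ultimately show "A = A' \<and> B = B' \<and> C = C' \<and> D = D'" using assms by (auto intro!: eq_matI)
qed simp

lemma four_block_split:
  assumes "A \<in> carrier_mat (n + n') (m + m')"
  obtains P Q R S where "P \<in> carrier_mat n m" "Q \<in> carrier_mat n m'" "R \<in> carrier_mat n' m" "S \<in> carrier_mat n' m'"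
    "A = four_block_mat P Q R (S :: real mat)"
proof -
  obtain P Q R S where s: "split_block A n m = (P, Q, R, S)" by (metis prod_cases4)
  from split_block[OF s, of n' m'] assms that show ?thesis by auto
qed

lemma invertible_diag_block:
  assumes "P \<in> sq_mats n" "invertible_mat P" "Q \<in> sq_mats m" "invertible_mat (Q :: real mat)"
  shows "invertible_mat (four_block_mat P (0\<^sub>m n m) (0\<^sub>m m n) Q)"
proof -
  obtain P' where P': "P' \<in> sq_mats n" "P * P' = 1\<^sub>m n" "P' * P = 1\<^sub>m n" using assms by (auto elim: invertible_matE)
  obtain Q' where Q': "Q' \<in> sq_mats m" "Q * Q' = 1\<^sub>m m" "Q' * Q = 1\<^sub>m m" using assms by (auto elim: invertible_matE)
  show ?thesis
    by (rule invertible_matI[of _ "n + m" "four_block_mat P' (0\<^sub>m n m) (0\<^sub>m m n) Q'"])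
       (use assms P' Q' in \<open>auto simp: mult_four_block_dim mat_simps four_block_one\<close>)
qed

text \<open>Padding with zero rows gives a singular square matrix, because its transpose annihilates
  the last unit vector.\<close>

lemma underdetermined_kernel:
  assumes A: "A \<in> carrier_mat nr nc" and lt: "nr < nc"
  shows "\<exists>x \<in> carrier_vec nc. x \<noteq> 0\<^sub>v nc \<and> A *\<^sub>v x = (0\<^sub>v nr :: real vec)"
proof -
  define B where "B = mat nc nc (\<lambda>(i, j). if i < nr then A $$ (i, j) else 0)"
  have B: "B \<in> sq_mats nc" unfolding B_def by auto
  have "B\<^sup>T *\<^sub>v unit_vec nc (nc - 1) = 0\<^sub>v nc"
    using lt mult_unit_vec[of "B\<^sup>T" nc nc "nc - 1"] B by (auto simp: B_def)
  then have "det (B\<^sup>T) = 0"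
    using det_0_iff_vec_prod_zero_field[of "B\<^sup>T" nc] B lt by (intro iffD2[OF det_0_iff_vec_prod_zero_field[of "B\<^sup>T" nc]]) (auto intro!: exI[of _ "unit_vec nc (nc - 1)"])
  then have "det B = 0" using det_transpose[OF B] by simp
  then obtain x where x: "x \<in> carrier_vec nc" "x \<noteq> 0\<^sub>v nc" "B *\<^sub>v x = 0\<^sub>v nc"
    using det_0_iff_vec_prod_zero_field[OF B] by auto
  have "(A *\<^sub>v x) $ i = 0" if i: "i < nr" for i
  proof -
    have "(B *\<^sub>v x) $ i = (A *\<^sub>v x) $ i" using i lt A x(1) unfolding B_def
      by (auto simp: scalar_prod_def)
    then show ?thesis using x i lt by simp
  qed
  then have "A *\<^sub>v x = 0\<^sub>v nr" using A by (intro eq_vecI) auto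
  with x show ?thesis by auto
qed

text \<open>The identity matrix with column i replaced by \<open>v\<close>, where v_i is not 0, is
  invertible and maps the i-th unit vector to \<open>v\<close>; a transposition of coordinates then
  moves i to 0.\<close>

lemma invertible_with_image:
  assumes v: "v \<in> carrier_vec n" "v \<noteq> 0\<^sub>v n"
  shows "\<exists>P \<in> sq_mats n. invertible_mat P \<and> P *\<^sub>v unit_vec n 0 = (v :: real vec)"
proof -
  obtain i where i: "i < n" "v $ i \<noteq> 0" using v by (metis carrier_vecD eq_vecI index_zero_vec)
  define P where "P = mat n n (\<lambda>(a, b). if b = i then v $ a else if a = b then 1 else 0)"
  have Pc: "P \<in> sq_mats n" unfolding P_def by auto
  have Px: "(P *\<^sub>v x) $ a = v $ a * x $ i + (if a = i then 0 else x $ a)" if x: "x \<in> carrier_vec n" and a: "a < n" for x a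
  proof -
    have "(P *\<^sub>v x) $ a = (\<Sum>b\<in>{0..<n}. (if b = i then v $ a else if a = b then 1 else 0) * x $ b)"
      using x a unfolding P_def by (simp add: scalar_prod_def)
    also have "\<dots> = (\<Sum>b\<in>{0..<n}. (if b = i then v $ a * x $ b else 0) + (if b = a then (if a = i then 0 else x $ b) else 0))"
      by (intro sum.cong) auto
    also have "\<dots> = v $ a * x $ i + (if a = i then 0 else x $ a)"
      unfolding sum.distrib using i a by simp
    finally show ?thesis .
  qed
  have "invertible_mat P"
  proof (rule invertible_of_trivial_kernel[OF Pc])
    fix x :: "real vec" assume x: "x \<in> carrier_vec n" "P *\<^sub>v x = 0\<^sub>v n"
    have xi: "x $ i = 0" using Px[OF x(1) i(1)] x(2) i by simp
    have "x $ a = 0" if "a < n" for a using Px[OF x(1) that] x(2) that xi by (cases "a = i") auto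
    then show "x = 0\<^sub>v n" using x by (intro eq_vecI) auto
  qed
  define S :: "real mat" where "S = mat n n (\<lambda>(a, b). if b = transpose 0 i a then 1 else 0)"
  have Sc: "S \<in> sq_mats n" unfolding S_def by auto
  have Sx: "(S *\<^sub>v x) $ a = x $ (transpose 0 i a)" if x: "x \<in> carrier_vec n" and a: "a < n" for x a
  proof -
    have t: "transpose 0 i a < n" using a i by (auto simp: Transposition.transpose_def)
    have "(S *\<^sub>v x) $ a = (\<Sum>b\<in>{0..<n}. (if b = transpose 0 i a then 1 else 0) * x $ b)"
      using x a unfolding S_def by (simp add: scalar_prod_def)
    also have "\<dots> = (\<Sum>b\<in>{0..<n}. (if b = transpose 0 i a then x $ b else 0))"
      by (intro sum.cong) auto
    finally have "(S *\<^sub>v x) $ a = (\<Sum>b\<in>{0..<n}. (if b = transpose 0 i a then x $ b else 0))" .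
    then show ?thesis using t by simp
  qed
  have "invertible_mat S"
  proof (rule invertible_of_trivial_kernel[OF Sc])
    fix x :: "real vec" assume x: "x \<in> carrier_vec n" "S *\<^sub>v x = 0\<^sub>v n"
    have "x $ a = 0" if a: "a < n" for a
    proof -
      have t: "transpose 0 i a < n" using a i by (auto simp: Transposition.transpose_def)
      show ?thesis using Sx[OF x(1) t] x(2) t by simp
    qed
    then show "x = 0\<^sub>v n" using x by (intro eq_vecI) auto
  qed
  have "S *\<^sub>v unit_vec n 0 = unit_vec n i"
  proof (rule eq_vecI)
    fix a assume "a < dim_vec (unit_vec n i :: real vec)"
    then have a: "a < n" by simp
    have t: "transpose 0 i a < n" using a i by (auto simp: Transposition.transpose_def)
    show "(S *\<^sub>v unit_vec n 0) $ a = unit_vec n i $ a"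
      using Sx[OF _ a, of "unit_vec n 0"] a t i by (auto simp: Transposition.transpose_def unit_vec_def)
  qed (use Sc in auto)
  moreover have "P *\<^sub>v unit_vec n i = v" using mult_unit_vec[OF Pc i(1)] v i by (auto simp: P_def intro!: eq_vecI)
  ultimately have "(P * S) *\<^sub>v unit_vec n 0 = v" using Pc Sc by (simp add: mat_simps)
  then show ?thesis using invertible_mult[OF Pc \<open>invertible_mat P\<close> Sc \<open>invertible_mat S\<close>] Pc Sc
    by (intro bexI[of _ "P * S"]) auto
qed

definition rank_mat :: "nat \<Rightarrow> nat \<Rightarrow> nat \<Rightarrow> real mat" where
  "rank_mat nr nc r = mat nr nc (\<lambda>(i, j). if i = j \<and> i < r then 1 else 0)"

lemma rank_mat_carrier [simp]: "rank_mat nr nc r \<in> carrier_mat nr nc"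
  "dim_row (rank_mat nr nc r) = nr" "dim_col (rank_mat nr nc r) = nc"
  unfolding rank_mat_def by auto

lemma rank_mat_Suc:
  "four_block_mat (1\<^sub>m 1) (0\<^sub>m 1 nc) (0\<^sub>m nr 1) (rank_mat nr nc r) = rank_mat (1 + nr) (1 + nc) (Suc r)"
  unfolding rank_mat_def by (intro eq_matI) auto

text \<open>Induction on the number of rows. Changes of basis on both sides turn a nonzero column
  into the first unit vector, a column operation clears the rest of the first row, and the lower
  right block is left to the induction hypothesis.\<close>

lemma rank_normal_form:
  assumes "A \<in> carrier_mat nr nc"
  shows "\<exists>P Q r. P \<in> sq_mats nr \<and> invertible_mat P \<and> Q \<in> sq_mats nc \<and> invertible_mat Q \<and>
     r \<le> nr \<and> r \<le> nc \<and> P * A * Q = rank_mat nr nc r"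
  using assms
proof (induction nr arbitrary: A nc)
  case 0
  have "invertible_mat (1\<^sub>m m :: real mat)" for m by (rule invertible_matI[of _ m "1\<^sub>m m"]) auto
  then show ?case using 0
    by (intro exI[of _ "1\<^sub>m 0"] exI[of _ "1\<^sub>m nc"] exI[of _ 0]) (auto simp: rank_mat_def)
next
  case (Suc nr)
  have inv1: "invertible_mat (1\<^sub>m m :: real mat)" for m by (rule invertible_matI[of _ m "1\<^sub>m m"]) auto
  show ?case
  proof (cases "A = 0\<^sub>m (Suc nr) nc")
    case True
    then show ?thesis using inv1
      by (intro exI[of _ "1\<^sub>m (Suc nr)"] exI[of _ "1\<^sub>m nc"] exI[of _ 0]) (auto simp: rank_mat_def intro!: eq_matI)
  next
    case False
    then obtain i j where ij: "i < Suc nr" "j < nc" "A $$ (i, j) \<noteq> 0" using Suc.prems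
      by (metis carrier_matD eq_matI index_zero_mat)
    obtain nc' where nc: "nc = 1 + nc'" using ij by (metis add.commute less_imp_Suc_add plus_1_eq_Suc not_add_less1 less_nat_zero_code nat.exhaust)
    have A: "A \<in> carrier_mat (1 + nr) (1 + nc')" using Suc.prems nc by simp
    define v where "v = A *\<^sub>v unit_vec nc j"
    have v: "v \<in> carrier_vec (1 + nr)" unfolding v_def using A by (intro carrier_vecI) auto
    have "v $ i \<noteq> 0" unfolding v_def using mult_unit_vec[OF Suc.prems ij(2)] ij Suc.prems by simp
    then have v0: "v \<noteq> 0\<^sub>v (1 + nr)" using ij by auto
    obtain P where P: "P \<in> sq_mats (1 + nr)" "invertible_mat P" "P *\<^sub>v unit_vec (1 + nr) 0 = v"
      using invertible_with_image[OF v v0] by blast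
    obtain S :: "real mat" where S: "S \<in> sq_mats (1 + nc')" "invertible_mat S" "S *\<^sub>v unit_vec (1 + nc') 0 = unit_vec (1 + nc') j"
      using invertible_with_image[of "unit_vec (1 + nc') j" "1 + nc'"] ij(2) unfolding nc by (metis unit_vec_carrier unit_vec_nonzero)
    obtain R where R: "R \<in> sq_mats (1 + nr)" "P * R = 1\<^sub>m (1 + nr)" "R * P = 1\<^sub>m (1 + nr)"
      using P by (auto elim: invertible_matE)
    have Ri: "invertible_mat R" using R P by (intro invertible_matI[of R _ P]) auto
    define B where "B = R * A * S"
    have B: "B \<in> carrier_mat (1 + nr) (1 + nc')" unfolding B_def using R A S by auto
    have "B *\<^sub>v unit_vec (1 + nc') 0 = R *\<^sub>v v" unfolding B_def v_def nc using R A S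
      by (simp add: mat_simps)
    also have "\<dots> = unit_vec (1 + nr) 0" unfolding P(3)[symmetric] using R P
      by (subst mult_vec_cancel_left_inverse[OF R(3)]) (auto simp: dim_of_carrier)
    finally have B0: "col B 0 = unit_vec (1 + nr) 0" using mult_unit_vec[OF B, of 0] by simp
    obtain a b c d where s: "a \<in> sq_mats 1" "b \<in> carrier_mat 1 nc'" "c \<in> carrier_mat nr 1" "d \<in> carrier_mat nr nc'"
      "B = four_block_mat a b c d" using four_block_split[OF B] .
    have "B $$ (i, 0) = (if i = 0 then 1 else 0)" if "i < 1 + nr" for i
      using arg_cong[OF B0, of "\<lambda>v. v $ i"] that B by simp
    note Be = this
    have a1: "a = 1\<^sub>m 1" using Be[of 0] s by (intro eq_matI) auto
    have c0: "c = 0\<^sub>m nr 1" 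
    proof (intro eq_matI)
      fix i j assume ij: "i < dim_row (0\<^sub>m nr 1 :: real mat)" "j < dim_col (0\<^sub>m nr 1 :: real mat)"
      then show "c $$ (i, j) = 0\<^sub>m nr 1 $$ (i, j)" using Be[of "1 + i"] s by auto
    qed (use s in auto)
    obtain P' Q' r where IH: "P' \<in> sq_mats nr" "invertible_mat P'" "Q' \<in> sq_mats nc'" "invertible_mat Q'"
      "r \<le> nr" "r \<le> nc'" "P' * d * Q' = rank_mat nr nc' r" using Suc.IH[OF s(4)] by blast
    define U where "U = four_block_mat (1\<^sub>m 1) (- b) (0\<^sub>m nc' 1) (1\<^sub>m nc')"
    define V where "V = four_block_mat (1\<^sub>m 1) b (0\<^sub>m nc' 1) (1\<^sub>m nc')"
    have bb: "- b + b = 0\<^sub>m 1 nc'" "b + - b = 0\<^sub>m 1 nc'" using s by auto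
    have U: "U \<in> sq_mats (1 + nc')" "V \<in> sq_mats (1 + nc')"
      unfolding U_def V_def using s by auto
    have "U * V = 1\<^sub>m (1 + nc')" "V * U = 1\<^sub>m (1 + nc')" unfolding U_def V_def four_block_one[symmetric] using s bb
      by (simp_all add: mult_four_block_dim mat_simps comm_add_mat[of b 1 nc'] del: One_nat_def)
    then have Ui: "invertible_mat U" using U by (intro invertible_matI[of U _ V]) auto
    define P2 where "P2 = four_block_mat (1\<^sub>m 1) (0\<^sub>m 1 nr) (0\<^sub>m nr 1) P'"
    define Q2 where "Q2 = four_block_mat (1\<^sub>m 1) (0\<^sub>m 1 nc') (0\<^sub>m nc' 1) Q'"
    have P2: "P2 \<in> sq_mats (1 + nr)" "invertible_mat P2" unfolding P2_def
      using IH inv1 by (auto intro: invertible_diag_block)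
    have Q2: "Q2 \<in> sq_mats (1 + nc')" "invertible_mat Q2" unfolding Q2_def
      using IH inv1 by (auto intro: invertible_diag_block)
    have "P2 * (B * U) * Q2 = rank_mat (1 + nr) (1 + nc') (Suc r)"
      unfolding P2_def Q2_def U_def s(5) a1 c0 rank_mat_Suc[symmetric] using s IH bb
      by (simp add: mult_four_block_dim mat_simps del: One_nat_def)
    then have "(P2 * R) * A * (S * U * Q2) = rank_mat (1 + nr) (1 + nc') (Suc r)"
      unfolding B_def using P2 R A S U Q2 by (simp add: mat_simps del: One_nat_def)
    moreover have "invertible_mat (P2 * R)" using P2 R Ri by (intro invertible_mult[of _ "1 + nr"]) auto
    moreover have "invertible_mat (S * U * Q2)" using S U Ui Q2 by (intro invertible_mult[of _ "1 + nc'"]) auto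
    moreover have "P2 * R \<in> sq_mats (1 + nr)" "S * U * Q2 \<in> sq_mats (1 + nc')"
      using P2 R S U Q2 by auto
    ultimately show ?thesis unfolding nc using IH(5,6)
      by (intro exI[of _ "P2 * R"] exI[of _ "S * U * Q2"] exI[of _ "Suc r"]) auto
  qed
qed

lemma rank_mat_block:
  "r \<le> n \<Longrightarrow> rank_mat n n r = four_block_mat (1\<^sub>m r) (0\<^sub>m r (n - r)) (0\<^sub>m (n - r) r) (0\<^sub>m (n - r) (n - r))"
  unfolding rank_mat_def by (intro eq_matI) auto

lemma rank_factorization:
  assumes "A \<in> sq_mats n"
  obtains P Q r where "P \<in> sq_mats n" "invertible_mat P" "Q \<in> sq_mats n" "invertible_mat Q"
    "r \<le> n" "A = P * rank_mat n n r * Q"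
proof -
  obtain P Q r where *: "P \<in> sq_mats n" "invertible_mat P" "Q \<in> sq_mats n" "invertible_mat Q"
    "r \<le> n" "P * A * Q = rank_mat n n r" using rank_normal_form[OF assms] by blast
  obtain P' where P': "P' \<in> sq_mats n" "P * P' = 1\<^sub>m n" "P' * P = 1\<^sub>m n" using * by (auto elim: invertible_matE)
  obtain Q' where Q': "Q' \<in> sq_mats n" "Q * Q' = 1\<^sub>m n" "Q' * Q = 1\<^sub>m n" using * by (auto elim: invertible_matE)
  have "A = P' * (P * A * Q) * Q'" using assms *(1,3) P' Q'
    by (simp add: mat_dim_simps mult_cancel_left_inverse[OF P'(3)] dim_of_carrier)
  then have "A = P' * rank_mat n n r * Q'" using * by simp
  moreover have "invertible_mat P'" "invertible_mat Q'" using *(1,3) P' Q' by (auto intro: invertible_matI)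
  ultimately show ?thesis using that P' Q' * by blast
qed

lemma pow_mat_plus:
  assumes "A \<in> sq_mats n"
  shows "A ^\<^sub>m (i + j) = A ^\<^sub>m i * (A ^\<^sub>m j :: real mat)"
proof (induction j)
  case (Suc j)
  then show ?case using assms pow_carrier_mat[OF assms] by (simp add: mat_simps)
qed (use assms in auto)

text \<open>Take an even positive power of minimal rank r, written as P J Q with J the rank matrix.
  Its square is again an even power and has the rank of the upper left block of Q P, so minimality
  makes that block invertible. Image and kernel of the power are then complementary, which gives the
  block form.\<close>

lemma fitting_decomposition:
  assumes A: "(A :: real mat) \<in> sq_mats n"
  shows "\<exists>j r G H C. even j \<and> j > 0 \<and> r \<le> n \<and> G \<in> sq_mats n \<and> H \<in> sq_mats n \<and>
     G * H = 1\<^sub>m n \<and> H * G = 1\<^sub>m n \<and> C \<in> sq_mats r \<and> invertible_mat C \<and>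
     G * (A ^\<^sub>m j) * H = four_block_mat C (0\<^sub>m r (n - r)) (0\<^sub>m (n - r) r) (0\<^sub>m (n - r) (n - r))"
proof -
  \<comment> \<open>Only even exponents compete, because \<open>even_power_adjoint\<close> is about
    them; doubling an exponent keeps it even.\<close>
  define R where "R r \<longleftrightarrow> (\<exists>j P Q. even j \<and> j > 0 \<and> P \<in> sq_mats n \<and> invertible_mat P \<and>
     Q \<in> sq_mats n \<and> invertible_mat Q \<and> r \<le> n \<and> A ^\<^sub>m j = P * rank_mat n n r * Q)" for r
  have Ac: "A ^\<^sub>m j \<in> sq_mats n" for j using A by (rule pow_carrier_mat)
  have "\<exists>r. R r" using rank_factorization[OF Ac[of 2]] unfolding R_def by (metis even_numeral zero_less_numeral)
  then obtain r where r: "R r" and min: "\<And>r'. r' < r \<Longrightarrow> \<not> R r'"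
    using LeastI_ex[of R] not_less_Least[of _ R] by blast
  obtain j P Q where *: "even j" "j > 0" "P \<in> sq_mats n" "invertible_mat P" "Q \<in> sq_mats n" "invertible_mat Q"
     "r \<le> n" "A ^\<^sub>m j = P * rank_mat n n r * Q" using r unfolding R_def by blast
  define m where "m = n - r"
  have n: "n = r + m" unfolding m_def using * by simp
  let ?D = "\<lambda>W. four_block_mat W (0\<^sub>m r m) (0\<^sub>m m r) (0\<^sub>m m m)"
  have rm: "rank_mat n n r = ?D (1\<^sub>m r)" using rank_mat_block[OF *(7)] unfolding m_def .
  have QP: "Q * P \<in> sq_mats (r + m)" using * n by auto
  obtain W1 W2 W3 W4 where W: "W1 \<in> sq_mats r" "W2 \<in> carrier_mat r m" "W3 \<in> carrier_mat m r" "W4 \<in> sq_mats m"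
    "Q * P = four_block_mat W1 W2 W3 W4" using four_block_split[OF QP] .
  \<comment> \<open>In the square, J (Q P) J appears as the middle factor and retains only the upper
    left block of Q P.\<close>
  have sq: "A ^\<^sub>m (j + j) = P * ?D W1 * Q"
  proof -
    have "A ^\<^sub>m (j + j) = A ^\<^sub>m j * A ^\<^sub>m j" using A by (rule pow_mat_plus)
    also have "\<dots> = P * (rank_mat n n r * (Q * P) * rank_mat n n r) * Q"
      unfolding *(8) using * by (simp add: mat_simps)
    also have "rank_mat n n r * (Q * P) * rank_mat n n r = ?D W1" unfolding W(5) rm using W
      by (simp add: mult_four_block_dim mat_simps)
    finally show ?thesis .
  qed
  have W1i: "invertible_mat W1"
  proof (rule ccontr)
    assume ni: "\<not> invertible_mat W1"
    obtain P' Q' r' where W1: "P' \<in> sq_mats r" "invertible_mat P'" "Q' \<in> sq_mats r" "invertible_mat Q'"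
      "r' \<le> r" "W1 = P' * rank_mat r r r' * Q'" using rank_factorization[OF W(1)] .
    have "r' \<noteq> r"
    proof
      assume "r' = r"
      then have "rank_mat r r r' = 1\<^sub>m r" unfolding rank_mat_def by (intro eq_matI) auto
      then have "W1 = P' * Q'" using W1 by simp
      then show False using invertible_mult[OF W1(1-4)] ni by simp
    qed
    with W1 have lt: "r' < r" by simp
    define P2 where "P2 = four_block_mat P' (0\<^sub>m r m) (0\<^sub>m m r) (1\<^sub>m m)"
    define Q2 where "Q2 = four_block_mat Q' (0\<^sub>m r m) (0\<^sub>m m r) (1\<^sub>m m)"
    have inv1: "invertible_mat (1\<^sub>m m :: real mat)" for m by (rule invertible_matI[of _ m "1\<^sub>m m"]) auto
    have P2: "P2 \<in> sq_mats n" "invertible_mat P2" unfolding P2_def n using W1 inv1 by (auto intro: invertible_diag_block)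
    have Q2: "Q2 \<in> sq_mats n" "invertible_mat Q2" unfolding Q2_def n using W1 inv1 by (auto intro: invertible_diag_block)
    have rr: "rank_mat n n r' = ?D (rank_mat r r r')" unfolding n rank_mat_def using lt by (intro eq_matI) auto
    have "P2 * rank_mat n n r' * Q2 = ?D W1" unfolding rr P2_def Q2_def W1(6) using W1
      by (simp add: mult_four_block_dim mat_simps)
    then have "A ^\<^sub>m (j + j) = P * (P2 * rank_mat n n r' * Q2) * Q" using sq by simp
    also have "\<dots> = (P * P2) * rank_mat n n r' * (Q2 * Q)" using * P2 Q2 by (simp add: mat_simps)
    finally have "A ^\<^sub>m (j + j) = (P * P2) * rank_mat n n r' * (Q2 * Q)" .
    moreover have "invertible_mat (P * P2)" "invertible_mat (Q2 * Q)" using * P2 Q2 by (auto intro: invertible_mult[of _ n])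
    moreover have "P * P2 \<in> sq_mats n" "Q2 * Q \<in> sq_mats n" using * P2 Q2 by auto
    moreover have "even (j + j)" "j + j > 0" "r' \<le> n" using * lt by auto
    ultimately have "R r'" unfolding R_def by blast
    then show False using min[OF lt] by simp
  qed
  obtain W' where W': "W' \<in> sq_mats r" "W1 * W' = 1\<^sub>m r" "W' * W1 = 1\<^sub>m r" using W1i W by (auto elim: invertible_matE)
  obtain Q' where Q': "Q' \<in> sq_mats n" "Q * Q' = 1\<^sub>m n" "Q' * Q = 1\<^sub>m n" using * by (auto elim: invertible_matE)
  \<comment> \<open>\<open>V\<close> agrees with \<open>Q * P\<close> in the first r columns, so
    both have the same product with a matrix supported in the upper left block; its zero upper right
    block makes \<open>rank_mat n n r * V\<close> such a matrix. Conjugation by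
    \<open>V' * Q\<close> therefore leaves just \<open>W1\<close>.\<close>
  define V where "V = four_block_mat W1 (0\<^sub>m r m) W3 (1\<^sub>m m)"
  define V' where "V' = four_block_mat W' (0\<^sub>m r m) (- (W3 * W')) (1\<^sub>m m)"
  have V: "V \<in> sq_mats n" "V' \<in> sq_mats n" unfolding V_def V'_def n using W W' by auto
  have "W3 * W' + - (W3 * W') = 0\<^sub>m m r" "- W3 + W3 = 0\<^sub>m m r" using W W' by auto
  then have VV: "V * V' = 1\<^sub>m n" "V' * V = 1\<^sub>m n" unfolding V_def V'_def n four_block_one[symmetric] using W W'
    by (simp_all add: mult_four_block_dim mat_simps)
  have "V' * Q * (Q' * V) = 1\<^sub>m n" "Q' * V * (V' * Q) = 1\<^sub>m n"
    using mat_inv_mult[OF V(2,1) VV(2,1) *(5) Q'] by auto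
  moreover have "V' * Q * (A ^\<^sub>m j) * (Q' * V) = ?D W1"
  proof -
    have V1: "V * ?D W1 = (Q * P) * ?D W1" unfolding W(5) V_def using W
      by (simp add: mult_four_block_dim mat_simps)
    have V2: "rank_mat n n r * V = ?D W1" unfolding rm V_def using W
      by (simp add: mult_four_block_dim mat_simps)
    have Dc: "?D W1 \<in> sq_mats n" using W n by auto
    have "V' * Q * (A ^\<^sub>m j) * (Q' * V) = V' * ((Q * P) * (rank_mat n n r * V))"
      unfolding *(8) using * V Q' 
      by (simp add: mat_simps mult_cancel_left_inverse[OF Q'(2)])
    also have "\<dots> = V' * (V * ?D W1)" unfolding V2 V1 ..
    also have "\<dots> = ?D W1" using V VV Dc by (intro mult_cancel_left_inverse[of _ _ n]) auto
    finally show ?thesis .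
  qed
  moreover have "V' * Q \<in> sq_mats n" "Q' * V \<in> sq_mats n" using V Q' * by auto
  ultimately show ?thesis using *(1,2,7) W(1) W1i unfolding m_def by blast
qed

subsection \<open>Commuting nilpotent matrices\<close>

fun mat_products :: "nat \<Rightarrow> real mat set \<Rightarrow> nat \<Rightarrow> real mat set" where
  "mat_products n M 0 = {1\<^sub>m n}"
| "mat_products n M (Suc k) = {A * P | A P. A \<in> M \<and> P \<in> mat_products n M k}"

lemma mat_products_carrier:
  assumes "M \<subseteq> sq_mats n"
  shows "P \<in> mat_products n M k \<Longrightarrow> P \<in> sq_mats n"
proof (induction k arbitrary: P)
  case (Suc k)
  then obtain A P' where "P = A * P'" "A \<in> M" "P' \<in> mat_products n M k" by auto
  then show ?case using Suc.IH[of P'] assms by auto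
qed simp

lemma mat_products_commute:
  assumes M: "M \<subseteq> sq_mats n" and comm: "\<And>A B. A \<in> M \<Longrightarrow> B \<in> M \<Longrightarrow> A * B = B * A"
    and A: "A \<in> M"
  shows "P \<in> mat_products n M k \<Longrightarrow> P * A = A * P"
proof (induction k arbitrary: P)
  case 0
  then show ?case using A M by auto
next
  case (Suc k)
  then obtain B P' where P: "P = B * P'" "B \<in> M" "P' \<in> mat_products n M k" by auto
  have c: "A \<in> sq_mats n" "B \<in> sq_mats n" "P' \<in> sq_mats n"
    using A P M mat_products_carrier[OF M P(3)] by auto
  have "P * A = B * (P' * A)" using c P by (simp add: mat_dim_simps)
  also have "\<dots> = B * (A * P')" using Suc.IH[OF P(3)] by simp
  also have "\<dots> = (B * A) * P'" using c by simp
  also have "\<dots> = (A * B) * P'" using comm A P by simp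
  also have "\<dots> = A * P" using c P by simp
  finally show ?case .
qed

lemma pow_mat_commute:
  assumes "A \<in> sq_mats n" "B \<in> sq_mats n" "B * A = A * B"
  shows "(A ^\<^sub>m m) * B = B * (A ^\<^sub>m m :: real mat)"
proof (induction m)
  case 0
  then show ?case using assms by auto
next
  case (Suc m)
  have c: "A ^\<^sub>m m \<in> sq_mats n" using assms by auto
  have "A ^\<^sub>m (Suc m) * B = A ^\<^sub>m m * (A * B)" using assms(1,2) c by (simp add: mat_simps)
  also have "\<dots> = (A ^\<^sub>m m * B) * A" using assms(1,2) c by (simp add: assms(3)[symmetric] mat_simps)
  also have "\<dots> = B * A ^\<^sub>m (Suc m)" unfolding Suc using assms(1,2) c by (simp add: mat_simps)
  finally show ?case .
qed

text \<open>The vectors \<open>W 0 x, \<dots>, W n x\<close> are dependent, so for some \<open>j\<close> we get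
  \<open>W j x = B A\<^sub>j (W j x)\<close> with \<open>B\<close> commuting with the nilpotent matrix \<open>A\<^sub>j\<close>, hence \<open>W j x = 0\<close>.\<close>

lemma commuting_nilpotent_chain:
  fixes A W :: "nat \<Rightarrow> real mat"
  assumes Ac: "\<And>j. j < n \<Longrightarrow> A j \<in> sq_mats n"
    and comm: "\<And>i j. i < n \<Longrightarrow> j < n \<Longrightarrow> A i * A j = A j * A i"
    and nil: "\<And>j. j < n \<Longrightarrow> nilpotent_mat (A j)"
    and W0: "W 0 = 1\<^sub>m n" and WS: "\<And>j. j < n \<Longrightarrow> W (Suc j) = A j * W j"
  shows "W n = 0\<^sub>m n n"
proof (rule mat_eq_by_vec[of _ n n])
  have Wc: "j \<le> n \<Longrightarrow> W j \<in> sq_mats n" for j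
  proof (induction j)
    case (Suc j)
    then have "A j \<in> sq_mats n" "W j \<in> sq_mats n" using Ac by auto
    then show ?case using WS[of j] Suc.prems by auto
  qed (use W0 in auto)
  then show "W n \<in> sq_mats n" by simp
  fix x :: "real vec" assume x: "x \<in> carrier_vec n"
  define B where "B = mat n (Suc n) (\<lambda>(i, j). (W j *\<^sub>v x) $ i)"
  have "B \<in> carrier_mat n (Suc n)" unfolding B_def by auto
  then obtain c where c: "c \<in> carrier_vec (Suc n)" "c \<noteq> 0\<^sub>v (Suc n)" "B *\<^sub>v c = 0\<^sub>v n"
    using underdetermined_kernel[of B n "Suc n"] by auto
  then have "\<exists>j. j \<le> n \<and> c $ j \<noteq> 0" by (metis carrier_vecD eq_vecI index_zero_vec less_Suc_eq_le)
  define j where "j = (LEAST j. j \<le> n \<and> c $ j \<noteq> 0)"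
  have j: "j \<le> n" "c $ j \<noteq> 0" unfolding j_def using LeastI_ex[OF \<open>\<exists>j. j \<le> n \<and> c $ j \<noteq> 0\<close>] by auto
  have jl: "c $ i = 0" if "i < j" for i
    using not_less_Least[of i "\<lambda>j. j \<le> n \<and> c $ j \<noteq> 0"] that j(1) unfolding j_def by force
  define w where "w = W j *\<^sub>v x"
  have w: "w \<in> carrier_vec n" unfolding w_def using Wc[OF j(1)] by (intro carrier_vecI) auto
  have wn0: "W n *\<^sub>v x = 0\<^sub>v n" if "w = 0\<^sub>v n"
  proof -
    have "i \<le> n \<Longrightarrow> j \<le> i \<Longrightarrow> W i *\<^sub>v x = 0\<^sub>v n" for i
    proof (induction i)
      case 0
      then show ?case using that w_def by auto
    next
      case (Suc i)
      show ?case
      proof (cases "j = Suc i")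
        case True
        then show ?thesis using that w_def by auto
      next
        case False
        then have "W i *\<^sub>v x = 0\<^sub>v n" using Suc by auto
        then show ?thesis using WS[of i] Suc.prems Ac[of i] Wc[of i] x by (simp add: mat_simps)
      qed
    qed
    then show ?thesis using j by auto
  qed
  have "w = 0\<^sub>v n"
  proof (cases "j = n")
    case True
    have "(B *\<^sub>v c) $ r = c $ n * w $ r" if r: "r < n" for r
    proof -
      have "(B *\<^sub>v c) $ r = (\<Sum>i = 0..<Suc n. (W i *\<^sub>v x) $ r * c $ i)" 
        using r c(1) unfolding B_def by (simp add: scalar_prod_def)
      also have "\<dots> = (W n *\<^sub>v x) $ r * c $ n" using jl True by simp
      finally show ?thesis unfolding w_def True by simp
    qed
    then show ?thesis using c(3) j(2) True w by (intro eq_vecI) auto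
  next
    case False
    then have jn: "j < n" using j by auto
    let ?A = "A j"
    \<comment> \<open>All factors commute, so in \<open>W i\<close> with i > j the factor
      \<open>?A\<close> can be moved next to \<open>W j\<close>. Every later term of the dependence
      relation is thus a multiple of A_j w by a matrix commuting with A_j.\<close>
    have D: "Suc j \<le> i \<Longrightarrow> i \<le> n \<Longrightarrow> \<exists>D. D \<in> sq_mats n \<and> D * ?A = ?A * D \<and> W i = D * (?A * W j)" for i
    proof (induction i)
      case (Suc i)
      show ?case
      proof (cases "i = j")
        case True
        then show ?thesis using WS[OF jn] Ac[OF jn] Wc[of j] jn by (intro exI[of _ "1\<^sub>m n"]) auto
      next
        case False
        then obtain D where D: "D \<in> sq_mats n" "D * ?A = ?A * D" "W i = D * (?A * W j)" using Suc by auto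
        have c: "A i \<in> sq_mats n" "?A \<in> sq_mats n" "W j \<in> sq_mats n" using Ac Wc Suc.prems jn by auto
        have "(A i * D) * ?A = A i * (?A * D)" using c D by simp
        also have "\<dots> = (A i * ?A) * D" using c D(1) by simp
        also have "\<dots> = (?A * A i) * D" using comm[of i j] Suc.prems jn by simp
        also have "\<dots> = ?A * (A i * D)" using c D(1) by simp
        finally have 1: "(A i * D) * ?A = ?A * (A i * D)" .
        have 2: "W (Suc i) = (A i * D) * (?A * W j)" using WS[of i] Suc.prems c D
          by (simp add: mat_simps)
        show ?thesis using 1 2 c D by (intro exI[of _ "A i * D"] conjI) auto
      qed
    qed simp
    have E: "t \<le> n \<Longrightarrow> j \<le> t \<Longrightarrow> \<exists>E. E \<in> sq_mats n \<and> E * ?A = ?A * E \<and>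
       (\<forall>r<n. (\<Sum>i = Suc j..<Suc t. (W i *\<^sub>v x) $ r * c $ i) = (E *\<^sub>v (?A *\<^sub>v w)) $ r)" for t
    proof (induction t)
      case 0
      then show ?case using Ac[OF jn] w by (intro exI[of _ "0\<^sub>m n n"]) (auto simp: mat_simps)
    next
      case (Suc t)
      show ?case
      proof (cases "j = Suc t")
        case True
        then show ?thesis using Ac[OF jn] w by (intro exI[of _ "0\<^sub>m n n"]) (auto simp: mat_simps)
      next
        case False
        then obtain E where E: "E \<in> sq_mats n" "E * ?A = ?A * E"
          "\<And>r. r < n \<Longrightarrow> (\<Sum>i = Suc j..<Suc t. (W i *\<^sub>v x) $ r * c $ i) = (E *\<^sub>v (?A *\<^sub>v w)) $ r" using Suc by auto
        obtain D where D: "D \<in> sq_mats n" "D * ?A = ?A * D" "W (Suc t) = D * (?A * W j)"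
          using D[of "Suc t"] Suc.prems False by auto
        have c: "?A \<in> sq_mats n" "W j \<in> sq_mats n" using Ac Wc jn by auto
        have Wt: "W (Suc t) *\<^sub>v x = D *\<^sub>v (?A *\<^sub>v w)" unfolding D(3) w_def using D(1) c x by (simp add: mat_simps)
        let ?E = "E + c $ (Suc t) \<cdot>\<^sub>m D"
        have "?E * ?A = ?A * ?E" using D E c by (simp add: mat_simps)
        moreover have "(\<Sum>i = Suc j..<Suc (Suc t). (W i *\<^sub>v x) $ r * c $ i) = (?E *\<^sub>v (?A *\<^sub>v w)) $ r" if "r < n" for r
          using E(3)[OF that] that D(1) E(1) c w Suc.prems False
          by (simp add: Wt mat_simps)
        ultimately show ?thesis using D E by (intro exI[of _ ?E]) auto
      qed
    qed
    obtain E where E: "E \<in> sq_mats n" "E * ?A = ?A * E"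
      "\<And>r. r < n \<Longrightarrow> (\<Sum>i = Suc j..<Suc n. (W i *\<^sub>v x) $ r * c $ i) = (E *\<^sub>v (?A *\<^sub>v w)) $ r" using E[of n] j by auto
    have cA: "?A \<in> sq_mats n" using Ac jn by auto
    define F where "F = (- 1 / c $ j) \<cdot>\<^sub>m E"
    have F: "F \<in> sq_mats n" "F * ?A = ?A * F" unfolding F_def using E cA by (auto simp: mat_simps)
    have wF: "w = F *\<^sub>v (?A *\<^sub>v w)"
    proof (rule eq_vecI)
      fix r assume "r < dim_vec (F *\<^sub>v (?A *\<^sub>v w))"
      then have r: "r < n" using F by auto
      have "0 = (B *\<^sub>v c) $ r" using c r by simp
      also have "\<dots> = (\<Sum>i = 0..<Suc n. (W i *\<^sub>v x) $ r * c $ i)" 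
        using r c(1) unfolding B_def by (simp add: scalar_prod_def)
      also have "\<dots> = (\<Sum>i = 0..<j. (W i *\<^sub>v x) $ r * c $ i) + (\<Sum>i = j..<Suc n. (W i *\<^sub>v x) $ r * c $ i)"
        using j by (subst sum.atLeastLessThan_concat) auto
      also have "(\<Sum>i = 0..<j. (W i *\<^sub>v x) $ r * c $ i) = 0" using jl by simp
      also have "(\<Sum>i = j..<Suc n. (W i *\<^sub>v x) $ r * c $ i) = w $ r * c $ j + (\<Sum>i = Suc j..<Suc n. (W i *\<^sub>v x) $ r * c $ i)"
        using jn unfolding w_def by (subst sum.atLeast_Suc_lessThan) auto
      also have "\<dots> = w $ r * c $ j + (E *\<^sub>v (?A *\<^sub>v w)) $ r" using E(3)[OF r] by simp
      finally have "w $ r * c $ j = - (E *\<^sub>v (?A *\<^sub>v w)) $ r" by simp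
      then have "w $ r = (- 1 / c $ j) * (E *\<^sub>v (?A *\<^sub>v w)) $ r" using j(2) by (simp add: field_simps)
      also have "\<dots> = (F *\<^sub>v (?A *\<^sub>v w)) $ r" unfolding F_def using E(1) cA w r by (simp add: mat_simps)
      finally show "w $ r = (F *\<^sub>v (?A *\<^sub>v w)) $ r" .
    qed (use w F in auto)
    have "\<exists>G. G \<in> sq_mats n \<and> w = G *\<^sub>v ((?A ^\<^sub>m m) *\<^sub>v w)" for m
    proof (induction m)
      case 0
      then show ?case using w cA by (intro exI[of _ "1\<^sub>m n"]) (auto simp: mat_simps)
    next
      case (Suc m)
      then obtain G where G: "G \<in> sq_mats n" "w = G *\<^sub>v ((?A ^\<^sub>m m) *\<^sub>v w)" by auto
      have cm: "?A ^\<^sub>m m \<in> sq_mats n" using cA by auto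
      have "w = G *\<^sub>v ((?A ^\<^sub>m m) *\<^sub>v (F *\<^sub>v (?A *\<^sub>v w)))" using G wF by simp
      also have "\<dots> = (G * ((?A ^\<^sub>m m) * F)) *\<^sub>v (?A *\<^sub>v w)" using G F cm cA w by (simp add: mat_simps)
      also have "(?A ^\<^sub>m m) * F = F * (?A ^\<^sub>m m)" using pow_mat_commute[OF cA F] .
      also have "(G * (F * (?A ^\<^sub>m m))) *\<^sub>v (?A *\<^sub>v w) = (G * F) *\<^sub>v ((?A ^\<^sub>m (Suc m)) *\<^sub>v w)"
        using G(1) F(1) cm cA w by (simp add: mat_simps)
      finally show ?case using G F by (intro exI[of _ "G * F"]) auto
    qed
    moreover obtain m where "?A ^\<^sub>m m = 0\<^sub>m n n" using nil[OF jn] cA unfolding nilpotent_mat_def by auto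
    ultimately obtain G where "G \<in> sq_mats n" "w = G *\<^sub>v (0\<^sub>m n n *\<^sub>v w)" by metis
    then show ?thesis using w by (simp add: mat_simps)
  qed
  then show "W n *\<^sub>v x = 0\<^sub>m n n *\<^sub>v x" using wn0 x by (simp add: mat_simps)
qed auto

lemma mat_products_chain:
  "P \<in> mat_products n M k \<Longrightarrow> \<exists>A W. W 0 = 1\<^sub>m n \<and> W k = P \<and> (\<forall>j<k. A j \<in> M \<and> W (Suc j) = A j * W j)"
proof (induction k arbitrary: P)
  case (Suc k)
  then obtain B P' where P: "P = B * P'" "B \<in> M" "P' \<in> mat_products n M k" by auto
  obtain A W where AW: "W 0 = 1\<^sub>m n" "W k = P'" "\<forall>j<k. A j \<in> M \<and> W (Suc j) = A j * W j" using Suc.IH[OF P(3)] by blast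
  show ?case
    by (rule exI[of _ "A(k := B)"], rule exI[of _ "W(Suc k := P)"]) (use AW P in \<open>auto simp: less_Suc_eq\<close>)
qed auto

lemma mat_products_zero:
  assumes M: "M \<subseteq> sq_mats n" and comm: "\<And>A B. A \<in> M \<Longrightarrow> B \<in> M \<Longrightarrow> A * B = B * A"
    and nil: "\<And>A. A \<in> M \<Longrightarrow> nilpotent_mat A" and P: "P \<in> mat_products n M k" and k: "n \<le> k"
  shows "P = 0\<^sub>m n n"
  using k P
proof (induction k arbitrary: P rule: dec_induct)
  case base
  obtain A W where AW: "W 0 = 1\<^sub>m n" "W n = P" "\<forall>j<n. A j \<in> M \<and> W (Suc j) = A j * W j"
    using mat_products_chain[OF base] by blast
  have "W n = 0\<^sub>m n n" using AW M comm nil by (intro commuting_nilpotent_chain[of n A W]) auto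
  then show ?case using AW by simp
next
  case (step k)
  then obtain B P' where P: "P = B * P'" "B \<in> M" "P' \<in> mat_products n M k" by auto
  then show ?case using step.IH[OF P(3)] M by auto
qed

text \<open>The index counts the factors from \<open>M\<close> on both sides of \<open>X\<close>
  together. Closure under differences is all that iterated brackets require, a bracket being the
  difference of a right and a left multiple.\<close>

inductive bracket_span :: "nat \<Rightarrow> real mat set \<Rightarrow> real mat \<Rightarrow> nat \<Rightarrow> real mat \<Rightarrow> bool" for n M X where
  "L \<in> mat_products n M a \<Longrightarrow> R \<in> mat_products n M b \<Longrightarrow> bracket_span n M X (a + b) (L * X * R)"
| "bracket_span n M X j Z \<Longrightarrow> bracket_span n M X j Z' \<Longrightarrow> bracket_span n M X j (Z - Z')"

lemma bracket_span_step:
  assumes M: "M \<subseteq> sq_mats n" and comm: "\<And>A B. A \<in> M \<Longrightarrow> B \<in> M \<Longrightarrow> A * B = B * A"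
    and X: "X \<in> sq_mats n" and A: "A \<in> M"
  shows "bracket_span n M X j Z \<Longrightarrow> Z \<in> sq_mats n \<and> bracket_span n M X (Suc j) (Z * A) \<and> bracket_span n M X (Suc j) (A * Z)"
proof (induction j Z rule: bracket_span.induct)
  case (1 L a R b)
  have c: "L \<in> sq_mats n" "R \<in> sq_mats n" "A \<in> sq_mats n"
    using mat_products_carrier[OF M] 1 A M by auto
  have "A * R \<in> mat_products n M (Suc b)" "A * L \<in> mat_products n M (Suc a)" using A 1 by auto
  then have "bracket_span n M X (a + Suc b) (L * X * (A * R))" "bracket_span n M X (Suc a + b) ((A * L) * X * R)"
    using 1 by (metis bracket_span.intros(1))+
  moreover have "L * X * (A * R) = (L * X * R) * A" using c X mat_products_commute[OF M comm A 1(2)]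
    by (simp add: mat_simps)
  moreover have "(A * L) * X * R = A * (L * X * R)" using c X by (simp add: mat_simps)
  ultimately show ?case using c X by auto
next
  case (2 j Z Z')
  have c: "A \<in> sq_mats n" using A M by auto
  have "(Z - Z') * A = Z * A - Z' * A" "A * (Z - Z') = A * Z - A * Z'"
    using 2 c by (auto simp: minus_mult_distrib_mat mult_minus_distrib_mat)
  then show ?case using 2 bracket_span.intros(2) by (metis minus_carrier_mat)
qed

text \<open>Of at least 2 n factors, at least n stand on one side of \<open>X\<close>, and a product
  of n commuting nilpotent matrices of size n vanishes.\<close>

lemma bracket_span_zero:
  assumes M: "M \<subseteq> sq_mats n" and comm: "\<And>A B. A \<in> M \<Longrightarrow> B \<in> M \<Longrightarrow> A * B = B * A"
    and nil: "\<And>A. A \<in> M \<Longrightarrow> nilpotent_mat A" and X: "X \<in> sq_mats n"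
  shows "bracket_span n M X j Z \<Longrightarrow> 2 * n \<le> j \<Longrightarrow> Z = 0\<^sub>m n n"
proof (induction j Z rule: bracket_span.induct)
  case (1 L a R b)
  have c: "L \<in> sq_mats n" "R \<in> sq_mats n" using mat_products_carrier[OF M] 1 by auto
  have "n \<le> a \<or> n \<le> b" using 1 by linarith
  then have "L = 0\<^sub>m n n \<or> R = 0\<^sub>m n n" using mat_products_zero[OF M comm nil] 1 by blast
  then show ?case using c X by auto
next
  case (2 j Z Z')
  then show ?case by auto
qed

text \<open>Iterated brackets expand into products with factors from \<open>M\<close> on the two
  sides, so 2 n brackets suffice. Read contrapositively: a MASA that is not a MANS contains a matrix
  that is not nilpotent.\<close>

lemma nilpotent_MASA_is_MANS:
  assumes L: "L \<subseteq> sq_mats n" and M: "MASA n L M" and nil: "\<And>A. A \<in> M \<Longrightarrow> nilpotent_mat A"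
  shows "MANS n L M"
proof -
  have Mc: "M \<subseteq> sq_mats n" and br: "\<And>A B. A \<in> M \<Longrightarrow> B \<in> M \<Longrightarrow> lie_bracket A B = 0\<^sub>m n n"
    using M unfolding MASA_def mat_subspace_def by auto
  have comm: "A * B = B * A" if "A \<in> M" "B \<in> M" for A B
    using br[OF that] that Mc bracket_zero_iff[of A n B] by auto
  have "foldl lie_bracket X As = 0\<^sub>m n n" if X: "X \<in> L" and As: "set As \<subseteq> M" "length As = 2 * n" for X As
  proof -
    have Xc: "X \<in> sq_mats n" using X L by auto
    have "set As \<subseteq> M \<Longrightarrow> bracket_span n M X (length As) (foldl lie_bracket X As)" for As
    proof (induction As rule: rev_induct)
      case Nil
      have "bracket_span n M X (0 + 0) (1\<^sub>m n * X * 1\<^sub>m n)" by (rule bracket_span.intros) auto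
      then show ?case using Xc by simp
    next
      case (snoc A As)
      then show ?case using bracket_span_step[OF Mc comm Xc, of A "length As" "foldl lie_bracket X As"]
        unfolding lie_bracket_def by (auto intro: bracket_span.intros(2))
    qed
    then show ?thesis using bracket_span_zero[OF Mc comm nil Xc] As by fastforce
  qed
  then show ?thesis unfolding MANS_def using M nil by blast
qed

subsection \<open>A MASA without a nilpotent block splits\<close>

text \<open>Moving \<open>K\<close> past one factor \<open>A\<close> costs a transpose and a sign,
  and the signs cancel in pairs.\<close>

lemma even_power_adjoint:
  assumes K: "K \<in> sq_mats n" and A: "A \<in> o_alg K"
  shows "A ^\<^sub>m (2 * i) * K = K * (A ^\<^sub>m (2 * i))\<^sup>T"
proof (induction i)
  case 0
  have "A \<in> sq_mats n" using A K o_alg_iff by blast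
  then show ?case using K by (auto simp: mat_dim_simps)
next
  case (Suc i)
  have Ac: "A \<in> sq_mats n" and AK: "A * K = - (K * A\<^sup>T)" using A K o_alg_iff by auto
  let ?P = "A ^\<^sub>m (2 * i)"
  have P: "?P \<in> sq_mats n" using Ac by auto
  have e: "A ^\<^sub>m (2 * Suc i) = ?P * (A * A)" "A ^\<^sub>m (2 * Suc i) = (A * A) * ?P"
  proof -
    show "A ^\<^sub>m (2 * Suc i) = ?P * (A * A)" using Ac P by (simp add: mat_simps)
    also have "\<dots> = A * A * ?P" using pow_mat_commute[OF Ac, of "A * A" "2 * i"] Ac by simp
    finally show "A ^\<^sub>m (2 * Suc i) = (A * A) * ?P" .
  qed
  have "(A * A) * K = A * (A * K)" using Ac K by simp
  also have "\<dots> = A * - (K * A\<^sup>T)" unfolding AK ..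
  also have "\<dots> = - (A * K * A\<^sup>T)" using Ac K by (simp add: mat_simps)
  also have "\<dots> = K * (A\<^sup>T * A\<^sup>T)" unfolding AK using Ac K by (simp add: mat_simps)
  finally have AAK: "(A * A) * K = K * (A\<^sup>T * A\<^sup>T)" .
  have "A ^\<^sub>m (2 * Suc i) * K = ?P * ((A * A) * K)" unfolding e(1) using Ac P K by (simp add: mat_simps)
  also have "\<dots> = (?P * K) * (A\<^sup>T * A\<^sup>T)" unfolding AAK using Ac P K by (simp add: mat_simps)
  also have "\<dots> = K * ((A * A) * ?P)\<^sup>T" unfolding Suc using Ac P K by (simp add: mat_simps)
  finally show ?case unfolding e(2) .
qed

lemma invertible_of_power:
  assumes A: "A \<in> sq_mats n" and j: "j > 0" and inv: "invertible_mat (A ^\<^sub>m j :: real mat)"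
  shows "invertible_mat A"
proof (rule invertible_of_trivial_kernel[OF A])
  fix v :: "real vec" assume v: "v \<in> carrier_vec n" "A *\<^sub>v v = 0\<^sub>v n"
  obtain i where i: "j = Suc i" using j by (cases j) auto
  have c: "A ^\<^sub>m i \<in> sq_mats n" using A by auto
  have "A ^\<^sub>m j *\<^sub>v v = A ^\<^sub>m i *\<^sub>v (A *\<^sub>v v)" unfolding i using A c v(1) by (simp add: mat_simps)
  also have "\<dots> = 0\<^sub>v n" unfolding v(2) using c A by (simp add: mat_simps)
  finally have z: "A ^\<^sub>m j *\<^sub>v v = 0\<^sub>v n" .
  obtain B where B: "B \<in> sq_mats n" "B * A ^\<^sub>m j = 1\<^sub>m n" using invertible_matE[OF inv pow_carrier_mat[OF A]] .
  have "v = B *\<^sub>v (A ^\<^sub>m j *\<^sub>v v)" using B A v(1) by (subst mult_vec_cancel_left_inverse[OF B(2)]) (auto simp: dim_of_carrier)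
  then show "v = 0\<^sub>v n" unfolding z using B by (simp add: mat_simps)
qed

lemma diag_block_mat_two: "diag_block_mat [A, B] = four_block_mat A (0\<^sub>m (dim_row A) (dim_col B)) (0\<^sub>m (dim_row B) (dim_col A)) (B :: real mat)"
  by (simp only: diag_block_mat.simps(2)[of A "[B]"] diag_block_mat_singleton Let_def)

text \<open>An even power of a non-nilpotent element commutes with the whole set and is
  self-adjoint, so its Fitting decomposition splits both the set and the metric. Indecomposability
  leaves a single block, and this is the invertible one because the element is not
  nilpotent.\<close>

lemma indecomposable_block_invertible:
  assumes K: "K \<in> sq_mats n" and X: "MASA n (o_alg K) \<X>" and nm: "\<not> MANS n (o_alg K) \<X>"
    and ind: "orth_indecomposable K \<X>"
  shows "\<exists>T\<in>\<X>. invertible_mat T"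
proof -
  have oc: "o_alg K \<subseteq> sq_mats n" using o_alg_carrier[OF K] by auto
  have Xo: "\<X> \<subseteq> o_alg K" and br: "\<And>A B. A \<in> \<X> \<Longrightarrow> B \<in> \<X> \<Longrightarrow> lie_bracket A B = 0\<^sub>m n n"
    using X unfolding MASA_def by blast+
  obtain A where A: "A \<in> \<X>" "\<not> nilpotent_mat A" using nilpotent_MASA_is_MANS[OF oc X] nm by auto
  have Ac: "A \<in> sq_mats n" using A Xo oc by auto
  obtain j r G H C where F: "even j" "j > 0" "r \<le> n" "G \<in> sq_mats n" "H \<in> sq_mats n"
     "G * H = 1\<^sub>m n" "H * G = 1\<^sub>m n" "C \<in> sq_mats r" "invertible_mat C"
     "G * (A ^\<^sub>m j) * H = four_block_mat C (0\<^sub>m r (n - r)) (0\<^sub>m (n - r) r) (0\<^sub>m (n - r) (n - r))"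
    using fitting_decomposition[OF Ac] by blast
  define m where "m = n - r"
  have n: "n = r + m" unfolding m_def using F by simp
  note F10 = F(10)[folded m_def]
  have Ajc: "A ^\<^sub>m j \<in> sq_mats n" using Ac by auto
  have r0: "r \<noteq> 0"
  proof
    assume "r = 0"
    then have "G * (A ^\<^sub>m j) * H = 0\<^sub>m n n" using F10 F(8) n by (auto intro!: eq_matI)
    then have "A ^\<^sub>m j = 0\<^sub>m n n" using conj_inj[OF F(4-7) Ajc, of "0\<^sub>m n n"] F by (simp add: mat_simps)
    then show False using A Ac unfolding nilpotent_mat_def by auto
  qed
  have m0: "m = 0"
  proof (rule ccontr)
    assume m0: "m \<noteq> 0"
    obtain C' where C': "C' \<in> sq_mats r" "C * C' = 1\<^sub>m r" "C' * C = 1\<^sub>m r" using F by (auto elim: invertible_matE)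
    define D where "D = G * (A ^\<^sub>m j) * H"
    have Dc: "D \<in> sq_mats n" unfolding D_def using F Ajc by auto
    have D: "D = four_block_mat C (0\<^sub>m r m) (0\<^sub>m m r) (0\<^sub>m m m)" unfolding D_def F10 ..
    define K' where "K' = G * K * G\<^sup>T"
    have K'c: "K' \<in> sq_mats (r + m)" unfolding K'_def using F K n by auto
    obtain K1 K2 K3 K4 where Kb: "K1 \<in> sq_mats r" "K2 \<in> carrier_mat r m" "K3 \<in> carrier_mat m r" "K4 \<in> sq_mats m"
      "K' = four_block_mat K1 K2 K3 K4" using four_block_split[OF K'c] .
    \<comment> \<open>Here the exponent has to be even. Self-adjointness makes the invertible
      \<open>C\<close> annihilate the off-diagonal blocks of the metric, so these vanish.\<close>
    have DK: "D * K' = K' * D\<^sup>T"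
    proof -
      obtain i where i: "j = 2 * i" using F by (elim evenE)
      have AK: "A ^\<^sub>m j * K = K * (A ^\<^sub>m j)\<^sup>T" using even_power_adjoint[OF K, of A i] A Xo i by auto
      have "D * K' = G * (A ^\<^sub>m j * K) * G\<^sup>T" unfolding D_def K'_def using F(4-7) K Ajc Ac
        by (simp add: mat_simps mult_cancel_left_inverse[OF F(7)])
      also have "\<dots> = K' * D\<^sup>T" unfolding D_def K'_def AK using F(4-7) K Ajc Ac transpose_inverse[OF F(5,4,7)]
        by (simp add: mat_simps mult_cancel_left_inverse[of "G\<^sup>T" "H\<^sup>T" n])
      finally show ?thesis .
    qed
    have DT: "D\<^sup>T = four_block_mat (C\<^sup>T) (0\<^sub>m r m) (0\<^sub>m m r) (0\<^sub>m m m)" unfolding D using F(8)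
      by (subst transpose_four_block_mat[of _ r r _ m _ m]) (auto simp: mat_dim_simps)
    have "four_block_mat (C * K1) (C * K2) (0\<^sub>m m r) (0\<^sub>m m m) = four_block_mat (K1 * C\<^sup>T) (0\<^sub>m r m) (K3 * C\<^sup>T) (0\<^sub>m m m)"
      using DK unfolding DT unfolding D Kb(5) using Kb F(8) by (simp add: mult_four_block_dim mat_simps)
    then have "C * K2 = 0\<^sub>m r m" "K3 * C\<^sup>T = 0\<^sub>m m r" using Kb F(8)
      by (auto simp: four_block_eq_iff[of _ r r _ m _ m])
    then have "C' * (C * K2) = 0\<^sub>m r m" "(K3 * C\<^sup>T) * C'\<^sup>T = 0\<^sub>m m r" using C' Kb F(8) by auto
    then have K0: "K2 = 0\<^sub>m r m" "K3 = 0\<^sub>m m r" using C' Kb F(8) transpose_inverse[OF C'(1) F(8) C'(3)]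
      by (simp_all add: mat_simps mult_cancel_left_inverse[OF C'(3)])
    have "linearly_represented K \<X> (diag_block_mat [K1, K4]) (conj_set G \<X>)"
      unfolding linearly_represented_def
    proof (intro bexI conjI)
      show "invertible_mat G" using F by (intro invertible_matI[of G n H]) auto
      show "diag_block_mat [K1, K4] = G * K * G\<^sup>T"
        unfolding K'_def[symmetric] Kb(5) diag_block_mat_two K0 using Kb(1,4) by (simp add: dim_of_carrier)
    qed (use F K in auto)
    moreover have "conj_set G \<X> \<subseteq> {diag_block_mat [X1, X2] | X1 X2. X1 \<in> sq_mats r \<and> X2 \<in> sq_mats m}"
    proof
      fix Z assume "Z \<in> conj_set G \<X>"
      then obtain X where X: "X \<in> \<X>" "Z = G * X * H" unfolding conj_set_def mat_inv_eqI[OF F(4-7)] by auto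
      have Xc: "X \<in> sq_mats n" using X Xo oc by auto
      have Zc: "Z \<in> sq_mats (r + m)" using X Xc F n by auto
      have "X * A = A * X" using br[OF X(1) A(1)] bracket_zero_iff[OF Xc Ac] by simp
      then have XA: "A ^\<^sub>m j * X = X * A ^\<^sub>m j" using pow_mat_commute[OF Ac Xc] by simp
      have DZ: "D * Z = Z * D" unfolding D_def X(2) using conj_mult_aux[OF F(4,5,7)] Xc Ajc XA by simp
      obtain Z1 Z2 Z3 Z4 where Zb: "Z1 \<in> sq_mats r" "Z2 \<in> carrier_mat r m" "Z3 \<in> carrier_mat m r" "Z4 \<in> sq_mats m"
        "Z = four_block_mat Z1 Z2 Z3 Z4" using four_block_split[OF Zc] .
      have "four_block_mat (C * Z1) (C * Z2) (0\<^sub>m m r) (0\<^sub>m m m) = four_block_mat (Z1 * C) (0\<^sub>m r m) (Z3 * C) (0\<^sub>m m m)"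
        using DZ unfolding D Zb(5) using Zb F(8) by (simp add: mult_four_block_dim mat_simps)
      then have "C * Z2 = 0\<^sub>m r m" "Z3 * C = 0\<^sub>m m r" using Zb F(8)
        by (auto simp: four_block_eq_iff[of _ r r _ m _ m])
      then have "C' * (C * Z2) = 0\<^sub>m r m" "(Z3 * C) * C' = 0\<^sub>m m r" using C' Zb F(8) by auto
      then have "Z2 = 0\<^sub>m r m" "Z3 = 0\<^sub>m m r" using C' Zb F(8)
        by (simp_all add: mat_simps mult_cancel_left_inverse[OF C'(3)])
      then have "Z = diag_block_mat [Z1, Z4]" unfolding Zb(5) diag_block_mat_two using Zb(1,4) by (simp add: dim_of_carrier)
      then show "Z \<in> {diag_block_mat [X1, X2] | X1 X2. X1 \<in> sq_mats r \<and> X2 \<in> sq_mats m}" using Zb by blast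
    qed
    moreover have "1 \<le> r" "1 \<le> m" using r0 m0 by auto
    ultimately show False using ind Kb(1,4) unfolding orth_indecomposable_def by blast
  qed
  have "G * (A ^\<^sub>m j) * H = C" unfolding F10 m0 using F(8) by (intro eq_matI) auto
  then have "A ^\<^sub>m j = H * C * G" using conj_cancel[OF F(4-7) Ajc] by simp
  moreover have "invertible_mat (H * C * G)" using F n m0
    by (intro invertible_mult[of _ n] invertible_matI[of H n G] invertible_matI[of G n H]) auto
  ultimately show ?thesis using invertible_of_power[OF Ac F(2)] A by auto
qed

lemma diag_block_mat_carrier:
  assumes "list_all2 (\<lambda>X d. X \<in> sq_mats d) Xs ds"
  shows "diag_block_mat Xs \<in> sq_mats (sum_list ds)"
  using assms
proof (induction Xs arbitrary: ds)
  case (Cons X Xs)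
  then obtain d ds' where "ds = d # ds'" "X \<in> sq_mats d" "list_all2 (\<lambda>X d. X \<in> sq_mats d) Xs ds'"
    by (auto simp: list_all2_Cons1)
  then show ?case using Cons.IH[of ds'] by (auto simp: Let_def)
qed auto

lemma invertible_diag_block_mat:
  assumes "list_all2 (\<lambda>X d. X \<in> sq_mats d \<and> invertible_mat X) Xs ds"
  shows "invertible_mat (diag_block_mat Xs :: real mat)"
  using assms
proof (induction Xs arbitrary: ds)
  case Nil
  show ?case by (rule invertible_matI[of _ 0 "0\<^sub>m 0 0"]) auto
next
  case (Cons X Xs)
  then obtain d ds' where d: "ds = d # ds'" "X \<in> sq_mats d" "invertible_mat X"
    "list_all2 (\<lambda>X d. X \<in> sq_mats d \<and> invertible_mat X) Xs ds'"
    by (auto simp: list_all2_Cons1)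
  have "list_all2 (\<lambda>X d. X \<in> sq_mats d) Xs ds'" using d(4) by (rule list_all2_mono) auto
  from diag_block_mat_carrier[OF this] have c: "diag_block_mat Xs \<in> sq_mats (sum_list ds')" .
  have "invertible_mat (four_block_mat X (0\<^sub>m d (sum_list ds')) (0\<^sub>m (sum_list ds') d) (diag_block_mat Xs))"
    by (rule invertible_diag_block[OF d(2,3) c Cons.IH[OF d(4)]])
  then show ?case using d(2) c by (simp add: Let_def dim_of_carrier)
qed

text \<open>Commuting with the pair of \<open>D\<close> and t gives D b = X t for every member (X,
  b). If c solves D c = t on the invertible part, then (X, X c) commutes with all members, hence is
  a member by maximality, and \<open>c\<close> satisfies the splitting criterion.\<close>

lemma splitting_of_invertible_part:
  assumes K: "K \<in> sq_mats n" and M: "e_MASA K M" and r: "represented K M K' M'"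
    and n: "n = d + m"
    and shape: "\<And>X. X \<in> o_proj n M' \<Longrightarrow> \<exists>D \<in> sq_mats d. X = four_block_mat D (0\<^sub>m d m) (0\<^sub>m m d) (0\<^sub>m m m)"
    and D: "D \<in> sq_mats d" "invertible_mat D" "four_block_mat D (0\<^sub>m d m) (0\<^sub>m m d) (0\<^sub>m m m) \<in> o_proj n M'"
  shows "splitting K M"
proof -
  let ?B = "\<lambda>D. four_block_mat D (0\<^sub>m d m) (0\<^sub>m m d) (0\<^sub>m m m) :: real mat"
  note r' = represented_e_MASA[OF K M r]
  note P = e_MASA_pairs[OF r'(2,1)]
  obtain t where t: "(?B D, t) \<in> pairs n M'" using D(3) unfolding o_proj_pairs by auto
  obtain t1 t2 where t12: "t1 \<in> carrier_vec d" "t2 \<in> carrier_vec m" "t = t1 @\<^sub>v t2"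
    using P(2)[OF t] unfolding n by (metis vec_first_carrier vec_first_last_append vec_last_carrier)
  obtain E where E: "E \<in> sq_mats d" "D * E = 1\<^sub>m d" "E * D = 1\<^sub>m d" using D by (auto elim: invertible_matE)
  define c where "c = (E *\<^sub>v t1) @\<^sub>v 0\<^sub>v m"
  have mv: "?B A *\<^sub>v (u @\<^sub>v w) = (A *\<^sub>v u) @\<^sub>v 0\<^sub>v m"
    if "A \<in> sq_mats d" "u \<in> carrier_vec d" "w \<in> carrier_vec m" for A u w
    using that by (subst four_block_mat_mult_vec[of _ d d _ m _ m]) (auto simp: mat_simps)
  have mm: "?B A * ?B B = ?B (A * B)" if "A \<in> sq_mats d" "B \<in> sq_mats d" for A B
    using that by (simp add: mult_four_block_dim mat_simps)
  have binj: "A = B" if "?B A = ?B B" "A \<in> sq_mats d" "B \<in> sq_mats d" for A B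
    using that four_block_eq_iff[of A d d "0\<^sub>m d m" m "0\<^sub>m m d" m "0\<^sub>m m m" B] by auto
  show ?thesis
  proof (rule splitting_representedI[OF K M r])
    show c: "c \<in> carrier_vec n" unfolding c_def n using E t12 by auto
    fix X b assume Xb: "(X, b) \<in> pairs n M'"
    have "X \<in> o_proj n M'" unfolding o_proj_pairs using Xb by force
    then obtain A where A: "A \<in> sq_mats d" "X = ?B A" using shape by auto
    have Xc: "X \<in> o_alg K'" "X \<in> sq_mats n" using P(2)[OF Xb] by auto
    have "?B (A * D) = ?B (D * A)" using P(6)[OF Xb t] mm[OF A(1) D(1)] mm[OF D(1) A(1)] A(2) by simp
    then have AD: "A * D = D * A" using binj A(1) D(1) by (metis mult_carrier_mat)
    have AE: "A * E = E * A"
    proof -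
      have "E * (A * D) * E = E * (D * A) * E" using AD by simp
      then show ?thesis using A(1) D(1) E by (simp add: mat_simps mult_cancel_left_inverse[OF E(3)])
    qed
    show "(X, X *\<^sub>v c) \<in> pairs n M'"
    proof (rule P(7))
      show "X *\<^sub>v c \<in> carrier_vec n" using Xc by (intro carrier_vecI) auto
      fix Y e assume Ye: "(Y, e) \<in> pairs n M'"
      have "Y \<in> o_proj n M'" unfolding o_proj_pairs using Ye by force
      then obtain B where B: "B \<in> sq_mats d" "Y = ?B B" using shape by auto
      obtain e1 e2 where e12: "e1 \<in> carrier_vec d" "e2 \<in> carrier_vec m" "e = e1 @\<^sub>v e2"
        using P(2)[OF Ye] unfolding n by (metis vec_first_carrier vec_first_last_append vec_last_carrier)
      have XY: "X * Y = Y * X" using P(6)[OF Xb Ye] by simp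
      have "?B (A * B) = ?B (B * A)" using XY mm[OF A(1) B(1)] mm[OF B(1) A(1)] A(2) B(2) by simp
      then have AB: "A * B = B * A" using binj A(1) B(1) by (metis mult_carrier_mat)
      have "Y *\<^sub>v t = ?B D *\<^sub>v e" using P(6)[OF Ye t] by simp
      then have "(B *\<^sub>v t1) @\<^sub>v 0\<^sub>v m = (D *\<^sub>v e1) @\<^sub>v (0\<^sub>v m :: real vec)" unfolding B(2) t12(3) e12(3)
        using mv[OF B(1) t12(1,2)] mv[OF D(1) e12(1,2)] by simp
      then have Bt: "B *\<^sub>v t1 = D *\<^sub>v e1" using B(1) D(1) t12 e12
        by (subst (asm) append_vec_eq[of _ d]) (auto intro!: carrier_vecI)
      have e1: "e1 = E *\<^sub>v (B *\<^sub>v t1)" unfolding Bt using E D e12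
        by (subst mult_vec_cancel_left_inverse[OF E(3)]) (auto simp: dim_of_carrier)
      have Xcv: "X *\<^sub>v c = ((A * E) *\<^sub>v t1) @\<^sub>v 0\<^sub>v m" unfolding A(2) c_def using mv[OF A(1)] E(1) t12(1) A(1)
        by (simp add: mat_simps)
      have "Y *\<^sub>v (X *\<^sub>v c) = (B *\<^sub>v ((A * E) *\<^sub>v t1)) @\<^sub>v 0\<^sub>v m" unfolding Xcv B(2)
        by (rule mv) (use A(1) B(1) E(1) t12 in \<open>auto intro!: carrier_vecI\<close>)
      also have "B *\<^sub>v ((A * E) *\<^sub>v t1) = ((B * A) * E) *\<^sub>v t1" using A(1) B(1) E(1) t12(1) by (simp add: mat_simps)
      also have "(B * A) * E = A * (B * E)" unfolding AB[symmetric] using A(1) B(1) E(1) by simp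
      also have "B * E = E * B"
      proof -
        have "?B (B * D) = ?B (D * B)" using P(6)[OF Ye t] mm[OF B(1) D(1)] mm[OF D(1) B(1)] B(2) by simp
        then have "B * D = D * B" using binj B(1) D(1) by (metis mult_carrier_mat)
        then have "E * (B * D) * E = E * (D * B) * E" by simp
        then show ?thesis using B(1) D(1) E by (simp add: mat_simps mult_cancel_left_inverse[OF E(3)])
      qed
      also have "(A * (E * B)) *\<^sub>v t1 = A *\<^sub>v e1" unfolding e1 using A(1) B(1) E(1) t12(1) by (simp add: mat_simps)
      also have "(A *\<^sub>v e1) @\<^sub>v 0\<^sub>v m = X *\<^sub>v e" unfolding A(2) e12(3) using mv[OF A(1) e12(1,2)] by simp
      finally show "X * Y = Y * X \<and> X *\<^sub>v e = Y *\<^sub>v (X *\<^sub>v c)" using XY by simp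
    qed (use Xc in auto)
  qed
qed

text \<open>Each remaining block contains an invertible matrix. The projection consists of all
  combinations of block elements, so these matrices can be chosen simultaneously, and the projection
  contains a matrix that is invertible outside the zero blocks.\<close>

lemma no_nilpotent_block_splitting:
  assumes sig: "has_signature K p q" and M: "e_MASA K M"
    and can: "canonical_form p q K M p\<^sub>0 q\<^sub>0 k\<^sub>0 None bs kp km"
  shows "splitting K M"
proof -
  have K: "K \<in> sq_mats (p + q)" using sig unfolding has_signature_def by auto
  define blocks where "blocks = map (\<lambda>(r, s, b). b) bs"
  define ds where "ds = map (\<lambda>(r, s, Kb, Xb). r + s) bs"
  have k0: "k\<^sub>0 = 0" "p\<^sub>0 = 0" "q\<^sub>0 = 0" using can unfolding canonical_form_def by auto
  have bsP: "has_signature Kb r s \<and> MASA (r + s) (o_alg Kb) Xb \<and> \<not> MANS (r + s) (o_alg Kb) Xb \<and> orth_indecomposable Kb Xb"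
    if "(r, s, Kb, Xb) \<in> set bs" for r s Kb Xb using can that unfolding canonical_form_def by auto
  have pq: "p = kp + (\<Sum>(r, s, Kb, Xb)\<leftarrow>bs. r)" "q = km + (\<Sum>(r, s, Kb, Xb)\<leftarrow>bs. s)"
    using can k0 unfolding canonical_form_def by auto
  obtain M' where M': "represented K M (diag_block_mat (map fst blocks @ [1\<^sub>m kp, - 1\<^sub>m km])) M'"
    "o_proj (p + q) M' = {diag_block_mat (Xs @ [0\<^sub>m kp kp, 0\<^sub>m km km]) | Xs. list_all2 (\<in>) Xs (map snd blocks)}"
    using can unfolding canonical_form_def blocks_def Let_def by auto
  have "(\<Sum>(r, s, Kb, Xb)\<leftarrow>bs. r) + (\<Sum>(r, s, Kb, Xb)\<leftarrow>bs. s) = sum_list ds"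
    unfolding ds_def by (induction bs) auto
  then have n: "p + q = sum_list ds + (kp + km)" using pq by simp
  have car: "list_all2 (\<lambda>X d. X \<in> sq_mats d) Xs ds" if "list_all2 (\<in>) Xs (map snd blocks)" for Xs
  proof -
    have "list_all2 (\<lambda>b d. \<forall>X\<in>snd b. X \<in> sq_mats d) blocks ds"
      unfolding blocks_def ds_def list_all2_map1 list_all2_map2
      list_all2_same using bsP by (fastforce simp: MASA_def mat_subspace_def)
    moreover have "list_all2 (\<lambda>X b. X \<in> snd b) Xs blocks" using that by (simp add: list_all2_map2)
    ultimately show ?thesis by (auto simp: list_all2_conv_all_nth)
  qed
  have shape: "diag_block_mat (Xs @ [0\<^sub>m kp kp, 0\<^sub>m km km]) = four_block_mat (diag_block_mat Xs)
      (0\<^sub>m (sum_list ds) (kp + km)) (0\<^sub>m (kp + km) (sum_list ds)) (0\<^sub>m (kp + km) (kp + km))"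
    if "list_all2 (\<in>) Xs (map snd blocks)" for Xs
  proof -
    have "diag_block_mat [0\<^sub>m kp kp, 0\<^sub>m km km] = (0\<^sub>m (kp + km) (kp + km) :: real mat)"
      unfolding diag_block_mat_two by (intro eq_matI) auto
    then show ?thesis using diag_block_mat_carrier[OF car[OF that]]
      unfolding diag_block_mat_append by (simp add: Let_def dim_of_carrier)
  qed
  have "\<exists>T. T \<in> snd b \<and> invertible_mat T" if bb: "b \<in> set blocks" for b
  proof -
    obtain r s where rs: "(r, s, b) \<in> set bs" using bb unfolding blocks_def by auto
    obtain Kb Xb where b: "b = (Kb, Xb)" by (cases b)
    have *: "has_signature Kb r s" "MASA (r + s) (o_alg Kb) Xb" "\<not> MANS (r + s) (o_alg Kb) Xb" "orth_indecomposable Kb Xb"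
      using bsP rs b by auto
    have "Kb \<in> sq_mats (r + s)" using *(1) unfolding has_signature_def by auto
    from indecomposable_block_invertible[OF this *(2-4)] b show ?thesis by auto
  qed
  then obtain f where f: "\<And>b. b \<in> set blocks \<Longrightarrow> f b \<in> snd b \<and> invertible_mat (f b)" by metis
  define Ts where "Ts = map f blocks"
  have Ts: "list_all2 (\<in>) Ts (map snd blocks)" unfolding Ts_def using f by (auto simp: list_all2_map1 list_all2_map2 list_all2_same)
  have "\<forall>T\<in>set Ts. invertible_mat T" unfolding Ts_def using f by auto
  then have "list_all2 (\<lambda>X d. X \<in> sq_mats d \<and> invertible_mat X) Ts ds"
    using car[OF Ts] by (auto simp: list_all2_conv_all_nth)
  then have inv: "invertible_mat (diag_block_mat Ts)" by (rule invertible_diag_block_mat)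
  show ?thesis
  proof (rule splitting_of_invertible_part[OF K M M'(1) n _ diag_block_mat_carrier[OF car[OF Ts]] inv])
    show "four_block_mat (diag_block_mat Ts) (0\<^sub>m (sum_list ds) (kp + km)) (0\<^sub>m (kp + km) (sum_list ds)) (0\<^sub>m (kp + km) (kp + km))
      \<in> o_proj (p + q) M'" unfolding M'(2) using Ts shape[OF Ts] by force
    fix X assume "X \<in> o_proj (p + q) M'"
    then obtain Xs where "X = diag_block_mat (Xs @ [0\<^sub>m kp kp, 0\<^sub>m km km])" "list_all2 (\<in>) Xs (map snd blocks)"
      unfolding M'(2) by auto
    then show "\<exists>D\<in>sq_mats (sum_list ds). X = four_block_mat D (0\<^sub>m (sum_list ds) (kp + km))
       (0\<^sub>m (kp + km) (sum_list ds)) (0\<^sub>m (kp + km) (kp + km))"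
      using shape diag_block_mat_carrier[OF car] by auto
  qed
qed

text \<open>The presence of the block is the splitting argument; the bounds are part of
  \<open>canonical_form\<close> or follow from its dimension count.\<close>

theorem nonsplitting_contains_MANS:
  assumes "q \<le> p" "has_signature K p q" "e_MASA K M" "\<not> splitting K M"
    "canonical_form p q K M p\<^sub>0 q\<^sub>0 k\<^sub>0 nb bs kp km"
  shows "(\<exists>K\<^sub>0 N. nb = Some (K\<^sub>0, N) \<and> MANS_block K\<^sub>0 N p\<^sub>0 q\<^sub>0 k\<^sub>0) \<and>
       1 \<le> k\<^sub>0 \<and> k\<^sub>0 \<le> q \<and> min (p\<^sub>0 + k\<^sub>0) (q\<^sub>0 + k\<^sub>0) \<ge> 1"
proof (cases nb)
  case None
  then show ?thesis using no_nilpotent_block_splitting assms by blast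
next
  case (Some b)
  then show ?thesis using assms(5) unfolding canonical_form_def by (cases b) auto
qed

lemma carrier_mat_dims: "A \<in> carrier_mat n m \<longleftrightarrow> dim_row A = n \<and> dim_col A = m"
  by auto

lemma carrier_vec_dims: "v \<in> carrier_vec n \<longleftrightarrow> dim_vec v = n"
  by (auto intro: carrier_vecI)

subsection \<open>Three by three block matrices\<close>

text \<open>A flat index scheme for block sizes k, m, k in place of nested
  \<open>four_block_mat\<close>: index sums split once, by \<open>sum_split3\<close>, and products
  then come out blockwise.\<close>

definition mat3 :: "nat \<Rightarrow> nat \<Rightarrow> real mat \<Rightarrow> real mat \<Rightarrow> real mat \<Rightarrow> real mat \<Rightarrow> real mat \<Rightarrow> real mat \<Rightarrow>
    real mat \<Rightarrow> real mat \<Rightarrow> real mat \<Rightarrow> real mat" where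
  "mat3 k m a b c d e f g h i = mat (k + m + k) (k + m + k) (\<lambda>(r, s).
     if r < k then (if s < k then a $$ (r, s) else if s < k + m then b $$ (r, s - k) else c $$ (r, s - (k + m)))
     else if r < k + m then (if s < k then d $$ (r - k, s) else if s < k + m then e $$ (r - k, s - k) else f $$ (r - k, s - (k + m)))
     else (if s < k then g $$ (r - (k + m), s) else if s < k + m then h $$ (r - (k + m), s - k) else i $$ (r - (k + m), s - (k + m))))"

lemma mat3_carrier [simp]: "mat3 k m a b c d e f g h i \<in> sq_mats (k + m + k)"
  "dim_row (mat3 k m a b c d e f g h i) = k + m + k" "dim_col (mat3 k m a b c d e f g h i) = k + m + k"
  unfolding mat3_def by auto

lemma mat3_index:
  "r < k \<Longrightarrow> s < k \<Longrightarrow> mat3 k m a b c d e f g h i $$ (r, s) = a $$ (r, s)"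
  "r < k \<Longrightarrow> s < m \<Longrightarrow> mat3 k m a b c d e f g h i $$ (r, k + s) = b $$ (r, s)"
  "r < k \<Longrightarrow> s < k \<Longrightarrow> mat3 k m a b c d e f g h i $$ (r, k + m + s) = c $$ (r, s)"
  "r < m \<Longrightarrow> s < k \<Longrightarrow> mat3 k m a b c d e f g h i $$ (k + r, s) = d $$ (r, s)"
  "r < m \<Longrightarrow> s < m \<Longrightarrow> mat3 k m a b c d e f g h i $$ (k + r, k + s) = e $$ (r, s)"
  "r < m \<Longrightarrow> s < k \<Longrightarrow> mat3 k m a b c d e f g h i $$ (k + r, k + m + s) = f $$ (r, s)"
  "r < k \<Longrightarrow> s < k \<Longrightarrow> mat3 k m a b c d e f g h i $$ (k + m + r, s) = g $$ (r, s)"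
  "r < k \<Longrightarrow> s < m \<Longrightarrow> mat3 k m a b c d e f g h i $$ (k + m + r, k + s) = h $$ (r, s)"
  "r < k \<Longrightarrow> s < k \<Longrightarrow> mat3 k m a b c d e f g h i $$ (k + m + r, k + m + s) = i $$ (r, s)"
  unfolding mat3_def by auto

lemma index3_cases:
  assumes "r < k + m + (k :: nat)"
  obtains (fst) "r < k" | (snd) r' where "r = k + r'" "r' < m" | (trd) r' where "r = k + m + r'" "r' < k"
proof -
  consider "r < k" | "k \<le> r" "r < k + m" | "k + m \<le> r" by linarith
  then show ?thesis
  proof cases
    case 2
    then show ?thesis using that(2)[of "r - k"] by simp
  next
    case 3
    then show ?thesis using that(3)[of "r - (k + m)"] assms by simp
  qed (rule that(1))
qed

lemma sum_split3:
  fixes f :: "nat \<Rightarrow> real"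
  shows "(\<Sum>t = 0..<k + m + k. f t) = (\<Sum>t = 0..<k. f t) + (\<Sum>t = 0..<m. f (k + t)) + (\<Sum>t = 0..<k. f (k + m + t))"
proof -
  have "(\<Sum>t = 0..<k + m + k. f t) = (\<Sum>t = 0..<k. f t) + (\<Sum>t = k..<k + m. f t) + (\<Sum>t = k + m..<k + m + k. f t)"
    by (simp add: sum.atLeastLessThan_concat)
  moreover have "(\<Sum>t = k..<k + m. f t) = (\<Sum>t = 0..<m. f (k + t))"
    using sum.shift_bounds_nat_ivl[of f 0 k m] by (simp add: add.commute)
  moreover have "(\<Sum>t = k + m..<k + m + k. f t) = (\<Sum>t = 0..<k. f (k + m + t))"
    using sum.shift_bounds_nat_ivl[of f 0 "k + m" k] by (simp add: add.commute)
  ultimately show ?thesis by simp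
qed

lemma mat3_transpose:
  assumes "a \<in> sq_mats k" "b \<in> carrier_mat k m" "c \<in> sq_mats k"
    "d \<in> carrier_mat m k" "e \<in> sq_mats m" "f \<in> carrier_mat m k"
    "g \<in> sq_mats k" "h \<in> carrier_mat k m" "i \<in> sq_mats k"
  shows "(mat3 k m a b c d e f g h i)\<^sup>T = mat3 k m (a\<^sup>T) (d\<^sup>T) (g\<^sup>T) (b\<^sup>T) (e\<^sup>T) (h\<^sup>T) (c\<^sup>T) (f\<^sup>T) (i\<^sup>T)"
proof (rule eq_matI)
  fix r s assume "r < dim_row (mat3 k m (a\<^sup>T) (d\<^sup>T) (g\<^sup>T) (b\<^sup>T) (e\<^sup>T) (h\<^sup>T) (c\<^sup>T) (f\<^sup>T) (i\<^sup>T))"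
    "s < dim_col (mat3 k m (a\<^sup>T) (d\<^sup>T) (g\<^sup>T) (b\<^sup>T) (e\<^sup>T) (h\<^sup>T) (c\<^sup>T) (f\<^sup>T) (i\<^sup>T))"
  then have rs: "r < k + m + k" "s < k + m + k" by auto
  show "(mat3 k m a b c d e f g h i)\<^sup>T $$ (r, s) = mat3 k m (a\<^sup>T) (d\<^sup>T) (g\<^sup>T) (b\<^sup>T) (e\<^sup>T) (h\<^sup>T) (c\<^sup>T) (f\<^sup>T) (i\<^sup>T) $$ (r, s)"
    by (rule index3_cases[OF rs(1)]; rule index3_cases[OF rs(2)]; use assms in \<open>simp add: mat3_index\<close>)
qed auto

lemma mat3_mult:
  assumes "a \<in> sq_mats k" "b \<in> carrier_mat k m" "c \<in> sq_mats k"
    "d \<in> carrier_mat m k" "e \<in> sq_mats m" "f \<in> carrier_mat m k"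
    "g \<in> sq_mats k" "h \<in> carrier_mat k m" "i \<in> sq_mats k"
    and "a' \<in> sq_mats k" "b' \<in> carrier_mat k m" "c' \<in> sq_mats k"
    "d' \<in> carrier_mat m k" "e' \<in> sq_mats m" "f' \<in> carrier_mat m k"
    "g' \<in> sq_mats k" "h' \<in> carrier_mat k m" "i' \<in> sq_mats k"
  shows "mat3 k m a b c d e f g h i * mat3 k m a' b' c' d' e' f' g' h' i' =
    mat3 k m (a * a' + b * d' + c * g') (a * b' + b * e' + c * h') (a * c' + b * f' + c * i')
      (d * a' + e * d' + f * g') (d * b' + e * e' + f * h') (d * c' + e * f' + f * i')
      (g * a' + h * d' + i * g') (g * b' + h * e' + i * h') (g * c' + h * f' + i * i')" (is "?L = ?R")
proof (rule eq_matI)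
  fix r s assume "r < dim_row ?R" "s < dim_col ?R"
  then have rs: "r < k + m + k" "s < k + m + k" by auto
  have "?L $$ (r, s) = (\<Sum>t = 0..<k + m + k. mat3 k m a b c d e f g h i $$ (r, t) * mat3 k m a' b' c' d' e' f' g' h' i' $$ (t, s))"
    using rs by (simp add: scalar_prod_def)
  also have "\<dots> = ?R $$ (r, s)" unfolding sum_split3
    by (rule index3_cases[OF rs(1)]; rule index3_cases[OF rs(2)]; use assms in \<open>simp add: mat3_index scalar_prod_def\<close>)
  finally show "?L $$ (r, s) = ?R $$ (r, s)" .
qed auto

lemma mat3_eq_iff:
  assumes "a \<in> sq_mats k" "b \<in> carrier_mat k m" "c \<in> sq_mats k"
    "d \<in> carrier_mat m k" "e \<in> sq_mats m" "f \<in> carrier_mat m k"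
    "g \<in> sq_mats k" "h \<in> carrier_mat k m" "i \<in> sq_mats k"
    and "a' \<in> sq_mats k" "b' \<in> carrier_mat k m" "c' \<in> sq_mats k"
    "d' \<in> carrier_mat m k" "e' \<in> sq_mats m" "f' \<in> carrier_mat m k"
    "g' \<in> sq_mats k" "h' \<in> carrier_mat k m" "i' \<in> sq_mats k"
  shows "mat3 k m a b c d e f g h i = mat3 k m a' b' c' d' e' f' g' h' i' \<longleftrightarrow>
    a = a' \<and> b = b' \<and> c = c' \<and> d = d' \<and> e = e' \<and> f = f' \<and> g = g' \<and> h = h' \<and> i = i'"
proof
  assume eq: "mat3 k m a b c d e f g h i = mat3 k m a' b' c' d' e' f' g' h' i'"
  have E: "mat3 k m a b c d e f g h i $$ (r, s) = mat3 k m a' b' c' d' e' f' g' h' i' $$ (r, s)" for r s using eq by simp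
  have "a $$ (r, s) = a' $$ (r, s)" if "r < k" "s < k" for r s
    using E[of r s] that by (simp add: mat3_index)
  moreover have "b $$ (r, s) = b' $$ (r, s)" if "r < k" "s < m" for r s
    using E[of r "k + s"] that by (simp add: mat3_index)
  moreover have "c $$ (r, s) = c' $$ (r, s)" if "r < k" "s < k" for r s
    using E[of r "k + m + s"] that by (simp add: mat3_index)
  moreover have "d $$ (r, s) = d' $$ (r, s)" if "r < m" "s < k" for r s
    using E[of "k + r" s] that by (simp add: mat3_index)
  moreover have "e $$ (r, s) = e' $$ (r, s)" if "r < m" "s < m" for r s
    using E[of "k + r" "k + s"] that by (simp add: mat3_index)
  moreover have "f $$ (r, s) = f' $$ (r, s)" if "r < m" "s < k" for r s
    using E[of "k + r" "k + m + s"] that by (simp add: mat3_index)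
  moreover have "g $$ (r, s) = g' $$ (r, s)" if "r < k" "s < k" for r s
    using E[of "k + m + r" s] that by (simp add: mat3_index)
  moreover have "h $$ (r, s) = h' $$ (r, s)" if "r < k" "s < m" for r s
    using E[of "k + m + r" "k + s"] that by (simp add: mat3_index)
  moreover have "i $$ (r, s) = i' $$ (r, s)" if "r < k" "s < k" for r s
    using E[of "k + m + r" "k + m + s"] that by (simp add: mat3_index)
  ultimately show "a = a' \<and> b = b' \<and> c = c' \<and> d = d' \<and> e = e' \<and> f = f' \<and> g = g' \<and> h = h' \<and> i = i'"
    using assms by (auto intro!: eq_matI)
qed simp

lemma mat3_uminus:
  assumes "a \<in> sq_mats k" "b \<in> carrier_mat k m" "c \<in> sq_mats k"
    "d \<in> carrier_mat m k" "e \<in> sq_mats m" "f \<in> carrier_mat m k"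
    "g \<in> sq_mats k" "h \<in> carrier_mat k m" "i \<in> sq_mats k"
  shows "- mat3 k m a b c d e f g h i = mat3 k m (- a) (- b) (- c) (- d) (- e) (- f) (- g) (- h) (- i)" (is "_ = ?R")
proof (rule eq_matI)
  fix r s assume "r < dim_row ?R" "s < dim_col ?R"
  then have rs: "r < k + m + k" "s < k + m + k" by auto
  show "(- mat3 k m a b c d e f g h i) $$ (r, s) = ?R $$ (r, s)"
    by (rule index3_cases[OF rs(1)]; rule index3_cases[OF rs(2)]; use assms in \<open>simp add: mat3_index\<close>)
qed auto

lemma mat3_smult:
  assumes "a \<in> sq_mats k" "b \<in> carrier_mat k m" "c \<in> sq_mats k"
    "d \<in> carrier_mat m k" "e \<in> sq_mats m" "f \<in> carrier_mat m k"
    "g \<in> sq_mats k" "h \<in> carrier_mat k m" "i \<in> sq_mats k"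
  shows "x \<cdot>\<^sub>m mat3 k m a b c d e f g h i = mat3 k m (x \<cdot>\<^sub>m a) (x \<cdot>\<^sub>m b) (x \<cdot>\<^sub>m c) (x \<cdot>\<^sub>m d) (x \<cdot>\<^sub>m e)
    (x \<cdot>\<^sub>m f) (x \<cdot>\<^sub>m g) (x \<cdot>\<^sub>m h) (x \<cdot>\<^sub>m i)" (is "_ = ?R")
proof (rule eq_matI)
  fix r s assume "r < dim_row ?R" "s < dim_col ?R"
  then have rs: "r < k + m + k" "s < k + m + k" by auto
  show "(x \<cdot>\<^sub>m mat3 k m a b c d e f g h i) $$ (r, s) = ?R $$ (r, s)"
    by (rule index3_cases[OF rs(1)]; rule index3_cases[OF rs(2)]; use assms in \<open>simp add: mat3_index\<close>)
qed auto

lemma mat3_add: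
  assumes "a' \<in> sq_mats k" "b' \<in> carrier_mat k m" "c' \<in> sq_mats k"
    "d' \<in> carrier_mat m k" "e' \<in> sq_mats m" "f' \<in> carrier_mat m k"
    "g' \<in> sq_mats k" "h' \<in> carrier_mat k m" "i' \<in> sq_mats k"
  shows "mat3 k m a b c d e f g h i + mat3 k m a' b' c' d' e' f' g' h' i' =
    mat3 k m (a + a') (b + b') (c + c') (d + d') (e + e') (f + f') (g + g') (h + h') (i + i')" (is "?L = ?R")
proof (rule eq_matI)
  fix r s assume "r < dim_row ?R" "s < dim_col ?R"
  then have rs: "r < k + m + k" "s < k + m + k" by auto
  show "?L $$ (r, s) = ?R $$ (r, s)"
    by (rule index3_cases[OF rs(1)]; rule index3_cases[OF rs(2)]; use assms in \<open>simp add: mat3_index\<close>)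
qed auto

lemma vec3_index:
  assumes "u \<in> carrier_vec k" "v \<in> carrier_vec m" "w \<in> carrier_vec k"
  shows "r < k \<Longrightarrow> (u @\<^sub>v v @\<^sub>v w) $ r = u $ r"
    "r < m \<Longrightarrow> (u @\<^sub>v v @\<^sub>v w) $ (k + r) = v $ r"
    "r < k \<Longrightarrow> (u @\<^sub>v v @\<^sub>v w) $ (k + m + r) = w $ r"
  using assms by auto

lemma vec3_carrier:
  assumes "u \<in> carrier_vec k" "v \<in> carrier_vec m" "w \<in> carrier_vec k"
  shows "u @\<^sub>v v @\<^sub>v w \<in> carrier_vec (k + m + k)"
  using assms by (metis add.assoc append_carrier_vec)

lemma vec3_eq_iff:
  assumes "u \<in> carrier_vec k" "v \<in> carrier_vec m" "u' \<in> carrier_vec k" "v' \<in> carrier_vec m"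
  shows "u @\<^sub>v v @\<^sub>v w = u' @\<^sub>v v' @\<^sub>v w' \<longleftrightarrow> u = u' \<and> v = v' \<and> (w :: real vec) = w'"
  using assms by (auto simp: append_vec_eq)

lemma vec3_split:
  assumes "t \<in> carrier_vec (k + m + k)"
  obtains u v w where "u \<in> carrier_vec k" "v \<in> carrier_vec m" "w \<in> carrier_vec k" "t = u @\<^sub>v v @\<^sub>v (w :: real vec)"
proof
  let ?u = "vec k (\<lambda>i. t $ i)" and ?v = "vec m (\<lambda>i. t $ (k + i))" and ?w = "vec k (\<lambda>i. t $ (k + m + i))"
  show "t = ?u @\<^sub>v ?v @\<^sub>v ?w"
  proof (rule eq_vecI)
    fix r assume "r < dim_vec (?u @\<^sub>v ?v @\<^sub>v ?w)"
    then have r: "r < k + m + k" by simp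
    show "t $ r = (?u @\<^sub>v ?v @\<^sub>v ?w) $ r" by (rule index3_cases[OF r]) auto
  qed (use assms in auto)
qed auto

lemma vec3_add:
  assumes "u \<in> carrier_vec k" "v \<in> carrier_vec m" "u' \<in> carrier_vec k" "v' \<in> carrier_vec m" "w \<in> carrier_vec l" "w' \<in> carrier_vec l"
  shows "(u @\<^sub>v v @\<^sub>v w) + (u' @\<^sub>v v' @\<^sub>v w') = (u + u') @\<^sub>v (v + v') @\<^sub>v (w + (w' :: real vec))"
  using assms by (auto intro!: eq_vecI)

lemma vec3_smult:
  "r \<cdot>\<^sub>v (u @\<^sub>v v @\<^sub>v w) = (r \<cdot>\<^sub>v u) @\<^sub>v (r \<cdot>\<^sub>v v) @\<^sub>v (r \<cdot>\<^sub>v (w :: real vec))"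
  by (auto intro!: eq_vecI)

lemma mult_vec_index:
  "A \<in> carrier_mat n m \<Longrightarrow> x \<in> carrier_vec m \<Longrightarrow> r < n \<Longrightarrow> (A *\<^sub>v x) $ r = (\<Sum>t = 0..<m. A $$ (r, t) * (x $ t :: real))"
  by (auto simp: scalar_prod_def)

lemma mat3_mult_vec:
  assumes "a \<in> sq_mats k" "b \<in> carrier_mat k m" "c \<in> sq_mats k"
    "d \<in> carrier_mat m k" "e \<in> sq_mats m" "f \<in> carrier_mat m k"
    "g \<in> sq_mats k" "h \<in> carrier_mat k m" "i \<in> sq_mats k"
    and uvw: "u \<in> carrier_vec k" "v \<in> carrier_vec m" "w \<in> carrier_vec k"
  shows "mat3 k m a b c d e f g h i *\<^sub>v (u @\<^sub>v v @\<^sub>v w) =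
    (a *\<^sub>v u + b *\<^sub>v v + c *\<^sub>v w) @\<^sub>v (d *\<^sub>v u + e *\<^sub>v v + f *\<^sub>v w) @\<^sub>v (g *\<^sub>v u + h *\<^sub>v v + i *\<^sub>v w)" (is "?L = ?R")
proof (rule eq_vecI)
  have c: "a *\<^sub>v u + b *\<^sub>v v + c *\<^sub>v w \<in> carrier_vec k" "d *\<^sub>v u + e *\<^sub>v v + f *\<^sub>v w \<in> carrier_vec m"
    "g *\<^sub>v u + h *\<^sub>v v + i *\<^sub>v w \<in> carrier_vec k" using assms by (auto intro!: carrier_vecI)
  fix r assume "r < dim_vec ?R"
  then have r: "r < k + m + k" using assms by simp
  have "?L $ r = (\<Sum>t = 0..<k + m + k. mat3 k m a b c d e f g h i $$ (r, t) * (u @\<^sub>v v @\<^sub>v w) $ t)"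
    using r by (intro mult_vec_index[OF _ vec3_carrier[OF uvw]]) auto
  also have "\<dots> = ?R $ r" unfolding sum_split3
    by (rule index3_cases[OF r]; use assms in \<open>simp add: mat3_index vec3_index[OF uvw] vec3_index[OF c] scalar_prod_def\<close>)
  finally show "?L $ r = ?R $ r" .
qed (use assms in auto)

lemmas mat3_dim_simps = mat3_transpose[unfolded carrier_mat_dims] mat3_mult[unfolded carrier_mat_dims]
  mat3_uminus[unfolded carrier_mat_dims] mat3_add[unfolded carrier_mat_dims] mat3_smult[unfolded carrier_mat_dims]
  mat3_mult_vec[unfolded carrier_mat_dims carrier_vec_dims]

subsection \<open>Kravchuk matrices\<close>

lemma kravchuk_mat3:
  assumes "Kt \<in> sq_mats m" "A \<in> carrier_mat k m" "S \<in> sq_mats m" "Y \<in> sq_mats k"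
  shows "kravchuk_mat Kt A S Y = mat3 k m (0\<^sub>m k k) A Y (0\<^sub>m m k) S (- (Kt * A\<^sup>T)) (0\<^sub>m k k) (0\<^sub>m k m) (0\<^sub>m k k)"
    (is "_ = ?R")
proof (rule eq_matI)
  fix r s assume "r < dim_row ?R" "s < dim_col ?R"
  then have rs: "r < k + m + k" "s < k + m + k" by auto
  show "kravchuk_mat Kt A S Y $$ (r, s) = ?R $$ (r, s)"
    unfolding kravchuk_mat_def Let_def append_rows_def
    by (rule index3_cases[OF rs(1)]; rule index3_cases[OF rs(2)]; use assms in \<open>simp add: mat3_index\<close>)
qed (use assms in \<open>auto simp: kravchuk_mat_def Let_def append_rows_def\<close>)

lemma kravchuk_metric3:
  assumes "Kt \<in> sq_mats m"
  shows "kravchuk_metric k Kt = mat3 k m (0\<^sub>m k k) (0\<^sub>m k m) (1\<^sub>m k) (0\<^sub>m m k) Kt (0\<^sub>m m k) (1\<^sub>m k) (0\<^sub>m k m) (0\<^sub>m k k)"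
    (is "_ = ?R")
proof (rule eq_matI)
  fix r s assume "r < dim_row ?R" "s < dim_col ?R"
  then have rs: "r < k + m + k" "s < k + m + k" by auto
  show "kravchuk_metric k Kt $$ (r, s) = ?R $$ (r, s)"
    unfolding kravchuk_metric_def Let_def append_rows_def
    by (rule index3_cases[OF rs(1)]; rule index3_cases[OF rs(2)]; use assms in \<open>simp add: mat3_index\<close>)
qed (use assms in \<open>auto simp: kravchuk_metric_def Let_def append_rows_def\<close>)

lemma kravchuk_carrier:
  assumes "Kt \<in> sq_mats m" "A \<in> carrier_mat k m" "S \<in> sq_mats m" "Y \<in> sq_mats k"
  shows "kravchuk_mat Kt A S Y \<in> sq_mats (k + m + k)"
    "kravchuk_metric k Kt \<in> sq_mats (k + m + k)"
  unfolding kravchuk_mat3[OF assms] kravchuk_metric3[OF assms(1)] by auto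

lemma kravchuk_mult_vec:
  assumes "Kt \<in> sq_mats m" "A \<in> carrier_mat k m" "Y \<in> sq_mats k"
    "u \<in> carrier_vec k" "v \<in> carrier_vec m" "w \<in> carrier_vec k"
  shows "kravchuk_mat Kt A (0\<^sub>m m m) Y *\<^sub>v (u @\<^sub>v v @\<^sub>v w) = (A *\<^sub>v v + Y *\<^sub>v w) @\<^sub>v (- (Kt *\<^sub>v (A\<^sup>T *\<^sub>v w))) @\<^sub>v 0\<^sub>v k"
  using assms by (subst kravchuk_mat3[of _ m _ k]) (auto simp: mat3_mult_vec mat_simps)

lemmas kravchuk_dim_simps = kravchuk_mat3[unfolded carrier_mat_dims] kravchuk_metric3[unfolded carrier_mat_dims] mat3_dim_simps

lemma kravchuk_add:
  assumes "Kt \<in> sq_mats m" "A \<in> carrier_mat k m" "S \<in> sq_mats m" "Y \<in> sq_mats k"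
    and "A' \<in> carrier_mat k m" "S' \<in> sq_mats m" "Y' \<in> sq_mats k"
  shows "kravchuk_mat Kt A S Y + kravchuk_mat Kt A' S' Y' = kravchuk_mat Kt (A + A') (S + S') (Y + Y')"
proof -
  have "- (Kt * (A + A')\<^sup>T) = - (Kt * A\<^sup>T) + - (Kt * A'\<^sup>T)"
    using assms by (intro eq_matI) (auto simp: mat_simps)
  then show ?thesis using assms
    by (simp add: kravchuk_dim_simps[where k = k and m = m] dim_of_carrier add_zero_dim)
qed

lemma kravchuk_smult:
  assumes "Kt \<in> sq_mats m" "A \<in> carrier_mat k m" "S \<in> sq_mats m" "Y \<in> sq_mats k"
  shows "r \<cdot>\<^sub>m kravchuk_mat Kt A S Y = kravchuk_mat Kt (r \<cdot>\<^sub>m A) (r \<cdot>\<^sub>m S) (r \<cdot>\<^sub>m Y)"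
proof -
  have "r \<cdot>\<^sub>m - (Kt * A\<^sup>T) = - (Kt * (r \<cdot>\<^sub>m A)\<^sup>T)" "r \<cdot>\<^sub>m 0\<^sub>m k k = (0\<^sub>m k k :: real mat)"
    "r \<cdot>\<^sub>m 0\<^sub>m m k = (0\<^sub>m m k :: real mat)" "r \<cdot>\<^sub>m 0\<^sub>m k m = (0\<^sub>m k m :: real mat)"
    using assms by (auto intro!: eq_matI simp: mat_simps)
  then show ?thesis using assms
    by (simp add: kravchuk_dim_simps[where k = k and m = m] dim_of_carrier)
qed

lemma skew_mats_iff: "Y \<in> skew_mats k \<longleftrightarrow> Y \<in> sq_mats k \<and> (\<forall>i<k. \<forall>j<k. Y $$ (i, j) = - Y $$ (j, i))"
proof -
  have "Y\<^sup>T = - Y \<longleftrightarrow> (\<forall>i<k. \<forall>j<k. Y\<^sup>T $$ (i, j) = (- Y) $$ (i, j))" if "Y \<in> sq_mats k"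
    using that by (auto simp: mat_eq_iff)
  also have "\<dots> \<longleftrightarrow> (\<forall>i<k. \<forall>j<k. Y $$ (j, i) = - Y $$ (i, j))" if "Y \<in> sq_mats k"
    using that by simp
  finally show ?thesis unfolding skew_mats_def by auto
qed

lemma kravchuk_in_o_alg:
  assumes "Kt \<in> sq_mats m" "Kt\<^sup>T = Kt" "A \<in> carrier_mat k m" "Y \<in> skew_mats k"
  shows "kravchuk_mat Kt A (0\<^sub>m m m) Y \<in> o_alg (kravchuk_metric k Kt)"
proof -
  have Y: "Y \<in> sq_mats k" "Y\<^sup>T = - Y" using assms unfolding skew_mats_def by auto
  have "kravchuk_mat Kt A (0\<^sub>m m m) Y * kravchuk_metric k Kt = - (kravchuk_metric k Kt * (kravchuk_mat Kt A (0\<^sub>m m m) Y)\<^sup>T)"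
    unfolding kravchuk_mat3[OF assms(1,3) zero_carrier_mat Y(1)] kravchuk_metric3[OF assms(1)]
    using assms(1-3) Y by (simp add: mat3_dim_simps mat_simps)
  then show ?thesis using assms Y by (subst o_alg_iff[of _ "k + m + k"]) (auto simp: kravchuk_carrier)
qed

section \<open>Rows \<alpha> Q_i and skew-symmetric matrices\<close>

lemma rows_mat_carrier: "a \<in> carrier_vec m \<Longrightarrow> rows_mat k Q a \<in> carrier_mat k m"
  unfolding rows_mat_def by auto

lemma rows_mat_row:
  assumes "a \<in> carrier_vec m" "i < k" "Q i \<in> sq_mats m"
  shows "row (rows_mat k Q a) i = (Q i)\<^sup>T *\<^sub>v a"
  using assms unfolding rows_mat_def row_mult_def by (subst mat_of_rows_row) (auto intro!: carrier_vecI)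

lemma rows_mat_mult_vec:
  assumes "a \<in> carrier_vec m" "i < k" "Q i \<in> sq_mats m" "v \<in> carrier_vec m"
  shows "(rows_mat k Q a *\<^sub>v v) $ i = a \<bullet> (Q i *\<^sub>v v)"
  using assms rows_mat_row[of a m i k Q] rows_mat_carrier[OF assms(1), of k Q]
    scalar_prod_mult_vec[OF assms(3,1,4)] by simp

lemma rows_mat_eqI:
  assumes "a \<in> carrier_vec m" "B \<in> carrier_mat k m"
    and "\<And>i. i < k \<Longrightarrow> Q i \<in> sq_mats m" "\<And>i. i < k \<Longrightarrow> row B i = (Q i)\<^sup>T *\<^sub>v a"
  shows "rows_mat k Q a = B"
  by (rule eq_rowI) (use assms rows_mat_carrier[OF assms(1), of k Q] rows_mat_row[OF assms(1)] in auto)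

lemma rows_mat_add:
  assumes "a \<in> carrier_vec m" "a' \<in> carrier_vec m" and "\<And>i. i < k \<Longrightarrow> Q i \<in> sq_mats m"
  shows "rows_mat k Q (a + a') = rows_mat k Q a + rows_mat k Q a'"
proof (rule rows_mat_eqI[of _ m])
  fix i assume i: "i < k"
  then show "row (rows_mat k Q a + rows_mat k Q a') i = (Q i)\<^sup>T *\<^sub>v (a + a')"
    using assms(1,2) assms(3)[OF i] rows_mat_row[OF assms(1) i, of Q] rows_mat_row[OF assms(2) i, of Q] rows_mat_carrier[OF assms(1), of k Q]
      rows_mat_carrier[OF assms(2), of k Q] by (simp add: mat_simps)
qed (use assms rows_mat_carrier in auto)

lemma rows_mat_smult:
  assumes "a \<in> carrier_vec m" and "\<And>i. i < k \<Longrightarrow> Q i \<in> sq_mats m"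
  shows "rows_mat k Q (c \<cdot>\<^sub>v a) = c \<cdot>\<^sub>m rows_mat k Q a"
proof (rule rows_mat_eqI[of _ m])
  fix i assume i: "i < k"
  then show "row (c \<cdot>\<^sub>m rows_mat k Q a) i = (Q i)\<^sup>T *\<^sub>v (c \<cdot>\<^sub>v a)"
    using assms(1) assms(2)[OF i] rows_mat_row[OF assms(1) i, of Q] rows_mat_carrier[OF assms(1), of k Q] by (simp add: mat_simps)
qed (use assms rows_mat_carrier in auto)

lemma rows_mat_zero:
  assumes "\<And>i. i < k \<Longrightarrow> Q i \<in> sq_mats m"
  shows "rows_mat k Q (0\<^sub>v m) = 0\<^sub>m k m"
proof (rule rows_mat_eqI[of _ m])
  fix i assume i: "i < k"
  then show "row (0\<^sub>m k m) i = (Q i)\<^sup>T *\<^sub>v 0\<^sub>v m" using assms[OF i] by (auto simp: mat_simps)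
qed (use assms in auto)

text \<open>For distinct i and j this is the elementary skew matrix E_ij - E_ji. Applied to a vector
  it isolates two entries, which makes it the test matrix for the cocycle equations.\<close>

definition skew_unit :: "nat \<Rightarrow> nat \<Rightarrow> nat \<Rightarrow> real mat" where
  "skew_unit k i j = mat k k (\<lambda>(r, s). if r = i \<and> s = j then 1 else if r = j \<and> s = i then - 1 else 0)"

lemma skew_unit_mem: "i \<noteq> j \<Longrightarrow> skew_unit k i j \<in> skew_mats k"
  unfolding skew_mats_iff skew_unit_def by auto

lemma skew_unit_mult_vec:
  assumes "w \<in> carrier_vec k" "i < k" "j < k" "i \<noteq> j" "r < k"
  shows "(skew_unit k i j *\<^sub>v w) $ r = (if r = i then w $ j else if r = j then - w $ i else 0)"
proof -
  have "(skew_unit k i j *\<^sub>v w) $ r = (\<Sum>s = 0..<k. (if r = i \<and> s = j then 1 else if r = j \<and> s = i then - 1 else 0) * w $ s)"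
    using assms unfolding skew_unit_def by (simp add: scalar_prod_def)
  also have "\<dots> = (\<Sum>s = 0..<k. (if s = j then (if r = i then w $ s else 0) else 0) + (if s = i then (if r = j then - w $ s else 0) else 0))"
    using assms by (intro sum.cong) auto
  also have "\<dots> = (if r = i then w $ j else if r = j then - w $ i else 0)"
    unfolding sum.distrib using assms by simp
  finally show ?thesis .
qed

lemma skew_carrier: "Y \<in> skew_mats k \<Longrightarrow> Y \<in> sq_mats k"
  unfolding skew_mats_def by auto

lemma skew_add:
  assumes "Y \<in> skew_mats k" "Y' \<in> skew_mats k"
  shows "Y + Y' \<in> skew_mats k"
proof -
  have Y: "Y \<in> sq_mats k" "Y\<^sup>T = - Y" "Y' \<in> sq_mats k" "Y'\<^sup>T = - Y'"
    using assms unfolding skew_mats_def by auto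
  have "(Y + Y')\<^sup>T = - Y + - Y'" using Y by (simp add: mat_simps)
  also have "\<dots> = - (Y + Y')" using Y(1,3) by (intro eq_matI) auto
  finally show ?thesis using Y unfolding skew_mats_def by auto
qed

lemma skew_smult:
  assumes "Y \<in> skew_mats k"
  shows "c \<cdot>\<^sub>m Y \<in> skew_mats k"
proof -
  have Y: "Y \<in> sq_mats k" "Y\<^sup>T = - Y" using assms unfolding skew_mats_def by auto
  have "(c \<cdot>\<^sub>m Y)\<^sup>T = c \<cdot>\<^sub>m - Y" using Y by (simp add: mat_dim_simps)
  also have "\<dots> = - (c \<cdot>\<^sub>m Y)" using Y(1) by (intro eq_matI) auto
  finally show ?thesis using Y unfolding skew_mats_def by auto
qed

lemma skew_zero: "0\<^sub>m k k \<in> skew_mats k"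
  unfolding skew_mats_def by auto

lemma skew_congruence:
  assumes "G \<in> sq_mats k" "Y \<in> skew_mats k"
  shows "G * Y * G\<^sup>T \<in> skew_mats k"
proof -
  have Y: "Y \<in> sq_mats k" "Y\<^sup>T = - Y" using assms unfolding skew_mats_def by auto
  have "(G * Y * G\<^sup>T)\<^sup>T = G * Y\<^sup>T * G\<^sup>T" using assms Y(1) by (simp add: mat_simps)
  then have "(G * Y * G\<^sup>T)\<^sup>T = - (G * Y * G\<^sup>T)" unfolding Y(2) using assms Y(1) by (simp add: mat_simps)
  then show ?thesis using assms Y unfolding skew_mats_def by auto
qed

subsection \<open>Translation parts as cocycles\<close>

text \<open>The last two equations are the first and second block rows of X b' = X' b, with the
  invertible metric cancelled from the second. The component z does not enter, since it is
  multiplied by zero blocks.\<close>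

definition normal_cocycle :: "nat \<Rightarrow> nat \<Rightarrow> (nat \<Rightarrow> real mat) \<Rightarrow> (real vec \<Rightarrow> real mat \<Rightarrow> real vec) \<Rightarrow>
    (real vec \<Rightarrow> real mat \<Rightarrow> real vec) \<Rightarrow> bool" where
  "normal_cocycle k m Q \<beta> \<gamma> \<longleftrightarrow>
    (\<forall>a\<in>carrier_vec m. \<forall>Y\<in>skew_mats k. \<beta> a Y \<in> carrier_vec m \<and> \<gamma> a Y \<in> carrier_vec k \<and>
      (\<forall>c. \<beta> (c \<cdot>\<^sub>v a) (c \<cdot>\<^sub>m Y) = c \<cdot>\<^sub>v \<beta> a Y \<and> \<gamma> (c \<cdot>\<^sub>v a) (c \<cdot>\<^sub>m Y) = c \<cdot>\<^sub>v \<gamma> a Y) \<and>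
      (\<forall>a'\<in>carrier_vec m. \<forall>Y'\<in>skew_mats k.
         \<beta> (a + a') (Y + Y') = \<beta> a Y + \<beta> a' Y' \<and> \<gamma> (a + a') (Y + Y') = \<gamma> a Y + \<gamma> a' Y' \<and>
         rows_mat k Q a *\<^sub>v \<beta> a' Y' + Y *\<^sub>v \<gamma> a' Y' = rows_mat k Q a' *\<^sub>v \<beta> a Y + Y' *\<^sub>v \<gamma> a Y \<and>
         (rows_mat k Q a)\<^sup>T *\<^sub>v \<gamma> a' Y' = (rows_mat k Q a')\<^sup>T *\<^sub>v \<gamma> a Y))"

definition kravchuk_family :: "nat \<Rightarrow> real mat \<Rightarrow> (nat \<Rightarrow> real mat) \<Rightarrow> real mat set" where
  "kravchuk_family k Kt Q = {kravchuk_mat Kt (rows_mat k Q a) (0\<^sub>m (dim_row Kt) (dim_row Kt)) Y | a Y.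
     a \<in> carrier_vec (dim_row Kt) \<and> Y \<in> skew_mats k}"

text \<open>For Y = 0, entry 0 of the first block row is \<alpha> v because the first matrix is the
  identity; so v = 0. For k > 1 the elementary skew matrices then give w = 0. For k = 1 there are
  none, and the second block row does it, which requires m > 0.\<close>

lemma kravchuk_family_kernel:
  assumes Kt: "Kt \<in> sq_mats m" "invertible_mat Kt" and k: "1 \<le> k" and km: "\<not> (k = 1 \<and> m = 0)"
    and Q: "\<And>i. i < k \<Longrightarrow> Q i \<in> sq_mats m" "Q 0 = 1\<^sub>m m"
    and uvw: "u \<in> carrier_vec k" "v \<in> carrier_vec m" "w \<in> carrier_vec k"
    and ker: "\<And>X. X \<in> kravchuk_family k Kt Q \<Longrightarrow> X *\<^sub>v (u @\<^sub>v v @\<^sub>v w) = 0\<^sub>v (k + m + k)"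
  shows "v = 0\<^sub>v m" "w = 0\<^sub>v k"
proof -
  have dK: "dim_row Kt = m" using Kt by auto
  have z3: "0\<^sub>v (k + m + k) = 0\<^sub>v k @\<^sub>v 0\<^sub>v m @\<^sub>v (0\<^sub>v k :: real vec)" by (auto intro!: eq_vecI)
  have eqs: "rows_mat k Q a *\<^sub>v v + Y *\<^sub>v w = 0\<^sub>v k" "Kt *\<^sub>v ((rows_mat k Q a)\<^sup>T *\<^sub>v w) = 0\<^sub>v m"
    if a: "a \<in> carrier_vec m" and Y: "Y \<in> skew_mats k" for a Y
  proof -
    have c: "rows_mat k Q a \<in> carrier_mat k m" "Y \<in> sq_mats k" using rows_mat_carrier[OF a] skew_carrier[OF Y] by auto
    have "kravchuk_mat Kt (rows_mat k Q a) (0\<^sub>m m m) Y \<in> kravchuk_family k Kt Q"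
      unfolding kravchuk_family_def dK using a Y by auto
    from ker[OF this] have "(rows_mat k Q a *\<^sub>v v + Y *\<^sub>v w) @\<^sub>v (- (Kt *\<^sub>v ((rows_mat k Q a)\<^sup>T *\<^sub>v w))) @\<^sub>v 0\<^sub>v k
       = 0\<^sub>v k @\<^sub>v 0\<^sub>v m @\<^sub>v 0\<^sub>v k"
      unfolding z3 using kravchuk_mult_vec[OF Kt(1) c uvw] by simp
    then have *: "rows_mat k Q a *\<^sub>v v + Y *\<^sub>v w = 0\<^sub>v k \<and> - (Kt *\<^sub>v ((rows_mat k Q a)\<^sup>T *\<^sub>v w)) = 0\<^sub>v m"
      using c Kt uvw by (subst (asm) vec3_eq_iff[of _ k _ m]) (auto intro!: carrier_vecI)
    show "rows_mat k Q a *\<^sub>v v + Y *\<^sub>v w = 0\<^sub>v k" using * by simp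
    from * have "- (- (Kt *\<^sub>v ((rows_mat k Q a)\<^sup>T *\<^sub>v w))) = - 0\<^sub>v m" by simp
    then show "Kt *\<^sub>v ((rows_mat k Q a)\<^sup>T *\<^sub>v w) = 0\<^sub>v m" by (simp add: mat_dim_simps)
  qed
  show v0: "v = 0\<^sub>v m"
  proof (rule vec_zero_iff_scalar_prods[OF uvw(2)])
    fix a :: "real vec" assume a: "a \<in> carrier_vec m"
    have "rows_mat k Q a *\<^sub>v v + 0\<^sub>m k k *\<^sub>v w = 0\<^sub>v k" using eqs(1)[OF a skew_zero] .
    then have "rows_mat k Q a *\<^sub>v v = 0\<^sub>v k" using rows_mat_carrier[OF a, of k Q] uvw
      by (simp add: mat_simps)
    then have "(rows_mat k Q a *\<^sub>v v) $ 0 = 0" using k by simp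
    then show "a \<bullet> v = 0" using rows_mat_mult_vec[where i=0, OF a _ _ uvw(2)] k Q uvw by (simp add: mat_simps)
  qed
  show "w = 0\<^sub>v k"
  proof (cases "k = 1")
    case True
    then have m: "m > 0" using km by simp
    let ?a = "unit_vec m 0 :: real vec"
    have a: "?a \<in> carrier_vec m" by simp
    obtain B where B: "B \<in> sq_mats m" "B * Kt = 1\<^sub>m m" using Kt by (auto elim: invertible_matE)
    have c: "rows_mat k Q ?a \<in> carrier_mat k m" using rows_mat_carrier[OF a] .
    have "B *\<^sub>v (Kt *\<^sub>v ((rows_mat k Q ?a)\<^sup>T *\<^sub>v w)) = B *\<^sub>v 0\<^sub>v m" using eqs(2)[OF a skew_zero] by simp
    then have z: "(rows_mat k Q ?a)\<^sup>T *\<^sub>v w = 0\<^sub>v m" using B Kt c uvw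
      by (simp add: mult_vec_cancel_left_inverse[OF B(2)] mat_simps)
    have "((rows_mat k Q ?a)\<^sup>T *\<^sub>v w) $ 0 = row ((rows_mat k Q ?a)\<^sup>T) 0 \<bullet> w" using c m by simp
    also have "\<dots> = rows_mat k Q ?a $$ (0, 0) * w $ 0" using c m uvw True by (simp add: scalar_prod_def)
    also have "rows_mat k Q ?a $$ (0, 0) = row (rows_mat k Q ?a) 0 $ 0" using c m k by simp
    also have "\<dots> = 1" using rows_mat_row[OF a, of 0 k Q] k Q m by (simp add: mat_simps)
    finally have "w $ 0 = 0" using z m by simp
    then show ?thesis using uvw True by (intro eq_vecI) auto
  next
    case False
    show ?thesis
    proof (rule eq_vecI)
      fix j assume "j < dim_vec (0\<^sub>v k :: real vec)"
      then have j: "j < k" by simp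
      \<comment> \<open>Any index other than j serves: entry i of
        \<open>skew_unit k i j *\<^sub>v w\<close> is w_j.\<close>
      define i where "i = (if j = 0 then 1 else 0 :: nat)"
      have i: "i < k" "i \<noteq> j" unfolding i_def using False k by auto
      have "rows_mat k Q (0\<^sub>v m) *\<^sub>v v + skew_unit k i j *\<^sub>v w = 0\<^sub>v k"
        using eqs(1)[of "0\<^sub>v m", OF _ skew_unit_mem[OF i(2)]] by simp
      then have "skew_unit k i j *\<^sub>v w = 0\<^sub>v k" unfolding v0 using uvw rows_mat_carrier[of "0\<^sub>v m" m k Q]
        by (simp add: mat_simps skew_unit_def)
      then have "(skew_unit k i j *\<^sub>v w) $ i = 0" using i by simp
      then show "w $ j = 0\<^sub>v k $ j" using skew_unit_mult_vec[OF uvw(3) i(1) j i(2) i(1)] j by simp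
    qed (use uvw in auto)
  qed
qed

lemma nonsplit_set_pairs:
  assumes Kt: "Kt \<in> sq_mats m"
    and \<beta>\<gamma>: "\<And>\<alpha> Y. \<alpha> \<in> carrier_vec m \<Longrightarrow> Y \<in> skew_mats k \<Longrightarrow> \<beta> \<alpha> Y \<in> carrier_vec m \<and> \<gamma> \<alpha> Y \<in> carrier_vec k"
  shows "pairs (k + m + k) (nonsplit_set k Kt Q \<beta> \<gamma>) =
     {(kravchuk_mat Kt (rows_mat k Q \<alpha>) (0\<^sub>m m m) Y, z @\<^sub>v \<beta> \<alpha> Y @\<^sub>v \<gamma> \<alpha> Y) | \<alpha> Y z.
       \<alpha> \<in> carrier_vec m \<and> Y \<in> skew_mats k \<and> z \<in> carrier_vec k}"
    and "nonsplit_set k Kt Q \<beta> \<gamma> = (\<lambda>(X, a). ext_mat X a 0) ` pairs (k + m + k) (nonsplit_set k Kt Q \<beta> \<gamma>)"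
    and "o_proj (k + m + k) (nonsplit_set k Kt Q \<beta> \<gamma>) = kravchuk_family k Kt Q"
proof -
  let ?n = "k + m + k"
  let ?X = "\<lambda>\<alpha> Y. kravchuk_mat Kt (rows_mat k Q \<alpha>) (0\<^sub>m m m) Y"
  let ?t = "\<lambda>\<alpha> Y z. z @\<^sub>v \<beta> \<alpha> Y @\<^sub>v \<gamma> \<alpha> Y"
  have dK: "dim_row Kt = m" using Kt by auto
  have car: "?X \<alpha> Y \<in> sq_mats ?n" "z \<in> carrier_vec k \<Longrightarrow> ?t \<alpha> Y z \<in> carrier_vec ?n"
    if "\<alpha> \<in> carrier_vec m" "Y \<in> skew_mats k" for \<alpha> Y z
    using that \<beta>\<gamma>[OF that] kravchuk_carrier(1)[OF Kt rows_mat_carrier[OF that(1), of k Q] zero_carrier_mat skew_carrier[OF that(2)]]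
    by (auto intro: vec3_carrier)
  show 1: "pairs ?n (nonsplit_set k Kt Q \<beta> \<gamma>) = {(?X \<alpha> Y, ?t \<alpha> Y z) | \<alpha> Y z.
       \<alpha> \<in> carrier_vec m \<and> Y \<in> skew_mats k \<and> z \<in> carrier_vec k}"
  proof (intro equalityI subsetI)
    fix p assume "p \<in> pairs ?n (nonsplit_set k Kt Q \<beta> \<gamma>)"
    then obtain X a \<alpha> Y z where p: "p = (X, a)" "X \<in> sq_mats ?n" "a \<in> carrier_vec ?n"
      "\<alpha> \<in> carrier_vec m" "Y \<in> skew_mats k" "z \<in> carrier_vec k" "ext_mat X a 0 = ext_mat (?X \<alpha> Y) (?t \<alpha> Y z) 0"
      unfolding pairs_def nonsplit_set_def dK by auto
    have "X = ?X \<alpha> Y \<and> a = ?t \<alpha> Y z"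
      using ext_mat_eq_iff[OF p(2) car(1)[OF p(4,5)] p(3) car(2)[OF p(4,5,6)], of 0 0] p(7) by simp
    then show "p \<in> {(?X \<alpha> Y, ?t \<alpha> Y z) | \<alpha> Y z. \<alpha> \<in> carrier_vec m \<and> Y \<in> skew_mats k \<and> z \<in> carrier_vec k}"
      using p by blast
  next
    fix p assume "p \<in> {(?X \<alpha> Y, ?t \<alpha> Y z) | \<alpha> Y z. \<alpha> \<in> carrier_vec m \<and> Y \<in> skew_mats k \<and> z \<in> carrier_vec k}"
    then obtain \<alpha> Y z where p: "p = (?X \<alpha> Y, ?t \<alpha> Y z)" "\<alpha> \<in> carrier_vec m" "Y \<in> skew_mats k" "z \<in> carrier_vec k" by blast
    have "ext_mat (?X \<alpha> Y) (?t \<alpha> Y z) 0 \<in> nonsplit_set k Kt Q \<beta> \<gamma>" unfolding nonsplit_set_def dK using p by blast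
    then show "p \<in> pairs ?n (nonsplit_set k Kt Q \<beta> \<gamma>)" unfolding pairs_def using car p by auto
  qed
  show "nonsplit_set k Kt Q \<beta> \<gamma> = (\<lambda>(X, a). ext_mat X a 0) ` pairs ?n (nonsplit_set k Kt Q \<beta> \<gamma>)"
  proof (intro equalityI subsetI)
    fix Z assume "Z \<in> nonsplit_set k Kt Q \<beta> \<gamma>"
    then obtain \<alpha> Y z where "Z = ext_mat (?X \<alpha> Y) (?t \<alpha> Y z) 0" "\<alpha> \<in> carrier_vec m" "Y \<in> skew_mats k" "z \<in> carrier_vec k"
      unfolding nonsplit_set_def dK by blast
    moreover from this have "(?X \<alpha> Y, ?t \<alpha> Y z) \<in> pairs ?n (nonsplit_set k Kt Q \<beta> \<gamma>)" unfolding 1 by blast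
    ultimately show "Z \<in> (\<lambda>(X, a). ext_mat X a 0) ` pairs ?n (nonsplit_set k Kt Q \<beta> \<gamma>)" by force
  qed (auto simp: pairs_def)
  show "o_proj ?n (nonsplit_set k Kt Q \<beta> \<gamma>) = kravchuk_family k Kt Q"
  proof (intro equalityI subsetI)
    fix X assume "X \<in> kravchuk_family k Kt Q"
    then obtain \<alpha> Y where X: "X = ?X \<alpha> Y" "\<alpha> \<in> carrier_vec m" "Y \<in> skew_mats k" unfolding kravchuk_family_def dK by blast
    have "(?X \<alpha> Y, ?t \<alpha> Y (0\<^sub>v k)) \<in> pairs ?n (nonsplit_set k Kt Q \<beta> \<gamma>)" unfolding 1
      by (intro CollectI exI[of _ \<alpha>] exI[of _ Y] exI[of _ "0\<^sub>v k"]) (use X in auto)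
    then have "(X, ?t \<alpha> Y (0\<^sub>v k)) \<in> pairs ?n (nonsplit_set k Kt Q \<beta> \<gamma>)" unfolding X(1) .
    then show "X \<in> o_proj ?n (nonsplit_set k Kt Q \<beta> \<gamma>)" unfolding o_proj_pairs by force
  qed (auto simp: o_proj_pairs 1 kravchuk_family_def dK, blast)
qed

text \<open>Two members with the same rotation part differ by a vector in the common kernel of the
  family, which consists of the z-components alone. So \<beta> and \<gamma> are functions of
  (\<alpha>, Y), and closure of \<open>M\<close> makes them linear.\<close>

lemma cocycle_form:
  assumes Kt: "Kt \<in> sq_mats m" "invertible_mat Kt" and k: "1 \<le> k" and km: "\<not> (k = 1 \<and> m = 0)"
    and Q: "\<And>i. i < k \<Longrightarrow> Q i \<in> sq_mats m" "Q 0 = 1\<^sub>m m"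
    and M: "e_MASA (kravchuk_metric k Kt) M" and F: "o_proj (k + m + k) M = kravchuk_family k Kt Q"
  shows "\<exists>\<beta> \<gamma>. normal_cocycle k m Q \<beta> \<gamma> \<and> M = nonsplit_set k Kt Q \<beta> \<gamma>"
proof -
  let ?n = "k + m + k"
  let ?A = "rows_mat k Q"
  let ?X = "\<lambda>a Y. kravchuk_mat Kt (?A a) (0\<^sub>m m m) Y"
  have dK: "dim_row Kt = m" using Kt by auto
  have Kc: "kravchuk_metric k Kt \<in> sq_mats ?n" using kravchuk_metric3[OF Kt(1)] by simp
  note P = e_MASA_pairs[OF Kc M]
  have Ac: "?A a \<in> carrier_mat k m" if "a \<in> carrier_vec m" for a using rows_mat_carrier[OF that] .
  have mv: "?X a Y *\<^sub>v (u @\<^sub>v v @\<^sub>v w) = (?A a *\<^sub>v v + Y *\<^sub>v w) @\<^sub>v (- (Kt *\<^sub>v ((?A a)\<^sup>T *\<^sub>v w))) @\<^sub>v 0\<^sub>v k"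
    if "a \<in> carrier_vec m" "Y \<in> skew_mats k" "u \<in> carrier_vec k" "v \<in> carrier_vec m" "w \<in> carrier_vec k" for a Y u v w
    using kravchuk_mult_vec[OF Kt(1) Ac[OF that(1)] skew_carrier[OF that(2)] that(3-5)] .
  have z3: "0\<^sub>v ?n = 0\<^sub>v k @\<^sub>v 0\<^sub>v m @\<^sub>v (0\<^sub>v k :: real vec)" by (auto intro!: eq_vecI)
  have Xin: "?X a Y \<in> kravchuk_family k Kt Q" if "a \<in> carrier_vec m" "Y \<in> skew_mats k" for a Y
    unfolding kravchuk_family_def dK using that by auto
  have ex: "\<exists>a\<in>carrier_vec m. \<exists>Y\<in>skew_mats k. X = ?X a Y" if "(X, t) \<in> pairs ?n M" for X t
  proof -
    have "X \<in> o_proj ?n M" unfolding o_proj_pairs using that by force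
    then show ?thesis unfolding F kravchuk_family_def dK by auto
  qed
  \<comment> \<open>The matrices of the family annihilate the first block, so these translations
    commute with all of \<open>M\<close>; maximality makes z free.\<close>
  have zin: "(0\<^sub>m ?n ?n, z @\<^sub>v 0\<^sub>v m @\<^sub>v 0\<^sub>v k) \<in> pairs ?n M" if z: "z \<in> carrier_vec k" for z
  proof (rule P(7))
    show "0\<^sub>m ?n ?n \<in> o_alg (kravchuk_metric k Kt)" using P(2)[OF P(3)] by simp
    show "z @\<^sub>v 0\<^sub>v m @\<^sub>v 0\<^sub>v k \<in> carrier_vec ?n" using z by (intro vec3_carrier) auto
    fix X t assume Xt: "(X, t) \<in> pairs ?n M"
    obtain a Y where X: "a \<in> carrier_vec m" "Y \<in> skew_mats k" "X = ?X a Y" using ex[OF Xt] by auto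
    have "X *\<^sub>v (z @\<^sub>v 0\<^sub>v m @\<^sub>v 0\<^sub>v k) = 0\<^sub>v ?n" unfolding X(3) z3 using mv[OF X(1,2) z] Ac[OF X(1)] skew_carrier[OF X(2)] Kt
      by (simp add: mat_simps)
    moreover have "X \<in> sq_mats ?n" "t \<in> carrier_vec ?n" using P(2)[OF Xt] by auto
    ultimately show "0\<^sub>m ?n ?n * X = X * 0\<^sub>m ?n ?n \<and> 0\<^sub>m ?n ?n *\<^sub>v t = X *\<^sub>v (z @\<^sub>v 0\<^sub>v m @\<^sub>v 0\<^sub>v k)"
      by (simp add: mat_simps)
  qed
  define B where "B a Y b g \<longleftrightarrow> b \<in> carrier_vec m \<and> g \<in> carrier_vec k \<and>
     (\<exists>z\<in>carrier_vec k. (?X a Y, z @\<^sub>v b @\<^sub>v g) \<in> pairs ?n M)" for a Y b g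
  have Bex: "\<exists>b g. B a Y b g" if "a \<in> carrier_vec m" "Y \<in> skew_mats k" for a Y
  proof -
    have "?X a Y \<in> o_proj ?n M" unfolding F using Xin[OF that] .
    then obtain t where t: "(?X a Y, t) \<in> pairs ?n M" unfolding o_proj_pairs by auto
    obtain z b g where "z \<in> carrier_vec k" "b \<in> carrier_vec m" "g \<in> carrier_vec k" "t = z @\<^sub>v b @\<^sub>v g"
      using vec3_split[of t k m] P(2)[OF t] by blast
    then show ?thesis unfolding B_def using t by blast
  qed
  have Badd: "B (a + a') (Y + Y') (b + b') (g + g')"
    if h: "a \<in> carrier_vec m" "Y \<in> skew_mats k" "a' \<in> carrier_vec m" "Y' \<in> skew_mats k" "B a Y b g" "B a' Y' b' g'"
    for a Y a' Y' b g b' g'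
  proof -
    obtain z z' where z: "z \<in> carrier_vec k" "z' \<in> carrier_vec k" "(?X a Y, z @\<^sub>v b @\<^sub>v g) \<in> pairs ?n M" "(?X a' Y', z' @\<^sub>v b' @\<^sub>v g') \<in> pairs ?n M"
      and c: "b \<in> carrier_vec m" "g \<in> carrier_vec k" "b' \<in> carrier_vec m" "g' \<in> carrier_vec k"
      using h(5,6) unfolding B_def by auto
    have "?X a Y + ?X a' Y' = ?X (a + a') (Y + Y')"
      using kravchuk_add[OF Kt(1) Ac[OF h(1)] zero_carrier_mat skew_carrier[OF h(2)] Ac[OF h(3)] zero_carrier_mat skew_carrier[OF h(4)]]
        rows_mat_add[OF h(1,3) Q(1)] by simp
    moreover have "(z @\<^sub>v b @\<^sub>v g) + (z' @\<^sub>v b' @\<^sub>v g') = (z + z') @\<^sub>v (b + b') @\<^sub>v (g + g')"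
      by (rule vec3_add) (use z c in auto)
    ultimately have "(?X (a + a') (Y + Y'), (z + z') @\<^sub>v (b + b') @\<^sub>v (g + g')) \<in> pairs ?n M" using P(4)[OF z(3,4)] by simp
    then show ?thesis unfolding B_def using c z(1,2) by (meson add_carrier_vec)
  qed
  have Bsm: "B (c \<cdot>\<^sub>v a) (c \<cdot>\<^sub>m Y) (c \<cdot>\<^sub>v b) (c \<cdot>\<^sub>v g)"
    if h: "a \<in> carrier_vec m" "Y \<in> skew_mats k" "B a Y b g" for a Y b g c
  proof -
    obtain z where z: "z \<in> carrier_vec k" "(?X a Y, z @\<^sub>v b @\<^sub>v g) \<in> pairs ?n M"
      and cc: "b \<in> carrier_vec m" "g \<in> carrier_vec k" using h(3) unfolding B_def by auto
    have "c \<cdot>\<^sub>m 0\<^sub>m m m = (0\<^sub>m m m :: real mat)" by auto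
    then have "c \<cdot>\<^sub>m ?X a Y = ?X (c \<cdot>\<^sub>v a) (c \<cdot>\<^sub>m Y)"
      using kravchuk_smult[OF Kt(1) Ac[OF h(1)] zero_carrier_mat skew_carrier[OF h(2)], of c]
        rows_mat_smult[OF h(1) Q(1)] by simp
    then have "(?X (c \<cdot>\<^sub>v a) (c \<cdot>\<^sub>m Y), (c \<cdot>\<^sub>v z) @\<^sub>v (c \<cdot>\<^sub>v b) @\<^sub>v (c \<cdot>\<^sub>v g)) \<in> pairs ?n M"
      using P(5)[OF z(2), of c] by (simp add: vec3_smult)
    then show ?thesis unfolding B_def using cc z(1) by (meson smult_carrier_vec)
  qed
  have Bun: "b = b' \<and> g = g'" if a: "a \<in> carrier_vec m" and Y: "Y \<in> skew_mats k" and B: "B a Y b g" "B a Y b' g'" for a Y b g b' g'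
  proof -
    have c: "b \<in> carrier_vec m" "g \<in> carrier_vec k" "b' \<in> carrier_vec m" "g' \<in> carrier_vec k" using B unfolding B_def by auto
    have Yc: "Y \<in> sq_mats k" using skew_carrier[OF Y] .
    \<comment> \<open>The difference of the two members has rotation part 0, so commuting with
      \<open>M\<close> places its translation part in the common kernel.\<close>
    have "B (a + - 1 \<cdot>\<^sub>v a) (Y + - 1 \<cdot>\<^sub>m Y) (b + - 1 \<cdot>\<^sub>v b') (g + - 1 \<cdot>\<^sub>v g')"
      by (rule Badd[OF a Y _ _ B(1) Bsm[OF a Y B(2)]]) (use a Y in \<open>auto intro: skew_smult\<close>)
    moreover have "a + - 1 \<cdot>\<^sub>v a = 0\<^sub>v m" using a by auto
    moreover have "Y + - 1 \<cdot>\<^sub>m Y = 0\<^sub>m k k" using Yc by (auto intro!: eq_matI)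
    moreover have "?X (0\<^sub>v m) (0\<^sub>m k k) = 0\<^sub>m ?n ?n"
    proof -
      have "0 \<cdot>\<^sub>m ?X a Y = ?X (0 \<cdot>\<^sub>v a) (0 \<cdot>\<^sub>m Y)"
      proof -
        have "0 \<cdot>\<^sub>m 0\<^sub>m m m = (0\<^sub>m m m :: real mat)" by auto
        then show ?thesis using kravchuk_smult[OF Kt(1) Ac[OF a] zero_carrier_mat Yc, of 0]
          rows_mat_smult[of a m k Q 0, OF a Q(1)] by simp
      qed
      moreover have "0 \<cdot>\<^sub>v a = 0\<^sub>v m" using a by auto
      moreover have "0 \<cdot>\<^sub>m Y = 0\<^sub>m k k" using Yc by auto
      moreover have "?X a Y \<in> sq_mats ?n" using kravchuk_carrier(1)[OF Kt(1) Ac[OF a] zero_carrier_mat Yc] .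
      moreover have "0 \<cdot>\<^sub>m ?X a Y = 0\<^sub>m ?n ?n" using calculation(4) by auto
      ultimately show ?thesis by simp
    qed
    ultimately obtain z where z: "z \<in> carrier_vec k" "(0\<^sub>m ?n ?n, z @\<^sub>v (b + - 1 \<cdot>\<^sub>v b') @\<^sub>v (g + - 1 \<cdot>\<^sub>v g')) \<in> pairs ?n M"
      unfolding B_def by auto
    have ker: "X *\<^sub>v (z @\<^sub>v (b + - 1 \<cdot>\<^sub>v b') @\<^sub>v (g + - 1 \<cdot>\<^sub>v g')) = 0\<^sub>v ?n" if "X \<in> kravchuk_family k Kt Q" for X
    proof -
      have "X \<in> o_proj ?n M" using that F by simp
      then obtain t where t: "(X, t) \<in> pairs ?n M" unfolding o_proj_pairs by auto
      have "t \<in> carrier_vec ?n" using P(2)[OF t] by auto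
      then show ?thesis using P(6)[OF t z(2)] by (simp add: mat_simps)
    qed
    have "b + - 1 \<cdot>\<^sub>v b' = 0\<^sub>v m" "g + - 1 \<cdot>\<^sub>v g' = 0\<^sub>v k"
      using kravchuk_family_kernel[of Kt m k Q z "b + - 1 \<cdot>\<^sub>v b'" "g + - 1 \<cdot>\<^sub>v g'", OF Kt k km Q z(1) _ _ ker] c by auto
    then have "b $ i + - 1 * b' $ i = 0" "j < k \<Longrightarrow> g $ j + - 1 * g' $ j = 0" if "i < m" for i j
      using c that by (auto simp: vec_eq_iff)
    moreover have "g $ j + - 1 * g' $ j = 0" if "j < k" for j
      using arg_cong[OF \<open>g + - 1 \<cdot>\<^sub>v g' = 0\<^sub>v k\<close>, of "\<lambda>v. v $ j"] c that by simp
    ultimately show ?thesis using c by (auto intro!: eq_vecI)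
  qed
  obtain \<beta> \<gamma> where BG: "\<And>a Y. a \<in> carrier_vec m \<Longrightarrow> Y \<in> skew_mats k \<Longrightarrow> B a Y (\<beta> a Y) (\<gamma> a Y)"
    using Bex by metis
  have c: "\<beta> a Y \<in> carrier_vec m" "\<gamma> a Y \<in> carrier_vec k" if "a \<in> carrier_vec m" "Y \<in> skew_mats k" for a Y
    using BG[OF that] unfolding B_def by auto
  have "normal_cocycle k m Q \<beta> \<gamma>"
    unfolding normal_cocycle_def
  proof (intro ballI conjI allI)
    fix a :: "real vec" and Y assume a: "a \<in> carrier_vec m" and Y: "Y \<in> skew_mats k"
    show "\<beta> a Y \<in> carrier_vec m" "\<gamma> a Y \<in> carrier_vec k" using c a Y by auto
    show "\<beta> (r \<cdot>\<^sub>v a) (r \<cdot>\<^sub>m Y) = r \<cdot>\<^sub>v \<beta> a Y" "\<gamma> (r \<cdot>\<^sub>v a) (r \<cdot>\<^sub>m Y) = r \<cdot>\<^sub>v \<gamma> a Y" for r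
      using Bun[OF _ _ BG Bsm[OF a Y BG[OF a Y]], of r] a skew_smult[OF Y] by auto
    fix a' :: "real vec" and Y' assume a': "a' \<in> carrier_vec m" and Y': "Y' \<in> skew_mats k"
    show "\<beta> (a + a') (Y + Y') = \<beta> a Y + \<beta> a' Y'" "\<gamma> (a + a') (Y + Y') = \<gamma> a Y + \<gamma> a' Y'"
      using Bun[OF _ _ BG Badd[OF a Y a' Y' BG[OF a Y] BG[OF a' Y']]] a a' skew_add[OF Y Y'] by auto
    obtain z where z: "z \<in> carrier_vec k" "(?X a Y, z @\<^sub>v \<beta> a Y @\<^sub>v \<gamma> a Y) \<in> pairs ?n M" using BG[OF a Y] unfolding B_def by auto
    obtain z' where z': "z' \<in> carrier_vec k" "(?X a' Y', z' @\<^sub>v \<beta> a' Y' @\<^sub>v \<gamma> a' Y') \<in> pairs ?n M" using BG[OF a' Y'] unfolding B_def by auto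
    have "?X a Y *\<^sub>v (z' @\<^sub>v \<beta> a' Y' @\<^sub>v \<gamma> a' Y') = ?X a' Y' *\<^sub>v (z @\<^sub>v \<beta> a Y @\<^sub>v \<gamma> a Y)"
      using P(6)[OF z(2) z'(2)] by simp
    then have "(?A a *\<^sub>v \<beta> a' Y' + Y *\<^sub>v \<gamma> a' Y') @\<^sub>v (- (Kt *\<^sub>v ((?A a)\<^sup>T *\<^sub>v \<gamma> a' Y'))) @\<^sub>v 0\<^sub>v k =
       (?A a' *\<^sub>v \<beta> a Y + Y' *\<^sub>v \<gamma> a Y) @\<^sub>v (- (Kt *\<^sub>v ((?A a')\<^sup>T *\<^sub>v \<gamma> a Y))) @\<^sub>v 0\<^sub>v k"
      using mv[OF a Y z'(1) c[OF a' Y']] mv[OF a' Y' z(1) c[OF a Y]] by simp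
    then have e: "?A a *\<^sub>v \<beta> a' Y' + Y *\<^sub>v \<gamma> a' Y' = ?A a' *\<^sub>v \<beta> a Y + Y' *\<^sub>v \<gamma> a Y \<and>
       - (Kt *\<^sub>v ((?A a)\<^sup>T *\<^sub>v \<gamma> a' Y')) = - (Kt *\<^sub>v ((?A a')\<^sup>T *\<^sub>v \<gamma> a Y))"
      using skew_carrier[OF Y] skew_carrier[OF Y'] Kt by (subst (asm) vec3_eq_iff[of _ k _ m]) (auto intro!: carrier_vecI)
    then show "?A a *\<^sub>v \<beta> a' Y' + Y *\<^sub>v \<gamma> a' Y' = ?A a' *\<^sub>v \<beta> a Y + Y' *\<^sub>v \<gamma> a Y" by simp
    from e have "Kt *\<^sub>v ((?A a)\<^sup>T *\<^sub>v \<gamma> a' Y') = Kt *\<^sub>v ((?A a')\<^sup>T *\<^sub>v \<gamma> a Y)"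
      by (metis uminus_uminus_vec)
    moreover obtain K' where K': "K' \<in> sq_mats m" "K' * Kt = 1\<^sub>m m" using Kt by (auto elim: invertible_matE)
    ultimately have "K' *\<^sub>v (Kt *\<^sub>v ((?A a)\<^sup>T *\<^sub>v \<gamma> a' Y')) = K' *\<^sub>v (Kt *\<^sub>v ((?A a')\<^sup>T *\<^sub>v \<gamma> a Y))" by simp
    then show "(?A a)\<^sup>T *\<^sub>v \<gamma> a' Y' = (?A a')\<^sup>T *\<^sub>v \<gamma> a Y"
      using K' Kt Ac[OF a] Ac[OF a'] by (simp add: mult_vec_cancel_left_inverse[OF K'(2)] dim_of_carrier)
  qed
  moreover have "pairs ?n M = {(?X a Y, z @\<^sub>v \<beta> a Y @\<^sub>v \<gamma> a Y) | a Y z. a \<in> carrier_vec m \<and> Y \<in> skew_mats k \<and> z \<in> carrier_vec k}"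
  proof (intro equalityI subsetI)
    fix p assume p: "p \<in> pairs ?n M"
    obtain X t where Xt: "p = (X, t)" by (cases p)
    then have p': "(X, t) \<in> pairs ?n M" using p by simp
    obtain a Y where X: "a \<in> carrier_vec m" "Y \<in> skew_mats k" "X = ?X a Y" using ex[OF p'] by auto
    obtain z b g where t: "z \<in> carrier_vec k" "b \<in> carrier_vec m" "g \<in> carrier_vec k" "t = z @\<^sub>v b @\<^sub>v g"
      using vec3_split[of t k m] P(2)[OF p'] by blast
    have "B a Y b g" unfolding B_def using t X p' by auto
    then have "b = \<beta> a Y \<and> g = \<gamma> a Y" using Bun[OF X(1,2) _ BG[OF X(1,2)]] by blast
    then show "p \<in> {(?X a Y, z @\<^sub>v \<beta> a Y @\<^sub>v \<gamma> a Y) | a Y z. a \<in> carrier_vec m \<and> Y \<in> skew_mats k \<and> z \<in> carrier_vec k}"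
      using Xt X t by blast
  next
    fix p assume "p \<in> {(?X a Y, z @\<^sub>v \<beta> a Y @\<^sub>v \<gamma> a Y) | a Y z. a \<in> carrier_vec m \<and> Y \<in> skew_mats k \<and> z \<in> carrier_vec k}"
    then obtain a Y z where p: "a \<in> carrier_vec m" "Y \<in> skew_mats k" "z \<in> carrier_vec k" "p = (?X a Y, z @\<^sub>v \<beta> a Y @\<^sub>v \<gamma> a Y)" by blast
    obtain z' where z': "z' \<in> carrier_vec k" "(?X a Y, z' @\<^sub>v \<beta> a Y @\<^sub>v \<gamma> a Y) \<in> pairs ?n M" using BG[OF p(1,2)] unfolding B_def by auto
    have d: "z - z' \<in> carrier_vec k" using p z' by auto
    have "(?X a Y + 0\<^sub>m ?n ?n, (z' @\<^sub>v \<beta> a Y @\<^sub>v \<gamma> a Y) + ((z - z') @\<^sub>v 0\<^sub>v m @\<^sub>v 0\<^sub>v k)) \<in> pairs ?n M"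
      using P(4)[OF z'(2) zin[OF d]] .
    moreover have "?X a Y \<in> sq_mats ?n" using P(2)[OF z'(2)] by simp
    moreover have "(z' @\<^sub>v \<beta> a Y @\<^sub>v \<gamma> a Y) + ((z - z') @\<^sub>v 0\<^sub>v m @\<^sub>v 0\<^sub>v k) = z @\<^sub>v \<beta> a Y @\<^sub>v \<gamma> a Y"
    proof -
      have "z' + (z - z') = z" using z' p by (intro eq_vecI) auto
      then show ?thesis using c[OF p(1,2)] z'(1) d by (subst vec3_add[of _ k _ m _ _ _ k]) auto
    qed
    ultimately show "p \<in> pairs ?n M" using p(4) by simp
  qed
  then have "M = nonsplit_set k Kt Q \<beta> \<gamma>"
    using P(1) nonsplit_set_pairs(1,2)[of Kt m k \<beta> \<gamma> Q, OF Kt(1) conjI[OF c]] by simp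
  ultimately show ?thesis by blast
qed

subsection \<open>Changes of basis preserving the normal form\<close>

lemma row_mult_mat:
  assumes "A \<in> carrier_mat n m" "B \<in> carrier_mat m l" "i < n"
  shows "row (A * B) i = B\<^sup>T *\<^sub>v row (A :: real mat) i"
  using assms by (intro eq_vecI) (auto simp: comm_scalar_prod[of _ m])

definition scale_mat :: "nat \<Rightarrow> (nat \<Rightarrow> real) \<Rightarrow> real mat" where
  "scale_mat k g = mat k k (\<lambda>(i, j). if i = j then g i else 0)"

lemma scale_mat_carrier [simp]: "scale_mat k g \<in> sq_mats k"
  "dim_row (scale_mat k g) = k" "dim_col (scale_mat k g) = k"
  unfolding scale_mat_def by auto

lemma scale_mat_mult_vec:
  assumes "v \<in> carrier_vec k" "i < k"
  shows "(scale_mat k g *\<^sub>v v) $ i = g i * v $ i"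
proof -
  have "(scale_mat k g *\<^sub>v v) $ i = (\<Sum>t = 0..<k. (if t = i then g i * v $ t else 0))"
    unfolding mult_vec_index[OF scale_mat_carrier(1) assms] using assms
    by (intro sum.cong) (auto simp: scale_mat_def)
  then show ?thesis using assms by simp
qed

lemma scale_mat_mult_index:
  assumes "A \<in> carrier_mat k m" "i < k" "j < m"
  shows "(scale_mat k g * A) $$ (i, j) = g i * A $$ (i, j)"
proof -
  have "(scale_mat k g * A) $$ (i, j) = (scale_mat k g *\<^sub>v col A j) $ i" using assms by simp
  then show ?thesis using scale_mat_mult_vec[of "col A j" k i g] assms by simp
qed

lemma scale_mat_inverse:
  assumes "\<And>i. i < k \<Longrightarrow> g i \<noteq> 0"
  shows "scale_mat k g * scale_mat k (\<lambda>i. 1 / g i) = 1\<^sub>m k"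
    "scale_mat k (\<lambda>i. 1 / g i) * scale_mat k g = 1\<^sub>m k"
proof -
  show "scale_mat k g * scale_mat k (\<lambda>i. 1 / g i) = 1\<^sub>m k"
    by (rule eq_matI) (use assms in \<open>auto simp del: index_mult_mat(1) simp: scale_mat_mult_index[of _ k k], auto simp: scale_mat_def\<close>)
  show "scale_mat k (\<lambda>i. 1 / g i) * scale_mat k g = 1\<^sub>m k"
    by (rule eq_matI) (use assms in \<open>auto simp del: index_mult_mat(1) simp: scale_mat_mult_index[of _ k k], auto simp: scale_mat_def\<close>)
qed

lemma scale_mat_transpose: "(scale_mat k g)\<^sup>T = scale_mat k g"
  unfolding scale_mat_def by (intro eq_matI) auto

text \<open>Keeping the first matrix equal to the identity forces the new parameter to be g_0
  \<open>H\<^sup>T\<close> \<alpha>. The other rows are measured against this one, whence the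
  quotients g_i / g_0.\<close>

lemma rows_mat_diagonal:
  assumes a: "a \<in> carrier_vec m" and g: "g 0 \<noteq> 0"
    and GH: "G \<in> sq_mats m" "H \<in> sq_mats m" "G * H = 1\<^sub>m m" "H * G = 1\<^sub>m m"
    and Q: "\<And>i. i < k \<Longrightarrow> Q i \<in> sq_mats m"
    and Q': "\<And>i. i < k \<Longrightarrow> Q' i = (g i / g 0) \<cdot>\<^sub>m (G * Q i * H)"
  shows "rows_mat k Q' (g 0 \<cdot>\<^sub>v (H\<^sup>T *\<^sub>v a)) = scale_mat k g * rows_mat k Q a * H"
proof (rule rows_mat_eqI[of _ m])
  have Ac: "rows_mat k Q a \<in> carrier_mat k m" using rows_mat_carrier[OF a] .
  show "g 0 \<cdot>\<^sub>v (H\<^sup>T *\<^sub>v a) \<in> carrier_vec m" using GH by (intro carrier_vecI) auto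
  show "scale_mat k g * rows_mat k Q a * H \<in> carrier_mat k m" using GH Ac by auto
  fix i assume i: "i < k"
  show "Q' i \<in> sq_mats m" using Q'[OF i] Q[OF i] GH by auto
  have "row (scale_mat k g * rows_mat k Q a * H) i = H\<^sup>T *\<^sub>v row (scale_mat k g * rows_mat k Q a) i"
    using GH Ac i by (intro row_mult_mat[of _ k m _ m]) auto
  also have "row (scale_mat k g * rows_mat k Q a) i = g i \<cdot>\<^sub>v row (rows_mat k Q a) i"
    using Ac i by (intro eq_vecI) (auto simp del: index_mult_mat(1) simp: scale_mat_mult_index[OF Ac])
  also have "row (rows_mat k Q a) i = (Q i)\<^sup>T *\<^sub>v a" using rows_mat_row[of a m i k Q] a i Q[OF i] by simp
  finally have L: "row (scale_mat k g * rows_mat k Q a * H) i = H\<^sup>T *\<^sub>v (g i \<cdot>\<^sub>v ((Q i)\<^sup>T *\<^sub>v a))" .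
  have GHT: "G\<^sup>T * H\<^sup>T = 1\<^sub>m m" using transpose_inverse[OF GH(2,1,4)] .
  have "(Q' i)\<^sup>T *\<^sub>v (g 0 \<cdot>\<^sub>v (H\<^sup>T *\<^sub>v a)) = g 0 \<cdot>\<^sub>v ((g i / g 0) \<cdot>\<^sub>v (H\<^sup>T *\<^sub>v ((Q i)\<^sup>T *\<^sub>v (G\<^sup>T *\<^sub>v (H\<^sup>T *\<^sub>v a)))))"
    unfolding Q'[OF i] using GH Q[OF i] a by (simp add: mat_simps)
  also have "\<dots> = g i \<cdot>\<^sub>v (H\<^sup>T *\<^sub>v ((Q i)\<^sup>T *\<^sub>v a))"
    using g mult_vec_cancel_left_inverse[OF GHT] GH a by (simp add: smult_smult_assoc dim_of_carrier)
  also have "\<dots> = H\<^sup>T *\<^sub>v (g i \<cdot>\<^sub>v ((Q i)\<^sup>T *\<^sub>v a))" using GH Q[OF i] a by (simp add: mat_simps)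
  finally show "row (scale_mat k g * rows_mat k Q a * H) i = (Q' i)\<^sup>T *\<^sub>v (g 0 \<cdot>\<^sub>v (H\<^sup>T *\<^sub>v a))" using L by simp
qed

lemma scaled_transpose_onto:
  assumes "g \<noteq> 0" and GH: "G \<in> sq_mats m" "H \<in> sq_mats m" "G * H = 1\<^sub>m m" "H * G = 1\<^sub>m m"
  shows "(\<lambda>a. g \<cdot>\<^sub>v (H\<^sup>T *\<^sub>v a)) ` carrier_vec m = (carrier_vec m :: real vec set)"
proof (intro equalityI subsetI)
  fix a :: "real vec" assume a: "a \<in> carrier_vec m"
  have HGT: "H\<^sup>T * G\<^sup>T = 1\<^sub>m m" using transpose_inverse[OF GH(1,2,3)] .
  have "a = g \<cdot>\<^sub>v (H\<^sup>T *\<^sub>v ((1 / g) \<cdot>\<^sub>v (G\<^sup>T *\<^sub>v a)))"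
    using assms(1) a GH by (simp add: mat_simps mult_vec_cancel_left_inverse[OF HGT] smult_smult_assoc)
  moreover have "(1 / g) \<cdot>\<^sub>v (G\<^sup>T *\<^sub>v a) \<in> carrier_vec m" using GH by (intro carrier_vecI) auto
  ultimately show "a \<in> (\<lambda>a. g \<cdot>\<^sub>v (H\<^sup>T *\<^sub>v a)) ` carrier_vec m" by blast
qed (use GH in \<open>auto intro!: carrier_vecI\<close>)

text \<open>The change of basis is diag(G1, G2, H1^T) with a translation. Only the last block
  \<open>c\<close> of the translation is used: the first would act trivially, and the second would
  alter only z, which is free.\<close>

lemma nonsplit_transform:
  assumes Kt: "Kt \<in> sq_mats m"
    and GH1: "G1 \<in> sq_mats k" "H1 \<in> sq_mats k" "G1 * H1 = 1\<^sub>m k" "H1 * G1 = 1\<^sub>m k"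
    and GH2: "G2 \<in> sq_mats m" "H2 \<in> sq_mats m" "G2 * H2 = 1\<^sub>m m" "H2 * G2 = 1\<^sub>m m"
    and c: "c \<in> carrier_vec k"
    and \<phi>: "\<phi> ` carrier_vec m = carrier_vec m"
    and A: "\<And>\<alpha>. \<alpha> \<in> carrier_vec m \<Longrightarrow> rows_mat k Q' (\<phi> \<alpha>) = G1 * rows_mat k Q \<alpha> * H2"
    and car: "\<And>\<alpha> Y. \<alpha> \<in> carrier_vec m \<Longrightarrow> Y \<in> skew_mats k \<Longrightarrow> \<beta> \<alpha> Y \<in> carrier_vec m \<and> \<gamma> \<alpha> Y \<in> carrier_vec k"
    and \<beta>: "\<And>\<alpha> Y. \<alpha> \<in> carrier_vec m \<Longrightarrow> Y \<in> skew_mats k \<Longrightarrow>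
        \<beta>' (\<phi> \<alpha>) (G1 * Y * G1\<^sup>T) = G2 *\<^sub>v (\<beta> \<alpha> Y - Kt *\<^sub>v ((rows_mat k Q \<alpha>)\<^sup>T *\<^sub>v c))"
    and \<gamma>: "\<And>\<alpha> Y. \<alpha> \<in> carrier_vec m \<Longrightarrow> Y \<in> skew_mats k \<Longrightarrow> \<gamma>' (\<phi> \<alpha>) (G1 * Y * G1\<^sup>T) = H1\<^sup>T *\<^sub>v \<gamma> \<alpha> Y"
  shows "represented (kravchuk_metric k Kt) (nonsplit_set k Kt Q \<beta> \<gamma>)
     (kravchuk_metric k (G2 * Kt * G2\<^sup>T)) (nonsplit_set k (G2 * Kt * G2\<^sup>T) Q' \<beta>' \<gamma>')"
proof -
  let ?n = "k + m + k"
  let ?A = "rows_mat k Q"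
  define G where "G = mat3 k m G1 (0\<^sub>m k m) (0\<^sub>m k k) (0\<^sub>m m k) G2 (0\<^sub>m m k) (0\<^sub>m k k) (0\<^sub>m k m) (H1\<^sup>T)"
  define H where "H = mat3 k m H1 (0\<^sub>m k m) (0\<^sub>m k k) (0\<^sub>m m k) H2 (0\<^sub>m m k) (0\<^sub>m k k) (0\<^sub>m k m) (G1\<^sup>T)"
  define K' where "K' = G2 * Kt * G2\<^sup>T"
  have K': "K' \<in> sq_mats m" unfolding K'_def using Kt GH2 by auto
  have dK: "dim_row Kt = m" "dim_row K' = m" using Kt K' by auto
  have T1: "H1\<^sup>T * G1\<^sup>T = 1\<^sub>m k" "G1\<^sup>T * H1\<^sup>T = 1\<^sub>m k" using transpose_inverse[OF GH1(1,2,3)] transpose_inverse[OF GH1(2,1,4)] by auto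
  have T2: "G2\<^sup>T * H2\<^sup>T = 1\<^sub>m m" using transpose_inverse[OF GH2(2,1,4)] .
  have one3: "mat3 k m (1\<^sub>m k) (0\<^sub>m k m) (0\<^sub>m k k) (0\<^sub>m m k) (1\<^sub>m m) (0\<^sub>m m k) (0\<^sub>m k k) (0\<^sub>m k m) (1\<^sub>m k) = 1\<^sub>m ?n"
    unfolding mat3_def by (intro eq_matI) auto
  have Gc: "G \<in> sq_mats ?n" "H \<in> sq_mats ?n" unfolding G_def H_def by auto
  have GH: "G * H = 1\<^sub>m ?n" "H * G = 1\<^sub>m ?n" unfolding G_def H_def one3[symmetric] using GH1 GH2 T1
    by (simp_all add: mat3_dim_simps mat_simps)
  have metric: "G * kravchuk_metric k Kt * G\<^sup>T = kravchuk_metric k K'"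
    unfolding kravchuk_metric3[OF Kt] kravchuk_metric3[OF K'] G_def using GH1 GH2 Kt T1
    by (simp add: mat3_dim_simps mat_simps K'_def)
  \<comment> \<open>With this sign the translation part t becomes G (t + X (0, 0, c)). The middle
    component of X (0, 0, c) is - K A^T c, the correction in the assumption on \<beta>', and its
    first component Y c is absorbed by z.\<close>
  define b where "b = - (G *\<^sub>v (0\<^sub>v k @\<^sub>v 0\<^sub>v m @\<^sub>v c))"
  have cc: "0\<^sub>v k @\<^sub>v 0\<^sub>v m @\<^sub>v c \<in> carrier_vec ?n" using c by (intro vec3_carrier) auto
  have b: "b \<in> carrier_vec ?n" unfolding b_def using Gc by (intro carrier_vecI) auto
  have GX: "G * kravchuk_mat Kt B (0\<^sub>m m m) Y * H = kravchuk_mat K' (G1 * B * H2) (0\<^sub>m m m) (G1 * Y * G1\<^sup>T)"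
    if B: "B \<in> carrier_mat k m" and Y: "Y \<in> sq_mats k" for B Y
  proof -
    have Bc: "G1 * B * H2 \<in> carrier_mat k m" "G1 * Y * G1\<^sup>T \<in> sq_mats k" using B Y GH1 GH2 by auto
    show ?thesis unfolding kravchuk_mat3[OF Kt B zero_carrier_mat Y] kravchuk_mat3[OF K' Bc(1) zero_carrier_mat Bc(2)] G_def H_def
      using B Y GH1 GH2 Kt
      by (simp add: mat3_dim_simps mat_simps K'_def mult_cancel_left_inverse[OF T2])
  qed
  have Gt: "G *\<^sub>v (u @\<^sub>v v @\<^sub>v w) = (G1 *\<^sub>v u) @\<^sub>v (G2 *\<^sub>v v) @\<^sub>v (H1\<^sup>T *\<^sub>v w)"
    if "u \<in> carrier_vec k" "v \<in> carrier_vec m" "w \<in> carrier_vec k" for u v w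
    unfolding G_def using that GH1 GH2 by (simp add: mat3_dim_simps mat_simps)
  define f where "f = (\<lambda>(X, t). (G * X * H, G *\<^sub>v t - G * X * H *\<^sub>v b))"
  let ?X = "\<lambda>\<alpha> Y. kravchuk_mat Kt (?A \<alpha>) (0\<^sub>m m m) Y"
  let ?X' = "\<lambda>\<alpha> Y. kravchuk_mat K' (rows_mat k Q' \<alpha>) (0\<^sub>m m m) Y"
  have fX: "f (?X \<alpha> Y, z @\<^sub>v \<beta> \<alpha> Y @\<^sub>v \<gamma> \<alpha> Y) =
      (?X' (\<phi> \<alpha>) (G1 * Y * G1\<^sup>T), (G1 *\<^sub>v (z + Y *\<^sub>v c)) @\<^sub>v \<beta>' (\<phi> \<alpha>) (G1 * Y * G1\<^sup>T) @\<^sub>v \<gamma>' (\<phi> \<alpha>) (G1 * Y * G1\<^sup>T))"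
    if \<alpha>: "\<alpha> \<in> carrier_vec m" and Y: "Y \<in> skew_mats k" and z: "z \<in> carrier_vec k" for \<alpha> Y z
  proof -
    have Yc: "Y \<in> sq_mats k" using skew_carrier[OF Y] .
    have Ac: "?A \<alpha> \<in> carrier_mat k m" using rows_mat_carrier[OF \<alpha>] .
    have bg: "\<beta> \<alpha> Y \<in> carrier_vec m" "\<gamma> \<alpha> Y \<in> carrier_vec k" using car[OF \<alpha> Y] by auto
    have Xc: "?X \<alpha> Y \<in> sq_mats ?n" using kravchuk_carrier(1)[OF Kt Ac zero_carrier_mat Yc] .
    have tc: "z @\<^sub>v \<beta> \<alpha> Y @\<^sub>v \<gamma> \<alpha> Y \<in> carrier_vec ?n" using z bg by (intro vec3_carrier) auto
    have "G * ?X \<alpha> Y * H *\<^sub>v b = - (G *\<^sub>v (?X \<alpha> Y *\<^sub>v (0\<^sub>v k @\<^sub>v 0\<^sub>v m @\<^sub>v c)))"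
      unfolding b_def using Gc Xc cc c by (simp add: mat_simps mult_vec_cancel_left_inverse[OF GH(2)])
    then have "G *\<^sub>v (z @\<^sub>v \<beta> \<alpha> Y @\<^sub>v \<gamma> \<alpha> Y) - G * ?X \<alpha> Y * H *\<^sub>v b =
       G *\<^sub>v ((z @\<^sub>v \<beta> \<alpha> Y @\<^sub>v \<gamma> \<alpha> Y) + ?X \<alpha> Y *\<^sub>v (0\<^sub>v k @\<^sub>v 0\<^sub>v m @\<^sub>v c))"
    proof -
      define s where "s = ?X \<alpha> Y *\<^sub>v (0\<^sub>v k @\<^sub>v 0\<^sub>v m @\<^sub>v c)"
      define t where "t = z @\<^sub>v \<beta> \<alpha> Y @\<^sub>v \<gamma> \<alpha> Y"
      have s: "s \<in> carrier_vec ?n" unfolding s_def using Xc by (intro carrier_vecI) auto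
      have "G *\<^sub>v t - - (G *\<^sub>v s) = G *\<^sub>v t + G *\<^sub>v s" using Gc by (intro eq_vecI) auto
      also have "\<dots> = G *\<^sub>v (t + s)" using mult_add_distrib_mat_vec[OF Gc(1) tc[folded t_def] s] by simp
      finally have "G *\<^sub>v t - - (G *\<^sub>v s) = G *\<^sub>v (t + s)" .
      moreover assume "G * ?X \<alpha> Y * H *\<^sub>v b = - (G *\<^sub>v (?X \<alpha> Y *\<^sub>v (0\<^sub>v k @\<^sub>v 0\<^sub>v m @\<^sub>v c)))"
      ultimately show ?thesis unfolding s_def t_def by simp
    qed
    also have "?X \<alpha> Y *\<^sub>v (0\<^sub>v k @\<^sub>v 0\<^sub>v m @\<^sub>v c) = (Y *\<^sub>v c) @\<^sub>v (- (Kt *\<^sub>v ((?A \<alpha>)\<^sup>T *\<^sub>v c))) @\<^sub>v 0\<^sub>v k"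
      using kravchuk_mult_vec[OF Kt Ac Yc, of "0\<^sub>v k" "0\<^sub>v m" c] Ac Yc c by (simp add: mat_simps)
    also have "(z @\<^sub>v \<beta> \<alpha> Y @\<^sub>v \<gamma> \<alpha> Y) + ((Y *\<^sub>v c) @\<^sub>v (- (Kt *\<^sub>v ((?A \<alpha>)\<^sup>T *\<^sub>v c))) @\<^sub>v 0\<^sub>v k) =
       (z + Y *\<^sub>v c) @\<^sub>v (\<beta> \<alpha> Y - Kt *\<^sub>v ((?A \<alpha>)\<^sup>T *\<^sub>v c)) @\<^sub>v \<gamma> \<alpha> Y"
    proof -
      have e: "\<beta> \<alpha> Y + - (Kt *\<^sub>v ((?A \<alpha>)\<^sup>T *\<^sub>v c)) = \<beta> \<alpha> Y - Kt *\<^sub>v ((?A \<alpha>)\<^sup>T *\<^sub>v c)" "\<gamma> \<alpha> Y + 0\<^sub>v k = \<gamma> \<alpha> Y"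
        using bg Kt by auto
      show ?thesis using z bg Yc Kt c e by (subst vec3_add[of _ k _ m _ _ _ k]) (auto intro!: carrier_vecI)
    qed
    also have "G *\<^sub>v \<dots> = (G1 *\<^sub>v (z + Y *\<^sub>v c)) @\<^sub>v (G2 *\<^sub>v (\<beta> \<alpha> Y - Kt *\<^sub>v ((?A \<alpha>)\<^sup>T *\<^sub>v c))) @\<^sub>v (H1\<^sup>T *\<^sub>v \<gamma> \<alpha> Y)"
      by (rule Gt) (use z bg Yc Kt in \<open>auto intro!: carrier_vecI\<close>)
    finally show ?thesis unfolding f_def using GX[OF Ac Yc] A[OF \<alpha>] \<beta>[OF \<alpha> Y] \<gamma>[OF \<alpha> Y] by simp
  qed
  have bck: "G1 * (H1 * Y' * H1\<^sup>T) * G1\<^sup>T = Y'" if "Y' \<in> skew_mats k" for Y'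
    using congruence_back[OF skew_carrier[OF that] GH1(2,1,3)] .
  have car': "\<beta>' \<alpha>' Y' \<in> carrier_vec m \<and> \<gamma>' \<alpha>' Y' \<in> carrier_vec k" if \<alpha>': "\<alpha>' \<in> carrier_vec m" and Y': "Y' \<in> skew_mats k" for \<alpha>' Y'
  proof -
    obtain \<alpha> where \<alpha>: "\<alpha> \<in> carrier_vec m" "\<alpha>' = \<phi> \<alpha>" using \<phi> \<alpha>' by blast
    have Y: "H1 * Y' * H1\<^sup>T \<in> skew_mats k" using skew_congruence[OF GH1(2) Y'] .
    show ?thesis using \<beta>[OF \<alpha>(1) Y] \<gamma>[OF \<alpha>(1) Y] unfolding bck[OF Y'] \<alpha>(2) using GH2 GH1 by (auto intro!: carrier_vecI)
  qed
  have N1: "pairs ?n (nonsplit_set k Kt Q \<beta> \<gamma>) = {(?X \<alpha> Y, z @\<^sub>v \<beta> \<alpha> Y @\<^sub>v \<gamma> \<alpha> Y) | \<alpha> Y z.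
       \<alpha> \<in> carrier_vec m \<and> Y \<in> skew_mats k \<and> z \<in> carrier_vec k}"
    by (rule nonsplit_set_pairs(1)[OF Kt]) (rule car)
  have N2: "nonsplit_set k Kt Q \<beta> \<gamma> = (\<lambda>(X, a). ext_mat X a 0) ` pairs ?n (nonsplit_set k Kt Q \<beta> \<gamma>)"
    by (rule nonsplit_set_pairs(2)[OF Kt]) (rule car)
  have N1': "pairs ?n (nonsplit_set k K' Q' \<beta>' \<gamma>') = {(?X' \<alpha> Y, z @\<^sub>v \<beta>' \<alpha> Y @\<^sub>v \<gamma>' \<alpha> Y) | \<alpha> Y z.
       \<alpha> \<in> carrier_vec m \<and> Y \<in> skew_mats k \<and> z \<in> carrier_vec k}"
    by (rule nonsplit_set_pairs(1)[OF K']) (rule car')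
  have N2': "nonsplit_set k K' Q' \<beta>' \<gamma>' = (\<lambda>(X, a). ext_mat X a 0) ` pairs ?n (nonsplit_set k K' Q' \<beta>' \<gamma>')"
    by (rule nonsplit_set_pairs(2)[OF K']) (rule car')
  have ec: "conj_set (ext_mat G b 1) M = (\<lambda>(X, t). ext_mat X t 0) ` f ` pairs ?n M"
    if ME: "M = (\<lambda>(X, t). ext_mat X t 0) ` pairs ?n M" for M
    unfolding conj_set_def
    by (subst ME, unfold image_image, rule image_cong) (auto simp: pairs_def f_def ext_mat_conj[OF Gc GH b])
  have "f ` pairs ?n (nonsplit_set k Kt Q \<beta> \<gamma>) = pairs ?n (nonsplit_set k K' Q' \<beta>' \<gamma>')"
  proof (intro equalityI subsetI)
    fix p assume "p \<in> f ` pairs ?n (nonsplit_set k Kt Q \<beta> \<gamma>)"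
    then obtain \<alpha> Y z where p: "\<alpha> \<in> carrier_vec m" "Y \<in> skew_mats k" "z \<in> carrier_vec k" "p = f (?X \<alpha> Y, z @\<^sub>v \<beta> \<alpha> Y @\<^sub>v \<gamma> \<alpha> Y)"
      unfolding N1 by blast
    have "\<phi> \<alpha> \<in> carrier_vec m" using \<phi> p by blast
    moreover have "G1 *\<^sub>v (z + Y *\<^sub>v c) \<in> carrier_vec k" using GH1 by (intro carrier_vecI) auto
    ultimately show "p \<in> pairs ?n (nonsplit_set k K' Q' \<beta>' \<gamma>')"
      unfolding N1' p(4) fX[OF p(1-3)] using skew_congruence[OF GH1(1) p(2)] by blast
  next
    fix p assume "p \<in> pairs ?n (nonsplit_set k K' Q' \<beta>' \<gamma>')"
    then obtain \<alpha>' Y' z' where p: "\<alpha>' \<in> carrier_vec m" "Y' \<in> skew_mats k" "z' \<in> carrier_vec k" "p = (?X' \<alpha>' Y', z' @\<^sub>v \<beta>' \<alpha>' Y' @\<^sub>v \<gamma>' \<alpha>' Y')"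
      unfolding N1' by blast
    obtain \<alpha> where \<alpha>: "\<alpha> \<in> carrier_vec m" "\<alpha>' = \<phi> \<alpha>" using \<phi> p by blast
    define Y where "Y = H1 * Y' * H1\<^sup>T"
    have Y: "Y \<in> skew_mats k" unfolding Y_def using skew_congruence[OF GH1(2) p(2)] .
    have YY: "G1 * Y * G1\<^sup>T = Y'" unfolding Y_def using bck[OF p(2)] .
    define z where "z = H1 *\<^sub>v z' - Y *\<^sub>v c"
    have z: "z \<in> carrier_vec k" unfolding z_def using skew_carrier[OF Y] by (intro carrier_vecI) auto
    have "z + Y *\<^sub>v c = H1 *\<^sub>v z'" unfolding z_def using GH1 skew_carrier[OF Y] by (intro eq_vecI) auto
    then have "G1 *\<^sub>v (z + Y *\<^sub>v c) = z'" using mult_vec_cancel_left_inverse[OF GH1(3)] GH1 p(3) by simp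
    then have "f (?X \<alpha> Y, z @\<^sub>v \<beta> \<alpha> Y @\<^sub>v \<gamma> \<alpha> Y) = p" unfolding fX[OF \<alpha>(1) Y z] YY p(4) \<alpha>(2) by simp
    moreover have "(?X \<alpha> Y, z @\<^sub>v \<beta> \<alpha> Y @\<^sub>v \<gamma> \<alpha> Y) \<in> pairs ?n (nonsplit_set k Kt Q \<beta> \<gamma>)"
      unfolding N1 using \<alpha>(1) Y z by blast
    ultimately show "p \<in> f ` pairs ?n (nonsplit_set k Kt Q \<beta> \<gamma>)" by blast
  qed
  then have "conj_set (ext_mat G b 1) (nonsplit_set k Kt Q \<beta> \<gamma>) = nonsplit_set k K' Q' \<beta>' \<gamma>'"
    using ec[OF N2] N2' by simp
  moreover have "invertible_mat G" using Gc GH by (intro invertible_matI[of G ?n H]) auto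
  moreover have "dim_row (kravchuk_metric k Kt) = ?n" using kravchuk_metric3[OF Kt] by simp
  ultimately show ?thesis unfolding represented_def K'_def[symmetric] using metric Gc b by (metis)
qed

section \<open>Linear combinations of the Q_i and conjugacy of the sets given by \<Lambda>\<close>

lemma lin_comb_mat_carrier [simp]: "lin_comb_mat m k c Q \<in> sq_mats m"
  "dim_row (lin_comb_mat m k c Q) = m" "dim_col (lin_comb_mat m k c Q) = m"
  unfolding lin_comb_mat_def by auto

text \<open>\<open>A\<^sup>T\<close> w combines the rows \<alpha> Q_i with coefficients w_i. By this
  identity a translation with entries \<theta>_k changes \<Lambda> by the combination of the
  matrices Q_k K with these coefficients.\<close>

lemma rows_mat_transpose_mult:
  assumes a: "a \<in> carrier_vec m" and Q: "\<And>i. i < k \<Longrightarrow> Q i \<in> sq_mats m" and w: "w \<in> carrier_vec k"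
  shows "(rows_mat k Q a)\<^sup>T *\<^sub>v w = (lin_comb_mat m k (vec_index w) Q)\<^sup>T *\<^sub>v a"
proof (rule eq_vecI)
  have Ac: "rows_mat k Q a \<in> carrier_mat k m" using rows_mat_carrier[OF a] .
  fix j assume "j < dim_vec ((lin_comb_mat m k (vec_index w) Q)\<^sup>T *\<^sub>v a)"
  then have j: "j < m" by simp
  have e: "rows_mat k Q a $$ (i, j) = (\<Sum>r = 0..<m. Q i $$ (r, j) * a $ r)" if i: "i < k" for i
  proof -
    have "rows_mat k Q a $$ (i, j) = row (rows_mat k Q a) i $ j" using Ac i j by simp
    also have "\<dots> = ((Q i)\<^sup>T *\<^sub>v a) $ j" using rows_mat_row[of a m i k Q] a i Q[OF i] by simp
    also have "\<dots> = (\<Sum>r = 0..<m. Q i $$ (r, j) * a $ r)" using Q[OF i] a j by (simp add: scalar_prod_def)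
    finally show ?thesis .
  qed
  have "((rows_mat k Q a)\<^sup>T *\<^sub>v w) $ j = (\<Sum>i = 0..<k. rows_mat k Q a $$ (i, j) * w $ i)"
    using Ac w j by (simp add: scalar_prod_def)
  also have "\<dots> = (\<Sum>i = 0..<k. \<Sum>r = 0..<m. w $ i * Q i $$ (r, j) * a $ r)"
    by (intro sum.cong) (auto simp: e sum_distrib_right sum_distrib_left ac_simps)
  also have "\<dots> = (\<Sum>r = 0..<m. (\<Sum>i<k. w $ i * Q i $$ (r, j)) * a $ r)"
    by (subst sum.swap) (simp add: sum_distrib_right lessThan_atLeast0)
  also have "\<dots> = ((lin_comb_mat m k (vec_index w) Q)\<^sup>T *\<^sub>v a) $ j"
    using j a by (simp add: scalar_prod_def lin_comb_mat_def)
  finally show "((rows_mat k Q a)\<^sup>T *\<^sub>v w) $ j = ((lin_comb_mat m k (vec_index w) Q)\<^sup>T *\<^sub>v a) $ j" .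
qed (use rows_mat_carrier[OF a, of k Q] in auto)

lemma lin_comb_mat_mult:
  assumes Q: "\<And>i. i < k \<Longrightarrow> Q i \<in> sq_mats m" and B: "B \<in> sq_mats m"
  shows "lin_comb_mat m k c (\<lambda>i. Q i * B) = lin_comb_mat m k c Q * B"
proof (rule eq_matI)
  fix r s assume "r < dim_row (lin_comb_mat m k c Q * B)" "s < dim_col (lin_comb_mat m k c Q * B)"
  then have rs: "r < m" "s < m" using B by auto
  have "lin_comb_mat m k c (\<lambda>i. Q i * B) $$ (r, s) = (\<Sum>i<k. c i * (\<Sum>t = 0..<m. Q i $$ (r, t) * B $$ (t, s)))"
  proof -
    have "(Q i * B) $$ (r, s) = (\<Sum>t = 0..<m. Q i $$ (r, t) * B $$ (t, s))" if "i < k" for i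
      using Q[OF that] B rs by (simp add: scalar_prod_def)
    then show ?thesis unfolding lin_comb_mat_def using rs by simp
  qed
  also have "\<dots> = (\<Sum>i<k. \<Sum>t = 0..<m. c i * Q i $$ (r, t) * B $$ (t, s))" by (simp add: sum_distrib_left ac_simps)
  also have "\<dots> = (\<Sum>t = 0..<m. (\<Sum>i<k. c i * Q i $$ (r, t)) * B $$ (t, s))"
    by (subst sum.swap) (simp add: sum_distrib_right)
  also have "\<dots> = (lin_comb_mat m k c Q * B) $$ (r, s)" using rs B by (simp add: lin_comb_mat_def scalar_prod_def)
  finally show "lin_comb_mat m k c (\<lambda>i. Q i * B) $$ (r, s) = (lin_comb_mat m k c Q * B) $$ (r, s)" .
qed (use B in auto)

lemma free_rowed_matricesD:
  assumes "free_rowed_matrices k Kt Q" "Kt \<in> sq_mats m"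
  shows "i < k \<Longrightarrow> Q i \<in> sq_mats m" "i < k \<Longrightarrow> Q i * Kt = Kt * (Q i)\<^sup>T" "Q 0 = 1\<^sub>m m"
    "1 \<le> i \<Longrightarrow> i < k \<Longrightarrow> (\<Sum>r<m. Q i $$ (r, r)) = 0"
    "k = 2 \<Longrightarrow> m \<ge> 2 \<Longrightarrow> Q 1 \<noteq> 0\<^sub>m m m"
  using assms unfolding free_rowed_matrices_def Let_def by auto

text \<open>An instance of \<open>nonsplit_transform\<close> with G1 = diag(g), with
  \<open>G\<^sub>2\<close> on the middle block and with c = \<theta>. The condition on the Q_j says
  that the rescaled rows are described by the same matrices, and \<open>G\<^sub>2\<close> preserves
  \<open>Kt\<close>, so the change of basis lies in the group of the given metric.\<close>

lemma Lambda_conjugation: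
  assumes Kt: "Kt \<in> sq_mats m" "Kt\<^sup>T = Kt" and k: "1 \<le> k"
    and Q: "free_rowed_matrices k Kt Q"
    and L: "\<Lambda> \<in> sq_mats m"
    and g: "\<And>j. j < k \<Longrightarrow> g j \<noteq> 0" and G: "G\<^sub>2 \<in> O_grp Kt" "invertible_mat Kt"
    and QG: "\<And>j. j < k \<Longrightarrow> Q j = (g j / g 0) \<cdot>\<^sub>m (G\<^sub>2 * Q j * mat_inv G\<^sub>2)"
    and L': "\<Lambda>' = (1 / g 0) \<cdot>\<^sub>m (G\<^sub>2 * (\<Lambda> - lin_comb_mat m k \<theta> (\<lambda>k. Q k * Kt)) * G\<^sub>2\<^sup>T)"
  shows "E_conjugate (kravchuk_metric k Kt) (Lambda_set k Kt Q \<Lambda>) (Lambda_set k Kt Q \<Lambda>')"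
proof -
  note QD = free_rowed_matricesD[OF Q Kt(1)]
  have G2: "G\<^sub>2 \<in> sq_mats m" "G\<^sub>2 * Kt * G\<^sub>2\<^sup>T = Kt" using G Kt unfolding O_grp_def by auto
  have "det G\<^sub>2 \<noteq> 0"
  proof
    assume z: "det G\<^sub>2 = 0"
    have "det Kt = det (G\<^sub>2 * (Kt * G\<^sub>2\<^sup>T))" using G2 Kt by (metis assoc_mult_mat transpose_carrier_mat)
    also have "\<dots> = 0" using z G2 Kt by (subst det_mult[of _ m]) auto
    finally show False using G(2) invertible_det_iff[OF Kt(1)] by simp
  qed
  then have "invertible_mat G\<^sub>2" using invertible_det_iff[OF G2(1)] by simp
  then obtain H2 where H2: "H2 \<in> sq_mats m" "G\<^sub>2 * H2 = 1\<^sub>m m" "H2 * G\<^sub>2 = 1\<^sub>m m" "mat_inv G\<^sub>2 = H2"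
    using invertible_matE[OF _ G2(1)] by metis
  have g0: "g 0 \<noteq> 0" using g k by auto
  define C where "C = lin_comb_mat m k \<theta> Q"
  have C: "C \<in> sq_mats m" unfolding C_def by simp
  have CK: "lin_comb_mat m k \<theta> (\<lambda>k. Q k * Kt) = C * Kt" unfolding C_def by (rule lin_comb_mat_mult[OF QD(1) Kt(1)])
  let ?\<phi> = "\<lambda>\<alpha>. g 0 \<cdot>\<^sub>v (H2\<^sup>T *\<^sub>v \<alpha>)"
  have "represented (kravchuk_metric k Kt) (nonsplit_set k Kt Q (\<lambda>\<alpha> Y. row_mult \<alpha> \<Lambda>) (\<lambda>\<alpha> Y. 0\<^sub>v k))
     (kravchuk_metric k (G\<^sub>2 * Kt * G\<^sub>2\<^sup>T)) (nonsplit_set k (G\<^sub>2 * Kt * G\<^sub>2\<^sup>T) Q (\<lambda>\<alpha> Y. row_mult \<alpha> \<Lambda>') (\<lambda>\<alpha> Y. 0\<^sub>v k))"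
  proof (rule nonsplit_transform[where ?G1.0 = "scale_mat k g" and ?H1.0 = "scale_mat k (\<lambda>i. 1 / g i)"
        and ?G2.0 = G\<^sub>2 and ?H2.0 = H2 and c = "vec k \<theta>" and \<phi> = ?\<phi>])
    show "scale_mat k g * scale_mat k (\<lambda>i. 1 / g i) = 1\<^sub>m k" "scale_mat k (\<lambda>i. 1 / g i) * scale_mat k g = 1\<^sub>m k"
      using scale_mat_inverse[OF g] by auto
    show "?\<phi> ` carrier_vec m = carrier_vec m" by (rule scaled_transpose_onto[OF g0 G2(1) H2(1-3)])
    fix \<alpha> :: "real vec" assume \<alpha>: "\<alpha> \<in> carrier_vec m"
    show "rows_mat k Q (?\<phi> \<alpha>) = scale_mat k g * rows_mat k Q \<alpha> * H2"
      by (rule rows_mat_diagonal[where g = g, OF \<alpha> g0 G2(1) H2(1-3)]) (use QG H2(4) QD(1) in auto)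
    fix Y assume "Y \<in> skew_mats k"
    show "row_mult \<alpha> \<Lambda> \<in> carrier_vec m \<and> 0\<^sub>v k \<in> carrier_vec k" unfolding row_mult_def using L by (auto intro!: carrier_vecI)
    show "0\<^sub>v k = (scale_mat k (\<lambda>i. 1 / g i))\<^sup>T *\<^sub>v (0\<^sub>v k :: real vec)" by (simp add: mat_dim_simps)
    have "(rows_mat k Q \<alpha>)\<^sup>T *\<^sub>v vec k \<theta> = C\<^sup>T *\<^sub>v \<alpha>"
    proof -
      have "lin_comb_mat m k (vec_index (vec k \<theta>)) Q = C" unfolding C_def lin_comb_mat_def by (intro eq_matI) auto
      then show ?thesis using rows_mat_transpose_mult[of \<alpha> m k Q "vec k \<theta>"] \<alpha> QD(1) by simp
    qed
    moreover have "(\<Lambda> - C * Kt)\<^sup>T *\<^sub>v \<alpha> = \<Lambda>\<^sup>T *\<^sub>v \<alpha> - Kt *\<^sub>v (C\<^sup>T *\<^sub>v \<alpha>)"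
    proof -
      have "(\<Lambda> - C * Kt)\<^sup>T = \<Lambda>\<^sup>T - (C * Kt)\<^sup>T" using L C Kt(1) by (intro eq_matI) auto
      also have "(C * Kt)\<^sup>T = Kt * C\<^sup>T" using C Kt by (simp add: mat_simps)
      finally have "(\<Lambda> - C * Kt)\<^sup>T *\<^sub>v \<alpha> = (\<Lambda>\<^sup>T - Kt * C\<^sup>T) *\<^sub>v \<alpha>" by simp
      also have "\<dots> = \<Lambda>\<^sup>T *\<^sub>v \<alpha> - (Kt * C\<^sup>T) *\<^sub>v \<alpha>" by (rule minus_mult_distrib_mat_vec[of _ m m]) (use L C Kt \<alpha> in auto)
      also have "(Kt * C\<^sup>T) *\<^sub>v \<alpha> = Kt *\<^sub>v (C\<^sup>T *\<^sub>v \<alpha>)" using C Kt(1) \<alpha> by (simp add: mat_simps)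
      finally show ?thesis .
    qed
    moreover have "row_mult (?\<phi> \<alpha>) \<Lambda>' = G\<^sub>2 *\<^sub>v ((\<Lambda> - C * Kt)\<^sup>T *\<^sub>v \<alpha>)"
    proof -
      define D where "D = \<Lambda> - C * Kt"
      have D: "D \<in> sq_mats m" unfolding D_def using L C Kt by auto
      have GHT: "G\<^sub>2\<^sup>T * H2\<^sup>T = 1\<^sub>m m" using transpose_inverse[OF H2(1) G2(1) H2(3)] .
      have "row_mult (?\<phi> \<alpha>) \<Lambda>' = g 0 \<cdot>\<^sub>v ((1 / g 0) \<cdot>\<^sub>v (G\<^sub>2 *\<^sub>v (D\<^sup>T *\<^sub>v (G\<^sub>2\<^sup>T *\<^sub>v (H2\<^sup>T *\<^sub>v \<alpha>)))))"
        unfolding row_mult_def L' CK D_def[symmetric] using D G2(1) H2(1) \<alpha> by (simp add: mat_simps)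
      also have "\<dots> = G\<^sub>2 *\<^sub>v (D\<^sup>T *\<^sub>v \<alpha>)" using g0 mult_vec_cancel_left_inverse[OF GHT] G2(1) H2(1) \<alpha>
        by (simp add: smult_smult_assoc dim_of_carrier)
      finally show ?thesis unfolding D_def .
    qed
    ultimately show "row_mult (?\<phi> \<alpha>) \<Lambda>' = G\<^sub>2 *\<^sub>v (row_mult \<alpha> \<Lambda> - Kt *\<^sub>v ((rows_mat k Q \<alpha>)\<^sup>T *\<^sub>v vec k \<theta>))"
      by (simp add: row_mult_def)
  qed (use Kt G2 H2 in auto)
  then have "represented (kravchuk_metric k Kt) (Lambda_set k Kt Q \<Lambda>) (kravchuk_metric k Kt) (Lambda_set k Kt Q \<Lambda>')"
    unfolding Lambda_set_def G2(2) .
  then obtain G a where Ga: "G \<in> carrier_mat (dim_row (kravchuk_metric k Kt)) (dim_row (kravchuk_metric k Kt))"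
    "a \<in> carrier_vec (dim_row (kravchuk_metric k Kt))" "kravchuk_metric k Kt = G * kravchuk_metric k Kt * G\<^sup>T"
    "Lambda_set k Kt Q \<Lambda>' = conj_set (ext_mat G a 1) (Lambda_set k Kt Q \<Lambda>)"
    unfolding represented_def by auto
  then show ?thesis unfolding E_conjugate_def E_grp_def O_grp_def by force
qed

subsection \<open>Solving the cocycle equations\<close>

text \<open>Induction over the truncations of \<alpha>, each of which adds one multiple of a unit
  vector.\<close>

lemma linear_map_matrix:
  fixes f :: "real vec \<Rightarrow> real vec"
  assumes c: "\<And>\<alpha>. \<alpha> \<in> carrier_vec m \<Longrightarrow> f \<alpha> \<in> carrier_vec l"
    and add: "\<And>\<alpha> \<alpha>'. \<alpha> \<in> carrier_vec m \<Longrightarrow> \<alpha>' \<in> carrier_vec m \<Longrightarrow> f (\<alpha> + \<alpha>') = f \<alpha> + f \<alpha>'"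
    and sm: "\<And>\<alpha> r. \<alpha> \<in> carrier_vec m \<Longrightarrow> f (r \<cdot>\<^sub>v \<alpha>) = r \<cdot>\<^sub>v f \<alpha>"
  shows "\<exists>L\<in>carrier_mat l m. \<forall>\<alpha>\<in>carrier_vec m. f \<alpha> = L *\<^sub>v \<alpha>"
proof -
  define L where "L = mat l m (\<lambda>(i, j). f (unit_vec m j) $ i)"
  have "f \<alpha> = L *\<^sub>v \<alpha>" if \<alpha>: "\<alpha> \<in> carrier_vec m" for \<alpha>
  proof -
    define a where "a t = vec m (\<lambda>i. if i < t then \<alpha> $ i else 0)" for t
    have ac: "a t \<in> carrier_vec m" for t unfolding a_def by simp
    have "t \<le> m \<Longrightarrow> i < l \<Longrightarrow> f (a t) $ i = (\<Sum>j = 0..<t. L $$ (i, j) * \<alpha> $ j)" for t i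
    proof (induction t)
      case 0
      have "a 0 = 0 \<cdot>\<^sub>v \<alpha>" unfolding a_def using \<alpha> by (intro eq_vecI) auto
      then have "f (a 0) = 0 \<cdot>\<^sub>v f \<alpha>" using sm[OF \<alpha>] by simp
      then show ?case using c[OF \<alpha>] 0 by simp
    next
      case (Suc t)
      have "a (Suc t) = a t + \<alpha> $ t \<cdot>\<^sub>v unit_vec m t" unfolding a_def using Suc.prems
        by (intro eq_vecI) (auto simp: less_Suc_eq)
      then have "f (a (Suc t)) = f (a t) + \<alpha> $ t \<cdot>\<^sub>v f (unit_vec m t)" using add[OF ac] sm by simp
      then show ?case using Suc c[OF ac] c[of "unit_vec m t"] by (simp add: L_def)
    qed
    from this[of m] have e: "i < l \<Longrightarrow> f (a m) $ i = (L *\<^sub>v \<alpha>) $ i" for i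
      using mult_vec_index[of L l m \<alpha> i] \<alpha> by (simp add: L_def)
    have "a m = \<alpha>" unfolding a_def using \<alpha> by (intro eq_vecI) auto
    then show ?thesis using e c[OF \<alpha>] by (intro eq_vecI) (auto simp: L_def)
  qed
  moreover have "L \<in> carrier_mat l m" unfolding L_def by simp
  ultimately show ?thesis by blast
qed

lemma nonsplit_set_cong:
  assumes "\<And>a Y. a \<in> carrier_vec (dim_row Kt) \<Longrightarrow> Y \<in> skew_mats k \<Longrightarrow> \<beta> a Y = \<beta>' a Y \<and> \<gamma> a Y = \<gamma>' a Y"
  shows "nonsplit_set k Kt Q \<beta> \<gamma> = nonsplit_set k Kt Q \<beta>' \<gamma>'"
proof -
  have *: "Z \<in> nonsplit_set k Kt Q \<beta> \<gamma>" if Z: "Z \<in> nonsplit_set k Kt Q \<beta>' \<gamma>'"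
    and e: "\<And>a Y. a \<in> carrier_vec (dim_row Kt) \<Longrightarrow> Y \<in> skew_mats k \<Longrightarrow> \<beta> a Y = \<beta>' a Y \<and> \<gamma> a Y = \<gamma>' a Y" for Z \<beta> \<gamma> \<beta>' \<gamma>'
  proof -
    obtain a Y z where *: "a \<in> carrier_vec (dim_row Kt)" "Y \<in> skew_mats k" "z \<in> carrier_vec k"
      "Z = ext_mat (kravchuk_mat Kt (rows_mat k Q a) (0\<^sub>m (dim_row Kt) (dim_row Kt)) Y) (z @\<^sub>v \<beta>' a Y @\<^sub>v \<gamma>' a Y) 0"
      using Z unfolding nonsplit_set_def by blast
    then have "Z = ext_mat (kravchuk_mat Kt (rows_mat k Q a) (0\<^sub>m (dim_row Kt) (dim_row Kt)) Y) (z @\<^sub>v \<beta> a Y @\<^sub>v \<gamma> a Y) 0"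
      using e[OF *(1,2)] by simp
    then show ?thesis using * unfolding nonsplit_set_def by blast
  qed
  show ?thesis
  proof (intro equalityI subsetI)
    fix Z assume "Z \<in> nonsplit_set k Kt Q \<beta> \<gamma>"
    then show "Z \<in> nonsplit_set k Kt Q \<beta>' \<gamma>'" by (rule *) (use assms in simp)
  next
    fix Z assume "Z \<in> nonsplit_set k Kt Q \<beta>' \<gamma>'"
    then show "Z \<in> nonsplit_set k Kt Q \<beta> \<gamma>" by (rule *) (use assms in simp)
  qed
qed

lemma cocycleD:
  assumes "normal_cocycle k m Q \<beta> \<gamma>" "a \<in> carrier_vec m" "Y \<in> skew_mats k"
  shows "\<beta> a Y \<in> carrier_vec m" "\<gamma> a Y \<in> carrier_vec k"
    "\<beta> (c \<cdot>\<^sub>v a) (c \<cdot>\<^sub>m Y) = c \<cdot>\<^sub>v \<beta> a Y" "\<gamma> (c \<cdot>\<^sub>v a) (c \<cdot>\<^sub>m Y) = c \<cdot>\<^sub>v \<gamma> a Y"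
    "a' \<in> carrier_vec m \<Longrightarrow> Y' \<in> skew_mats k \<Longrightarrow> \<beta> (a + a') (Y + Y') = \<beta> a Y + \<beta> a' Y'"
    "a' \<in> carrier_vec m \<Longrightarrow> Y' \<in> skew_mats k \<Longrightarrow> \<gamma> (a + a') (Y + Y') = \<gamma> a Y + \<gamma> a' Y'"
    "a' \<in> carrier_vec m \<Longrightarrow> Y' \<in> skew_mats k \<Longrightarrow>
      rows_mat k Q a *\<^sub>v \<beta> a' Y' + Y *\<^sub>v \<gamma> a' Y' = rows_mat k Q a' *\<^sub>v \<beta> a Y + Y' *\<^sub>v \<gamma> a Y"
    "a' \<in> carrier_vec m \<Longrightarrow> Y' \<in> skew_mats k \<Longrightarrow>
      (rows_mat k Q a)\<^sup>T *\<^sub>v \<gamma> a' Y' = (rows_mat k Q a')\<^sup>T *\<^sub>v \<gamma> a Y"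
  using assms unfolding normal_cocycle_def by blast+

lemma cocycle_split:
  assumes N: "normal_cocycle k m Q \<beta> \<gamma>" and a: "a \<in> carrier_vec m" and Y: "Y \<in> skew_mats k"
  shows "\<beta> a Y = \<beta> a (0\<^sub>m k k) + \<beta> (0\<^sub>v m) Y" "\<gamma> a Y = \<gamma> a (0\<^sub>m k k) + \<gamma> (0\<^sub>v m) Y"
proof -
  have "a + 0\<^sub>v m = a" "0\<^sub>m k k + Y = Y" using a skew_carrier[OF Y] by auto
  then show "\<beta> a Y = \<beta> a (0\<^sub>m k k) + \<beta> (0\<^sub>v m) Y" "\<gamma> a Y = \<gamma> a (0\<^sub>m k k) + \<gamma> (0\<^sub>v m) Y"
    using cocycleD(5,6)[OF N a skew_zero zero_carrier_vec Y] by simp_all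
qed

text \<open>The cocycle equations are bilinear. With one argument (0, Y) and the other of the form
  (\<alpha>, 0) or (0, Y'), most terms drop out because the rows belonging to 0 vanish.\<close>

lemma cocycle_mixed:
  assumes N: "normal_cocycle k m Q \<beta> \<gamma>" and a: "a \<in> carrier_vec m" and Y: "Y \<in> skew_mats k" and Y': "Y' \<in> skew_mats k"
    and Q: "\<And>i. i < k \<Longrightarrow> Q i \<in> sq_mats m"
  shows "Y *\<^sub>v \<gamma> a (0\<^sub>m k k) = rows_mat k Q a *\<^sub>v \<beta> (0\<^sub>v m) Y"
    "Y *\<^sub>v \<gamma> (0\<^sub>v m) Y' = Y' *\<^sub>v \<gamma> (0\<^sub>v m) Y"
    "(rows_mat k Q a)\<^sup>T *\<^sub>v \<gamma> (0\<^sub>v m) Y = 0\<^sub>v m"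
proof -
  note z = zero_carrier_vec[of m] skew_zero[of k]
  note c = cocycleD(1,2)[OF N z(1) Y] cocycleD(1,2)[OF N a z(2)] cocycleD(1,2)[OF N z(1) Y'] skew_carrier[OF Y] skew_carrier[OF Y']
    rows_mat_carrier[OF a, of k Q]
  have r0: "rows_mat k Q (0\<^sub>v m) = 0\<^sub>m k m" by (rule rows_mat_zero) (rule Q)
  show "Y *\<^sub>v \<gamma> a (0\<^sub>m k k) = rows_mat k Q a *\<^sub>v \<beta> (0\<^sub>v m) Y"
    using cocycleD(7)[OF N z(1) Y a z(2)] unfolding r0 using c by (simp add: mat_simps)
  show "Y *\<^sub>v \<gamma> (0\<^sub>v m) Y' = Y' *\<^sub>v \<gamma> (0\<^sub>v m) Y"
    using cocycleD(7)[OF N z(1) Y z(1) Y'] unfolding r0 using c by (simp add: mat_simps)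
  show "(rows_mat k Q a)\<^sup>T *\<^sub>v \<gamma> (0\<^sub>v m) Y = 0\<^sub>v m"
    using cocycleD(8)[OF N a z(2) z(1) Y] unfolding r0 using c by (simp add: mat_simps)
qed

text \<open>Let L be the matrix of \<beta> at Y = 0. Entry i of the first equation says that
  \<alpha> Q_i L \<alpha>' is symmetric in \<alpha> and \<alpha>', so every Q_i L is symmetric. The
  first of them gives L = L^T; together with Q_i K = K Q_i^T the others give the commutation with L
  K^-1.\<close>

lemma cocycle_Lambda:
  assumes Kt: "Kt \<in> sq_mats m" "invertible_mat Kt" and k: "1 \<le> k"
    and Q: "free_rowed_matrices k Kt Q" and N: "normal_cocycle k m Q \<beta> \<gamma>"
  shows "\<exists>\<Lambda>. Lambda_condition k Kt Q \<Lambda> \<and> (\<forall>a\<in>carrier_vec m. \<beta> a (0\<^sub>m k k) = row_mult a \<Lambda>)"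
proof -
  note QD = free_rowed_matricesD[OF Q Kt(1)]
  note z = skew_zero[of k]
  have zs: "c \<cdot>\<^sub>m 0\<^sub>m k k = (0\<^sub>m k k :: real mat)" for c by auto
  have "\<exists>L\<in>sq_mats m. \<forall>a\<in>carrier_vec m. \<beta> a (0\<^sub>m k k) = L *\<^sub>v a"
  proof (rule linear_map_matrix)
    fix a :: "real vec" assume a: "a \<in> carrier_vec m"
    show "\<beta> a (0\<^sub>m k k) \<in> carrier_vec m" using cocycleD(1)[OF N a z] .
    show "\<beta> (r \<cdot>\<^sub>v a) (0\<^sub>m k k) = r \<cdot>\<^sub>v \<beta> a (0\<^sub>m k k)" for r using cocycleD(3)[OF N a z, of r] unfolding zs .
    fix a' :: "real vec" assume a': "a' \<in> carrier_vec m"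
    show "\<beta> (a + a') (0\<^sub>m k k) = \<beta> a (0\<^sub>m k k) + \<beta> a' (0\<^sub>m k k)" using cocycleD(5)[OF N a z a' z] by simp
  qed
  then obtain L where L: "L \<in> sq_mats m" "\<And>a. a \<in> carrier_vec m \<Longrightarrow> \<beta> a (0\<^sub>m k k) = L *\<^sub>v a" by blast
  have QL: "Q i * L = (Q i * L)\<^sup>T" if i: "i < k" for i
  proof (rule mat_eqI_bilinear[of _ m m])
    show "Q i * L \<in> sq_mats m" "(Q i * L)\<^sup>T \<in> sq_mats m" using QD(1)[OF i] L by auto
    fix v w :: "real vec" assume v: "v \<in> carrier_vec m" and w: "w \<in> carrier_vec m"
    note c = rows_mat_carrier[OF v, of k Q] rows_mat_carrier[OF w, of k Q] cocycleD(1,2)[OF N v z] cocycleD(1,2)[OF N w z]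
    have "rows_mat k Q v *\<^sub>v \<beta> w (0\<^sub>m k k) = rows_mat k Q w *\<^sub>v \<beta> v (0\<^sub>m k k)"
      using cocycleD(7)[OF N v z w z] c by (simp add: mat_simps)
    then have "(rows_mat k Q v *\<^sub>v \<beta> w (0\<^sub>m k k)) $ i = (rows_mat k Q w *\<^sub>v \<beta> v (0\<^sub>m k k)) $ i" by simp
    then have e: "v \<bullet> (Q i *\<^sub>v (L *\<^sub>v w)) = w \<bullet> (Q i *\<^sub>v (L *\<^sub>v v))"
      using rows_mat_mult_vec[of v m i k Q] rows_mat_mult_vec[of w m i k Q] i v w QD(1)[OF i] c L by simp
    have QLc: "Q i * L \<in> sq_mats m" using QD(1)[OF i] L by auto
    have "v \<bullet> ((Q i * L) *\<^sub>v w) = w \<bullet> ((Q i * L) *\<^sub>v v)" using e QD(1)[OF i] L(1) v w by (simp add: mat_simps)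
    also have "\<dots> = ((Q i * L)\<^sup>T *\<^sub>v w) \<bullet> v" using scalar_prod_mult_vec[OF QLc w v] .
    also have "\<dots> = v \<bullet> ((Q i * L)\<^sup>T *\<^sub>v w)" using QLc v w by (intro comm_scalar_prod[of _ m]) (auto intro!: carrier_vecI)
    finally show "v \<bullet> ((Q i * L) *\<^sub>v w) = v \<bullet> ((Q i * L)\<^sup>T *\<^sub>v w)" .
  qed
  have LT: "L = L\<^sup>T" using QL[of 0] k QD(3) L by simp
  obtain B where B: "B \<in> sq_mats m" "Kt * B = 1\<^sub>m m" "B * Kt = 1\<^sub>m m" "mat_inv Kt = B"
    using Kt by (auto elim: invertible_matE)
  have "Q j * L * mat_inv Kt = L * mat_inv Kt * Q j" if j: "j < k" for j
  proof -
    \<comment> \<open>The symmetry of Q_j with respect to \<open>Kt\<close>, rewritten for the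
      inverse metric.\<close>
    have QB: "(Q j)\<^sup>T * B = B * Q j"
    proof -
      have "B * (Q j * Kt) * B = B * (Kt * (Q j)\<^sup>T) * B" using QD(2)[OF j] by simp
      then show ?thesis using B Kt QD(1)[OF j] by (simp add: mat_simps mult_cancel_left_inverse[OF B(3)])
    qed
    have "Q j * L = L * (Q j)\<^sup>T"
    proof -
      have "Q j * L = (Q j * L)\<^sup>T" using QL[OF j] .
      also have "\<dots> = L\<^sup>T * (Q j)\<^sup>T" using QD(1)[OF j] L(1) by (simp add: mat_simps)
      finally show ?thesis using LT by simp
    qed
    then have "Q j * L * B = L * ((Q j)\<^sup>T * B)" using QD(1)[OF j] L(1) B(1) by (simp add: mat_simps)
    also have "\<dots> = L * B * Q j" unfolding QB using QD(1)[OF j] L(1) B(1) by (simp add: mat_simps)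
    finally show ?thesis unfolding B(4) .
  qed
  then have "Lambda_condition k Kt Q L" unfolding Lambda_condition_def using L(1) LT Kt(1) by auto
  moreover have "\<beta> a (0\<^sub>m k k) = row_mult a L" if "a \<in> carrier_vec m" for a
    unfolding row_mult_def LT[symmetric] using L(2)[OF that] .
  ultimately show ?thesis by blast
qed

text \<open>Three distinct indices are available. They make the Y-part of \<gamma> vanish by a
  symmetry argument in the indices. In the mixed equation they allow elementary skew matrices with
  zero first row; \<beta> vanishes on these, which then removes the \<alpha>-part of \<gamma> and
  finally the Y-part of \<beta>.\<close>

lemma cocycle_large:
  assumes k: "3 \<le> k" and Q: "\<And>i. i < k \<Longrightarrow> Q i \<in> sq_mats m" "Q 0 = 1\<^sub>m m"
    and N: "normal_cocycle k m Q \<beta> \<gamma>" and \<alpha>: "\<alpha> \<in> carrier_vec m" and Y: "Y \<in> skew_mats k"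
  shows "\<beta> \<alpha> Y = \<beta> \<alpha> (0\<^sub>m k k)" "\<gamma> \<alpha> Y = 0\<^sub>v k"
proof -
  let ?E = "skew_unit k"
  let ?z = "0\<^sub>v m :: real vec"
  define g where "g Y = \<gamma> ?z Y" for Y
  note z = zero_carrier_vec[of m] skew_zero[of k]
  have gc: "g Y \<in> carrier_vec k" if "Y \<in> skew_mats k" for Y unfolding g_def using cocycleD(2)[OF N z(1) that] .
  have ggen: "Y *\<^sub>v g Y' = Y' *\<^sub>v g Y" if "Y \<in> skew_mats k" "Y' \<in> skew_mats k" for Y Y'
    unfolding g_def by (rule cocycle_mixed(2)[OF N z(1) that]) (rule Q)
  \<comment> \<open>Entries i and j of E_ij g(E_lj) = E_lj g(E_ij) for distinct i, j, l.\<close>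
  have g1: "g (?E l j) $ j = 0" and g2: "g (?E l j) $ i = g (?E i j) $ l"
    if ijl: "i < k" "j < k" "l < k" "i \<noteq> j" "j \<noteq> l" "i \<noteq> l" for i j l
  proof -
    have lj: "l \<noteq> j" using ijl by simp
    have e: "(?E i j *\<^sub>v g (?E l j)) $ r = (?E l j *\<^sub>v g (?E i j)) $ r" for r
      using ggen[OF skew_unit_mem[OF ijl(4)] skew_unit_mem[OF lj]] by simp
    note sv = skew_unit_mult_vec[OF gc[OF skew_unit_mem[OF lj]] ijl(1,2,4)] skew_unit_mult_vec[OF gc[OF skew_unit_mem[OF ijl(4)]] ijl(3,2) lj]
    show "g (?E l j) $ j = 0" using e[of i] sv(1)[OF ijl(1)] sv(2)[OF ijl(1)] ijl by simp
    show "g (?E l j) $ i = g (?E i j) $ l" using e[of j] sv(1)[OF ijl(2)] sv(2)[OF ijl(2)] ijl by simp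
  qed
  have ganti: "g (?E j l) = - 1 \<cdot>\<^sub>v g (?E l j)" if "j \<noteq> l" for j l
  proof -
    have "?E j l = - 1 \<cdot>\<^sub>m ?E l j" unfolding skew_unit_def using that by (intro eq_matI) auto
    moreover have "- 1 \<cdot>\<^sub>v ?z = ?z" by auto
    ultimately show ?thesis unfolding g_def using cocycleD(4)[OF N z(1) skew_unit_mem[of l j k], of "- 1"] that by simp
  qed
  have ganti': "g (?E j l) $ r = - g (?E l j) $ r" if "j \<noteq> l" "r < k" for j l r
    using ganti[OF that(1)] gc[OF skew_unit_mem[of l j k]] that by simp
  have third: "\<exists>i<k. i \<noteq> j \<and> i \<noteq> l" for j l :: nat
  proof -
    have "\<exists>i\<in>{0, 1, 2 :: nat}. i \<noteq> j \<and> i \<noteq> l" by auto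
    then obtain i where i: "i \<in> {0, 1, 2 :: nat}" "i \<noteq> j" "i \<noteq> l" by blast
    then have "i < k" using k by auto
    then show ?thesis using i by blast
  qed
  have g0: "g (?E l j) = 0\<^sub>v k" if lj: "l < k" "j < k" "l \<noteq> j" for l j
  proof (rule eq_vecI)
    fix i assume "i < dim_vec (0\<^sub>v k :: real vec)"
    then have i: "i < k" by simp
    have end0: "g (?E a b) $ b = 0" if "a < k" "b < k" "a \<noteq> b" for a b
      using third[of a b] g1[of _ b a] that by metis
    consider "i = j" | "i = l" | "i \<noteq> j" "i \<noteq> l" by blast
    then show "g (?E l j) $ i = 0\<^sub>v k $ i"
    proof cases
      case 1
      then show ?thesis using end0[OF lj] i by simp
    next
      case 2
      then show ?thesis using end0[of j l] ganti'[of l j l] lj i by simp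
    next
      case 3
      \<comment> \<open>The value is symmetric under exchange of i and l and antisymmetric under
        exchange of l and j. Six such exchanges return it with the opposite sign.\<close>
      have "g (?E l j) $ i = g (?E i j) $ l" using g2[of i j l] lj i 3 by simp
      also have "\<dots> = - g (?E j i) $ l" using ganti'[of i j l] 3 lj by simp
      also have "g (?E j i) $ l = g (?E l i) $ j" using g2[of l i j] lj i 3 by simp
      also have "g (?E l i) $ j = - g (?E i l) $ j" using ganti'[of l i j] 3 lj by simp
      also have "g (?E i l) $ j = g (?E j l) $ i" using g2[of j l i] lj i 3 by simp
      also have "g (?E j l) $ i = - g (?E l j) $ i" using ganti'[of j l i] i lj by simp
      finally show ?thesis using i by simp
    qed
  qed (use gc[OF skew_unit_mem[OF lj(3)]] in auto)
  have gz: "g Y = 0\<^sub>v k" if Y: "Y \<in> skew_mats k" for Y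
  proof (rule eq_vecI)
    fix j assume "j < dim_vec (0\<^sub>v k :: real vec)"
    then have j: "j < k" by simp
    obtain i where i: "i < k" "i \<noteq> j" using third by metis
    have "?E i j *\<^sub>v g Y = Y *\<^sub>v g (?E i j)" using ggen[OF skew_unit_mem[OF i(2)] Y] .
    also have "\<dots> = 0\<^sub>v k" unfolding g0[OF i(1) j i(2)] using skew_carrier[OF Y] by (simp add: mat_simps)
    finally have "(?E i j *\<^sub>v g Y) $ i = 0" using i by simp
    then show "g Y $ j = 0\<^sub>v k $ j" using skew_unit_mult_vec[OF gc[OF Y] i(1) j i(2) i(1)] j by simp
  qed (use gc[OF Y] in auto)
  define b where "b Y = \<beta> ?z Y" for Y
  have bc: "b Y \<in> carrier_vec m" if "Y \<in> skew_mats k" for Y unfolding b_def using cocycleD(1)[OF N z(1) that] .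
  define h where "h \<alpha> = \<gamma> \<alpha> (0\<^sub>m k k)" for \<alpha>
  have hc: "h \<alpha> \<in> carrier_vec k" if "\<alpha> \<in> carrier_vec m" for \<alpha> unfolding h_def using cocycleD(2)[OF N that z(2)] .
  have mix: "(Y *\<^sub>v h \<alpha>) $ r = \<alpha> \<bullet> (Q r *\<^sub>v b Y)" if h: "\<alpha> \<in> carrier_vec m" "Y \<in> skew_mats k" "r < k" for \<alpha> Y r
  proof -
    have "Y *\<^sub>v h \<alpha> = rows_mat k Q \<alpha> *\<^sub>v b Y" unfolding b_def h_def by (rule cocycle_mixed(1)[OF N h(1,2,2)]) (rule Q)
    then show ?thesis using rows_mat_mult_vec[of \<alpha> m r k Q "b Y"] h Q(1)[OF h(3)] bc[OF h(2)] by simp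
  qed
  have mix0: "(Y *\<^sub>v h \<alpha>) $ 0 = \<alpha> \<bullet> b Y" if h: "\<alpha> \<in> carrier_vec m" "Y \<in> skew_mats k" for \<alpha> Y
    using mix[OF h, of 0] k Q(2) bc[OF h(2)] by simp
  have Eh: "(?E i j *\<^sub>v h \<alpha>) $ r = (if r = i then h \<alpha> $ j else if r = j then - h \<alpha> $ i else 0)"
    if "\<alpha> \<in> carrier_vec m" "i < k" "j < k" "i \<noteq> j" "r < k" for \<alpha> i j r
    using skew_unit_mult_vec[OF hc[OF that(1)] that(2-5)] .
  have Qz: "Q r *\<^sub>v 0\<^sub>v m = 0\<^sub>v m" if "r < k" for r using Q(1)[OF that] by (simp add: mat_simps)
  \<comment> \<open>With i and j both different from 0 the first row of E_ij vanishes, so entry 0 of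
    the mixed equation gives b(E_ij) = 0. Entry i then reads h_j = 0.\<close>
  have hj: "h \<alpha> $ j = 0" if \<alpha>: "\<alpha> \<in> carrier_vec m" and j: "1 \<le> j" "j < k" for \<alpha> j
  proof -
    define i where "i = (if j = 1 then 2 else 1 :: nat)"
    have i: "i < k" "i \<noteq> j" "i \<noteq> 0" unfolding i_def using k by auto
    have S: "?E i j \<in> skew_mats k" using skew_unit_mem[OF i(2)] .
    have "b (?E i j) = 0\<^sub>v m"
    proof (rule vec_zero_iff_scalar_prods[OF bc[OF S]])
      fix w :: "real vec" assume w: "w \<in> carrier_vec m"
      show "w \<bullet> b (?E i j) = 0" using mix0[OF w S] Eh[OF w i(1) j(2) i(2), of 0] i j k by simp
    qed
    then show ?thesis using mix[OF \<alpha> S i(1)] Eh[OF \<alpha> i(1) j(2) i(2) i(1)] Qz[OF i(1)] \<alpha> by simp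
  qed
  \<comment> \<open>Now E_01 has a nonzero first row, but the entry h_1 that it picks is already
    known to vanish. So b(E_01) = 0, and entry 1 reads - h_0 = 0.\<close>
  have h0: "h \<alpha> $ 0 = 0" if \<alpha>: "\<alpha> \<in> carrier_vec m" for \<alpha>
  proof -
    have S: "?E 0 1 \<in> skew_mats k" using skew_unit_mem[of 0 1 k] by simp
    have k01: "0 < k" "1 < k" using k by auto
    have "b (?E 0 1) = 0\<^sub>v m"
    proof (rule vec_zero_iff_scalar_prods[OF bc[OF S]])
      fix w :: "real vec" assume w: "w \<in> carrier_vec m"
      show "w \<bullet> b (?E 0 1) = 0" using mix0[OF w S] Eh[OF w k01 _ k01(1)] hj[OF w, of 1] k by simp
    qed
    then show ?thesis using mix[OF \<alpha> S k01(2)] Eh[OF \<alpha> k01 _ k01(2)] Qz[OF k01(2)] \<alpha> by simp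
  qed
  have hz: "h \<alpha> = 0\<^sub>v k" if \<alpha>: "\<alpha> \<in> carrier_vec m" for \<alpha>
  proof (rule eq_vecI)
    fix i assume "i < dim_vec (0\<^sub>v k :: real vec)"
    then show "h \<alpha> $ i = 0\<^sub>v k $ i" using h0[OF \<alpha>] hj[OF \<alpha>, of i] by (cases "i = 0") auto
  qed (use hc[OF \<alpha>] in auto)
  have bz: "b Y = 0\<^sub>v m"
  proof (rule vec_zero_iff_scalar_prods[OF bc[OF Y]])
    fix w :: "real vec" assume w: "w \<in> carrier_vec m"
    show "w \<bullet> b Y = 0" using mix0[OF w Y] hz[OF w] skew_carrier[OF Y] k by (simp add: mat_simps)
  qed
  show "\<beta> \<alpha> Y = \<beta> \<alpha> (0\<^sub>m k k)" using cocycle_split(1)[OF N \<alpha> Y] bz cocycleD(1)[OF N \<alpha> z(2)] unfolding b_def by simp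
  show "\<gamma> \<alpha> Y = 0\<^sub>v k" using cocycle_split(2)[OF N \<alpha> Y] gz[OF Y] hz[OF \<alpha>] unfolding g_def h_def by simp
qed

lemma skew_one: "Y \<in> skew_mats 1 \<Longrightarrow> Y = 0\<^sub>m 1 1"
proof -
  assume "Y \<in> skew_mats 1"
  then have c: "Y \<in> sq_mats 1" and e: "Y $$ (0, 0) = - Y $$ (0, 0)"
    unfolding skew_mats_iff by blast+
  have "Y $$ (0, 0) = 0" using e by linarith
  then show ?thesis using c by (intro eq_matI) auto
qed

lemma skew_two: "Y \<in> skew_mats 2 \<Longrightarrow> Y = Y $$ (0, 1) \<cdot>\<^sub>m skew_unit 2 0 1"
proof -
  assume "Y \<in> skew_mats 2"
  then have c: "Y \<in> sq_mats 2" and e: "\<And>i j. i < 2 \<Longrightarrow> j < 2 \<Longrightarrow> Y $$ (i, j) = - Y $$ (j, i)"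
    unfolding skew_mats_iff by blast+
  have "Y $$ (0, 0) = 0" "Y $$ (1, 1) = 0" "Y $$ (1, 0) = - Y $$ (0, 1)"
    using e[of 0 0] e[of 1 1] e[of 1 0] by auto
  then show ?thesis using c by (intro eq_matI) (auto simp: skew_unit_def less_2_cases_iff)
qed

text \<open>For k = 1 the second equation reads h(\<alpha>') \<alpha> = h(\<alpha>) \<alpha>', where
  h is the entry of \<gamma>. Two independent vectors force h = 0.\<close>

lemma cocycle_one:
  assumes m: "2 \<le> m" and Q: "Q 0 = 1\<^sub>m m"
    and N: "normal_cocycle 1 m Q \<beta> \<gamma>" and a: "a \<in> carrier_vec m"
  shows "\<gamma> a (0\<^sub>m 1 1) = 0\<^sub>v 1"
proof -
  note z = skew_zero[of 1]
  define h where "h a = \<gamma> a (0\<^sub>m 1 1)" for a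
  have hc: "h a \<in> carrier_vec 1" if "a \<in> carrier_vec m" for a unfolding h_def using cocycleD(2)[OF N that z] .
  have Qc: "\<And>i. i < 1 \<Longrightarrow> Q i \<in> sq_mats m" using Q by simp
  have rt: "(rows_mat 1 Q v)\<^sup>T *\<^sub>v w = w $ 0 \<cdot>\<^sub>v v" if v: "v \<in> carrier_vec m" and w: "w \<in> carrier_vec 1" for v w
  proof (rule eq_vecI)
    have c: "rows_mat 1 Q v \<in> carrier_mat 1 m" using rows_mat_carrier[OF v] .
    fix j assume "j < dim_vec (w $ 0 \<cdot>\<^sub>v v)"
    then have j: "j < m" using v by simp
    have "rows_mat 1 Q v $$ (0, j) = row (rows_mat 1 Q v) 0 $ j" using c j by simp
    also have "\<dots> = v $ j" using rows_mat_row[of v m 0 1 Q] v Q by (simp add: mat_dim_simps)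
    finally show "((rows_mat 1 Q v)\<^sup>T *\<^sub>v w) $ j = (w $ 0 \<cdot>\<^sub>v v) $ j" using c j w v by (simp add: scalar_prod_def)
  qed (use rows_mat_carrier[OF v, of 1 Q] v in auto)
  have e: "h w $ 0 \<cdot>\<^sub>v v = h v $ 0 \<cdot>\<^sub>v w" if v: "v \<in> carrier_vec m" and w: "w \<in> carrier_vec m" for v w
    using cocycleD(8)[OF N v z w z] rt[OF v hc[OF w]] rt[OF w hc[OF v]] unfolding h_def by simp
  have e': "h w $ 0 * v $ j = h v $ 0 * w $ j" if v: "v \<in> carrier_vec m" and w: "w \<in> carrier_vec m" and j: "j < m" for v w j
    using arg_cong[OF e[OF v w], of "\<lambda>x. x $ j"] v w j by simp
  have "h (unit_vec m 1) $ 0 = 0" using e'[of "unit_vec m 0" "unit_vec m 1" 0] m by simp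
  then have "h a $ 0 = 0" using e'[of a "unit_vec m 1" 1] m a by simp
  then show ?thesis using hc[OF a] unfolding h_def by (intro eq_vecI) auto
qed

text \<open>Skew matrices of size 2 are multiples of a single J, so the values v and p on J and the
  values at Y = 0 carry all of the data. The two rows of J \<gamma>(\<alpha>, 0) = A v express
  \<gamma>(\<alpha>, 0) by v; the fourth relation is A^T p = 0.\<close>

lemma cocycle_two:
  assumes Q: "\<And>i. i < 2 \<Longrightarrow> Q i \<in> sq_mats m" "Q 0 = 1\<^sub>m m"
    and N: "normal_cocycle 2 m Q \<beta> \<gamma>"
    and v: "v = \<beta> (0\<^sub>v m) (skew_unit 2 0 1)" and p: "p = \<gamma> (0\<^sub>v m) (skew_unit 2 0 1)"
    and a: "a \<in> carrier_vec m" and Y: "Y \<in> skew_mats 2"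
  shows "\<beta> a Y = \<beta> a (0\<^sub>m 2 2) + Y $$ (0, 1) \<cdot>\<^sub>v v"
    "\<gamma> a Y $ 0 = - (a \<bullet> (Q 1 *\<^sub>v v)) + Y $$ (0, 1) * p $ 0"
    "\<gamma> a Y $ 1 = a \<bullet> v + Y $$ (0, 1) * p $ 1"
    "p $ 0 \<cdot>\<^sub>v a + p $ 1 \<cdot>\<^sub>v ((Q 1)\<^sup>T *\<^sub>v a) = 0\<^sub>v m"
    "v \<in> carrier_vec m" "p \<in> carrier_vec 2"
proof -
  let ?J = "skew_unit 2 0 1"
  note z = zero_carrier_vec[of m] skew_zero[of 2]
  have J: "?J \<in> skew_mats 2" using skew_unit_mem[of 0 1 2] by simp
  show vc: "v \<in> carrier_vec m" and pc: "p \<in> carrier_vec 2" unfolding v p using cocycleD(1,2)[OF N z(1) J] by auto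
  have Ye: "\<beta> (0\<^sub>v m) Y = Y $$ (0, 1) \<cdot>\<^sub>v v" "\<gamma> (0\<^sub>v m) Y = Y $$ (0, 1) \<cdot>\<^sub>v p"
  proof -
    have "c \<cdot>\<^sub>v 0\<^sub>v m = (0\<^sub>v m :: real vec)" for c by auto
    then show "\<beta> (0\<^sub>v m) Y = Y $$ (0, 1) \<cdot>\<^sub>v v" "\<gamma> (0\<^sub>v m) Y = Y $$ (0, 1) \<cdot>\<^sub>v p"
      unfolding v p using cocycleD(3,4)[OF N z(1) J, of "Y $$ (0, 1)"] skew_two[OF Y] by simp_all
  qed
  show "\<beta> a Y = \<beta> a (0\<^sub>m 2 2) + Y $$ (0, 1) \<cdot>\<^sub>v v" using cocycle_split(1)[OF N a Y] Ye by simp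
  define h where "h = \<gamma> a (0\<^sub>m 2 2)"
  have hc: "h \<in> carrier_vec 2" unfolding h_def using cocycleD(2)[OF N a z(2)] .
  have mix: "?J *\<^sub>v h = rows_mat 2 Q a *\<^sub>v v" unfolding h_def v by (rule cocycle_mixed(1)[OF N a J J]) (rule Q)
  have r: "(rows_mat 2 Q a *\<^sub>v v) $ i = a \<bullet> (Q i *\<^sub>v v)" if "i < 2" for i
    using rows_mat_mult_vec[of a m i 2 Q v] a that Q(1)[OF that] vc by simp
  have "h $ 1 = a \<bullet> v" using arg_cong[OF mix, of "\<lambda>x. x $ 0"] skew_unit_mult_vec[OF hc, of 0 1 0] r[of 0] Q(2) vc by simp
  moreover have "h $ 0 = - (a \<bullet> (Q 1 *\<^sub>v v))" using arg_cong[OF mix, of "\<lambda>x. x $ 1"] skew_unit_mult_vec[OF hc, of 0 1 1] r[of 1] by simp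
  moreover have "\<gamma> a Y = h + Y $$ (0, 1) \<cdot>\<^sub>v p" unfolding h_def using cocycle_split(2)[OF N a Y] Ye by simp
  ultimately show "\<gamma> a Y $ 0 = - (a \<bullet> (Q 1 *\<^sub>v v)) + Y $$ (0, 1) * p $ 0"
    "\<gamma> a Y $ 1 = a \<bullet> v + Y $$ (0, 1) * p $ 1" using hc pc by simp_all
  have "0\<^sub>v m = (rows_mat 2 Q a)\<^sup>T *\<^sub>v p" unfolding p by (rule cocycle_mixed(3)[OF N a J J, symmetric]) (rule Q)
  also have "\<dots> = (lin_comb_mat m 2 (vec_index p) Q)\<^sup>T *\<^sub>v a" by (rule rows_mat_transpose_mult[OF a _ pc]) (rule Q)
  also have "lin_comb_mat m 2 (vec_index p) Q = p $ 0 \<cdot>\<^sub>m 1\<^sub>m m + p $ 1 \<cdot>\<^sub>m Q 1"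
    unfolding lin_comb_mat_def using Q(1)[of 1] Q(2) by (intro eq_matI) (auto simp: numeral_2_eq_2)
  also have "(p $ 0 \<cdot>\<^sub>m 1\<^sub>m m + p $ 1 \<cdot>\<^sub>m Q 1)\<^sup>T *\<^sub>v a = p $ 0 \<cdot>\<^sub>v a + p $ 1 \<cdot>\<^sub>v ((Q 1)\<^sup>T *\<^sub>v a)"
    using Q(1)[of 1] a by (simp add: mat_simps)
  finally show "p $ 0 \<cdot>\<^sub>v a + p $ 1 \<cdot>\<^sub>v ((Q 1)\<^sup>T *\<^sub>v a) = 0\<^sub>v m" by simp
qed

section \<open>From a MASA to its cocycle, and coboundaries\<close>

lemma characterized_form:
  assumes K: "K \<in> sq_mats n" and M: "e_MASA K M" and k: "1 \<le> k" and km: "\<not> (k = 1 \<and> m = 0)"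
    and Kt: "Kt \<in> sq_mats m" "invertible_mat Kt"
    and Q: "\<And>i. i < k \<Longrightarrow> Q i \<in> sq_mats m" "Q 0 = 1\<^sub>m m"
    and lr: "linearly_represented K (o_proj n M) (kravchuk_metric k Kt) (kravchuk_family k Kt Q)"
  shows "n = k + m + k" "\<exists>\<beta> \<gamma>. normal_cocycle k m Q \<beta> \<gamma> \<and> represented K M (kravchuk_metric k Kt) (nonsplit_set k Kt Q \<beta> \<gamma>)"
proof -
  have dK: "dim_row K = n" using K by auto
  obtain G where G: "G \<in> sq_mats n" "invertible_mat G" "kravchuk_metric k Kt = G * K * G\<^sup>T"
    "kravchuk_family k Kt Q = conj_set G (o_proj n M)" using lr unfolding linearly_represented_def dK by auto
  have "dim_row (kravchuk_metric k Kt) = n" unfolding G(3) using G by auto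
  then show n: "n = k + m + k" using kravchuk_metric3[OF Kt(1)] by simp
  obtain H where H: "H \<in> sq_mats n" "G * H = 1\<^sub>m n" "H * G = 1\<^sub>m n" using G by (auto elim: invertible_matE)
  define M' where "M' = conj_set (ext_mat G (0\<^sub>v n) 1) M"
  have r: "represented K M (kravchuk_metric k Kt) M'" unfolding represented_def dK M'_def
    by (intro bexI[of _ G] bexI[of _ "0\<^sub>v n"]) (use G in auto)
  have "o_proj n M' = kravchuk_family k Kt Q" unfolding M'_def G(4)
    by (rule o_proj_conj[OF e_MASA_pairs(1)[OF K M] G(1) H]) simp
  then obtain \<beta> \<gamma> where "normal_cocycle k m Q \<beta> \<gamma>" "M' = nonsplit_set k Kt Q \<beta> \<gamma>"
    using cocycle_form[OF Kt k km, of Q M'] Q represented_e_MASA(1)[OF K M r] unfolding n by auto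
  then show "\<exists>\<beta> \<gamma>. normal_cocycle k m Q \<beta> \<gamma> \<and> represented K M (kravchuk_metric k Kt) (nonsplit_set k Kt Q \<beta> \<gamma>)"
    using r by auto
qed

text \<open>On the vector (0, 0, - c) the rotation parts take exactly these values \<beta> and
  \<gamma>, up to the first component, which may be anything since z is free. So this vector meets
  the splitting criterion.\<close>

lemma coboundary_splitting:
  assumes K: "K \<in> sq_mats (k + m + k)" and M: "e_MASA K M" and Kt: "Kt \<in> sq_mats m"
    and r: "represented K M (kravchuk_metric k Kt) (nonsplit_set k Kt Q \<beta> \<gamma>)"
    and c: "c \<in> carrier_vec k"
    and \<beta>: "\<And>a Y. a \<in> carrier_vec m \<Longrightarrow> Y \<in> skew_mats k \<Longrightarrow> \<beta> a Y = Kt *\<^sub>v ((rows_mat k Q a)\<^sup>T *\<^sub>v c)"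
    and \<gamma>: "\<And>a Y. a \<in> carrier_vec m \<Longrightarrow> Y \<in> skew_mats k \<Longrightarrow> \<gamma> a Y = 0\<^sub>v k"
  shows "splitting K M"
proof (rule splitting_representedI[OF K M r])
  let ?c = "0\<^sub>v k @\<^sub>v 0\<^sub>v m @\<^sub>v (- c)"
  show "?c \<in> carrier_vec (k + m + k)" using c by (intro vec3_carrier) auto
  have P: "pairs (k + m + k) (nonsplit_set k Kt Q \<beta> \<gamma>) =
     {(kravchuk_mat Kt (rows_mat k Q a) (0\<^sub>m m m) Y, z @\<^sub>v \<beta> a Y @\<^sub>v \<gamma> a Y) | a Y z.
       a \<in> carrier_vec m \<and> Y \<in> skew_mats k \<and> z \<in> carrier_vec k}"
    by (rule nonsplit_set_pairs(1)[OF Kt]) (use \<beta> \<gamma> Kt in \<open>auto intro!: carrier_vecI\<close>)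
  fix X b assume "(X, b) \<in> pairs (k + m + k) (nonsplit_set k Kt Q \<beta> \<gamma>)"
  then obtain a Y where X: "a \<in> carrier_vec m" "Y \<in> skew_mats k" "X = kravchuk_mat Kt (rows_mat k Q a) (0\<^sub>m m m) Y"
    unfolding P by blast
  have Ac: "rows_mat k Q a \<in> carrier_mat k m" using rows_mat_carrier[OF X(1)] .
  have Yc: "Y \<in> sq_mats k" using skew_carrier[OF X(2)] .
  have "X *\<^sub>v ?c = (rows_mat k Q a *\<^sub>v 0\<^sub>v m + Y *\<^sub>v (- c)) @\<^sub>v (- (Kt *\<^sub>v ((rows_mat k Q a)\<^sup>T *\<^sub>v (- c)))) @\<^sub>v 0\<^sub>v k"
    unfolding X(3) by (rule kravchuk_mult_vec[OF Kt Ac Yc]) (use c in auto)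
  also have "\<dots> = (Y *\<^sub>v (- c)) @\<^sub>v \<beta> a Y @\<^sub>v \<gamma> a Y"
    using Ac Yc c Kt \<beta>[OF X(1,2)] \<gamma>[OF X(1,2)] by (simp add: mat_simps)
  finally have "X *\<^sub>v ?c = (Y *\<^sub>v (- c)) @\<^sub>v \<beta> a Y @\<^sub>v \<gamma> a Y" .
  moreover have "Y *\<^sub>v (- c) \<in> carrier_vec k" using Yc by (intro carrier_vecI) auto
  ultimately show "(X, X *\<^sub>v ?c) \<in> pairs (k + m + k) (nonsplit_set k Kt Q \<beta> \<gamma>)" unfolding P using X by blast
qed

lemma rows_mat_transpose_unit:
  assumes "a \<in> carrier_vec m" "1 \<le> k" "Q 0 = 1\<^sub>m m"
  shows "(rows_mat k Q a)\<^sup>T *\<^sub>v (s \<cdot>\<^sub>v unit_vec k 0) = s \<cdot>\<^sub>v a"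
proof -
  have c: "rows_mat k Q a \<in> carrier_mat k m" using rows_mat_carrier[OF assms(1)] .
  have "(rows_mat k Q a)\<^sup>T *\<^sub>v unit_vec k 0 = col ((rows_mat k Q a)\<^sup>T) 0" using c assms by (intro mult_unit_vec[of _ m]) auto
  also have "\<dots> = row (rows_mat k Q a) 0" using c assms by simp
  also have "\<dots> = a" using rows_mat_row[of a m 0 k Q] assms by (simp add: mat_simps)
  finally show ?thesis using c by (simp add: mat_simps)
qed

lemma one_by_one_mult_vec:
  assumes "A \<in> sq_mats 1" "v \<in> carrier_vec 1"
  shows "A *\<^sub>v v = A $$ (0, 0) \<cdot>\<^sub>v (v :: real vec)"
  using assms by (intro eq_vecI) (auto simp: scalar_prod_def)

text \<open>In size 1 every \<Lambda> is a multiple of the nonzero \<open>Kt\<close>, and multiples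
  of the first unit vector as \<open>c\<close> produce all of these. This is why no \<Lambda>
  survives for m = 1.\<close>

lemma one_dim_coboundary:
  assumes Kt: "Kt \<in> sq_mats 1" "invertible_mat Kt" and k: "1 \<le> k" and Q: "Q 0 = 1\<^sub>m 1"
    and L: "\<Lambda> \<in> sq_mats 1"
  shows "\<exists>c\<in>carrier_vec k. \<forall>a\<in>carrier_vec 1. Kt *\<^sub>v ((rows_mat k Q a)\<^sup>T *\<^sub>v c) = row_mult a \<Lambda>"
proof -
  have "det Kt = Kt $$ (0, 0)" using Kt(1) by (rule det_single)
  then have K0: "Kt $$ (0, 0) \<noteq> 0" using Kt invertible_det_iff[OF Kt(1)] by simp
  let ?s = "\<Lambda> $$ (0, 0) / Kt $$ (0, 0)"
  have "Kt *\<^sub>v ((rows_mat k Q a)\<^sup>T *\<^sub>v (?s \<cdot>\<^sub>v unit_vec k 0)) = row_mult a \<Lambda>" if a: "a \<in> carrier_vec 1" for a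
  proof -
    have "Kt *\<^sub>v ((rows_mat k Q a)\<^sup>T *\<^sub>v (?s \<cdot>\<^sub>v unit_vec k 0)) = Kt *\<^sub>v (?s \<cdot>\<^sub>v a)"
      using rows_mat_transpose_unit[where k = k and Q = Q, OF a k Q] by simp
    also have "\<dots> = Kt $$ (0, 0) \<cdot>\<^sub>v (?s \<cdot>\<^sub>v a)" using Kt a by (intro one_by_one_mult_vec) auto
    also have "\<dots> = \<Lambda> $$ (0, 0) \<cdot>\<^sub>v a" using K0 by (simp add: smult_smult_assoc)
    also have "\<dots> = row_mult a \<Lambda>" unfolding row_mult_def using one_by_one_mult_vec[of "\<Lambda>\<^sup>T" a] L a by simp
    finally show ?thesis .
  qed
  then show ?thesis by (intro bexI[of _ "?s \<cdot>\<^sub>v unit_vec k 0"]) auto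
qed

section \<open>Normal forms of nonsplitting MASAs outside the case k = 2, m >= 2\<close>

context
  fixes K M n k m Kt Q
  assumes K: "K \<in> sq_mats n" and M: "e_MASA K M" and ns: "\<not> splitting K M"
    and Kt: "Kt \<in> sq_mats m" "Kt\<^sup>T = Kt" "invertible_mat Kt" and k: "1 \<le> k" and km: "\<not> (k = 1 \<and> m = 0)"
    and Q: "free_rowed_matrices k Kt Q"
    and lr: "linearly_represented K (o_proj n M) (kravchuk_metric k Kt) (kravchuk_family k Kt Q)"
begin

lemma Q_carrier: "i < k \<Longrightarrow> Q i \<in> sq_mats m" and Q_zero: "Q 0 = 1\<^sub>m m"
  using free_rowed_matricesD[OF Q Kt(1)] by auto

lemma dK: "dim_row Kt = m"
  using Kt by auto

lemma n_eq: "n = k + m + k"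
  by (rule characterized_form(1)[where k = k and m = m and Q = Q, OF K M k km Kt(1,3) Q_carrier Q_zero lr])

lemma cocycle_ex:
  obtains \<beta> \<gamma> where "normal_cocycle k m Q \<beta> \<gamma>" "represented K M (kravchuk_metric k Kt) (nonsplit_set k Kt Q \<beta> \<gamma>)"
  using characterized_form(2)[where k = k and m = m and Q = Q, OF K M k km Kt(1,3) Q_carrier Q_zero lr] by blast

lemma nonsplit_large:
  assumes k3: "3 \<le> k"
  shows "\<exists>\<Lambda>. Lambda_condition k Kt Q \<Lambda> \<and> represented K M (kravchuk_metric k Kt)
    (nonsplit_set k Kt Q (\<lambda>a Y. row_mult a \<Lambda>) (\<lambda>a Y. 0\<^sub>v k))"
proof -
  obtain \<beta> \<gamma> where N: "normal_cocycle k m Q \<beta> \<gamma>" and r: "represented K M (kravchuk_metric k Kt) (nonsplit_set k Kt Q \<beta> \<gamma>)"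
    using cocycle_ex .
  obtain \<Lambda> where L: "Lambda_condition k Kt Q \<Lambda>" "\<And>a. a \<in> carrier_vec m \<Longrightarrow> \<beta> a (0\<^sub>m k k) = row_mult a \<Lambda>"
    using cocycle_Lambda[OF Kt(1,3) k Q N] by blast
  have "nonsplit_set k Kt Q \<beta> \<gamma> = nonsplit_set k Kt Q (\<lambda>a Y. row_mult a \<Lambda>) (\<lambda>a Y. 0\<^sub>v k)"
  proof (rule nonsplit_set_cong)
    fix a :: "real vec" and Y assume "a \<in> carrier_vec (dim_row Kt)" and Y: "Y \<in> skew_mats k"
    then have a: "a \<in> carrier_vec m" using dK by simp
    have "\<beta> a Y = \<beta> a (0\<^sub>m k k)" "\<gamma> a Y = 0\<^sub>v k"
      by (rule cocycle_large[OF k3 _ Q_zero N a Y], rule Q_carrier, assumption)+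
    then show "\<beta> a Y = row_mult a \<Lambda> \<and> \<gamma> a Y = 0\<^sub>v k" using L(2)[OF a] by simp
  qed
  then show ?thesis using L r by auto
qed

lemma nonsplit_one:
  assumes k1: "k = 1" and m: "2 \<le> m"
  shows "\<exists>\<Lambda>\<in>sq_mats m. \<Lambda> = \<Lambda>\<^sup>T \<and> represented K M (kravchuk_metric k Kt)
    (nonsplit_set k Kt Q (\<lambda>a Y. row_mult a \<Lambda>) (\<lambda>a Y. 0\<^sub>v 1))"
proof -
  obtain \<beta> \<gamma> where N: "normal_cocycle k m Q \<beta> \<gamma>" and r: "represented K M (kravchuk_metric k Kt) (nonsplit_set k Kt Q \<beta> \<gamma>)"
    using cocycle_ex .
  obtain \<Lambda> where L: "Lambda_condition k Kt Q \<Lambda>" "\<And>a. a \<in> carrier_vec m \<Longrightarrow> \<beta> a (0\<^sub>m k k) = row_mult a \<Lambda>"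
    using cocycle_Lambda[OF Kt(1,3) k Q N] by blast
  have "nonsplit_set k Kt Q \<beta> \<gamma> = nonsplit_set k Kt Q (\<lambda>a Y. row_mult a \<Lambda>) (\<lambda>a Y. 0\<^sub>v 1)"
  proof (rule nonsplit_set_cong)
    fix a :: "real vec" and Y assume "a \<in> carrier_vec (dim_row Kt)" and Y: "Y \<in> skew_mats k"
    then have a: "a \<in> carrier_vec m" using dK by simp
    have "Y = 0\<^sub>m 1 1" using skew_one Y k1 by simp
    then show "\<beta> a Y = row_mult a \<Lambda> \<and> \<gamma> a Y = 0\<^sub>v 1" using L(2)[OF a] cocycle_one[OF m Q_zero N[unfolded k1] a] k1 by simp
  qed
  moreover have "\<Lambda> \<in> sq_mats m" "\<Lambda> = \<Lambda>\<^sup>T" using L(1) dK unfolding Lambda_condition_def by auto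
  ultimately show ?thesis using r by auto
qed

lemma M_sub: "M \<subseteq> sq_mats (n + 1)"
  using e_MASA_subset[OF K M] .

lemma nonsplit_one_one:
  assumes k1: "k = 1" and m1: "m = 1"
  shows "represented K M (kravchuk_metric k Kt) (nonsplit_set k Kt Q (\<lambda>a Y. 0\<^sub>v 1) (\<lambda>a Y. vec_of_list [a $ 0]))"
proof -
  obtain \<beta> \<gamma> where N: "normal_cocycle k m Q \<beta> \<gamma>" and r: "represented K M (kravchuk_metric k Kt) (nonsplit_set k Kt Q \<beta> \<gamma>)"
    using cocycle_ex .
  obtain \<Lambda> where L: "Lambda_condition k Kt Q \<Lambda>" "\<And>a. a \<in> carrier_vec m \<Longrightarrow> \<beta> a (0\<^sub>m k k) = row_mult a \<Lambda>"
    using cocycle_Lambda[OF Kt(1,3) k Q N] by blast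
  have Lc: "\<Lambda> \<in> sq_mats 1" using L(1) dK m1 unfolding Lambda_condition_def by auto
  obtain c where c: "c \<in> carrier_vec k" "\<And>a. a \<in> carrier_vec 1 \<Longrightarrow> Kt *\<^sub>v ((rows_mat k Q a)\<^sup>T *\<^sub>v c) = row_mult a \<Lambda>"
    using one_dim_coboundary[of Kt k Q \<Lambda>] Kt k Q_zero Lc m1 by auto
  have Y0: "Y = 0\<^sub>m k k" if "Y \<in> skew_mats k" for Y using skew_one that k1 by simp
  have \<beta>: "\<beta> a Y = Kt *\<^sub>v ((rows_mat k Q a)\<^sup>T *\<^sub>v c)" if "a \<in> carrier_vec m" "Y \<in> skew_mats k" for a Y
    using L(2)[OF that(1)] c(2)[of a] that m1 Y0 by simp
  define x where "x = \<gamma> (unit_vec 1 0) (0\<^sub>m k k) $ 0"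
  have \<gamma>: "\<gamma> a Y = vec_of_list [x * a $ 0]" if a: "a \<in> carrier_vec m" and Y: "Y \<in> skew_mats k" for a Y
  proof -
    have "a = a $ 0 \<cdot>\<^sub>v unit_vec 1 0" using a m1 by (intro eq_vecI) auto
    moreover have "s \<cdot>\<^sub>m 0\<^sub>m k k = (0\<^sub>m k k :: real mat)" for s by auto
    ultimately have "\<gamma> a Y = a $ 0 \<cdot>\<^sub>v \<gamma> (unit_vec 1 0) (0\<^sub>m k k)"
      using cocycleD(4)[OF N _ skew_zero, of "unit_vec 1 0" "a $ 0"] Y0[OF Y] m1 by simp
    moreover have "\<gamma> (unit_vec 1 0) (0\<^sub>m k k) \<in> carrier_vec 1" using cocycleD(2)[OF N _ skew_zero, of "unit_vec 1 0"] m1 k1 by simp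
    ultimately show ?thesis unfolding x_def by (intro eq_vecI) auto
  qed
  \<comment> \<open>\<beta> is the coboundary of \<open>c\<close>; if \<gamma> vanished as well,
    \<open>M\<close> would split.\<close>
  have x0: "x \<noteq> 0"
  proof
    assume x0: "x = 0"
    have "splitting K M"
    proof (rule coboundary_splitting[OF _ M Kt(1) r c(1) \<beta>])
      show "K \<in> sq_mats (k + m + k)" using K n_eq by simp
      show "\<gamma> a Y = 0\<^sub>v k" if "a \<in> carrier_vec m" "Y \<in> skew_mats k" for a Y
        unfolding \<gamma>[OF that] x0 k1 by (intro eq_vecI) auto
    qed
    then show False using ns by simp
  qed
  \<comment> \<open>The parameter a becomes g e a while \<gamma> is divided by g, so the normal form
    \<gamma> = a requires x = e g^2. The sign e is realized by the isometry \<open>E\<close> of the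
    middle block.\<close>
  define g where "g = sqrt \<bar>x\<bar>"
  have g: "g \<noteq> 0" "g * g = \<bar>x\<bar>" unfolding g_def using x0 by auto
  define e where "e = sgn x"
  have e: "e * e = 1" "e * \<bar>x\<bar> = x" unfolding e_def using x0 by (auto simp: sgn_if)
  define E where "E = e \<cdot>\<^sub>m (1\<^sub>m m :: real mat)"
  have E: "E \<in> sq_mats m" "E * E = 1\<^sub>m m" unfolding E_def using e
    by (auto simp: mat_dim_simps smult_smult_assoc intro!: eq_matI)
  have ET: "E\<^sup>T = E" unfolding E_def by (simp add: mat_dim_simps)
  have Ev: "E *\<^sub>v v = e \<cdot>\<^sub>v v" if "v \<in> carrier_vec m" for v unfolding E_def using that by (simp add: mat_simps)
  have EKE: "E * Kt * E\<^sup>T = Kt" unfolding ET unfolding E_def using Kt(1) e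
    by (intro eq_matI) (auto simp: mat_simps)
  have "represented (kravchuk_metric k Kt) (nonsplit_set k Kt Q \<beta> \<gamma>)
    (kravchuk_metric k (E * Kt * E\<^sup>T)) (nonsplit_set k (E * Kt * E\<^sup>T) Q (\<lambda>a Y. 0\<^sub>v 1) (\<lambda>a Y. vec_of_list [a $ 0]))"
  proof (rule nonsplit_transform[where ?G1.0 = "scale_mat k (\<lambda>_. g)" and ?H1.0 = "scale_mat k (\<lambda>_. 1 / g)"
        and ?G2.0 = E and ?H2.0 = E and c = c and \<phi> = "\<lambda>a. g \<cdot>\<^sub>v (E\<^sup>T *\<^sub>v a)", OF Kt(1) _ _ _ _ E(1) E(1) E(2) E(2) c(1)])
    show "scale_mat k (\<lambda>_. g) * scale_mat k (\<lambda>_. 1 / g) = 1\<^sub>m k" "scale_mat k (\<lambda>_. 1 / g) * scale_mat k (\<lambda>_. g) = 1\<^sub>m k"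
      using scale_mat_inverse[of k "\<lambda>_. g"] g by auto
    show "(\<lambda>a. g \<cdot>\<^sub>v (E\<^sup>T *\<^sub>v a)) ` carrier_vec m = carrier_vec m" by (rule scaled_transpose_onto[OF g(1) E(1) E(1) E(2) E(2)])
    fix a :: "real vec" assume a: "a \<in> carrier_vec m"
    show "rows_mat k Q (g \<cdot>\<^sub>v (E\<^sup>T *\<^sub>v a)) = scale_mat k (\<lambda>_. g) * rows_mat k Q a * E"
      by (rule rows_mat_diagonal[where g = "\<lambda>_. g", OF a g(1) E(1) E(1) E(2) E(2)])
         (use Q_carrier g E k1 Q_zero in auto)
    fix Y assume Y: "Y \<in> skew_mats k"
    show "\<beta> a Y \<in> carrier_vec m \<and> \<gamma> a Y \<in> carrier_vec k" using cocycleD(1,2)[OF N a Y] by simp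
    show "0\<^sub>v 1 = E *\<^sub>v (\<beta> a Y - Kt *\<^sub>v ((rows_mat k Q a)\<^sup>T *\<^sub>v c))"
    proof -
      have "\<beta> a Y - Kt *\<^sub>v ((rows_mat k Q a)\<^sup>T *\<^sub>v c) = 0\<^sub>v m" unfolding \<beta>[OF a Y] using Kt(1) by (intro eq_vecI) auto
      then show ?thesis using E(1) m1 by (simp add: mat_simps)
    qed
    have "(scale_mat k (\<lambda>_. 1 / g))\<^sup>T *\<^sub>v \<gamma> a Y = (1 / g) \<cdot>\<^sub>v \<gamma> a Y"
      unfolding scale_mat_transpose using cocycleD(2)[OF N a Y] by (intro eq_vecI) (auto simp del: index_mult_mat_vec simp: scale_mat_mult_vec)
    also have "\<dots> = vec_of_list [(g \<cdot>\<^sub>v (E\<^sup>T *\<^sub>v a)) $ 0]"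
    proof -
      have "(g \<cdot>\<^sub>v (E\<^sup>T *\<^sub>v a)) $ 0 = g * (e * a $ 0)" unfolding ET Ev[OF a] using a m1 by simp
      also have "\<dots> = (1 / g) * (x * a $ 0)" using g e by (simp add: field_simps)
      finally show ?thesis unfolding \<gamma>[OF a Y] by (intro eq_vecI) auto
    qed
    finally show "vec_of_list [(g \<cdot>\<^sub>v (E\<^sup>T *\<^sub>v a)) $ 0] = (scale_mat k (\<lambda>_. 1 / g))\<^sup>T *\<^sub>v \<gamma> a Y" by simp
  qed auto
  then have "represented (kravchuk_metric k Kt) (nonsplit_set k Kt Q \<beta> \<gamma>)
    (kravchuk_metric k Kt) (nonsplit_set k Kt Q (\<lambda>a Y. 0\<^sub>v 1) (\<lambda>a Y. vec_of_list [a $ 0]))" unfolding EKE .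
  then show ?thesis using represented_trans[OF K M_sub r] by blast
qed

lemma nonsplit_two_one:
  assumes k2: "k = 2" and m1: "m = 1"
  shows "\<exists>\<rho> p\<^sub>2. (\<rho>, p\<^sub>2) \<in> {(1, 0), (0, 1), (1, 1)} \<and> represented K M (kravchuk_metric k Kt)
    (nonsplit_set k Kt Q (\<lambda>a Y. vec_of_list [Y $$ (0, 1) * \<rho>])
       (\<lambda>a Y. vec_of_list [0, a $ 0 * \<rho> + p\<^sub>2 * Y $$ (0, 1)]))"
proof -
  obtain \<beta> \<gamma> where N: "normal_cocycle k m Q \<beta> \<gamma>" and r: "represented K M (kravchuk_metric k Kt) (nonsplit_set k Kt Q \<beta> \<gamma>)"
    using cocycle_ex .
  obtain \<Lambda> where L: "Lambda_condition k Kt Q \<Lambda>" "\<And>a. a \<in> carrier_vec m \<Longrightarrow> \<beta> a (0\<^sub>m k k) = row_mult a \<Lambda>"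
    using cocycle_Lambda[OF Kt(1,3) k Q N] by blast
  have Lc: "\<Lambda> \<in> sq_mats 1" using L(1) dK m1 unfolding Lambda_condition_def by auto
  obtain c where c: "c \<in> carrier_vec k" "\<And>a. a \<in> carrier_vec 1 \<Longrightarrow> Kt *\<^sub>v ((rows_mat k Q a)\<^sup>T *\<^sub>v c) = row_mult a \<Lambda>"
    using one_dim_coboundary[of Kt k Q \<Lambda>] Kt k Q_zero Lc m1 by auto
  \<comment> \<open>In size 1 the trace condition leaves only 0.\<close>
  have Q1: "Q 1 = 0\<^sub>m 1 1" using free_rowed_matricesD(4)[OF Q Kt(1), of 1] Q_carrier[of 1] k2 m1 by (intro eq_matI) auto
  define v where "v = \<beta> (0\<^sub>v m) (skew_unit 2 0 1)"
  define p where "p = \<gamma> (0\<^sub>v m) (skew_unit 2 0 1)"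
  have Q2: "\<And>i. i < 2 \<Longrightarrow> Q i \<in> sq_mats m" using Q_carrier k2 by simp
  note T = cocycle_two[where Q = Q, OF Q2 Q_zero N[unfolded k2] v_def p_def]
  have vp: "v \<in> carrier_vec 1" "p \<in> carrier_vec 2" using T(5,6)[OF _ zero_carrier_vec skew_zero] m1 by auto
  have p0: "p $ 0 = 0"
  proof -
    have "p $ 0 \<cdot>\<^sub>v unit_vec 1 0 + p $ 1 \<cdot>\<^sub>v ((Q 1)\<^sup>T *\<^sub>v unit_vec 1 0) = (0\<^sub>v 1 :: real vec)"
      using T(4)[OF _ _ skew_zero, of "unit_vec 1 0"] m1 by simp
    from arg_cong[OF this, of "\<lambda>x. x $ 0"] show ?thesis unfolding Q1 by (simp add: mat_dim_simps)
  qed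
  define \<rho> where "\<rho> = v $ 0"
  define q where "q = p $ 1"
  have \<beta>: "\<beta> a Y - Kt *\<^sub>v ((rows_mat k Q a)\<^sup>T *\<^sub>v c) = vec_of_list [Y $$ (0, 1) * \<rho>]"
    if a: "a \<in> carrier_vec m" and Y: "Y \<in> skew_mats k" for a Y
  proof -
    have "\<beta> a Y = row_mult a \<Lambda> + Y $$ (0, 1) \<cdot>\<^sub>v v" using T(1)[OF _ a, of Y] L(2)[OF a] Y k2 by simp
    then have "\<beta> a Y - Kt *\<^sub>v ((rows_mat k Q a)\<^sup>T *\<^sub>v c) = row_mult a \<Lambda> + Y $$ (0, 1) \<cdot>\<^sub>v v - row_mult a \<Lambda>"
      using c(2)[of a] a m1 by simp
    then show ?thesis using vp Lc unfolding \<rho>_def row_mult_def by (intro eq_vecI) (auto simp: m1)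
  qed
  have \<gamma>: "\<gamma> a Y = vec_of_list [0, a $ 0 * \<rho> + q * Y $$ (0, 1)]"
    if a: "a \<in> carrier_vec m" and Y: "Y \<in> skew_mats k" for a Y
  proof -
    have g0: "\<gamma> a Y $ 0 = 0" using T(2)[OF _ a, of Y] Y k2 p0 a m1 vp unfolding Q1 by (simp add: mat_simps)
    have "a \<bullet> v = a $ 0 * \<rho>" unfolding \<rho>_def using a vp m1 by (simp add: scalar_prod_def)
    then have g1: "\<gamma> a Y $ 1 = a $ 0 * \<rho> + q * Y $$ (0, 1)" using T(3)[OF _ a, of Y] Y k2 unfolding q_def by simp
    have "\<gamma> a Y \<in> carrier_vec 2" using cocycleD(2)[OF N a Y] k2 by simp
    then show ?thesis using g0 g1 by (intro eq_vecI) (auto simp: less_Suc_eq)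
  qed
  \<comment> \<open>If both vanished, \<gamma> would be 0 and \<beta> the coboundary of
    \<open>c\<close>, so \<open>M\<close> would split.\<close>
  have nz: "\<rho> \<noteq> 0 \<or> q \<noteq> 0"
  proof (rule ccontr)
    assume "\<not> (\<rho> \<noteq> 0 \<or> q \<noteq> 0)"
    then have z: "\<rho> = 0" "q = 0" by auto
    have "splitting K M"
    proof (rule coboundary_splitting[OF _ M Kt(1) r c(1)])
      show "K \<in> sq_mats (k + m + k)" using K n_eq by simp
      fix a :: "real vec" and Y assume h: "a \<in> carrier_vec m" "Y \<in> skew_mats k"
      show "\<gamma> a Y = 0\<^sub>v k" unfolding \<gamma>[OF h] z k2 by (intro eq_vecI) (auto simp: less_2_cases_iff)
      have "\<beta> a Y - Kt *\<^sub>v ((rows_mat k Q a)\<^sup>T *\<^sub>v c) = 0\<^sub>v 1" unfolding \<beta>[OF h] z by (intro eq_vecI) auto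
      then have e: "(\<beta> a Y - Kt *\<^sub>v ((rows_mat k Q a)\<^sup>T *\<^sub>v c)) $ 0 = 0" by simp
      show "\<beta> a Y = Kt *\<^sub>v ((rows_mat k Q a)\<^sup>T *\<^sub>v c)"
        using e cocycleD(1)[OF N h] Kt(1) by (intro eq_vecI) (auto simp: m1)
    qed
    then show False using ns by simp
  qed
  \<comment> \<open>Scaling by diag(g, h) sends y to g h y and a to g a, and divides the second
    entry of \<gamma> by h; hence the last two equations. The three normalized pairs correspond to
    which of \<rho> and q vanish.\<close>
  obtain g h \<rho>' p' where gh: "g \<noteq> 0" "h \<noteq> 0" "(\<rho>', p') \<in> {(1, 0), (0, 1), (1, 1 :: real)}" "\<rho> = g * h * \<rho>'" "q = g * h * h * p'"
  proof (cases "\<rho> = 0")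
    case True
    then show ?thesis using nz that[of q 1 0 1] by simp
  next
    case False
    show ?thesis
    proof (cases "q = 0")
      case True
      then show ?thesis using False that[of \<rho> 1 1 0] by simp
    next
      case q: False
      show ?thesis using False q that[of "\<rho> * \<rho> / q" "q / \<rho>" 1 1] by simp
    qed
  qed
  let ?g = "\<lambda>i::nat. if i = 0 then g else h :: real"
  have gnz: "?g i \<noteq> 0" for i :: nat using gh by simp
  have one: "(1\<^sub>m m :: real mat) \<in> sq_mats m" "1\<^sub>m m * 1\<^sub>m m = (1\<^sub>m m :: real mat)" by auto
  have "represented (kravchuk_metric k Kt) (nonsplit_set k Kt Q \<beta> \<gamma>)
    (kravchuk_metric k (1\<^sub>m m * Kt * (1\<^sub>m m)\<^sup>T)) (nonsplit_set k (1\<^sub>m m * Kt * (1\<^sub>m m)\<^sup>T) Q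
       (\<lambda>a Y. vec_of_list [Y $$ (0, 1) * \<rho>']) (\<lambda>a Y. vec_of_list [0, a $ 0 * \<rho>' + p' * Y $$ (0, 1)]))"
  proof (rule nonsplit_transform[where ?G1.0 = "scale_mat k ?g" and ?H1.0 = "scale_mat k (\<lambda>i. 1 / ?g i)"
        and ?G2.0 = "1\<^sub>m m" and ?H2.0 = "1\<^sub>m m" and c = c and \<phi> = "\<lambda>a. ?g 0 \<cdot>\<^sub>v ((1\<^sub>m m)\<^sup>T *\<^sub>v a)", OF Kt(1) _ _ _ _ one(1,1,2,2) c(1)])
    show "scale_mat k ?g * scale_mat k (\<lambda>i. 1 / ?g i) = 1\<^sub>m k" "scale_mat k (\<lambda>i. 1 / ?g i) * scale_mat k ?g = 1\<^sub>m k"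
      using scale_mat_inverse[of k ?g] gnz by blast+
    show "(\<lambda>a. ?g 0 \<cdot>\<^sub>v ((1\<^sub>m m)\<^sup>T *\<^sub>v a)) ` carrier_vec m = carrier_vec m"
      by (rule scaled_transpose_onto[OF _ one(1,1,2,2)]) (use gh(1) in simp)
    fix a :: "real vec" assume a: "a \<in> carrier_vec m"
    show "rows_mat k Q (?g 0 \<cdot>\<^sub>v ((1\<^sub>m m)\<^sup>T *\<^sub>v a)) = scale_mat k ?g * rows_mat k Q a * 1\<^sub>m m"
    proof (rule rows_mat_diagonal[where g = ?g, OF a gnz one(1,1,2,2)])
      show "Q i = (?g i / ?g 0) \<cdot>\<^sub>m (1\<^sub>m m * Q i * 1\<^sub>m m)" if "i < k" for i
      proof (cases "i = 0")
        case True
        then show ?thesis using Q_zero gh by (intro eq_matI) auto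
      next
        case False
        then have "Q i = 0\<^sub>m 1 1" using that k2 Q1 by (auto simp: less_2_cases_iff)
        then show ?thesis using m1 by (intro eq_matI) auto
      qed
    qed (rule Q_carrier)
    fix Y assume Y: "Y \<in> skew_mats k"
    have Yc: "Y \<in> sq_mats 2" using skew_carrier[OF Y] k2 by simp
    show "\<beta> a Y \<in> carrier_vec m \<and> \<gamma> a Y \<in> carrier_vec k" using cocycleD(1,2)[OF N a Y] by simp
    have Y01: "(scale_mat k ?g * Y * (scale_mat k ?g)\<^sup>T) $$ (0, 1) = g * h * Y $$ (0, 1)"
      unfolding scale_mat_transpose k2 using Yc
      by (simp add: scale_mat_def scalar_prod_def numeral_2_eq_2)
    have \<phi>0: "(?g 0 \<cdot>\<^sub>v ((1\<^sub>m m)\<^sup>T *\<^sub>v a)) $ 0 = g * a $ 0" using a m1 by (simp add: mat_dim_simps)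
    show "vec_of_list [(scale_mat k ?g * Y * (scale_mat k ?g)\<^sup>T) $$ (0, 1) * \<rho>'] =
      1\<^sub>m m *\<^sub>v (\<beta> a Y - Kt *\<^sub>v ((rows_mat k Q a)\<^sup>T *\<^sub>v c))"
      unfolding \<beta>[OF a Y] Y01 using gh(4) m1 by (simp add: mat_dim_simps)
    show "vec_of_list [0, (?g 0 \<cdot>\<^sub>v ((1\<^sub>m m)\<^sup>T *\<^sub>v a)) $ 0 * \<rho>' + p' * (scale_mat k ?g * Y * (scale_mat k ?g)\<^sup>T) $$ (0, 1)] =
      (scale_mat k (\<lambda>i. 1 / ?g i))\<^sup>T *\<^sub>v \<gamma> a Y" (is "?l = ?r")
    proof (rule eq_vecI)
      fix i assume "i < dim_vec ?r"
      then have i: "i < 2" using k2 by simp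
      have gc: "\<gamma> a Y \<in> carrier_vec 2" using cocycleD(2)[OF N a Y] k2 by simp
      have rr: "?r $ i = 1 / ?g i * \<gamma> a Y $ i" unfolding scale_mat_transpose k2 by (rule scale_mat_mult_vec[OF gc i])
      have "i = 0 \<or> i = 1" using i by auto
      then have "?l $ i = 1 / ?g i * \<gamma> a Y $ i" unfolding \<phi>0 Y01 \<gamma>[OF a Y] using gh(1,2,4,5) by (elim disjE) (simp_all add: field_simps)
      then show "?l $ i = ?r $ i" using rr by simp
    qed (simp add: k2)
  qed auto
  moreover have "1\<^sub>m m * Kt * (1\<^sub>m m)\<^sup>T = Kt" using Kt(1) by (simp add: mat_dim_simps)
  ultimately have "represented (kravchuk_metric k Kt) (nonsplit_set k Kt Q \<beta> \<gamma>) (kravchuk_metric k Kt)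
     (nonsplit_set k Kt Q (\<lambda>a Y. vec_of_list [Y $$ (0, 1) * \<rho>']) (\<lambda>a Y. vec_of_list [0, a $ 0 * \<rho>' + p' * Y $$ (0, 1)]))" by simp
  then show ?thesis using represented_trans[OF K M_sub r] gh(3) by blast
qed

lemma nonsplit_two_zero:
  assumes k2: "k = 2" and m0: "m = 0"
  shows "represented K M (kravchuk_metric k Kt) (nonsplit_set k Kt Q (\<lambda>a Y. 0\<^sub>v 0) (\<lambda>a Y. vec_of_list [Y $$ (0, 1), 0]))"
proof -
  obtain \<beta> \<gamma> where N: "normal_cocycle k m Q \<beta> \<gamma>" and r: "represented K M (kravchuk_metric k Kt) (nonsplit_set k Kt Q \<beta> \<gamma>)"
    using cocycle_ex .
  define v where "v = \<beta> (0\<^sub>v m) (skew_unit 2 0 1)"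
  define p where "p = \<gamma> (0\<^sub>v m) (skew_unit 2 0 1)"
  have Q2: "\<And>i. i < 2 \<Longrightarrow> Q i \<in> sq_mats m" using Q_carrier k2 by simp
  note T = cocycle_two[where Q = Q, OF Q2 Q_zero N[unfolded k2] v_def p_def]
  have vp: "v \<in> carrier_vec 0" "p \<in> carrier_vec 2" using T(5,6)[OF _ zero_carrier_vec skew_zero] m0 by auto
  have v0: "x = y" if "x \<in> carrier_vec 0" "y \<in> carrier_vec 0" for x y :: "real vec" using that by auto
  have \<gamma>: "\<gamma> a Y = Y $$ (0, 1) \<cdot>\<^sub>v p" if a: "a \<in> carrier_vec m" and Y: "Y \<in> skew_mats k" for a Y
  proof -
    have z: "a \<bullet> w = 0" if "w \<in> carrier_vec 0" for w using that by (simp add: scalar_prod_def)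
    have "Q 1 *\<^sub>v v \<in> carrier_vec 0" using Q2[of 1] m0 by (intro carrier_vecI) auto
    then have "\<gamma> a Y $ 0 = Y $$ (0, 1) * p $ 0" "\<gamma> a Y $ 1 = Y $$ (0, 1) * p $ 1"
      using T(2,3)[OF _ a, of Y] Y k2 z vp by simp_all
    moreover have "\<gamma> a Y \<in> carrier_vec 2" using cocycleD(2)[OF N a Y] k2 by simp
    ultimately show ?thesis using vp by (intro eq_vecI) (auto simp: less_2_cases_iff)
  qed
  have pz: "p $ 0 \<noteq> 0 \<or> p $ 1 \<noteq> 0"
  proof (rule ccontr)
    assume "\<not> (p $ 0 \<noteq> 0 \<or> p $ 1 \<noteq> 0)"
    then have p0: "p = 0\<^sub>v 2" using vp by (intro eq_vecI) (auto simp: less_2_cases_iff)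
    have "splitting K M"
    proof (rule coboundary_splitting[OF _ M Kt(1) r zero_carrier_vec])
      show "K \<in> sq_mats (k + m + k)" using K n_eq by simp
      fix a :: "real vec" and Y assume h: "a \<in> carrier_vec m" "Y \<in> skew_mats k"
      show "\<gamma> a Y = 0\<^sub>v k" unfolding \<gamma>[OF h] p0 k2 by auto
      show "\<beta> a Y = Kt *\<^sub>v ((rows_mat k Q a)\<^sup>T *\<^sub>v 0\<^sub>v k)"
        by (rule v0) (use cocycleD(1)[OF N h] Kt(1) m0 in \<open>auto intro!: carrier_vecI\<close>)
    qed
    then show False using ns by simp
  qed
  define d where "d = p $ 0 * p $ 0 + p $ 1 * p $ 1"
  have d: "d \<noteq> 0" unfolding d_def using pz by (metis add_nonneg_eq_0_iff mult_eq_0_iff zero_le_square)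
  \<comment> \<open>The first row is p and the second is p turned by a right angle, divided by its
    square length, so that the determinant is 1. Hence G Y G^T = Y for skew Y of size 2, while the
    inverse transpose of \<open>G\<close> maps p to the first unit vector.\<close>
  define G where "G = mat_of_rows_list 2 [[p $ 0, p $ 1], [- p $ 1 / d, p $ 0 / d]]"
  define H where "H = mat_of_rows_list 2 [[p $ 0 / d, - p $ 1], [p $ 1 / d, p $ 0]]"
  have Gc: "G \<in> sq_mats 2" "H \<in> sq_mats 2" unfolding G_def H_def mat_of_rows_list_def by auto
  have Ge: "G $$ (0, 0) = p $ 0" "G $$ (0, 1) = p $ 1" "G $$ (1, 0) = - p $ 1 / d" "G $$ (1, 1) = p $ 0 / d"
    "H $$ (0, 0) = p $ 0 / d" "H $$ (0, 1) = - p $ 1" "H $$ (1, 0) = p $ 1 / d" "H $$ (1, 1) = p $ 0"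
    unfolding G_def H_def mat_of_rows_list_def by auto
  have m2: "(A * B) $$ (i, j) = A $$ (i, 0) * B $$ (0, j) + A $$ (i, 1) * B $$ (1, j)"
    if "A \<in> sq_mats 2" "B \<in> sq_mats 2" "i < 2" "j < 2" for A B :: "real mat" and i j
    using that by (simp add: scalar_prod_def numeral_2_eq_2)
  have GH: "G * H = 1\<^sub>m 2"
  proof (rule eq_matI)
    fix i j assume "i < dim_row (1\<^sub>m 2 :: real mat)" "j < dim_col (1\<^sub>m 2 :: real mat)"
    then have ij: "i < 2" "j < 2" by auto
    have "(G * H) $$ (i, j) = G $$ (i, 0) * H $$ (0, j) + G $$ (i, 1) * H $$ (1, j)" using m2[OF Gc ij] .
    moreover have "i = 0 \<or> i = 1" "j = 0 \<or> j = 1" using ij by auto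
    moreover have "p $ 0 * p $ 0 + p $ 1 * p $ 1 = d" unfolding d_def ..
    ultimately show "(G * H) $$ (i, j) = 1\<^sub>m 2 $$ (i, j)" using d
      by (elim disjE; simp only: Ge; simp add: field_simps)
  qed (use Gc in auto)
  have HG: "H * G = 1\<^sub>m 2" using left_inverse_imp_right_inverse[OF Gc(2,1) GH] .
  have one: "(1\<^sub>m m :: real mat) \<in> sq_mats m" "1\<^sub>m m * 1\<^sub>m m = (1\<^sub>m m :: real mat)" by auto
  have "represented (kravchuk_metric k Kt) (nonsplit_set k Kt Q \<beta> \<gamma>)
    (kravchuk_metric k (1\<^sub>m m * Kt * (1\<^sub>m m)\<^sup>T)) (nonsplit_set k (1\<^sub>m m * Kt * (1\<^sub>m m)\<^sup>T) Q
       (\<lambda>a Y. 0\<^sub>v 0) (\<lambda>a Y. vec_of_list [Y $$ (0, 1), 0]))"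
  proof (rule nonsplit_transform[where ?G1.0 = G and ?H1.0 = H
        and ?G2.0 = "1\<^sub>m m" and ?H2.0 = "1\<^sub>m m" and c = "0\<^sub>v k" and \<phi> = "\<lambda>a. a", OF Kt(1) _ _ _ _ one(1,1,2,2)])
    fix a :: "real vec" assume a: "a \<in> carrier_vec m"
    show "rows_mat k Q a = G * rows_mat k Q a * 1\<^sub>m m" using rows_mat_carrier[OF a, of k Q] m0 Gc k2 by (intro eq_matI) auto
    fix Y assume Y: "Y \<in> skew_mats k"
    show "\<beta> a Y \<in> carrier_vec m \<and> \<gamma> a Y \<in> carrier_vec k" using cocycleD(1,2)[OF N a Y] by simp
    show "0\<^sub>v 0 = 1\<^sub>m m *\<^sub>v (\<beta> a Y - Kt *\<^sub>v ((rows_mat k Q a)\<^sup>T *\<^sub>v 0\<^sub>v k))" by (rule v0) (auto intro!: carrier_vecI simp: m0)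
    have Yc: "Y \<in> sq_mats 2" using skew_carrier[OF Y] k2 by simp
    define y where "y = Y $$ (0, 1)"
    have Ye: "Y = y \<cdot>\<^sub>m skew_unit 2 0 1" unfolding y_def using skew_two Y k2 by simp
    have Y2: "Y $$ (0, 0) = 0" "Y $$ (0, 1) = y" "Y $$ (1, 0) = - y" "Y $$ (1, 1) = 0"
      unfolding Ye by (auto simp: skew_unit_def)
    have "(G * Y * G\<^sup>T) $$ (0, 1) = (G * Y) $$ (0, 0) * G\<^sup>T $$ (0, 1) + (G * Y) $$ (0, 1) * G\<^sup>T $$ (1, 1)"
      using Gc Yc by (intro m2) auto
    also have "\<dots> = - p $ 1 * y * (- p $ 1 / d) + p $ 0 * y * (p $ 0 / d)"
      using Gc Yc by (simp del: index_mult_mat(1) add: m2 Y2 Ge Y2[unfolded One_nat_def] Ge[unfolded One_nat_def])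
    also have "\<dots> = y * (p $ 0 * p $ 0 + p $ 1 * p $ 1) / d" by (simp add: add_divide_distrib algebra_simps)
    also have "\<dots> = y" unfolding d_def[symmetric] using d by simp
    finally have GY: "(G * Y * G\<^sup>T) $$ (0, 1) = y" .
    show "vec_of_list [(G * Y * G\<^sup>T) $$ (0, 1), 0] = H\<^sup>T *\<^sub>v \<gamma> a Y" (is "_ = ?r")
    proof (rule eq_vecI)
      fix i assume "i < dim_vec ?r"
      then have i: "i < 2" using Gc by simp
      have rr: "?r $ i = H $$ (0, i) * (y * p $ 0) + H $$ (1, i) * (y * p $ 1)" unfolding \<gamma>[OF a Y] using i Gc vp
        by (simp add: scalar_prod_def numeral_2_eq_2 y_def)
      have "p $ 0 / d * (y * p $ 0) + p $ 1 / d * (y * p $ 1) = y * (p $ 0 * p $ 0 + p $ 1 * p $ 1) / d"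
        by (simp add: add_divide_distrib algebra_simps)
      also have "\<dots> = y" unfolding d_def[symmetric] using d by simp
      finally have y: "p $ 0 / d * (y * p $ 0) + p $ 1 / d * (y * p $ 1) = y" .
      have "i = 0 \<or> i = 1" using i by auto
      then show "vec_of_list [(G * Y * G\<^sup>T) $$ (0, 1), 0] $ i = ?r $ i" unfolding GY rr
        by (elim disjE; simp only: Ge y; simp)
    qed (use Gc in simp)
  qed (use Gc GH HG k2 in auto)
  moreover have "1\<^sub>m m * Kt * (1\<^sub>m m)\<^sup>T = Kt" using Kt(1) by (simp add: mat_dim_simps)
  ultimately have "represented (kravchuk_metric k Kt) (nonsplit_set k Kt Q \<beta> \<gamma>) (kravchuk_metric k Kt)
     (nonsplit_set k Kt Q (\<lambda>a Y. 0\<^sub>v 0) (\<lambda>a Y. vec_of_list [Y $$ (0, 1), 0]))" by simp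
  then show ?thesis using represented_trans[OF K M_sub r] by blast
qed

end

subsection \<open>Signature and congruence\<close>

text \<open>A complex eigenvalue exists by the fundamental theorem of algebra. It is real because
  the Hermitian form of a symmetric real matrix takes real values. As a real root of the
  characteristic polynomial it has a real eigenvector.\<close>

lemma symmetric_real_eigenvector:
  assumes K: "K \<in> sq_mats n" "K\<^sup>T = K" and n: "n > 0"
  shows "\<exists>v l. v \<in> carrier_vec n \<and> v \<bullet> v = 1 \<and> K *\<^sub>v v = l \<cdot>\<^sub>v (v :: real vec)"
proof -
  let ?C = "map_mat complex_of_real K"
  have C: "?C \<in> sq_mats n" using K by auto
  have "degree (char_poly ?C) = n" using degree_monic_char_poly[OF C] by simp
  then have "\<not> constant (poly (char_poly ?C))" using n by (simp add: constant_degree)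
  then obtain \<mu> where \<mu>: "poly (char_poly ?C) \<mu> = 0" using fundamental_theorem_of_algebra by blast
  then have "eigenvalue ?C \<mu>" using eigenvalue_root_char_poly[OF C] by simp
  then obtain x where x: "x \<in> carrier_vec n" "x \<noteq> 0\<^sub>v n" "?C *\<^sub>v x = \<mu> \<cdot>\<^sub>v x"
    using C unfolding eigenvalue_def eigenvector_def by auto
  have sym: "K $$ (i, j) = K $$ (j, i)" if "i < n" "j < n" for i j
    using arg_cong[OF K(2), of "\<lambda>M. M $$ (j, i)"] K(1) that by simp
  have Cx: "(\<Sum>j = 0..<n. complex_of_real (K $$ (i, j)) * x $ j) = \<mu> * x $ i" if i: "i < n" for i
    using arg_cong[OF x(3), of "\<lambda>v. v $ i"] i K(1) x(1) by (simp add: scalar_prod_def)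
  \<comment> \<open>The square norm of x, and next the value of the Hermitian form at x. Both are
    real and t = \<mu> s, so \<mu> is real.\<close>
  define s where "s = (\<Sum>i = 0..<n. cnj (x $ i) * x $ i)"
  define t where "t = (\<Sum>i = 0..<n. \<Sum>j = 0..<n. cnj (x $ i) * complex_of_real (K $$ (i, j)) * x $ j)"
  have "t = (\<Sum>i = 0..<n. cnj (x $ i) * (\<Sum>j = 0..<n. complex_of_real (K $$ (i, j)) * x $ j))"
    unfolding t_def by (simp add: sum_distrib_left mult.assoc)
  also have "\<dots> = (\<Sum>i = 0..<n. \<mu> * (cnj (x $ i) * x $ i))" by (intro sum.cong) (auto simp: Cx)
  also have "\<dots> = \<mu> * s" unfolding s_def by (simp add: sum_distrib_left)
  finally have t: "t = \<mu> * s" .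
  have "cnj t = (\<Sum>i = 0..<n. \<Sum>j = 0..<n. x $ i * complex_of_real (K $$ (i, j)) * cnj (x $ j))"
    unfolding t_def by simp
  also have "\<dots> = (\<Sum>j = 0..<n. \<Sum>i = 0..<n. x $ i * complex_of_real (K $$ (i, j)) * cnj (x $ j))"
    by (rule sum.swap)
  also have "\<dots> = t" unfolding t_def
  proof (intro sum.cong refl)
    fix i j assume "i \<in> {0..<n}" "j \<in> {0..<n}"
    then show "x $ j * complex_of_real (K $$ (j, i)) * cnj (x $ i) = cnj (x $ i) * complex_of_real (K $$ (i, j)) * x $ j"
      using sym[of i j] by simp
  qed
  finally have ct: "cnj t = t" .
  have s: "s = complex_of_real (\<Sum>i = 0..<n. (cmod (x $ i))\<^sup>2)"
    unfolding s_def by (simp add: complex_norm_square mult.commute del: of_real_power)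
  obtain i where i: "i < n" "x $ i \<noteq> 0" using x(1,2) by (metis carrier_vecD eq_vecI index_zero_vec)
  have "(\<Sum>i = 0..<n. (cmod (x $ i))\<^sup>2) > 0"
    by (rule sum_pos2[of _ i]) (use i in auto)
  then have "s \<noteq> 0" "cnj s = s" unfolding s by (simp_all del: of_real_sum)
  then have "cnj \<mu> = \<mu>" using ct t by simp
  then have \<mu>r: "\<mu> = complex_of_real (Re \<mu>)" by (simp add: complex_eq_iff)
  have "poly (map_poly complex_of_real (char_poly K)) (complex_of_real (Re \<mu>)) = 0"
    using \<mu> \<mu>r of_real_hom.char_poly_hom[OF K(1), where 'a = complex] by simp
  then have "complex_of_real (poly (char_poly K) (Re \<mu>)) = 0" by (metis of_real_hom.poly_map_poly)
  then have "eigenvalue K (Re \<mu>)" using eigenvalue_root_char_poly[OF K(1)] by simp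
  then obtain w where w: "w \<in> carrier_vec n" "w \<noteq> 0\<^sub>v n" "K *\<^sub>v w = Re \<mu> \<cdot>\<^sub>v w"
    using K unfolding eigenvalue_def eigenvector_def by auto
  have ww: "w \<bullet> w > 0"
  proof -
    obtain i where i: "i < n" "w $ i \<noteq> 0" using w(1,2) by (metis carrier_vecD eq_vecI index_zero_vec)
    have "w \<bullet> w = (\<Sum>i = 0..<n. w $ i * w $ i)" using w(1) by (simp add: scalar_prod_def)
    also have "\<dots> > 0" by (rule sum_pos2[of _ i]) (use i in \<open>auto simp: zero_less_mult_iff\<close>)
    finally show ?thesis .
  qed
  define r where "r = 1 / sqrt (w \<bullet> w)"
  have "(r \<cdot>\<^sub>v w) \<bullet> (r \<cdot>\<^sub>v w) = r * r * (w \<bullet> w)" using w(1) by (simp add: scalar_prod_def sum_distrib_left ac_simps)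
  also have "\<dots> = 1" unfolding r_def using ww by (simp add: real_sqrt_mult_self)
  finally have "(r \<cdot>\<^sub>v w) \<bullet> (r \<cdot>\<^sub>v w) = 1" .
  moreover have "K *\<^sub>v (r \<cdot>\<^sub>v w) = Re \<mu> \<cdot>\<^sub>v (r \<cdot>\<^sub>v w)" using K(1) w by (simp add: mat_simps smult_smult_assoc mult.commute)
  ultimately show ?thesis using w(1) by (intro exI[of _ "r \<cdot>\<^sub>v w"] exI[of _ "Re \<mu>"]) auto
qed

lemma scalar_prod_self_zero:
  assumes "w \<in> carrier_vec n" "w \<bullet> w = (0 :: real)"
  shows "w = 0\<^sub>v n"
proof -
  have "\<forall>i\<in>{0..<n}. w $ i * w $ i = 0"
    using assms by (subst sum_nonneg_eq_0_iff[symmetric]) (auto simp: scalar_prod_def)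
  then show ?thesis using assms(1) by (intro eq_vecI) auto
qed

text \<open>The reflection in the hyperplane orthogonal to u - e_0 exchanges the two unit vectors;
  if they coincide, the identity serves.\<close>

lemma householder:
  assumes u: "u \<in> carrier_vec n" "u \<bullet> u = 1" and n: "n > 0"
  shows "\<exists>H \<in> sq_mats n. H\<^sup>T = H \<and> H * H = 1\<^sub>m n \<and> H *\<^sub>v unit_vec n 0 = (u :: real vec)"
proof (cases "u = unit_vec n 0")
  case True
  then show ?thesis by (intro bexI[of _ "1\<^sub>m n"]) (auto simp: mat_dim_simps)
next
  case False
  define w where "w = u - unit_vec n 0"
  have w: "w \<in> carrier_vec n" unfolding w_def using u by auto
  have "w \<noteq> 0\<^sub>v n"
  proof
    assume "w = 0\<^sub>v n"
    then have "w $ i = 0" if "i < n" for i using that by simp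
    then have "u = unit_vec n 0" unfolding w_def using u by (intro eq_vecI) auto
    then show False using False by simp
  qed
  then have ww: "w \<bullet> w \<noteq> 0" using scalar_prod_self_zero[OF w] by auto
  define H where "H = mat n n (\<lambda>(i, j). (if i = j then 1 else 0) - 2 * w $ i * w $ j / (w \<bullet> w))"
  have H: "H \<in> sq_mats n" unfolding H_def by simp
  have HT: "H\<^sup>T = H" unfolding H_def by (intro eq_matI) auto
  have Hv: "H *\<^sub>v x = x - (2 * (w \<bullet> x) / (w \<bullet> w)) \<cdot>\<^sub>v w" if x: "x \<in> carrier_vec n" for x
  proof (rule eq_vecI)
    fix i assume "i < dim_vec (x - (2 * (w \<bullet> x) / (w \<bullet> w)) \<cdot>\<^sub>v w)"
    then have i: "i < n" using w by simp
    have "(H *\<^sub>v x) $ i = (\<Sum>j = 0..<n. ((if i = j then 1 else 0) - 2 * w $ i * w $ j / (w \<bullet> w)) * x $ j)"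
      unfolding mult_vec_index[OF H x i] using i by (intro sum.cong) (auto simp: H_def)
    also have "\<dots> = (\<Sum>j = 0..<n. (if i = j then x $ j else 0)) - (\<Sum>j = 0..<n. 2 * w $ i / (w \<bullet> w) * (w $ j * x $ j))"
      unfolding sum_subtractf[symmetric] by (intro sum.cong) (auto simp: algebra_simps)
    also have "(\<Sum>j = 0..<n. (if i = j then x $ j else 0)) = x $ i" using i by simp
    also have "(\<Sum>j = 0..<n. 2 * w $ i / (w \<bullet> w) * (w $ j * x $ j)) = 2 * w $ i / (w \<bullet> w) * (w \<bullet> x)"
      unfolding sum_distrib_left[symmetric] using x by (simp add: scalar_prod_def)
    finally show "(H *\<^sub>v x) $ i = (x - (2 * (w \<bullet> x) / (w \<bullet> w)) \<cdot>\<^sub>v w) $ i" using i x w by simp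
  qed (use H x w in auto)
  have HH: "H * H = 1\<^sub>m n"
  proof (rule mat_eq_by_vec[of _ n n])
    fix x :: "real vec" assume x: "x \<in> carrier_vec n"
    define a where "a = 2 * (w \<bullet> x) / (w \<bullet> w)"
    have Hx: "H *\<^sub>v x = x - a \<cdot>\<^sub>v w" unfolding a_def using Hv[OF x] .
    have xc: "x - a \<cdot>\<^sub>v w \<in> carrier_vec n" using x w by auto
    have "w \<bullet> (x - a \<cdot>\<^sub>v w) = w \<bullet> x - a * (w \<bullet> w)" using x w by (simp add: scalar_prod_minus_distrib[of _ n])
    also have "\<dots> = - (w \<bullet> x)" unfolding a_def using ww by simp
    finally have "H *\<^sub>v (x - a \<cdot>\<^sub>v w) = (x - a \<cdot>\<^sub>v w) - (- a) \<cdot>\<^sub>v w" using Hv[OF xc] unfolding a_def by simp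
    also have "\<dots> = x" using x w by (intro eq_vecI) auto
    finally show "H * H *\<^sub>v x = 1\<^sub>m n *\<^sub>v x" using H x Hx by (simp add: mat_simps)
  qed (use H in auto)
  have "H *\<^sub>v unit_vec n 0 = u"
  proof -
    have wu: "w \<bullet> unit_vec n 0 = u $ 0 - 1" unfolding w_def using u n by simp
    have "w \<bullet> w = w \<bullet> u - w \<bullet> unit_vec n 0" using w u by (subst (2) w_def) (simp add: scalar_prod_minus_distrib[of _ n])
    also have "w \<bullet> u = u \<bullet> u - unit_vec n 0 \<bullet> u" unfolding w_def using u by (intro minus_scalar_prod_distrib[of _ n]) auto
    also have "\<dots> = 1 - u $ 0" using u n by simp
    finally have "w \<bullet> w = 2 * (1 - u $ 0)" unfolding wu by simp
    then have "2 * (w \<bullet> unit_vec n 0) / (w \<bullet> w) = - 1" unfolding wu using ww by (simp add: field_simps)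
    then have "H *\<^sub>v unit_vec n 0 = unit_vec n 0 - (- 1) \<cdot>\<^sub>v w" using Hv[of "unit_vec n 0"] by simp
    also have "\<dots> = u" unfolding w_def using u by (intro eq_vecI) auto
    finally show ?thesis .
  qed
  then show ?thesis using H HT HH by blast
qed

lemma scale_mat_block:
  "four_block_mat (scale_mat n d) (0\<^sub>m n m) (0\<^sub>m m n) (scale_mat m e) = scale_mat (n + m) (\<lambda>i. if i < n then d i else e (i - n))"
  unfolding scale_mat_def by (intro eq_matI) auto

text \<open>Deflation: a Householder reflection moves a unit eigenvector to the first coordinate.
  The first column of the transformed matrix is then a multiple of the first unit vector, and by
  symmetry so is the first row.\<close>

lemma spectral_symmetric:
  assumes "K \<in> sq_mats n" "K\<^sup>T = K"
  shows "\<exists>U d. U \<in> sq_mats n \<and> U\<^sup>T * U = 1\<^sub>m n \<and> U * U\<^sup>T = 1\<^sub>m n \<and> K = U * scale_mat n d * (U :: real mat)\<^sup>T"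
  using assms
proof (induction n arbitrary: K)
  case 0
  then show ?case by (intro exI[of _ "1\<^sub>m 0"] exI[of _ "\<lambda>_. 0"]) (auto intro!: eq_matI)
next
  case (Suc n)
  obtain u l where u: "u \<in> carrier_vec (Suc n)" "u \<bullet> u = 1" "K *\<^sub>v u = l \<cdot>\<^sub>v u"
    using symmetric_real_eigenvector[OF Suc.prems] by auto
  obtain H where H: "H \<in> sq_mats (Suc n)" "H\<^sup>T = H" "H * H = 1\<^sub>m (Suc n)" "H *\<^sub>v unit_vec (Suc n) 0 = u"
    using householder[OF u(1,2)] by auto
  define B where "B = H * K * H"
  have B: "B \<in> sq_mats (1 + n)" unfolding B_def using H Suc.prems by auto
  have BT: "B\<^sup>T = B" unfolding B_def using H Suc.prems by (simp add: mat_simps)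
  have "B *\<^sub>v unit_vec (Suc n) 0 = H *\<^sub>v (K *\<^sub>v u)" unfolding B_def H(4)[symmetric] using H(1) Suc.prems
    by (simp add: mat_simps)
  also have "\<dots> = l \<cdot>\<^sub>v (H *\<^sub>v (H *\<^sub>v unit_vec (Suc n) 0))" unfolding u(3) H(4) using H(1) u(1) by (simp add: mat_simps)
  also have "\<dots> = l \<cdot>\<^sub>v unit_vec (Suc n) 0" using H(1) mult_vec_cancel_left_inverse[OF H(3)] by simp
  finally have Bc: "B *\<^sub>v unit_vec (Suc n) 0 = l \<cdot>\<^sub>v unit_vec (Suc n) 0" .
  obtain a b c e where s: "a \<in> sq_mats 1" "b \<in> carrier_mat 1 n" "c \<in> carrier_mat n 1" "e \<in> sq_mats n"
    "B = four_block_mat a b c e" using four_block_split[OF B] .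
  have Be: "B $$ (i, 0) = (if i = 0 then l else 0)" if "i < Suc n" for i
    using arg_cong[OF Bc, of "\<lambda>v. v $ i"] mult_unit_vec[of B "Suc n" "Suc n" 0] B that by simp
  have BTe: "B $$ (0, i) = B $$ (i, 0)" if "i < Suc n" for i
    using arg_cong[OF BT, of "\<lambda>M. M $$ (i, 0)"] B that by simp
  have a: "a = scale_mat 1 (\<lambda>_. l)" using Be[of 0] s by (intro eq_matI) (auto simp: scale_mat_def)
  have c0: "c = 0\<^sub>m n 1"
  proof (rule eq_matI)
    fix i j assume "i < dim_row (0\<^sub>m n 1 :: real mat)" "j < dim_col (0\<^sub>m n 1 :: real mat)"
    then show "c $$ (i, j) = 0\<^sub>m n 1 $$ (i, j)" using Be[of "Suc i"] s by simp
  qed (use s in auto)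
  have b0: "b = 0\<^sub>m 1 n"
  proof (rule eq_matI)
    fix i j assume "i < dim_row (0\<^sub>m 1 n :: real mat)" "j < dim_col (0\<^sub>m 1 n :: real mat)"
    then show "b $$ (i, j) = 0\<^sub>m 1 n $$ (i, j)" using Be[of "Suc j"] BTe[of "Suc j"] s by simp
  qed (use s in auto)
  have "e\<^sup>T = e"
  proof -
    have "B\<^sup>T = four_block_mat (a\<^sup>T) (c\<^sup>T) (b\<^sup>T) (e\<^sup>T)" unfolding s(5) using s by (intro transpose_four_block_mat) auto
    then have "four_block_mat (a\<^sup>T) (c\<^sup>T) (b\<^sup>T) (e\<^sup>T) = four_block_mat a b c e" using BT s(5) by simp
    then show ?thesis using s by (subst (asm) four_block_eq_iff[of _ 1 1 _ n _ n]) auto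
  qed
  then obtain U d where U: "U \<in> sq_mats n" "U\<^sup>T * U = 1\<^sub>m n" "U * U\<^sup>T = 1\<^sub>m n" "e = U * scale_mat n d * U\<^sup>T"
    using Suc.IH[OF s(4)] by blast
  define V where "V = four_block_mat (1\<^sub>m 1) (0\<^sub>m 1 n) (0\<^sub>m n 1) U"
  have V: "V \<in> sq_mats (1 + n)" unfolding V_def using U by auto
  have VT: "V\<^sup>T = four_block_mat (1\<^sub>m 1) (0\<^sub>m 1 n) (0\<^sub>m n 1) (U\<^sup>T)" unfolding V_def using U
    by (subst transpose_four_block_mat[of _ 1 1 _ n _ n]) (auto simp: mat_dim_simps)
  have VV: "V\<^sup>T * V = 1\<^sub>m (1 + n)" "V * V\<^sup>T = 1\<^sub>m (1 + n)" unfolding VT unfolding V_def four_block_one[symmetric] using U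
    by (simp_all add: mult_four_block_dim mat_simps del: One_nat_def)
  define d' where "d' i = (if i < 1 then l else d (i - 1))" for i :: nat
  have sb: "scale_mat (1 + n) d' = four_block_mat (scale_mat 1 (\<lambda>_. l)) (0\<^sub>m 1 n) (0\<^sub>m n 1) (scale_mat n d)"
    unfolding scale_mat_block d'_def by (rule arg_cong[of _ _ "scale_mat (1 + n)"]) auto
  have BV: "B = V * scale_mat (1 + n) d' * V\<^sup>T"
    unfolding VT unfolding V_def sb s(5) a b0 c0 U(4) using U(1)
    by (simp add: mult_four_block_dim mat_simps del: One_nat_def)
  have HV: "H * V \<in> sq_mats (Suc n)" "(H * V)\<^sup>T = V\<^sup>T * H" using H V by (auto simp: mat_dim_simps)
  have "K = H * B * H" unfolding B_def using H Suc.prems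
    by (simp add: mat_simps mult_cancel_left_inverse[OF H(3)])
  also have "\<dots> = (H * V) * scale_mat (Suc n) d' * (H * V)\<^sup>T" unfolding BV HV(2) using H V by (simp add: mat_simps)
  finally have "K = (H * V) * scale_mat (Suc n) d' * (H * V)\<^sup>T" .
  moreover have "(H * V)\<^sup>T * (H * V) = 1\<^sub>m (Suc n)" unfolding HV(2) using H V VV
    by (simp add: mat_simps mult_cancel_left_inverse[OF H(3)])
  moreover have "(H * V) * (H * V)\<^sup>T = 1\<^sub>m (Suc n)" unfolding HV(2) using H V VV
    by (simp add: mat_simps mult_cancel_left_inverse[OF VV(2)])
  ultimately show ?case using HV(1) by blast
qed

section \<open>Sylvester's law of inertia and the signature\<close>

lemma scale_mat_quadratic:
  assumes "x \<in> carrier_vec n"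
  shows "x \<bullet> (scale_mat n d *\<^sub>v x) = (\<Sum>i = 0..<n. d i * (x $ i)\<^sup>2)"
proof -
  have "x \<bullet> (scale_mat n d *\<^sub>v x) = (\<Sum>i = 0..<n. x $ i * (scale_mat n d *\<^sub>v x) $ i)" by (simp add: scalar_prod_def)
  also have "\<dots> = (\<Sum>i = 0..<n. d i * (x $ i)\<^sup>2)"
    by (intro sum.cong refl) (use scale_mat_mult_vec[OF assms] in \<open>simp add: power2_eq_square\<close>)
  finally show ?thesis .
qed

text \<open>Were there more positive e_i than positive d_i, some nonzero x supported on the positive
  e_i would have R x vanishing at all positive d_i. The quadratic form at x would be positive by the
  first property and at most 0 by the second.\<close>

lemma inertia_le:
  assumes R: "R \<in> sq_mats n" and eq: "scale_mat n e = R\<^sup>T * scale_mat n d * R"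
  shows "card {i. i < n \<and> e i > 0} \<le> card {i. i < n \<and> d i > (0 :: real)}"
proof (rule ccontr)
  define P where "P = {i. i < n \<and> d i > 0}"
  define P' where "P' = {i. i < n \<and> e i > 0}"
  assume "\<not> ?thesis"
  then have lt: "card P < card P'" unfolding P_def P'_def by simp
  have fin: "finite P" "finite P'" unfolding P_def P'_def by auto
  obtain f where f: "bij_betw f {0..<card P'} P'" using ex_bij_betw_nat_finite[OF fin(2)] by blast
  obtain g where g: "bij_betw g {0..<card P} P" using ex_bij_betw_nat_finite[OF fin(1)] by blast
  \<comment> \<open>The rows of \<open>R\<close> with d > 0 and the columns with e > 0. There are
    more columns than rows, so a kernel vector exists; it is placed on the coordinates with e >
    0.\<close>
  define B where "B = mat (card P) (card P') (\<lambda>(i, j). R $$ (g i, f j))"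
  have B: "B \<in> carrier_mat (card P) (card P')" unfolding B_def by simp
  obtain y where y: "y \<in> carrier_vec (card P')" "y \<noteq> 0\<^sub>v (card P')" "B *\<^sub>v y = 0\<^sub>v (card P)"
    using underdetermined_kernel[OF B lt] by blast
  define h where "h = the_inv_into {0..<card P'} f"
  have h: "h (f j) = j" if "j < card P'" for j unfolding h_def using f that
    by (intro the_inv_into_f_f) (auto simp: bij_betw_def)
  define x where "x = vec n (\<lambda>r. if r \<in> P' then y $ h r else 0)"
  have x: "x \<in> carrier_vec n" unfolding x_def by simp
  have fP: "f j \<in> P'" if "j < card P'" for j using f that unfolding bij_betw_def by auto
  have gP: "\<exists>i<card P. g i = r" if "r \<in> P" for r using g that unfolding bij_betw_def by (metis atLeastLessThan_iff imageE)
  have Rx: "(R *\<^sub>v x) $ r = 0" if r: "r \<in> P" for r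
  proof -
    obtain i where i: "i < card P" "g i = r" using gP[OF r] by auto
    have rn: "r < n" using r unfolding P_def by simp
    have "(R *\<^sub>v x) $ r = (\<Sum>t = 0..<n. R $$ (r, t) * x $ t)" by (rule mult_vec_index[OF R x rn])
    also have "\<dots> = (\<Sum>t\<in>P'. R $$ (r, t) * y $ h t)"
      by (rule sum.mono_neutral_cong_right) (auto simp: x_def P'_def)
    also have "\<dots> = (\<Sum>j = 0..<card P'. R $$ (r, f j) * y $ h (f j))"
      using sum.reindex_bij_betw[OF f, of "\<lambda>t. R $$ (r, t) * y $ h t"] by simp
    also have "\<dots> = (\<Sum>j = 0..<card P'. B $$ (i, j) * y $ j)"
      by (intro sum.cong refl) (use h i in \<open>simp add: B_def\<close>)
    also have "\<dots> = (B *\<^sub>v y) $ i" using mult_vec_index[OF B y(1) i(1)] by simp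
    finally show ?thesis using y(3) i by simp
  qed
  have Rxc: "R *\<^sub>v x \<in> carrier_vec n" using R by (intro carrier_vecI) auto
  have "x \<bullet> (scale_mat n e *\<^sub>v x) = x \<bullet> (R\<^sup>T *\<^sub>v (scale_mat n d *\<^sub>v (R *\<^sub>v x)))"
    unfolding eq using R x by (simp add: mat_simps)
  also have "\<dots> = (R *\<^sub>v x) \<bullet> (scale_mat n d *\<^sub>v (R *\<^sub>v x))"
  proof -
    have "scale_mat n d *\<^sub>v (R *\<^sub>v x) \<in> carrier_vec n" by (intro carrier_vecI) simp
    then show ?thesis using scalar_prod_mult_vec[of "R\<^sup>T" n n x "scale_mat n d *\<^sub>v (R *\<^sub>v x)"] R x by simp
  qed
  also have "\<dots> = (\<Sum>i = 0..<n. d i * ((R *\<^sub>v x) $ i)\<^sup>2)" using scale_mat_quadratic[OF Rxc] .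
  also have "\<dots> \<le> 0"
  proof (rule sum_nonpos)
    fix i assume "i \<in> {0..<n}"
    then show "d i * ((R *\<^sub>v x) $ i)\<^sup>2 \<le> 0" using Rx[of i] unfolding P_def
      by (cases "d i > 0") (auto intro: mult_nonpos_nonneg)
  qed
  finally have le: "(\<Sum>i = 0..<n. e i * (x $ i)\<^sup>2) \<le> 0" unfolding scale_mat_quadratic[OF x] .
  obtain j where j: "j < card P'" "y $ j \<noteq> 0" using y(1,2) by (metis carrier_vecD eq_vecI index_zero_vec)
  have "(\<Sum>i = 0..<n. e i * (x $ i)\<^sup>2) > 0"
  proof (rule sum_pos2[of _ "f j"])
    show "f j \<in> {0..<n}" using fP[OF j(1)] unfolding P'_def by simp
    show "0 < e (f j) * (x $ f j)\<^sup>2" using fP[OF j(1)] h[OF j(1)] j(2) unfolding x_def P'_def by simp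
    show "0 \<le> e i * (x $ i)\<^sup>2" if "i \<in> {0..<n}" for i using that unfolding x_def P'_def by auto
  qed simp
  then show False using le by simp
qed

text \<open>As \<open>R\<close> and \<open>S\<close> are both invertible, \<open>inertia_le\<close>
  applies in both directions; applied to the negated diagonals it counts the negative
  entries.\<close>

lemma inertia:
  assumes R: "R \<in> sq_mats n" "invertible_mat R" and S: "S \<in> sq_mats n" "invertible_mat S"
    and eq: "R * scale_mat n d * R\<^sup>T = S * scale_mat n e * S\<^sup>T"
  shows "card {i. i < n \<and> e i > 0} = card {i. i < n \<and> d i > (0 :: real)}"
    "card {i. i < n \<and> e i < 0} = card {i. i < n \<and> d i < (0 :: real)}"
proof -
  have *: "card {i. i < n \<and> e i > 0} \<le> card {i. i < n \<and> d i > 0} \<and> card {i. i < n \<and> e i < 0} \<le> card {i. i < n \<and> d i < 0}"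
    if S: "S \<in> sq_mats n" "invertible_mat S" and R: "R \<in> sq_mats n"
      and eq: "R * scale_mat n d * R\<^sup>T = S * scale_mat n e * S\<^sup>T" for R S and d e :: "nat \<Rightarrow> real"
  proof -
    obtain S' where S': "S' \<in> sq_mats n" "S * S' = 1\<^sub>m n" "S' * S = 1\<^sub>m n" using S by (auto elim: invertible_matE)
    define T where "T = (S' * R)\<^sup>T"
    have T: "T \<in> sq_mats n" unfolding T_def using S' R by auto
    have "scale_mat n e = S' * (S * scale_mat n e * S\<^sup>T) * S'\<^sup>T"
      using congruence_back[of "scale_mat n e" n S S'] S S' by simp
    also have "\<dots> = T\<^sup>T * scale_mat n d * T" unfolding eq[symmetric] T_def using S' R by (simp add: mat_simps)
    finally have e: "scale_mat n e = T\<^sup>T * scale_mat n d * T" .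
    have neg: "scale_mat n (\<lambda>i. - f i) = - 1 \<cdot>\<^sub>m scale_mat n f" for f unfolding scale_mat_def by (intro eq_matI) auto
    have "scale_mat n (\<lambda>i. - e i) = T\<^sup>T * scale_mat n (\<lambda>i. - d i) * T" unfolding neg e using T
      by (simp add: mat_simps)
    from inertia_le[OF T e] inertia_le[OF T this] show ?thesis by simp
  qed
  show "card {i. i < n \<and> e i > 0} = card {i. i < n \<and> d i > 0}" "card {i. i < n \<and> e i < 0} = card {i. i < n \<and> d i < 0}"
    using *[OF S R(1) eq] *[OF R S(1) eq[symmetric]] by auto
qed

lemma order_linear_product:
  "Polynomial.order l (\<Prod>a\<leftarrow>es. [:- a, 1:]) = count_list es (l :: real)"
proof -
  have "Polynomial.order l (\<Prod>a\<leftarrow>es. [:- a, 1:]) = (\<Sum>a\<leftarrow>es. Polynomial.order l [:- a, 1:])"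
    by (subst order_prod_list) (auto simp: o_def)
  also have "\<dots> = count_list es l" by (induction es) (auto simp: order_linear')
  finally show ?thesis .
qed

text \<open>An orthogonal diagonalization is a similarity, so its diagonal lists the eigenvalues
  with multiplicity, and also a congruence, so by inertia it has the same sign counts as any other
  diagonalization by congruence.\<close>

lemma has_signature_diagonal_iff:
  assumes A: "A \<in> sq_mats n" "A\<^sup>T = A" and R: "R \<in> sq_mats n" "invertible_mat R"
    and eq: "A = R * scale_mat n d * R\<^sup>T"
  shows "has_signature A p q \<longleftrightarrow> n = p + q \<and> card {i. i < n \<and> d i > 0} = p \<and> card {i. i < n \<and> d i < 0} = q"
proof -
  obtain U e where U: "U \<in> sq_mats n" "U\<^sup>T * U = 1\<^sub>m n" "U * U\<^sup>T = 1\<^sub>m n" "A = U * scale_mat n e * U\<^sup>T"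
    using spectral_symmetric[OF A] by blast
  have Ui: "invertible_mat U" using U by (intro invertible_matI[of U n "U\<^sup>T"]) auto
  have cnt: "card {i. i < n \<and> e i > 0} = card {i. i < n \<and> d i > 0}" "card {i. i < n \<and> e i < 0} = card {i. i < n \<and> d i < 0}"
    using inertia[OF R U(1) Ui, of d e] eq U(4) by auto
  define es where "es = map e [0..<n]"
  have sim: "similar_mat A (scale_mat n e)"
    unfolding similar_mat_def similar_mat_wit_def Let_def using A(1) U by (intro exI[of _ U] exI[of _ "U\<^sup>T"]) auto
  have "char_poly A = (\<Prod>a\<leftarrow>diag_mat (scale_mat n e). [:- a, 1:])"
    unfolding char_poly_similar[OF sim] by (rule char_poly_upper_triangular[of _ n]) (auto simp: scale_mat_def)
  moreover have "diag_mat (scale_mat n e) = es" unfolding diag_mat_def es_def scale_mat_def by auto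
  ultimately have cp: "char_poly A = (\<Prod>a\<leftarrow>es. [:- a, 1:])" by simp
  have ord: "Polynomial.order l (char_poly A) = count_list es l" for l unfolding cp by (rule order_linear_product)
  have ev: "eigenvalue A l \<longleftrightarrow> l \<in> set es" for l
    unfolding eigenvalue_root_char_poly[OF A(1)] cp by (auto simp: poly_prod_list prod_list_zero_iff)
  have sumc: "(\<Sum>l | eigenvalue A l \<and> T l. Polynomial.order l (char_poly A)) = card {i. i < n \<and> T (e i)}" for T
  proof -
    have "(\<Sum>l | eigenvalue A l \<and> T l. Polynomial.order l (char_poly A)) = (\<Sum>l \<in> set (filter T es). count_list es l)"
      unfolding ord by (intro sum.cong) (auto simp: ev)
    also have "\<dots> = (\<Sum>l \<in> set (filter T es). count_list (filter T es) l)"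
    proof (intro sum.cong refl)
      fix l assume "l \<in> set (filter T es)"
      then have "T l" by simp
      then show "count_list es l = count_list (filter T es) l" by (induction es) auto
    qed
    also have "\<dots> = length (filter T es)" by (rule sum_count_set) auto
    also have "\<dots> = card {i. i < length es \<and> T (es ! i)}" by (rule length_filter_conv_card)
    also have "{i. i < length es \<and> T (es ! i)} = {i. i < n \<and> T (e i)}" unfolding es_def by auto
    finally show ?thesis .
  qed
  have "A \<in> sq_mats (p + q) \<longleftrightarrow> n = p + q" using A(1) by auto
  then show ?thesis unfolding has_signature_def sumc using A(2) cnt by auto
qed

lemma has_signature_congruent:
  assumes A: "has_signature A p q" and G: "G \<in> sq_mats (p + q)" "invertible_mat G"
  shows "has_signature (G * A * G\<^sup>T) p q"
proof -
  let ?n = "p + q"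
  have Ac: "A \<in> sq_mats ?n" "A\<^sup>T = A" using A unfolding has_signature_def by auto
  obtain U e where U: "U \<in> sq_mats ?n" "U\<^sup>T * U = 1\<^sub>m ?n" "U * U\<^sup>T = 1\<^sub>m ?n" "A = U * scale_mat ?n e * U\<^sup>T"
    using spectral_symmetric[OF Ac] by blast
  have Ui: "invertible_mat U" using U by (intro invertible_matI[of U ?n "U\<^sup>T"]) auto
  have B: "G * A * G\<^sup>T \<in> sq_mats ?n" "(G * A * G\<^sup>T)\<^sup>T = G * A * G\<^sup>T"
    using G Ac by (auto simp: mat_simps)
  have eq: "G * A * G\<^sup>T = (G * U) * scale_mat ?n e * (G * U)\<^sup>T" unfolding U(4) using G U(1) by (simp add: mat_simps)
  have GU: "G * U \<in> sq_mats ?n" "invertible_mat (G * U)" using G U(1) Ui invertible_mult by auto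
  show ?thesis using A has_signature_diagonal_iff[OF Ac U(1) Ui U(4)] has_signature_diagonal_iff[OF B GU eq] by simp
qed

text \<open>The positive and negative diagonal entries together exhaust the size of the matrix, so
  no entry is 0.\<close>

lemma has_signature_invertible:
  assumes A: "has_signature A p q"
  shows "invertible_mat A"
proof -
  let ?n = "p + q"
  have Ac: "A \<in> sq_mats ?n" "A\<^sup>T = A" using A unfolding has_signature_def by auto
  obtain U e where U: "U \<in> sq_mats ?n" "U\<^sup>T * U = 1\<^sub>m ?n" "U * U\<^sup>T = 1\<^sub>m ?n" "A = U * scale_mat ?n e * U\<^sup>T"
    using spectral_symmetric[OF Ac] by blast
  have Ui: "invertible_mat U" "invertible_mat (U\<^sup>T)"
    using invertible_matI[of U ?n "U\<^sup>T"] invertible_matI[of "U\<^sup>T" ?n U] U by auto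
  have "card {i. i < ?n \<and> e i > 0} + card {i. i < ?n \<and> e i < 0} = ?n"
    using A has_signature_diagonal_iff[OF Ac U(1) Ui(1) U(4)] by simp
  moreover have "card {i. i < ?n \<and> e i > 0} + card {i. i < ?n \<and> e i < 0} = card ({i. i < ?n \<and> e i > 0} \<union> {i. i < ?n \<and> e i < 0})"
    by (rule card_Un_disjoint[symmetric]) auto
  moreover have "{i. i < ?n \<and> e i > 0} \<union> {i. i < ?n \<and> e i < 0} = {i. i < ?n \<and> e i \<noteq> 0}" by auto
  ultimately have c: "card {i. i < ?n \<and> e i \<noteq> 0} = card {..<?n}" by simp
  have "{i. i < ?n \<and> e i \<noteq> 0} = {..<?n}" by (rule card_subset_eq) (use c in auto)
  then have e: "e i \<noteq> 0" if "i < ?n" for i using that by auto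
  have "invertible_mat (scale_mat ?n e)" using scale_mat_inverse[of ?n e] e
    by (intro invertible_matI[of _ ?n "scale_mat ?n (\<lambda>i. 1 / e i)"]) auto
  then show ?thesis unfolding U(4) using U(1) Ui by (intro invertible_mult[of _ ?n]) auto
qed

subsection \<open>Isotropic vectors and the exceptional form of \<open>Q\<close>\<close>

abbreviation hyp_plane :: "real mat" where
  "hyp_plane \<equiv> mat_of_rows_list 2 [[0, 1], [1, 0]]"

lemma hyp_plane_carrier [simp]: "hyp_plane \<in> sq_mats 2" "dim_row hyp_plane = 2" "dim_col hyp_plane = 2"
  unfolding mat_of_rows_list_def by auto

lemma hyp_plane_index: "i < 2 \<Longrightarrow> j < 2 \<Longrightarrow> hyp_plane $$ (i, j) = (if i = j then 0 else 1)"
  by (auto simp: mat_of_rows_list_def less_2_cases_iff)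

lemma hyp_plane_transpose: "hyp_plane\<^sup>T = hyp_plane"
  by (rule eq_matI) (auto simp: hyp_plane_index)

lemma hyp_plane_square: "hyp_plane * hyp_plane = 1\<^sub>m 2"
  by (rule eq_matI) (auto simp: scalar_prod_def numeral_2_eq_2 mat_of_rows_list_def less_Suc_eq)

lemma has_signature_hyp_plane_sum:
  assumes K': "K' \<in> sq_mats l" "K'\<^sup>T = K'" and sig: "has_signature (diag_block_mat [hyp_plane, K']) p q"
  shows "\<exists>p' q'. p = p' + 1 \<and> q = q' + 1 \<and> has_signature K' p' q'"
proof -
  obtain U e where U: "U \<in> sq_mats l" "U\<^sup>T * U = 1\<^sub>m l" "U * U\<^sup>T = 1\<^sub>m l" "K' = U * scale_mat l e * U\<^sup>T"
    using spectral_symmetric[OF K'] by blast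
  have Ui: "invertible_mat U" using U by (intro invertible_matI[of U l "U\<^sup>T"]) auto
  \<comment> \<open>The identity 2 x y = ((x + y)^2 - (x - y)^2) / 2 in matrix form: the hyperbolic
    plane has one positive and one negative entry.\<close>
  define R :: "real mat" where "R = mat 2 2 (\<lambda>(i, j). if i = 1 \<and> j = 1 then - 1 else 1)"
  have R: "R \<in> sq_mats 2" unfolding R_def by simp
  have RR: "R * ((1 / 2) \<cdot>\<^sub>m R) = 1\<^sub>m 2"
    by (rule eq_matI) (auto simp: R_def scalar_prod_def numeral_2_eq_2 less_Suc_eq)
  have Ri: "invertible_mat R"
    using left_inverse_imp_right_inverse[of "(1 / 2) \<cdot>\<^sub>m R" 2 R] R RR
    by (intro invertible_matI[of R 2 "(1 / 2) \<cdot>\<^sub>m R"]) auto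
  define f where "f i = (if i = 0 then 1 / 2 else - 1 / 2 :: real)" for i :: nat
  have H: "hyp_plane = R * scale_mat 2 f * R\<^sup>T"
    by (rule eq_matI) (auto simp: R_def scale_mat_def f_def scalar_prod_def numeral_2_eq_2 mat_of_rows_list_def less_Suc_eq)
  let ?A = "diag_block_mat [hyp_plane, K']"
  have Ab: "?A = four_block_mat hyp_plane (0\<^sub>m 2 l) (0\<^sub>m l 2) K'" unfolding diag_block_mat_two using K' by (simp add: dim_of_carrier)
  have A: "?A \<in> sq_mats (2 + l)" unfolding Ab using K' by auto
  have AT: "?A\<^sup>T = ?A" unfolding Ab using K'
    by (subst transpose_four_block_mat[of _ 2 2 _ l _ l]) (auto simp: hyp_plane_transpose mat_dim_simps)
  define S where "S = four_block_mat R (0\<^sub>m 2 l) (0\<^sub>m l 2) U"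
  have S: "S \<in> sq_mats (2 + l)" "invertible_mat S" unfolding S_def using R U(1) Ri Ui
    by (auto intro: invertible_diag_block)
  have ST: "S\<^sup>T = four_block_mat (R\<^sup>T) (0\<^sub>m 2 l) (0\<^sub>m l 2) (U\<^sup>T)" unfolding S_def using R U(1)
    by (subst transpose_four_block_mat[of _ 2 2 _ l _ l]) (auto simp: mat_dim_simps)
  define d where "d i = (if i < 2 then f i else e (i - 2))" for i
  have sd: "scale_mat (2 + l) d = four_block_mat (scale_mat 2 f) (0\<^sub>m 2 l) (0\<^sub>m l 2) (scale_mat l e)"
    unfolding scale_mat_block d_def ..
  have eq: "?A = S * scale_mat (2 + l) d * S\<^sup>T" unfolding ST unfolding Ab unfolding S_def sd H U(4) using R U(1)
    by (simp add: mult_four_block_dim mat_simps)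
  have *: "2 + l = p + q" "card {i. i < 2 + l \<and> d i > 0} = p" "card {i. i < 2 + l \<and> d i < 0} = q"
    using sig has_signature_diagonal_iff[OF A AT S eq] by auto
  have cnt: "card {i. i < 2 + l \<and> T (d i)} = card {i. i < 2 \<and> T (f i)} + card {i. i < l \<and> T (e i)}" for T
  proof -
    have "{i. i < 2 + l \<and> T (d i)} = {i. i < 2 \<and> T (f i)} \<union> (\<lambda>i. i + 2) ` {i. i < l \<and> T (e i)}" (is "?L = ?B")
    proof (intro equalityI subsetI)
      fix i assume i: "i \<in> ?L"
      show "i \<in> ?B"
      proof (cases "i < 2")
        case False
        then have "i = (i - 2) + 2" "i - 2 \<in> {i. i < l \<and> T (e i)}" using i by (auto simp: d_def)
        then show ?thesis by blast
      qed (use i in \<open>auto simp: d_def\<close>)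
    qed (auto simp: d_def)
    also have "card \<dots> = card {i. i < 2 \<and> T (f i)} + card ((\<lambda>i. i + 2) ` {i. i < l \<and> T (e i)})"
      by (rule card_Un_disjoint) auto
    also have "card ((\<lambda>i. i + 2) ` {i. i < l \<and> T (e i)}) = card {i. i < l \<and> T (e i)}" by (rule card_image) (auto simp: inj_on_def)
    finally show ?thesis .
  qed
  have "{i. i < 2 \<and> f i > 0} = {0}" "{i. i < 2 \<and> f i < 0} = {1}" unfolding f_def by auto
  then have "p = card {i. i < l \<and> e i > 0} + 1" "q = card {i. i < l \<and> e i < 0} + 1"
    using *(2,3) cnt[of "\<lambda>x. x > 0"] cnt[of "\<lambda>x. x < 0"] by auto
  moreover from this have "has_signature K' (card {i. i < l \<and> e i > 0}) (card {i. i < l \<and> e i < 0})"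
    using has_signature_diagonal_iff[OF K' U(1) Ui U(4)] *(1) by simp
  ultimately show ?thesis by blast
qed

text \<open>After the first vector has been made a column of an invertible \<open>P\<close>,
  independence says that the preimage of the second has a nonzero part below its first entry, and
  \<open>invertible_with_image\<close> applies to this part.\<close>

lemma two_columns_invertible:
  assumes w: "w \<in> carrier_vec (2 + l)" and u: "u \<in> carrier_vec (2 + l)"
    and ind: "\<And>a b. a \<cdot>\<^sub>v w + b \<cdot>\<^sub>v u = 0\<^sub>v (2 + l) \<Longrightarrow> a = 0 \<and> b = (0 :: real)"
  shows "\<exists>P\<in>sq_mats (2 + l). invertible_mat P \<and> P *\<^sub>v unit_vec (2 + l) 0 = w \<and> P *\<^sub>v unit_vec (2 + l) 1 = u"
proof -
  let ?n = "1 + (1 + l)"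
  have n: "2 + l = ?n" by simp
  have "w \<noteq> 0\<^sub>v (2 + l)"
  proof
    assume "w = 0\<^sub>v (2 + l)"
    then have "1 \<cdot>\<^sub>v w + 0 \<cdot>\<^sub>v u = 0\<^sub>v (2 + l)" using u by auto
    then show False using ind[of 1 0] by simp
  qed
  then obtain P where P: "P \<in> sq_mats ?n" "invertible_mat P" "P *\<^sub>v unit_vec ?n 0 = w"
    using invertible_with_image[of w ?n] w unfolding n by blast
  obtain P' where P': "P' \<in> sq_mats ?n" "P * P' = 1\<^sub>m ?n" "P' * P = 1\<^sub>m ?n" using P by (auto elim: invertible_matE)
  define y where "y = P' *\<^sub>v u"
  have y: "y \<in> carrier_vec ?n" unfolding y_def using P' by (intro carrier_vecI) auto
  have Py: "P *\<^sub>v y = u" unfolding y_def using P P' u n by (intro mult_vec_cancel_left_inverse[OF P'(2)]) auto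
  define a where "a = y $ 0"
  define z where "z = vec (1 + l) (\<lambda>i. y $ (Suc i))"
  have z: "z \<in> carrier_vec (1 + l)" unfolding z_def by simp
  have "z \<noteq> 0\<^sub>v (1 + l)"
  proof
    assume z0: "z = 0\<^sub>v (1 + l)"
    have yS: "y $ Suc i = 0" if "i < 1 + l" for i using arg_cong[OF z0, of "\<lambda>v. v $ i"] that unfolding z_def by simp
    have "y = a \<cdot>\<^sub>v unit_vec ?n 0"
    proof (rule eq_vecI)
      fix i assume "i < dim_vec (a \<cdot>\<^sub>v unit_vec ?n 0)"
      then show "y $ i = (a \<cdot>\<^sub>v unit_vec ?n 0) $ i" using yS by (cases i) (auto simp: a_def)
    qed (use y in auto)
    then have "u = a \<cdot>\<^sub>v w" using Py P by (simp add: mat_simps)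
    then have "(- a) \<cdot>\<^sub>v w + 1 \<cdot>\<^sub>v u = 0\<^sub>v (2 + l)" using w by auto
    then show False using ind[of "- a" 1] by simp
  qed
  then obtain Q where Q: "Q \<in> sq_mats (1 + l)" "invertible_mat Q" "Q *\<^sub>v unit_vec (1 + l) 0 = z"
    using invertible_with_image[OF z] by blast
  define b where "b = mat 1 (1 + l) (\<lambda>(i, j). if j = 0 then a else 0)"
  have b: "b \<in> carrier_mat 1 (1 + l)" unfolding b_def by simp
  \<comment> \<open>\<open>T\<close> fixes the first unit vector and sends the second one to y, the
    preimage of \<open>u\<close> under \<open>P\<close>.\<close>
  define T where "T = four_block_mat (1\<^sub>m 1) b (0\<^sub>m (1 + l) 1) Q"
  have T: "T \<in> sq_mats ?n" unfolding T_def using Q b by auto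
  have "det T = det (1\<^sub>m 1) * det Q" unfolding T_def using Q b by (intro det_four_block_mat_lower_left_zero[of _ 1 _ "1 + l"]) auto
  then have Ti: "invertible_mat T" using invertible_det_iff[OF T] invertible_det_iff[OF Q(1)] Q(2) by simp
  have T0: "T *\<^sub>v unit_vec ?n 0 = unit_vec ?n 0"
    unfolding mult_unit_vec[OF T, of 0, simplified] unfolding T_def using Q b by (intro eq_vecI) auto
  have T1: "T *\<^sub>v unit_vec ?n 1 = y"
  proof -
    have "T *\<^sub>v unit_vec ?n 1 = col T 1" using T by (intro mult_unit_vec) auto
    also have "\<dots> = y"
    proof (rule eq_vecI)
      fix i assume "i < dim_vec y"
      then have i: "i < ?n" using y by simp
      have "Q $$ (r, 0) = z $ r" if "r < 1 + l" for r
        using arg_cong[OF Q(3), of "\<lambda>v. v $ r"] mult_unit_vec[OF Q(1), of 0] Q(1) that by simp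
      then show "col T 1 $ i = y $ i" using i Q b unfolding T_def by (cases i) (auto simp: b_def a_def z_def)
    qed (use T y in auto)
    finally show ?thesis .
  qed
  have "(P * T) *\<^sub>v unit_vec ?n 0 = w" "(P * T) *\<^sub>v unit_vec ?n 1 = u"
    using P T T0 T1 Py by (simp_all add: mult_vec_assoc_dim dim_of_carrier)
  moreover have "invertible_mat (P * T)" using invertible_mult[OF P(1,2) T Ti] .
  moreover have "P * T \<in> sq_mats ?n" using P T by auto
  ultimately show ?thesis unfolding n by blast
qed

text \<open>An isotropic vector \<open>u\<close> is paired with an isotropic w such that w K u = 1.
  The two span a hyperbolic plane, whose form is invertible, so the rest of the space splits off as
  a Schur complement.\<close>

lemma isotropic_vector_hyperbolic:
  assumes Kt: "Kt \<in> sq_mats (2 + l)" "Kt\<^sup>T = Kt" "invertible_mat Kt"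
    and u: "u \<in> carrier_vec (2 + l)" "u \<noteq> 0\<^sub>v (2 + l)" "u \<bullet> (Kt *\<^sub>v u) = (0 :: real)"
  shows "\<exists>G K'. G \<in> sq_mats (2 + l) \<and> invertible_mat G \<and> G\<^sup>T *\<^sub>v unit_vec (2 + l) 1 = u \<and>
     K' \<in> sq_mats l \<and> K'\<^sup>T = K' \<and> G * Kt * G\<^sup>T = diag_block_mat [hyp_plane, K']"
proof -
  let ?n = "2 + l"
  have Kv: "Kt *\<^sub>v x \<in> carrier_vec ?n" for x using Kt by (intro carrier_vecI) auto
  have symK: "x \<bullet> (Kt *\<^sub>v y) = y \<bullet> (Kt *\<^sub>v x)" if "x \<in> carrier_vec ?n" "y \<in> carrier_vec ?n" for x y
    using scalar_prod_mult_vec[OF Kt(1) that] Kt(2) comm_scalar_prod[of "Kt *\<^sub>v x" ?n y] Kv[of x] that by simp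
  define k where "k = Kt *\<^sub>v u"
  have k: "k \<in> carrier_vec ?n" unfolding k_def by (rule Kv)
  have kk: "k \<bullet> k \<noteq> 0"
  proof
    assume "k \<bullet> k = 0"
    then have k0: "Kt *\<^sub>v u = 0\<^sub>v ?n" using scalar_prod_self_zero[OF k] unfolding k_def by simp
    obtain B where B: "B \<in> sq_mats ?n" "B * Kt = 1\<^sub>m ?n" using Kt by (auto elim: invertible_matE)
    have "u = B *\<^sub>v (Kt *\<^sub>v u)" using B Kt u by (subst mult_vec_cancel_left_inverse[OF B(2)]) (auto simp: dim_of_carrier)
    then show False using u(2) B unfolding k0 by (simp add: mat_simps)
  qed
  \<comment> \<open>k = K u is not 0, so a multiple of k itself pairs to 1 with \<open>u\<close>
    under the metric.\<close>
  define w0 where "w0 = (1 / (k \<bullet> k)) \<cdot>\<^sub>v k"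
  have w0: "w0 \<in> carrier_vec ?n" unfolding w0_def using k by simp
  have w0u: "w0 \<bullet> (Kt *\<^sub>v u) = 1" unfolding k_def[symmetric] w0_def using k kk by simp
  \<comment> \<open>Half of the square of w0. Subtracting c u makes the vector isotropic and,
    \<open>u\<close> being isotropic, does not change its pairing with \<open>u\<close>.\<close>
  define c where "c = (w0 \<bullet> (Kt *\<^sub>v w0)) / 2"
  define w where "w = w0 - c \<cdot>\<^sub>v u"
  have w: "w \<in> carrier_vec ?n" unfolding w_def using w0 u by auto
  have Kw: "Kt *\<^sub>v w = Kt *\<^sub>v w0 - c \<cdot>\<^sub>v (Kt *\<^sub>v u)" unfolding w_def using Kt(1) w0 u(1) by (simp add: mat_simps)
  have wx: "w \<bullet> x = w0 \<bullet> x - c * (u \<bullet> x)" if "x \<in> carrier_vec ?n" for x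
    unfolding w_def using w0 u that by (simp add: minus_scalar_prod_distrib[of _ ?n])
  have xKw: "x \<bullet> (Kt *\<^sub>v w) = x \<bullet> (Kt *\<^sub>v w0) - c * (x \<bullet> (Kt *\<^sub>v u))" if "x \<in> carrier_vec ?n" for x
    unfolding Kw using that Kv by (simp add: scalar_prod_minus_distrib[of _ ?n])
  have wu: "w \<bullet> (Kt *\<^sub>v u) = 1" using wx[OF Kv] w0u u(3) by simp
  have ww: "w \<bullet> (Kt *\<^sub>v w) = 0"
  proof -
    have "w \<bullet> (Kt *\<^sub>v w) = w0 \<bullet> (Kt *\<^sub>v w) - c * (u \<bullet> (Kt *\<^sub>v w))" using wx[OF Kv] .
    also have "u \<bullet> (Kt *\<^sub>v w) = 1" using symK[OF u(1) w] wu by simp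
    also have "w0 \<bullet> (Kt *\<^sub>v w) = 2 * c - c" using xKw[OF w0] w0u unfolding c_def by simp
    finally show ?thesis by simp
  qed
  have ind: "a = 0 \<and> b = 0" if "a \<cdot>\<^sub>v w + b \<cdot>\<^sub>v u = 0\<^sub>v ?n" for a b
  proof -
    have e: "(a \<cdot>\<^sub>v w + b \<cdot>\<^sub>v u) \<bullet> (Kt *\<^sub>v x) = a * (w \<bullet> (Kt *\<^sub>v x)) + b * (u \<bullet> (Kt *\<^sub>v x))" for x
      using w u Kv by (simp add: add_scalar_prod_distrib[of _ ?n])
    have z: "(0\<^sub>v ?n) \<bullet> (Kt *\<^sub>v x) = 0" for x using Kv by simp
    have "u \<bullet> (Kt *\<^sub>v w) = 1" using symK[OF u(1) w] wu by simp
    then show ?thesis using e[of u] e[of w] wu ww u(3) unfolding that z by simp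
  qed
  \<comment> \<open>\<open>u\<close> takes the second place because the exceptional Q sends x to x_1
    e_0, with indices from 0: the functional u has to become coordinate 1.\<close>
  obtain P where P: "P \<in> sq_mats ?n" "invertible_mat P" "P *\<^sub>v unit_vec ?n 0 = w" "P *\<^sub>v unit_vec ?n 1 = u"
    using two_columns_invertible[OF w u(1) ind] by blast
  define \<Gamma> where "\<Gamma> = P\<^sup>T * Kt * P"
  have \<Gamma>: "\<Gamma> \<in> sq_mats ?n" unfolding \<Gamma>_def using P Kt by auto
  have \<Gamma>T: "\<Gamma>\<^sup>T = \<Gamma>" unfolding \<Gamma>_def using P(1) Kt by (simp add: mat_simps)
  obtain A B C D where s: "A \<in> sq_mats 2" "B \<in> carrier_mat 2 l" "C \<in> carrier_mat l 2" "D \<in> sq_mats l"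
    "\<Gamma> = four_block_mat A B C D" using four_block_split[OF \<Gamma>] .
  have \<Gamma>e: "\<Gamma> $$ (i, j) = (P *\<^sub>v unit_vec ?n i) \<bullet> (Kt *\<^sub>v (P *\<^sub>v unit_vec ?n j))" if "i < ?n" "j < ?n" for i j
  proof -
    have "\<Gamma> $$ (i, j) = (\<Gamma> *\<^sub>v unit_vec ?n j) $ i" using mult_unit_vec[OF \<Gamma> that(2)] \<Gamma> that by simp
    also have "\<dots> = unit_vec ?n i \<bullet> (\<Gamma> *\<^sub>v unit_vec ?n j)" using \<Gamma> that by simp
    also have "\<Gamma> *\<^sub>v unit_vec ?n j = P\<^sup>T *\<^sub>v (Kt *\<^sub>v (P *\<^sub>v unit_vec ?n j))" unfolding \<Gamma>_def using P(1) Kt(1) by (simp add: mat_simps)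
    also have "unit_vec ?n i \<bullet> \<dots> = (P *\<^sub>v unit_vec ?n i) \<bullet> (Kt *\<^sub>v (P *\<^sub>v unit_vec ?n j))"
      using scalar_prod_mult_vec[of "P\<^sup>T" ?n ?n "unit_vec ?n i" "Kt *\<^sub>v (P *\<^sub>v unit_vec ?n j)"] P(1) Kv by simp
    finally show ?thesis .
  qed
  have A: "A = hyp_plane"
  proof (rule eq_matI)
    fix i j assume "i < dim_row hyp_plane" "j < dim_col hyp_plane"
    then have ij: "i < 2" "j < 2" by auto
    have "A $$ (i, j) = \<Gamma> $$ (i, j)" unfolding s(5) using s ij by simp
    also have "\<dots> = (P *\<^sub>v unit_vec ?n i) \<bullet> (Kt *\<^sub>v (P *\<^sub>v unit_vec ?n j))" using ij by (intro \<Gamma>e) auto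
    also have "\<dots> = (if i = j then 0 else 1)"
    proof -
      have "i = 0 \<or> i = 1" "j = 0 \<or> j = 1" using ij by auto
      then show ?thesis using P(3,4) ww wu u(3) symK[OF u(1) w] by (elim disjE) simp_all
    qed
    finally show "A $$ (i, j) = hyp_plane $$ (i, j)" using hyp_plane_index[OF ij] by simp
  qed (use s in auto)
  have "\<Gamma>\<^sup>T = four_block_mat (A\<^sup>T) (C\<^sup>T) (B\<^sup>T) (D\<^sup>T)" unfolding s(5) using s by (intro transpose_four_block_mat) auto
  then have "four_block_mat (A\<^sup>T) (C\<^sup>T) (B\<^sup>T) (D\<^sup>T) = four_block_mat A B C D" using \<Gamma>T s(5) by simp
  then have CB: "B\<^sup>T = C" "D\<^sup>T = D" using s by (subst (asm) four_block_eq_iff[of _ 2 2 _ l _ l]; simp)+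
  \<comment> \<open>Clears the off-diagonal blocks. The Gram matrix of a hyperbolic plane is its own
    inverse, so this is minus its inverse times B, and \<open>K'\<close> below is the Schur
    complement.\<close>
  define Z where "Z = - (hyp_plane * B)"
  have Z: "Z \<in> carrier_mat 2 l" unfolding Z_def using s by auto
  define T where "T = four_block_mat (1\<^sub>m 2) Z (0\<^sub>m l 2) (1\<^sub>m l)"
  have T: "T \<in> sq_mats ?n" unfolding T_def using Z by auto
  have TT: "T\<^sup>T = four_block_mat (1\<^sub>m 2) (0\<^sub>m 2 l) (Z\<^sup>T) (1\<^sub>m l)" unfolding T_def using Z
    by (subst transpose_four_block_mat[of _ 2 2 _ l _ l]) (auto simp: mat_dim_simps)
  have "det T = det (1\<^sub>m 2) * det (1\<^sub>m l)" unfolding T_def using Z by (intro det_four_block_mat_lower_left_zero[of _ 2 _ l]) auto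
  then have Ti: "invertible_mat T" using invertible_det_iff[OF T] by simp
  define K' where "K' = Z\<^sup>T * B + D"
  have K'c: "K' \<in> sq_mats l" unfolding K'_def using Z s by auto
  have hZ: "hyp_plane * Z = - B" unfolding Z_def using s
    by (simp add: uminus_mult_dim mult_cancel_left_inverse[OF hyp_plane_square] dim_of_carrier)
  have BB: "hyp_plane * Z + B = 0\<^sub>m 2 l" unfolding hZ using s by (intro eq_matI) auto
  have ZC: "Z\<^sup>T * hyp_plane + C = 0\<^sub>m l 2"
  proof -
    have "Z\<^sup>T * hyp_plane = (hyp_plane * Z)\<^sup>T" using Z by (simp add: transpose_mult_dim dim_of_carrier hyp_plane_transpose)
    also have "\<dots> = - C" unfolding hZ using CB by (simp add: mat_dim_simps)
    finally show ?thesis using s by (auto intro!: eq_matI)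
  qed
  have "T\<^sup>T * \<Gamma> * T = four_block_mat hyp_plane (0\<^sub>m 2 l) (0\<^sub>m l 2) K'"
  proof -
    have 1: "T\<^sup>T * \<Gamma> = four_block_mat hyp_plane B (0\<^sub>m l 2) K'" unfolding TT s(5) A K'_def using s Z ZC
      by (simp add: mult_four_block_dim mult_one_dim mult_zero_dim add_zero_dim dim_of_carrier)
    show ?thesis unfolding 1 unfolding T_def using s Z K'c BB
      by (simp add: mult_four_block_dim mult_one_dim mult_zero_dim add_zero_dim dim_of_carrier)
  qed
  moreover have "diag_block_mat [hyp_plane, K'] = four_block_mat hyp_plane (0\<^sub>m 2 l) (0\<^sub>m l 2) K'"
    unfolding diag_block_mat_two using K'c by (simp add: dim_of_carrier)
  ultimately have Te: "T\<^sup>T * \<Gamma> * T = diag_block_mat [hyp_plane, K']" by simp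
  \<comment> \<open>The new basis vectors are the columns of \<open>P * T\<close>, whereas the
    metric transforms as \<open>G * Kt * G\<^sup>T\<close>; hence the transpose.\<close>
  define G where "G = (P * T)\<^sup>T"
  have G: "G \<in> sq_mats ?n" unfolding G_def using P T by auto
  have "det G = det (P * T)" unfolding G_def using P T by (intro det_transpose) auto
  then have Gi: "invertible_mat G" using invertible_det_iff[OF G] invertible_det_iff[of "P * T" ?n] invertible_mult[OF P(1,2) T Ti] P T by auto
  have GT: "G\<^sup>T = P * T" unfolding G_def by simp
  have GK: "G * Kt * G\<^sup>T = diag_block_mat [hyp_plane, K']" unfolding GT Te[symmetric] \<Gamma>_def unfolding G_def using P(1) T Kt(1)
    by (simp add: mat_simps)
  have T1: "T *\<^sub>v unit_vec ?n 1 = unit_vec ?n 1"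
  proof -
    have "T *\<^sub>v unit_vec ?n 1 = col T 1" using T by (intro mult_unit_vec) auto
    also have "\<dots> = unit_vec ?n 1" unfolding T_def using Z by (intro eq_vecI) auto
    finally show ?thesis .
  qed
  have "G\<^sup>T *\<^sub>v unit_vec ?n 1 = u" unfolding GT using P T T1 by (simp add: mult_vec_assoc_dim dim_of_carrier)
  moreover have "K'\<^sup>T = K'"
  proof -
    have "Z\<^sup>T * B = - (B\<^sup>T * (hyp_plane * B))" unfolding Z_def using s
      by (simp add: mat_simps hyp_plane_transpose)
    then show ?thesis unfolding K'_def using s CB(2)
      by (simp add: mat_simps hyp_plane_transpose)
  qed
  ultimately show ?thesis using G Gi GK K'c by blast
qed

section \<open>The exceptional form of Q for k = 2, m >= 2\<close>

lemma lin_comb_mat_two: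
  assumes "Q 0 \<in> sq_mats m" "Q 1 \<in> sq_mats m"
  shows "lin_comb_mat m 2 c Q = c 0 \<cdot>\<^sub>m Q 0 + c 1 \<cdot>\<^sub>m Q 1"
  unfolding lin_comb_mat_def using assms by (intro eq_matI) (auto simp: numeral_2_eq_2)

text \<open>The trace separates a traceless nonzero matrix from multiples of the identity, so the
  number of independent matrices is 2.\<close>

lemma free_rowed_two:
  assumes Kt: "Kt \<in> sq_mats m" and m: "1 \<le> m" and Q0: "Q 0 = 1\<^sub>m m"
    and Q1: "Q 1 \<in> sq_mats m" "Q 1 * Kt = Kt * (Q 1)\<^sup>T" "(\<Sum>r<m. Q 1 $$ (r, r)) = 0" "Q 1 \<noteq> 0\<^sub>m m m"
  shows "free_rowed_matrices 2 Kt Q"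
proof -
  have dK: "dim_row Kt = m" using Kt by simp
  have i2: "i < 2 \<Longrightarrow> i = 0 \<or> i = 1" for i :: nat by auto
  have Qc: "Q 0 \<in> sq_mats m" using Q0 by simp
  have li: "c i = 0" if c: "lin_comb_mat m 2 c Q = 0\<^sub>m m m" and i: "i < 2" for c and i :: nat
  proof -
    have e: "c 0 * 1\<^sub>m m $$ (r, s) + c 1 * Q 1 $$ (r, s) = 0" if "r < m" "s < m" for r s
      using arg_cong[OF c, of "\<lambda>M. M $$ (r, s)"] lin_comb_mat_two[OF Qc Q1(1), of c] Q0 Q1(1) that by simp
    have "c 0 + c 1 * Q 1 $$ (r, r) = 0" if "r < m" for r using e[OF that that] that by simp
    then have "(\<Sum>r<m. c 0 + c 1 * Q 1 $$ (r, r)) = 0" by (intro sum.neutral) auto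
    then have "real m * c 0 + c 1 * (\<Sum>r<m. Q 1 $$ (r, r)) = 0" by (simp add: sum.distrib sum_distrib_left)
    then have c0: "c 0 = 0" using Q1(3) m by simp
    have "c 1 = 0"
    proof (rule ccontr)
      assume "c 1 \<noteq> 0"
      then have "Q 1 $$ (r, s) = 0" if "r < m" "s < m" for r s using e[OF that] c0 by simp
      then have "Q 1 = 0\<^sub>m m m" using Q1(1) by (intro eq_matI) auto
      then show False using Q1(4) by simp
    qed
    then show ?thesis using c0 i2[OF i] by auto
  qed
  have b00: "lie_bracket (1\<^sub>m m) (1\<^sub>m m) = (0\<^sub>m m m :: real mat)" "lie_bracket (1\<^sub>m m) (Q 1) = 0\<^sub>m m m"
    "lie_bracket (Q 1) (1\<^sub>m m) = 0\<^sub>m m m" "lie_bracket (Q 1) (Q 1) = 0\<^sub>m m m"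
    using Q1(1) by (auto simp: bracket_zero_iff[of _ m])
  show ?thesis unfolding free_rowed_matrices_def Let_def dK
  proof (intro conjI allI impI)
    fix i :: nat assume "i < 2"
    then show "Q i \<in> sq_mats m" "Q i * Kt = Kt * (Q i)\<^sup>T" using i2[of i] Q0 Q1 Kt by (auto simp: mat_dim_simps)
    fix j :: nat assume "j < 2"
    then show "lie_bracket (Q i) (Q j) = 0\<^sub>m m m" using i2[of i] i2[of j] \<open>i < 2\<close> b00 Q0 by auto
  next
    show "\<exists>l\<ge>1. l \<le> 2 \<and> (\<forall>c. lin_comb_mat m l c Q = 0\<^sub>m m m \<longrightarrow> (\<forall>i<l. c i = 0)) \<and> (\<forall>i. l \<le> i \<and> i < 2 \<longrightarrow> Q i = 0\<^sub>m m m)"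
      using li by (intro exI[of _ 2]) auto
  next
    fix i :: nat assume "1 \<le> i \<and> i < 2"
    then have "i = 1" by auto
    then show "(\<Sum>r<m. Q i $$ (r, r)) = 0" using Q1(3) by simp
  qed (use Q0 Q1 in auto)
qed

text \<open>\<Lambda> times the inverse metric is conjugated by \<open>G\<close>, up to the factor
  r, and the Q_j are conjugated by \<open>G\<close>, up to the factors s_j. Commutation is invariant
  under this.\<close>

lemma Lambda_condition_conj:
  assumes Kt: "Kt \<in> sq_mats m" "invertible_mat Kt"
    and GH: "G \<in> sq_mats m" "H \<in> sq_mats m" "G * H = 1\<^sub>m m" "H * G = 1\<^sub>m m"
    and L: "Lambda_condition k Kt Q \<Lambda>" and Q: "\<And>j. j < k \<Longrightarrow> Q j \<in> sq_mats m"
    and Q': "\<And>j. j < k \<Longrightarrow> Q' j = s j \<cdot>\<^sub>m (G * Q j * H)"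
  shows "Lambda_condition k (G * Kt * G\<^sup>T) Q' (r \<cdot>\<^sub>m (G * \<Lambda> * G\<^sup>T))"
proof -
  have dK: "dim_row Kt = m" "dim_row (G * Kt * G\<^sup>T) = m" using Kt GH by auto
  have Lc: "\<Lambda> \<in> sq_mats m" "\<Lambda> = \<Lambda>\<^sup>T" "\<And>j. j < k \<Longrightarrow> Q j * \<Lambda> * mat_inv Kt = \<Lambda> * mat_inv Kt * Q j"
    using L unfolding Lambda_condition_def dK by auto
  obtain B where B: "B \<in> sq_mats m" "Kt * B = 1\<^sub>m m" "B * Kt = 1\<^sub>m m" "mat_inv Kt = B"
    using Kt by (auto elim: invertible_matE)
  have T: "G\<^sup>T * H\<^sup>T = 1\<^sub>m m" "H\<^sup>T * G\<^sup>T = 1\<^sub>m m" using transpose_inverse[OF GH(2,1,4)] transpose_inverse[OF GH(1,2,3)] by auto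
  have inv: "mat_inv (G * Kt * G\<^sup>T) = H\<^sup>T * B * H"
  proof (rule mat_inv_eqI)
    show "G * Kt * G\<^sup>T * (H\<^sup>T * B * H) = 1\<^sub>m m" using GH B Kt T
      by (simp add: mat_simps mult_cancel_left_inverse[OF T(1)] mult_cancel_left_inverse[OF B(2)])
    show "H\<^sup>T * B * H * (G * Kt * G\<^sup>T) = 1\<^sub>m m" using GH B Kt T
      by (simp add: mat_simps mult_cancel_left_inverse[OF GH(4)] mult_cancel_left_inverse[OF B(3)])
  qed (use GH B Kt in auto)
  have "Q' j * (r \<cdot>\<^sub>m (G * \<Lambda> * G\<^sup>T)) * (H\<^sup>T * B * H) = r \<cdot>\<^sub>m (G * \<Lambda> * G\<^sup>T) * (H\<^sup>T * B * H) * Q' j" if j: "j < k" for j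
  proof -
    have c: "Q j * (\<Lambda> * B) = \<Lambda> * (B * Q j)"
      using Lc(3)[OF j] Q[OF j] Lc(1) B(1) unfolding B(4) by (simp add: mat_simps)
    have "Q' j * (r \<cdot>\<^sub>m (G * \<Lambda> * G\<^sup>T)) * (H\<^sup>T * B * H) = r \<cdot>\<^sub>m (s j \<cdot>\<^sub>m (G * (Q j * (\<Lambda> * B)) * H))"
      unfolding Q'[OF j] using Q[OF j] Lc(1) GH B(1) T
      by (simp add: mat_simps mult_cancel_left_inverse[OF T(1)] mult_cancel_left_inverse[OF GH(4)])
    also have "\<dots> = s j \<cdot>\<^sub>m (r \<cdot>\<^sub>m (G * (Q j * (\<Lambda> * B)) * H))" by (intro eq_matI) auto
    also have "\<dots> = r \<cdot>\<^sub>m (G * \<Lambda> * G\<^sup>T) * (H\<^sup>T * B * H) * Q' j"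
      unfolding Q'[OF j] c using Q[OF j] Lc(1) GH B(1) T
      by (simp add: mat_simps mult_cancel_left_inverse[OF T(1)] mult_cancel_left_inverse[OF GH(4)])
    finally show ?thesis .
  qed
  moreover have "r \<cdot>\<^sub>m (G * \<Lambda> * G\<^sup>T) = (r \<cdot>\<^sub>m (G * \<Lambda> * G\<^sup>T))\<^sup>T"
  proof -
    have "(r \<cdot>\<^sub>m (G * \<Lambda> * G\<^sup>T))\<^sup>T = r \<cdot>\<^sub>m (G * \<Lambda>\<^sup>T * G\<^sup>T)" using GH Lc(1) by (simp add: mat_simps)
    then show ?thesis using Lc(2) by simp
  qed
  ultimately show ?thesis unfolding Lambda_condition_def dK inv using GH Lc(1) by auto
qed

text \<open>\<open>E\<close> is the second cocycle equation for \<gamma> = (- \<alpha> Q v, \<alpha>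
  v). Testing it with a vector b such that b v = 1 gives Q = c + v u^T with u v = 0. The trace of
  this is m c, so the trace condition removes c.\<close>

lemma symmetric_annihilation:
  assumes v: "v \<in> carrier_vec m" "v \<noteq> 0\<^sub>v m" and Q: "Q \<in> sq_mats m" and m: "2 \<le> m"
    and tr: "(\<Sum>r<m. Q $$ (r, r)) = (0 :: real)"
    and E: "\<And>a a'. a \<in> carrier_vec m \<Longrightarrow> a' \<in> carrier_vec m \<Longrightarrow>
      (a' \<bullet> v) \<cdot>\<^sub>v (Q\<^sup>T *\<^sub>v a) - (a' \<bullet> (Q *\<^sub>v v)) \<cdot>\<^sub>v a = (a \<bullet> v) \<cdot>\<^sub>v (Q\<^sup>T *\<^sub>v a') - (a \<bullet> (Q *\<^sub>v v)) \<cdot>\<^sub>v a'"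
  shows "\<exists>u\<in>carrier_vec m. u \<bullet> v = 0 \<and> (\<forall>x\<in>carrier_vec m. Q *\<^sub>v x = (u \<bullet> x) \<cdot>\<^sub>v v)"
proof -
  have vv: "v \<bullet> v \<noteq> 0" using scalar_prod_self_zero[OF v(1)] v(2) by auto
  have Qv: "Q *\<^sub>v x \<in> carrier_vec m" "Q\<^sup>T *\<^sub>v x \<in> carrier_vec m" for x using Q by (auto intro!: carrier_vecI)
  have adj: "(Q\<^sup>T *\<^sub>v x) \<bullet> y = x \<bullet> (Q *\<^sub>v y)" if "x \<in> carrier_vec m" "y \<in> carrier_vec m" for x y
    using scalar_prod_mult_vec[OF Q that] by simp
  define b where "b = (1 / (v \<bullet> v)) \<cdot>\<^sub>v v"
  have b: "b \<in> carrier_vec m" "b \<bullet> v = 1" unfolding b_def using v vv by auto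
  define c where "c = b \<bullet> (Q *\<^sub>v v)"
  have E1: "Q\<^sup>T *\<^sub>v a - c \<cdot>\<^sub>v a = (a \<bullet> v) \<cdot>\<^sub>v (Q\<^sup>T *\<^sub>v b) - (a \<bullet> (Q *\<^sub>v v)) \<cdot>\<^sub>v b" if "a \<in> carrier_vec m" for a
    using E[OF that b(1)] b(2) unfolding c_def by simp
  \<comment> \<open>Pairing \<open>E1\<close> with v shows that a (Q v) - c (a v) is its own
    negative.\<close>
  have perp: "a \<bullet> (Q *\<^sub>v v) = c * (a \<bullet> v)" if a: "a \<in> carrier_vec m" for a
  proof -
    have "(Q\<^sup>T *\<^sub>v a - c \<cdot>\<^sub>v a) \<bullet> v = ((a \<bullet> v) \<cdot>\<^sub>v (Q\<^sup>T *\<^sub>v b) - (a \<bullet> (Q *\<^sub>v v)) \<cdot>\<^sub>v b) \<bullet> v" using E1[OF a] by simp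
    then have "a \<bullet> (Q *\<^sub>v v) - c * (a \<bullet> v) = (a \<bullet> v) * c - (a \<bullet> (Q *\<^sub>v v))"
      using a v(1) b Qv adj[OF a v(1)] adj[OF b(1) v(1)]
      by (simp add: minus_scalar_prod_distrib[of _ m] smult_scalar_prod_distrib[OF Qv(2) v(1)] c_def)
    then show ?thesis by simp
  qed
  define u where "u = Q\<^sup>T *\<^sub>v b - c \<cdot>\<^sub>v b"
  have u: "u \<in> carrier_vec m" unfolding u_def using Qv b by auto
  have uv: "u \<bullet> v = 0" unfolding u_def using Qv b v(1) adj[OF b(1) v(1)] by (simp add: minus_scalar_prod_distrib[of _ m] c_def)
  have QT: "Q\<^sup>T *\<^sub>v a = c \<cdot>\<^sub>v a + (a \<bullet> v) \<cdot>\<^sub>v u" if a: "a \<in> carrier_vec m" for a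
  proof -
    have e: "Q\<^sup>T *\<^sub>v a - c \<cdot>\<^sub>v a = (a \<bullet> v) \<cdot>\<^sub>v (Q\<^sup>T *\<^sub>v b) - (c * (a \<bullet> v)) \<cdot>\<^sub>v b" using E1[OF a] perp[OF a] by simp
    show ?thesis
    proof (rule eq_vecI)
      fix i assume "i < dim_vec (c \<cdot>\<^sub>v a + (a \<bullet> v) \<cdot>\<^sub>v u)"
      then have i: "i < m" using u by simp
      have "(Q\<^sup>T *\<^sub>v a - c \<cdot>\<^sub>v a) $ i = ((a \<bullet> v) \<cdot>\<^sub>v (Q\<^sup>T *\<^sub>v b) - (c * (a \<bullet> v)) \<cdot>\<^sub>v b) $ i" using e by simp
      then have "(Q\<^sup>T *\<^sub>v a) $ i - c * a $ i = (a \<bullet> v) * (Q\<^sup>T *\<^sub>v b) $ i - c * (a \<bullet> v) * b $ i"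
        using i a b Q by (simp del: index_mult_mat_vec)
      then show "(Q\<^sup>T *\<^sub>v a) $ i = (c \<cdot>\<^sub>v a + (a \<bullet> v) \<cdot>\<^sub>v u) $ i"
        unfolding u_def using i a b Q by (simp del: index_mult_mat_vec add: algebra_simps)
    qed (use u Q in auto)
  qed
  have Qx: "Q *\<^sub>v x = c \<cdot>\<^sub>v x + (u \<bullet> x) \<cdot>\<^sub>v v" if x: "x \<in> carrier_vec m" for x
  proof (rule vec_eqI_scalar_prods[of _ m])
    fix w :: "real vec" assume w: "w \<in> carrier_vec m"
    have "w \<bullet> (Q *\<^sub>v x) = (Q\<^sup>T *\<^sub>v w) \<bullet> x" using adj[OF w x] by simp
    also have "\<dots> = c * (w \<bullet> x) + (w \<bullet> v) * (u \<bullet> x)" unfolding QT[OF w] using w x u by (simp add: add_scalar_prod_distrib[of _ m])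
    also have "\<dots> = w \<bullet> (c \<cdot>\<^sub>v x + (u \<bullet> x) \<cdot>\<^sub>v v)" using w x v(1) by (simp add: scalar_prod_add_distrib[of _ m])
    finally show "w \<bullet> (Q *\<^sub>v x) = w \<bullet> (c \<cdot>\<^sub>v x + (u \<bullet> x) \<cdot>\<^sub>v v)" .
  qed (use Qv x v in auto)
  have "Q $$ (r, r) = c + u $ r * v $ r" if r: "r < m" for r
  proof -
    have "Q $$ (r, r) = (Q *\<^sub>v unit_vec m r) $ r" using mult_unit_vec[OF Q r] Q r by simp
    also have "\<dots> = c + u $ r * v $ r" unfolding Qx[OF unit_vec_carrier] using r u v(1) by simp
    finally show ?thesis .
  qed
  then have "(\<Sum>r<m. c + u $ r * v $ r) = 0" using tr by simp
  then have "real m * c + u \<bullet> v = 0" using v(1) by (simp add: sum.distrib scalar_prod_def atLeast0LessThan)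
  then have c0: "c = 0" using uv m by simp
  have "Q *\<^sub>v x = (u \<bullet> x) \<cdot>\<^sub>v v" if x: "x \<in> carrier_vec m" for x
    unfolding Qx[OF x] c0 using x v(1) by (intro eq_vecI) auto
  then show ?thesis using u uv by blast
qed


text \<open>The coefficient v of y in \<beta> decides. For v = 0 the cocycle is given by \<Lambda>
  alone. Otherwise Q takes the exceptional form after a change of basis that also moves v to the
  first unit vector, up to a factor, and \<gamma> is determined by v.\<close>

lemma nonsplit_two_large:
  assumes K: "K \<in> sq_mats n" and M: "e_MASA K M"
    and sig: "has_signature Kt p\<^sub>0 q\<^sub>0" and m: "2 \<le> p\<^sub>0 + q\<^sub>0" and Q: "free_rowed_matrices 2 Kt Q"
    and lr: "linearly_represented K (o_proj n M) (kravchuk_metric 2 Kt) (kravchuk_family 2 Kt Q)"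
  shows "\<exists>Kt' Q' \<Lambda>. has_signature Kt' p\<^sub>0 q\<^sub>0 \<and> free_rowed_matrices 2 Kt' Q' \<and>
     linearly_represented K (o_proj n M) (kravchuk_metric 2 Kt') (kravchuk_family 2 Kt' Q') \<and>
     Lambda_condition 2 Kt' Q' \<Lambda> \<and>
     represented K M (kravchuk_metric 2 Kt')
       (if special_Q p\<^sub>0 q\<^sub>0 Kt' (Q' 1)
        then nonsplit_set 2 Kt' Q'
               (\<lambda>\<alpha> Y. row_mult \<alpha> \<Lambda> + Y $$ (0, 1) \<cdot>\<^sub>v unit_vec (p\<^sub>0 + q\<^sub>0) 0)
               (\<lambda>\<alpha> Y. vec_of_list [0, \<alpha> \<bullet> unit_vec (p\<^sub>0 + q\<^sub>0) 0])
        else nonsplit_set 2 Kt' Q' (\<lambda>\<alpha> Y. row_mult \<alpha> \<Lambda>) (\<lambda>\<alpha> Y. 0\<^sub>v 2))"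
proof -
  define m where "m = p\<^sub>0 + q\<^sub>0"
  have m2: "2 \<le> m" "1 \<le> m" using m unfolding m_def by auto
  have Kt: "Kt \<in> sq_mats m" "Kt\<^sup>T = Kt" using sig unfolding has_signature_def m_def by auto
  have Kti: "invertible_mat Kt" using has_signature_invertible[OF sig] .
  have dK: "dim_row Kt = m" using Kt by simp
  note QD = free_rowed_matricesD[OF Q Kt(1)]
  have Q1: "Q 1 \<in> sq_mats m" "Q 1 * Kt = Kt * (Q 1)\<^sup>T" "(\<Sum>r<m. Q 1 $$ (r, r)) = 0" "Q 1 \<noteq> 0\<^sub>m m m"
    using QD(1)[of 1] QD(2)[of 1] QD(4)[of 1] QD(5) m2 by auto
  have k: "(1 :: nat) \<le> 2" "\<not> ((2 :: nat) = 1 \<and> m = 0)" by auto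
  have n: "n = 2 + m + 2"
    by (rule characterized_form(1)[where k = 2 and m = m and Q = Q, OF K M k Kt(1) Kti QD(1) QD(3) lr])
  obtain \<beta> \<gamma> where N: "normal_cocycle 2 m Q \<beta> \<gamma>" and r: "represented K M (kravchuk_metric 2 Kt) (nonsplit_set 2 Kt Q \<beta> \<gamma>)"
    using characterized_form(2)[where k = 2 and m = m and Q = Q, OF K M k Kt(1) Kti QD(1) QD(3) lr] by blast
  obtain \<Lambda> where L: "Lambda_condition 2 Kt Q \<Lambda>" "\<And>\<alpha>. \<alpha> \<in> carrier_vec m \<Longrightarrow> \<beta> \<alpha> (0\<^sub>m 2 2) = row_mult \<alpha> \<Lambda>"
    using cocycle_Lambda[OF Kt(1) Kti k(1) Q N] by blast
  have Lc: "\<Lambda> \<in> sq_mats m" using L(1) dK unfolding Lambda_condition_def by simp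
  define v where "v = \<beta> (0\<^sub>v m) (skew_unit 2 0 1)"
  define p where "p = \<gamma> (0\<^sub>v m) (skew_unit 2 0 1)"
  note T = cocycle_two[where Q = Q, OF QD(1) QD(3) N v_def p_def]
  have vp: "v \<in> carrier_vec m" "p \<in> carrier_vec 2" using T(5,6)[OF _ zero_carrier_vec skew_zero] by auto
  \<comment> \<open>The relation for p says p_0 1 + p_1 Q = 0. Its trace gives p_0 = 0, and then p_1
    = 0 since Q is not 0.\<close>
  have p0: "p = 0\<^sub>v 2"
  proof -
    have e: "p $ 0 * \<alpha> $ i + p $ 1 * ((Q 1)\<^sup>T *\<^sub>v \<alpha>) $ i = 0" if \<alpha>: "\<alpha> \<in> carrier_vec m" and i: "i < m" for \<alpha> i
      using arg_cong[OF T(4)[OF _ \<alpha> skew_zero], of "\<lambda>x. x $ i"] \<alpha> i Q1(1) by (simp del: index_mult_mat_vec)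
    have e': "p $ 0 * 1\<^sub>m m $$ (r, i) + p $ 1 * Q 1 $$ (r, i) = 0" if "r < m" "i < m" for r i
      using e[of "unit_vec m r" i] mult_unit_vec[of "(Q 1)\<^sup>T" m m r] Q1(1) that by (cases "r = i") (simp_all del: index_mult_mat_vec)
    have "p $ i = 0" if "i < 2" for i
    proof -
      have tr: "(\<Sum>r<m. p $ 0 * 1\<^sub>m m $$ (r, r) + p $ 1 * Q 1 $$ (r, r)) = 0" by (intro sum.neutral ballI) (rule e', auto)
      have "(\<Sum>r<m. p $ 0 * 1\<^sub>m m $$ (r, r) + p $ 1 * Q 1 $$ (r, r)) = real m * p $ 0 + p $ 1 * (\<Sum>r<m. Q 1 $$ (r, r))"
        by (simp add: sum.distrib sum_distrib_left)
      then have a: "p $ 0 = 0" using tr Q1(3) m2 by simp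
      have b: "p $ 1 = 0"
      proof (rule ccontr)
        assume "p $ 1 \<noteq> 0"
        then have "Q 1 $$ (r, s) = 0" if "r < m" "s < m" for r s using e'[OF that] a by simp
        then have "Q 1 = 0\<^sub>m m m" using Q1(1) by (intro eq_matI) auto
        then show False using Q1(4) by simp
      qed
      have "i = 0 \<or> i = 1" using \<open>i < 2\<close> by auto
      then show ?thesis using a b by auto
    qed
    then show ?thesis using vp(2) by (intro eq_vecI) auto
  qed
  have \<beta>: "\<beta> \<alpha> Y = row_mult \<alpha> \<Lambda> + Y $$ (0, 1) \<cdot>\<^sub>v v" if "\<alpha> \<in> carrier_vec m" "Y \<in> skew_mats 2" for \<alpha> Y
    using T(1)[OF _ that] L(2)[OF that(1)] by simp
  have \<gamma>: "\<gamma> \<alpha> Y = vec_of_list [- (\<alpha> \<bullet> (Q 1 *\<^sub>v v)), \<alpha> \<bullet> v]" if h: "\<alpha> \<in> carrier_vec m" "Y \<in> skew_mats 2" for \<alpha> Y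
  proof -
    have "\<gamma> \<alpha> Y $ 0 = - (\<alpha> \<bullet> (Q 1 *\<^sub>v v))" "\<gamma> \<alpha> Y $ 1 = \<alpha> \<bullet> v" using T(2,3)[OF _ h] p0 by simp_all
    moreover have "\<gamma> \<alpha> Y \<in> carrier_vec 2" using cocycleD(2)[OF N h] .
    ultimately show ?thesis by (intro eq_vecI) (auto simp: less_Suc_eq)
  qed
  have Msub: "M \<subseteq> sq_mats (n + 1)" using e_MASA_subset[OF K M] .
  have lr_of: "linearly_represented K (o_proj n M) (kravchuk_metric 2 Kt') (kravchuk_family 2 Kt' Q')"
    if r': "represented K M (kravchuk_metric 2 Kt') (nonsplit_set 2 Kt' Q' \<beta>' \<gamma>')" and Kt': "Kt' \<in> sq_mats m"
      and car: "\<And>\<alpha> Y. \<alpha> \<in> carrier_vec m \<Longrightarrow> Y \<in> skew_mats 2 \<Longrightarrow> \<beta>' \<alpha> Y \<in> carrier_vec m \<and> \<gamma>' \<alpha> Y \<in> carrier_vec 2"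
    for Kt' Q' \<beta>' \<gamma>'
  proof -
    have "o_proj n (nonsplit_set 2 Kt' Q' \<beta>' \<gamma>') = kravchuk_family 2 Kt' Q'"
      unfolding n by (rule nonsplit_set_pairs(3)[OF Kt']) (rule car)
    then show ?thesis using represented_e_MASA(3)[OF K M r'] by simp
  qed
  show ?thesis
  proof (cases "v = 0\<^sub>v m")
    case v0: True
    have \<gamma>0: "\<gamma> \<alpha> Y = 0\<^sub>v 2" "\<beta> \<alpha> Y = row_mult \<alpha> \<Lambda>" if h: "\<alpha> \<in> carrier_vec m" "Y \<in> skew_mats 2" for \<alpha> Y
    proof -
      show "\<gamma> \<alpha> Y = 0\<^sub>v 2" unfolding \<gamma>[OF h] v0 using h Q1(1) by (intro eq_vecI) (auto simp: mat_simps less_2_cases_iff)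
      show "\<beta> \<alpha> Y = row_mult \<alpha> \<Lambda>" unfolding \<beta>[OF h] v0 row_mult_def using Lc by (intro eq_vecI) auto
    qed
    show ?thesis
    proof (cases "special_Q p\<^sub>0 q\<^sub>0 Kt (Q 1)")
      case False
      have "nonsplit_set 2 Kt Q \<beta> \<gamma> = nonsplit_set 2 Kt Q (\<lambda>\<alpha> Y. row_mult \<alpha> \<Lambda>) (\<lambda>\<alpha> Y. 0\<^sub>v 2)"
        by (rule nonsplit_set_cong) (use \<gamma>0 dK in simp)
      then show ?thesis using False sig Q lr L(1) r by (intro exI[of _ Kt] exI[of _ Q] exI[of _ \<Lambda>]) simp
    next
      case True
      \<comment> \<open>Doubling the second row leaves the special form, so that the regular normal form applies.\<close>
      define Q' where "Q' i = (if i = 0 then 1 else 2 :: real) \<cdot>\<^sub>m Q i" for i :: nat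
      let ?g = "\<lambda>i::nat. if i = 0 then 1 else 2 :: real"
      have one: "(1\<^sub>m m :: real mat) \<in> sq_mats m" "1\<^sub>m m * 1\<^sub>m m = (1\<^sub>m m :: real mat)" by auto
      have K1: "1\<^sub>m m * Kt * (1\<^sub>m m)\<^sup>T = Kt" using Kt(1) by (simp add: mat_dim_simps)
      have QQ: "Q' i = (?g i / ?g 0) \<cdot>\<^sub>m (1\<^sub>m m * Q i * 1\<^sub>m m)" if "i < 2" for i unfolding Q'_def using QD(1)[OF that] by simp
      have gnz: "?g i \<noteq> 0" for i by simp
      have "represented (kravchuk_metric 2 Kt) (nonsplit_set 2 Kt Q \<beta> \<gamma>)
        (kravchuk_metric 2 (1\<^sub>m m * Kt * (1\<^sub>m m)\<^sup>T)) (nonsplit_set 2 (1\<^sub>m m * Kt * (1\<^sub>m m)\<^sup>T) Q'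
           (\<lambda>\<alpha> Y. row_mult \<alpha> \<Lambda>) (\<lambda>\<alpha> Y. 0\<^sub>v 2))"
      proof (rule nonsplit_transform[where ?G1.0 = "scale_mat 2 ?g" and ?H1.0 = "scale_mat 2 (\<lambda>i. 1 / ?g i)"
            and ?G2.0 = "1\<^sub>m m" and ?H2.0 = "1\<^sub>m m" and c = "0\<^sub>v 2" and \<phi> = "\<lambda>\<alpha>. ?g 0 \<cdot>\<^sub>v ((1\<^sub>m m)\<^sup>T *\<^sub>v \<alpha>)", OF Kt(1) _ _ _ _ one(1,1,2,2)])
        show "scale_mat 2 ?g * scale_mat 2 (\<lambda>i. 1 / ?g i) = 1\<^sub>m 2" "scale_mat 2 (\<lambda>i. 1 / ?g i) * scale_mat 2 ?g = 1\<^sub>m 2"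
          using scale_mat_inverse[of 2 ?g] gnz by blast+
        show "(\<lambda>\<alpha>. ?g 0 \<cdot>\<^sub>v ((1\<^sub>m m)\<^sup>T *\<^sub>v \<alpha>)) ` carrier_vec m = carrier_vec m"
          by (rule scaled_transpose_onto[OF gnz one(1,1,2,2)])
        fix \<alpha> :: "real vec" assume \<alpha>: "\<alpha> \<in> carrier_vec m"
        show "rows_mat 2 Q' (?g 0 \<cdot>\<^sub>v ((1\<^sub>m m)\<^sup>T *\<^sub>v \<alpha>)) = scale_mat 2 ?g * rows_mat 2 Q \<alpha> * 1\<^sub>m m"
          by (rule rows_mat_diagonal[where g = ?g, OF \<alpha> gnz one(1,1,2,2)]) (use QD(1) QQ in auto)
        fix Y assume Y: "Y \<in> skew_mats 2"
        show "\<beta> \<alpha> Y \<in> carrier_vec m \<and> \<gamma> \<alpha> Y \<in> carrier_vec 2" using cocycleD(1,2)[OF N \<alpha> Y] by simp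
        show "0\<^sub>v 2 = (scale_mat 2 (\<lambda>i. 1 / ?g i))\<^sup>T *\<^sub>v \<gamma> \<alpha> Y" unfolding \<gamma>0[OF \<alpha> Y] by (simp add: mat_dim_simps)
        show "row_mult (?g 0 \<cdot>\<^sub>v ((1\<^sub>m m)\<^sup>T *\<^sub>v \<alpha>)) \<Lambda> = 1\<^sub>m m *\<^sub>v (\<beta> \<alpha> Y - Kt *\<^sub>v ((rows_mat 2 Q \<alpha>)\<^sup>T *\<^sub>v 0\<^sub>v 2))"
          unfolding \<gamma>0[OF \<alpha> Y] row_mult_def using \<alpha> Lc Kt(1) rows_mat_carrier[OF \<alpha>, of 2 Q]
          by (simp add: mat_simps)
      qed auto
      then have r': "represented K M (kravchuk_metric 2 Kt) (nonsplit_set 2 Kt Q' (\<lambda>\<alpha> Y. row_mult \<alpha> \<Lambda>) (\<lambda>\<alpha> Y. 0\<^sub>v 2))"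
        unfolding K1 using represented_trans[OF K Msub r] by blast
      have Q'1: "Q' 0 = 1\<^sub>m m" "Q' 1 = 2 \<cdot>\<^sub>m Q 1" unfolding Q'_def using QD(3) by auto
      have fr: "free_rowed_matrices 2 Kt Q'"
      proof (rule free_rowed_two[where Q = Q', OF Kt(1) m2(2) Q'1(1)])
        show "Q' 1 \<in> sq_mats m" unfolding Q'1 using Q1(1) by simp
        show "Q' 1 * Kt = Kt * (Q' 1)\<^sup>T" unfolding Q'1 using Q1(1,2) Kt(1) by (simp add: mat_simps)
        have "(\<Sum>r<m. Q' 1 $$ (r, r)) = 2 * (\<Sum>r<m. Q 1 $$ (r, r))" unfolding Q'1 sum_distrib_left using Q1(1) by (intro sum.cong) auto
        then show "(\<Sum>r<m. Q' 1 $$ (r, r)) = 0" using Q1(3) by simp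
        show "Q' 1 \<noteq> 0\<^sub>m m m"
        proof
          assume z: "Q' 1 = 0\<^sub>m m m"
          have "Q 1 $$ (r, s) = 0" if "r < m" "s < m" for r s
            using arg_cong[OF z, of "\<lambda>x. x $$ (r, s)"] that Q1(1) unfolding Q'1 by simp
          then have "Q 1 = 0\<^sub>m m m" using Q1(1) by (intro eq_matI) auto
          then show False using Q1(4) by simp
        qed
      qed
      have L': "Lambda_condition 2 Kt Q' \<Lambda>"
      proof -
        have "Lambda_condition 2 (1\<^sub>m m * Kt * (1\<^sub>m m)\<^sup>T) Q' (1 \<cdot>\<^sub>m (1\<^sub>m m * \<Lambda> * (1\<^sub>m m)\<^sup>T))"
          by (rule Lambda_condition_conj[OF Kt(1) Kti one(1,1,2,2) L(1) QD(1) QQ])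
        moreover have "1 \<cdot>\<^sub>m (1\<^sub>m m * \<Lambda> * (1\<^sub>m m)\<^sup>T) = \<Lambda>" using Lc by (intro eq_matI) auto
        ultimately show ?thesis unfolding K1 by simp
      qed
      have "\<not> special_Q p\<^sub>0 q\<^sub>0 Kt (Q' 1)"
      proof
        assume s: "special_Q p\<^sub>0 q\<^sub>0 Kt (Q' 1)"
        have "Q' 1 $$ (0, 1) = 1" using s m2 unfolding special_Q_def m_def by auto
        moreover have "Q 1 $$ (0, 1) = 1" using True m2 unfolding special_Q_def m_def by auto
        ultimately show False unfolding Q'1 using Q1(1) m2 by simp
      qed
      moreover have "linearly_represented K (o_proj n M) (kravchuk_metric 2 Kt) (kravchuk_family 2 Kt Q')"
        by (rule lr_of[OF r' Kt(1)]) (use Lc in \<open>auto simp: row_mult_def intro!: carrier_vecI\<close>)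
      ultimately show ?thesis using sig fr L' r' by (intro exI[of _ Kt] exI[of _ Q'] exI[of _ \<Lambda>]) simp
    qed
  next
    case False
    \<comment> \<open>The second cocycle equation at Y = Y' = 0, with \<gamma> expressed by
      v.\<close>
    have E: "(\<alpha>' \<bullet> v) \<cdot>\<^sub>v ((Q 1)\<^sup>T *\<^sub>v \<alpha>) - (\<alpha>' \<bullet> (Q 1 *\<^sub>v v)) \<cdot>\<^sub>v \<alpha> =
        (\<alpha> \<bullet> v) \<cdot>\<^sub>v ((Q 1)\<^sup>T *\<^sub>v \<alpha>') - (\<alpha> \<bullet> (Q 1 *\<^sub>v v)) \<cdot>\<^sub>v \<alpha>'"
      if \<alpha>: "\<alpha> \<in> carrier_vec m" and \<alpha>': "\<alpha>' \<in> carrier_vec m" for \<alpha> \<alpha>'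
    proof -
      have rt: "(rows_mat 2 Q a)\<^sup>T *\<^sub>v \<gamma> b (0\<^sub>m 2 2) = (b \<bullet> v) \<cdot>\<^sub>v ((Q 1)\<^sup>T *\<^sub>v a) - (b \<bullet> (Q 1 *\<^sub>v v)) \<cdot>\<^sub>v a"
        if a: "a \<in> carrier_vec m" and b: "b \<in> carrier_vec m" for a b
      proof -
        have gc: "\<gamma> b (0\<^sub>m 2 2) \<in> carrier_vec 2" using cocycleD(2)[OF N b skew_zero] .
        have "(rows_mat 2 Q a)\<^sup>T *\<^sub>v \<gamma> b (0\<^sub>m 2 2) = (lin_comb_mat m 2 (vec_index (\<gamma> b (0\<^sub>m 2 2))) Q)\<^sup>T *\<^sub>v a"
          by (rule rows_mat_transpose_mult[OF a QD(1) gc])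
        also have "lin_comb_mat m 2 (vec_index (\<gamma> b (0\<^sub>m 2 2))) Q = (- (b \<bullet> (Q 1 *\<^sub>v v))) \<cdot>\<^sub>m 1\<^sub>m m + (b \<bullet> v) \<cdot>\<^sub>m Q 1"
          using lin_comb_mat_two[of Q m "vec_index (\<gamma> b (0\<^sub>m 2 2))"] QD(3) Q1(1) \<gamma>[OF b skew_zero] by simp
        also have "\<dots>\<^sup>T *\<^sub>v a = (- (b \<bullet> (Q 1 *\<^sub>v v))) \<cdot>\<^sub>v a + (b \<bullet> v) \<cdot>\<^sub>v ((Q 1)\<^sup>T *\<^sub>v a)"
          using a Q1(1) by (simp add: mat_simps)
        also have "\<dots> = (b \<bullet> v) \<cdot>\<^sub>v ((Q 1)\<^sup>T *\<^sub>v a) - (b \<bullet> (Q 1 *\<^sub>v v)) \<cdot>\<^sub>v a"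
          using a Q1(1) by (intro eq_vecI) (simp_all del: index_mult_mat_vec)
        finally show ?thesis .
      qed
      show ?thesis using cocycleD(8)[OF N \<alpha> skew_zero \<alpha>' skew_zero] rt[OF \<alpha> \<alpha>'] rt[OF \<alpha>' \<alpha>] by simp
    qed
    obtain u where u: "u \<in> carrier_vec m" "u \<bullet> v = 0" "\<And>x. x \<in> carrier_vec m \<Longrightarrow> Q 1 *\<^sub>v x = (u \<bullet> x) \<cdot>\<^sub>v v"
      using symmetric_annihilation[OF vp(1) False Q1(1) m2(1) Q1(3) E] by blast
    have u0: "u \<noteq> 0\<^sub>v m"
    proof
      assume u0: "u = 0\<^sub>v m"
      have "Q 1 = 0\<^sub>m m m"
      proof (rule mat_eq_by_vec[OF Q1(1)])
        fix x :: "real vec" assume x: "x \<in> carrier_vec m"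
        show "Q 1 *\<^sub>v x = 0\<^sub>m m m *\<^sub>v x" unfolding u(3)[OF x] u0 using x vp(1) by (auto simp: mat_dim_simps)
      qed simp
      then show False using Q1(4) by simp
    qed
    have vv: "v \<bullet> v \<noteq> 0" using scalar_prod_self_zero[OF vp(1)] False by auto
    define \<kappa> where "\<kappa> = Kt *\<^sub>v u"
    have \<kappa>: "\<kappa> \<in> carrier_vec m" unfolding \<kappa>_def using Kt(1) by (intro carrier_vecI) auto
    have QT: "(Q 1)\<^sup>T *\<^sub>v x = (v \<bullet> x) \<cdot>\<^sub>v u" if x: "x \<in> carrier_vec m" for x
    proof (rule vec_eqI_scalar_prods[of _ m])
      show "(Q 1)\<^sup>T *\<^sub>v x \<in> carrier_vec m" using Q1(1) by (intro carrier_vecI) auto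
      fix w :: "real vec" assume w: "w \<in> carrier_vec m"
      have "w \<bullet> ((Q 1)\<^sup>T *\<^sub>v x) = (Q 1 *\<^sub>v w) \<bullet> x" using scalar_prod_mult_vec[of "(Q 1)\<^sup>T" m m w x] Q1(1) w x by simp
      also have "\<dots> = w \<bullet> ((v \<bullet> x) \<cdot>\<^sub>v u)" unfolding u(3)[OF w] using w x vp(1) u(1) comm_scalar_prod[OF u(1) w] by simp
      finally show "w \<bullet> ((Q 1)\<^sup>T *\<^sub>v x) = w \<bullet> ((v \<bullet> x) \<cdot>\<^sub>v u)" .
    qed (use u in auto)
    \<comment> \<open>For Q = v u^T, the symmetry Q K = K Q^T says that v (K u)^T is a symmetric
      matrix, so K u is proportional to v.\<close>
    have sv: "(\<kappa> \<bullet> x) \<cdot>\<^sub>v v = (v \<bullet> x) \<cdot>\<^sub>v \<kappa>" if x: "x \<in> carrier_vec m" for x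
    proof -
      have "(Q 1 * Kt) *\<^sub>v x = (Kt * (Q 1)\<^sup>T) *\<^sub>v x" using Q1(2) by simp
      then have "Q 1 *\<^sub>v (Kt *\<^sub>v x) = Kt *\<^sub>v ((Q 1)\<^sup>T *\<^sub>v x)" using Q1(1) Kt(1) x by (simp add: mat_simps)
      moreover have "Kt *\<^sub>v x \<in> carrier_vec m" using Kt(1) by (intro carrier_vecI) auto
      ultimately have "(u \<bullet> (Kt *\<^sub>v x)) \<cdot>\<^sub>v v = (v \<bullet> x) \<cdot>\<^sub>v \<kappa>"
        unfolding \<kappa>_def using u(3)[of "Kt *\<^sub>v x"] QT[OF x] Kt(1) u(1) by (simp add: mat_simps)
      moreover have "u \<bullet> (Kt *\<^sub>v x) = \<kappa> \<bullet> x" unfolding \<kappa>_def using scalar_prod_mult_vec[OF Kt(1) u(1) x] Kt(2) by simp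
      ultimately show ?thesis by simp
    qed
    define s where "s = (\<kappa> \<bullet> v) / (v \<bullet> v)"
    have \<kappa>s: "\<kappa> = s \<cdot>\<^sub>v v"
    proof -
      have "(1 / (v \<bullet> v)) \<cdot>\<^sub>v ((\<kappa> \<bullet> v) \<cdot>\<^sub>v v) = (1 / (v \<bullet> v)) \<cdot>\<^sub>v ((v \<bullet> v) \<cdot>\<^sub>v \<kappa>)" using sv[OF vp(1)] by simp
      then show ?thesis using vv unfolding s_def by (simp add: smult_smult_assoc)
    qed
    have s0: "s \<noteq> 0"
    proof
      assume "s = 0"
      then have z: "Kt *\<^sub>v u = 0\<^sub>v m" using \<kappa>s vp(1) unfolding \<kappa>_def by auto
      obtain B where B: "B \<in> sq_mats m" "B * Kt = 1\<^sub>m m" using Kt Kti by (auto elim: invertible_matE)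
      have "u = B *\<^sub>v (Kt *\<^sub>v u)" using B Kt u by (subst mult_vec_cancel_left_inverse[OF B(2)]) (auto simp: dim_of_carrier)
      then show False using u0 B unfolding z by (simp add: mat_simps)
    qed
    \<comment> \<open>K u = s v and u v = 0.\<close>
    have iso: "u \<bullet> (Kt *\<^sub>v u) = 0" using u(2) \<kappa>s u(1) vp(1) unfolding \<kappa>_def by simp
    define l where "l = m - 2"
    have ml: "m = 2 + l" unfolding l_def using m2 by simp
    obtain G K' where G: "G \<in> sq_mats m" "invertible_mat G" "G\<^sup>T *\<^sub>v unit_vec m 1 = u"
      "K' \<in> sq_mats l" "K'\<^sup>T = K'" "G * Kt * G\<^sup>T = diag_block_mat [hyp_plane, K']"
      using isotropic_vector_hyperbolic[of Kt l u] Kt Kti u(1) u0 iso unfolding ml by blast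
    obtain H where H: "H \<in> sq_mats m" "G * H = 1\<^sub>m m" "H * G = 1\<^sub>m m" using G by (auto elim: invertible_matE)
    define Kt' where "Kt' = G * Kt * G\<^sup>T"
    have Kt'c: "Kt' \<in> sq_mats m" unfolding Kt'_def using G(1) Kt(1) by auto
    have sig': "has_signature Kt' p\<^sub>0 q\<^sub>0" unfolding Kt'_def using has_signature_congruent[OF sig] G(1,2) unfolding m_def by simp
    define E12 :: "real mat" where "E12 = mat m m (\<lambda>(i, j). if i = 0 \<and> j = 1 then 1 else 0)"
    have E12: "E12 \<in> sq_mats m" unfolding E12_def by simp
    have E12v: "E12 *\<^sub>v x = x $ 1 \<cdot>\<^sub>v unit_vec m 0" if x: "x \<in> carrier_vec m" for x
    proof (rule eq_vecI)
      fix i assume "i < dim_vec (x $ 1 \<cdot>\<^sub>v unit_vec m 0)"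
      then have i: "i < m" by simp
      have "(E12 *\<^sub>v x) $ i = (\<Sum>t = 0..<m. (if t = 1 then (if i = 0 then x $ t else 0) else 0))"
        unfolding mult_vec_index[OF E12 x i] using i by (intro sum.cong) (auto simp: E12_def)
      then show "(E12 *\<^sub>v x) $ i = (x $ 1 \<cdot>\<^sub>v unit_vec m 0) $ i" using i m2 by simp
    qed (use E12 in auto)
    have Kt'1: "Kt' *\<^sub>v unit_vec m 1 = unit_vec m 0"
    proof -
      have "Kt' *\<^sub>v unit_vec m 1 = col Kt' 1" using Kt'c m2 by (intro mult_unit_vec) auto
      also have "\<dots> = unit_vec m 0"
      proof (rule eq_vecI)
        fix i assume "i < dim_vec (unit_vec m 0 :: real vec)"
        then have i: "i < m" by simp
        have "Kt' $$ (i, 1) = (if i = 0 then 1 else 0)"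
          unfolding Kt'_def G(6) diag_block_mat_two using G(4) i ml hyp_plane_index[of i 1]
          by (cases "i < 2") (auto simp: less_2_cases_iff)
        then show "col Kt' 1 $ i = unit_vec m 0 $ i" using Kt'c i m2 by simp
      qed (use Kt'c in auto)
      finally show ?thesis .
    qed
    have sGv: "s \<cdot>\<^sub>v (G *\<^sub>v v) = unit_vec m 0"
    proof -
      have "Kt' *\<^sub>v unit_vec m 1 = G *\<^sub>v (Kt *\<^sub>v (G\<^sup>T *\<^sub>v unit_vec m 1))" unfolding Kt'_def using G(1) Kt(1) by (simp add: mat_simps)
      also have "\<dots> = s \<cdot>\<^sub>v (G *\<^sub>v v)" unfolding G(3) \<kappa>_def[symmetric] \<kappa>s using G(1) vp(1) by (simp add: mat_simps)
      finally show ?thesis using Kt'1 by simp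
    qed
    have Gx1: "(G *\<^sub>v x) $ 1 = u \<bullet> x" if x: "x \<in> carrier_vec m" for x
    proof -
      have "(G *\<^sub>v x) $ 1 = unit_vec m 1 \<bullet> (G *\<^sub>v x)" using G(1) m2 by (simp add: carrier_vecI)
      also have "\<dots> = u \<bullet> x" using scalar_prod_mult_vec[OF G(1) unit_vec_carrier x, of 1] G(3) by simp
      finally show ?thesis .
    qed
    \<comment> \<open>\<open>G\<close> turns the functional u into coordinate 1 and s v into the
      first unit vector, so v u^T becomes \<open>E12\<close> divided by s.\<close>
    have EG: "E12 = s \<cdot>\<^sub>m (G * Q 1 * H)"
    proof -
      have "E12 * G = s \<cdot>\<^sub>m (G * Q 1)"
      proof (rule mat_eq_by_vec[of _ m m])
        fix x :: "real vec" assume x: "x \<in> carrier_vec m"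
        have Gx: "G *\<^sub>v x \<in> carrier_vec m" using G(1) by (intro carrier_vecI) auto
        have "(E12 * G) *\<^sub>v x = (u \<bullet> x) \<cdot>\<^sub>v unit_vec m 0" using E12 G(1) x E12v[OF Gx] Gx1[OF x] by (simp add: mult_vec_assoc_dim dim_of_carrier)
        also have "\<dots> = (u \<bullet> x) \<cdot>\<^sub>v (s \<cdot>\<^sub>v (G *\<^sub>v v))" unfolding sGv ..
        also have "\<dots> = s \<cdot>\<^sub>v ((u \<bullet> x) \<cdot>\<^sub>v (G *\<^sub>v v))" by (simp add: smult_smult_assoc mult.commute)
        also have "(u \<bullet> x) \<cdot>\<^sub>v (G *\<^sub>v v) = G *\<^sub>v (Q 1 *\<^sub>v x)" unfolding u(3)[OF x] using G(1) vp(1) by (simp add: mat_simps)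
        finally show "(E12 * G) *\<^sub>v x = (s \<cdot>\<^sub>m (G * Q 1)) *\<^sub>v x" using G(1) Q1(1) x by (simp add: mat_simps)
      qed (use E12 G(1) Q1(1) in auto)
      then have "E12 * G * H = s \<cdot>\<^sub>m (G * Q 1) * H" by simp
      then show ?thesis using E12 G(1) H Q1(1) by (simp add: mat_simps)
    qed
    define Q' where "Q' i = (if i = 0 then 1\<^sub>m m else E12)" for i :: nat
    \<comment> \<open>The quotient of the two scalings has to be s, so that
      \<open>G * Q 1 * H\<close> becomes \<open>E12\<close>. The factor 1 / s also fits \<beta>: y
      turns into y / s, and G v is the first unit vector divided by s.\<close>
    let ?g = "\<lambda>i::nat. if i = 0 then 1 / s else 1 :: real"
    have gnz: "?g i \<noteq> 0" for i using s0 by simp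
    have QQ: "Q' i = (?g i / ?g 0) \<cdot>\<^sub>m (G * Q i * H)" if "i < 2" for i
    proof (cases "i = 0")
      case True
      then show ?thesis unfolding Q'_def using QD(3) G(1) H s0 by (auto intro!: eq_matI)
    next
      case False
      then have "i = 1" using that by simp
      then show ?thesis unfolding Q'_def using EG s0 by simp
    qed
    define \<Lambda>' where "\<Lambda>' = (1 / ?g 0) \<cdot>\<^sub>m (G * \<Lambda> * G\<^sup>T)"
    have L': "Lambda_condition 2 Kt' Q' \<Lambda>'" unfolding Kt'_def \<Lambda>'_def
      by (rule Lambda_condition_conj[OF Kt(1) Kti G(1) H L(1) QD(1) QQ])
    have Lc': "\<Lambda>' \<in> sq_mats m" unfolding \<Lambda>'_def using G(1) Lc by auto
    have GHT: "G\<^sup>T * H\<^sup>T = 1\<^sub>m m" using transpose_inverse[OF H(1) G(1) H(3)] .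
    have Qv0: "Q 1 *\<^sub>v v = 0\<^sub>v m" using u(3)[OF vp(1)] u(2) vp(1) by auto
    have "represented (kravchuk_metric 2 Kt) (nonsplit_set 2 Kt Q \<beta> \<gamma>)
      (kravchuk_metric 2 (G * Kt * G\<^sup>T)) (nonsplit_set 2 (G * Kt * G\<^sup>T) Q'
         (\<lambda>\<alpha> Y. row_mult \<alpha> \<Lambda>' + Y $$ (0, 1) \<cdot>\<^sub>v unit_vec m 0) (\<lambda>\<alpha> Y. vec_of_list [0, \<alpha> \<bullet> unit_vec m 0]))"
    proof (rule nonsplit_transform[where ?G1.0 = "scale_mat 2 ?g" and ?H1.0 = "scale_mat 2 (\<lambda>i. 1 / ?g i)"
          and ?G2.0 = G and ?H2.0 = H and c = "0\<^sub>v 2" and \<phi> = "\<lambda>\<alpha>. ?g 0 \<cdot>\<^sub>v (H\<^sup>T *\<^sub>v \<alpha>)", OF Kt(1) _ _ _ _ G(1) H])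
      show "scale_mat 2 ?g * scale_mat 2 (\<lambda>i. 1 / ?g i) = 1\<^sub>m 2" "scale_mat 2 (\<lambda>i. 1 / ?g i) * scale_mat 2 ?g = 1\<^sub>m 2"
        using scale_mat_inverse[of 2 ?g] gnz by blast+
      show "(\<lambda>\<alpha>. ?g 0 \<cdot>\<^sub>v (H\<^sup>T *\<^sub>v \<alpha>)) ` carrier_vec m = carrier_vec m"
        by (rule scaled_transpose_onto[OF gnz G(1) H])
      fix \<alpha> :: "real vec" assume \<alpha>: "\<alpha> \<in> carrier_vec m"
      show "rows_mat 2 Q' (?g 0 \<cdot>\<^sub>v (H\<^sup>T *\<^sub>v \<alpha>)) = scale_mat 2 ?g * rows_mat 2 Q \<alpha> * H"
        by (rule rows_mat_diagonal[where g = ?g, OF \<alpha> gnz G(1) H]) (use QD(1) QQ in auto)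
      fix Y assume Y: "Y \<in> skew_mats 2"
      have Yc: "Y \<in> sq_mats 2" using skew_carrier[OF Y] .
      show "\<beta> \<alpha> Y \<in> carrier_vec m \<and> \<gamma> \<alpha> Y \<in> carrier_vec 2" using cocycleD(1,2)[OF N \<alpha> Y] by simp
      have Y01: "(scale_mat 2 ?g * Y * (scale_mat 2 ?g)\<^sup>T) $$ (0, 1) = (1 / s) * Y $$ (0, 1)"
        unfolding scale_mat_transpose using Yc
        by (simp add: scale_mat_def scalar_prod_def numeral_2_eq_2)
      have HTa: "H\<^sup>T *\<^sub>v \<alpha> \<in> carrier_vec m" using H by (intro carrier_vecI) auto
      have rm: "row_mult (?g 0 \<cdot>\<^sub>v (H\<^sup>T *\<^sub>v \<alpha>)) \<Lambda>' = G *\<^sub>v row_mult \<alpha> \<Lambda>"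
      proof -
        have "row_mult (?g 0 \<cdot>\<^sub>v (H\<^sup>T *\<^sub>v \<alpha>)) \<Lambda>' = (1 / s) \<cdot>\<^sub>v (s \<cdot>\<^sub>v (G *\<^sub>v (\<Lambda>\<^sup>T *\<^sub>v (G\<^sup>T *\<^sub>v (H\<^sup>T *\<^sub>v \<alpha>)))))"
          unfolding row_mult_def \<Lambda>'_def using Lc G(1) H(1) \<alpha> by (simp add: mat_simps)
        also have "\<dots> = G *\<^sub>v (\<Lambda>\<^sup>T *\<^sub>v \<alpha>)" using s0 mult_vec_cancel_left_inverse[OF GHT] G(1) H(1) \<alpha>
          by (simp add: smult_smult_assoc dim_of_carrier)
        finally show ?thesis unfolding row_mult_def .
      qed
      have Gv: "G *\<^sub>v v = (1 / s) \<cdot>\<^sub>v unit_vec m 0" unfolding sGv[symmetric] using s0 by (simp add: smult_smult_assoc)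
      show "row_mult (?g 0 \<cdot>\<^sub>v (H\<^sup>T *\<^sub>v \<alpha>)) \<Lambda>' + (scale_mat 2 ?g * Y * (scale_mat 2 ?g)\<^sup>T) $$ (0, 1) \<cdot>\<^sub>v unit_vec m 0
        = G *\<^sub>v (\<beta> \<alpha> Y - Kt *\<^sub>v ((rows_mat 2 Q \<alpha>)\<^sup>T *\<^sub>v 0\<^sub>v 2))"
      proof -
        have rc: "row_mult \<alpha> \<Lambda> \<in> carrier_vec m" unfolding row_mult_def using Lc by (intro carrier_vecI) auto
        have "\<beta> \<alpha> Y - Kt *\<^sub>v ((rows_mat 2 Q \<alpha>)\<^sup>T *\<^sub>v 0\<^sub>v 2) = row_mult \<alpha> \<Lambda> + Y $$ (0, 1) \<cdot>\<^sub>v v"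
          unfolding \<beta>[OF \<alpha> Y] using rc vp(1) Kt(1) rows_mat_carrier[OF \<alpha>, of 2 Q] by (simp add: mat_simps)
        then have "G *\<^sub>v (\<beta> \<alpha> Y - Kt *\<^sub>v ((rows_mat 2 Q \<alpha>)\<^sup>T *\<^sub>v 0\<^sub>v 2)) = G *\<^sub>v row_mult \<alpha> \<Lambda> + Y $$ (0, 1) \<cdot>\<^sub>v (G *\<^sub>v v)"
          using rc vp(1) G(1) by (simp add: mat_simps)
        then show ?thesis unfolding rm Y01 Gv by (simp add: smult_smult_assoc mult.commute)
      qed
      show "vec_of_list [0, (?g 0 \<cdot>\<^sub>v (H\<^sup>T *\<^sub>v \<alpha>)) \<bullet> unit_vec m 0] = (scale_mat 2 (\<lambda>i. 1 / ?g i))\<^sup>T *\<^sub>v \<gamma> \<alpha> Y" (is "?l = ?r")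
      proof (rule eq_vecI)
        fix i assume "i < dim_vec ?r"
        then have i: "i < 2" by simp
        have gc: "\<gamma> \<alpha> Y \<in> carrier_vec 2" using cocycleD(2)[OF N \<alpha> Y] .
        have rr: "?r $ i = 1 / ?g i * \<gamma> \<alpha> Y $ i" unfolding scale_mat_transpose by (rule scale_mat_mult_vec[OF gc i])
        have "(H\<^sup>T *\<^sub>v \<alpha>) \<bullet> unit_vec m 0 = \<alpha> \<bullet> (H *\<^sub>v unit_vec m 0)" using scalar_prod_mult_vec[OF H(1) \<alpha> unit_vec_carrier, of 0] by simp
        also have "H *\<^sub>v unit_vec m 0 = s \<cdot>\<^sub>v v" unfolding sGv[symmetric] using H G(1) vp(1)
          by (simp add: mat_simps mult_vec_cancel_left_inverse[OF H(3)])
        finally have "(H\<^sup>T *\<^sub>v \<alpha>) \<bullet> unit_vec m 0 = s * (\<alpha> \<bullet> v)" using \<alpha> vp(1) by simp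
        then have "(?g 0 \<cdot>\<^sub>v (H\<^sup>T *\<^sub>v \<alpha>)) \<bullet> unit_vec m 0 = (1 / s) * (s * (\<alpha> \<bullet> v))"
          using smult_scalar_prod_distrib[OF HTa unit_vec_carrier, of "?g 0" 0] by simp
        then have e: "(?g 0 \<cdot>\<^sub>v (H\<^sup>T *\<^sub>v \<alpha>)) \<bullet> unit_vec m 0 = \<alpha> \<bullet> v" using s0 by simp
        have "i = 0 \<or> i = 1" using i by auto
        then have "?l $ i = 1 / ?g i * \<gamma> \<alpha> Y $ i" unfolding e \<gamma>[OF \<alpha> Y] Qv0 using \<alpha> by (elim disjE) simp_all
        then show "?l $ i = ?r $ i" using rr by simp
      qed simp
    qed auto
    then have r': "represented K M (kravchuk_metric 2 Kt') (nonsplit_set 2 Kt' Q'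
         (\<lambda>\<alpha> Y. row_mult \<alpha> \<Lambda>' + Y $$ (0, 1) \<cdot>\<^sub>v unit_vec m 0) (\<lambda>\<alpha> Y. vec_of_list [0, \<alpha> \<bullet> unit_vec m 0]))"
      unfolding Kt'_def using represented_trans[OF K Msub r] by blast
    \<comment> \<open>The hyperbolic plane takes one from each part of the signature, which leaves
      the signature demanded of the complementary block.\<close>
    have spec: "special_Q p\<^sub>0 q\<^sub>0 Kt' (Q' 1)"
    proof -
      have "\<exists>p' q'. p\<^sub>0 = p' + 1 \<and> q\<^sub>0 = q' + 1 \<and> has_signature K' p' q'"
        using has_signature_hyp_plane_sum[OF G(4,5)] sig' unfolding Kt'_def G(6) by blast
      then show ?thesis unfolding special_Q_def Q'_def E12_def Kt'_def G(6) m_def by auto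
    qed
    have fr: "free_rowed_matrices 2 Kt' Q'"
    proof (rule free_rowed_two[where Q = Q', OF Kt'c m2(2)])
      show "Q' 0 = 1\<^sub>m m" unfolding Q'_def by simp
      have Q'1: "Q' 1 = E12" unfolding Q'_def by simp
      show "Q' 1 \<in> sq_mats m" unfolding Q'1 by (rule E12)
      have "E12 * Kt' = s \<cdot>\<^sub>m (G * (Q 1 * Kt) * G\<^sup>T)" unfolding EG Kt'_def using G(1) H Q1(1) Kt(1)
        by (simp add: mat_simps mult_cancel_left_inverse[OF H(3)])
      also have "\<dots> = Kt' * E12\<^sup>T" unfolding EG Kt'_def Q1(2) using G(1) H Q1(1) Kt(1)
        by (simp add: mat_simps mult_cancel_left_inverse[OF GHT])
      finally show "Q' 1 * Kt' = Kt' * (Q' 1)\<^sup>T" unfolding Q'1 .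
      show "(\<Sum>r<m. Q' 1 $$ (r, r)) = 0" unfolding Q'1 E12_def by (intro sum.neutral) auto
      have "E12 $$ (0, 1) = 1" unfolding E12_def using m2 by simp
      then show "Q' 1 \<noteq> 0\<^sub>m m m" unfolding Q'1 using m2 by auto
    qed
    have "linearly_represented K (o_proj n M) (kravchuk_metric 2 Kt') (kravchuk_family 2 Kt' Q')"
      by (rule lr_of[OF r' Kt'c]) (use Lc' in \<open>auto simp: row_mult_def intro!: carrier_vecI\<close>)
    then show ?thesis using spec sig' fr L' r' unfolding m_def by (intro exI[of _ Kt'] exI[of _ Q'] exI[of _ \<Lambda>']) simp
  qed
qed

subsection \<open>Existence of the characterizing matrices\<close>

lemma MASA_maximal:
  assumes "MASA n L N" "X \<in> L" "X \<in> sq_mats n" "\<And>A. A \<in> N \<Longrightarrow> X * A = A * X"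
  shows "X \<in> N"
proof -
  have sub: "N \<subseteq> sq_mats n" using assms(1) unfolding MASA_def mat_subspace_def by blast
  have "lie_bracket X A = 0\<^sub>m n n" if "A \<in> N" for A
    using bracket_zero_iff[OF assms(3), of A] sub assms(4)[OF that] that by blast
  moreover have "N = {X \<in> L. \<forall>A\<in>N. lie_bracket X A = 0\<^sub>m n n}" using assms(1) unfolding MASA_def by blast
  ultimately show ?thesis using assms(2) by blast
qed

lemma MASA_commute:
  assumes "MASA n L N" "A \<in> N" "B \<in> N"
  shows "A * B = B * A"
  using assms bracket_zero_iff[of A n B] unfolding MASA_def mat_subspace_def by blast

lemma linearly_represented_MASA:
  assumes K: "K \<in> sq_mats n" and N: "MASA n (o_alg K) N" and lr: "linearly_represented K N K' N'"
  shows "MASA n (o_alg K') N'"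
proof -
  obtain G where G: "G \<in> sq_mats n" "invertible_mat G" "K' = G * K * G\<^sup>T" "N' = conj_set G N"
    using lr K unfolding linearly_represented_def by auto
  obtain H where H: "H \<in> sq_mats n" "G * H = 1\<^sub>m n" "H * G = 1\<^sub>m n" using G by (auto elim: invertible_matE)
  have "o_alg K \<subseteq> sq_mats n" using o_alg_carrier[OF K] by blast
  from MASA_conj[OF G(1) H this N] show ?thesis unfolding G(3,4) o_alg_conj[OF K G(1) H] .
qed

lemma kravchuk_mult:
  assumes "Kt \<in> sq_mats m" "A \<in> carrier_mat k m" "S \<in> sq_mats m" "Y \<in> sq_mats k"
    and "A' \<in> carrier_mat k m" "S' \<in> sq_mats m" "Y' \<in> sq_mats k"
  shows "kravchuk_mat Kt A S Y * kravchuk_mat Kt A' S' Y' =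
    mat3 k m (0\<^sub>m k k) (A * S') (- (A * (Kt * A'\<^sup>T))) (0\<^sub>m m k) (S * S') (- (S * (Kt * A'\<^sup>T))) (0\<^sub>m k k) (0\<^sub>m k m) (0\<^sub>m k k)"
  unfolding kravchuk_mat3[OF assms(1-4)] kravchuk_mat3[OF assms(1,5-7)]
  using assms by (simp add: mat3_dim_simps mat_simps)

lemma kravchuk_commuteD:
  assumes "Kt \<in> sq_mats m" "A \<in> carrier_mat k m" "S \<in> sq_mats m" "Y \<in> sq_mats k"
    and "A' \<in> carrier_mat k m" "S' \<in> sq_mats m" "Y' \<in> sq_mats k"
    and "kravchuk_mat Kt A S Y * kravchuk_mat Kt A' S' Y' = kravchuk_mat Kt A' S' Y' * kravchuk_mat Kt A S Y"
  shows "A * S' = A' * S" "A * (Kt * A'\<^sup>T) = A' * (Kt * A\<^sup>T)"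
proof -
  have "A * S' = A' * S \<and> - (A * (Kt * A'\<^sup>T)) = - (A' * (Kt * A\<^sup>T))"
    using assms(8) unfolding kravchuk_mult[OF assms(1-7)] kravchuk_mult[OF assms(1,5-7,2-4)]
    using assms(1-7) by (subst (asm) mat3_eq_iff) auto
  then show "A * S' = A' * S" "A * (Kt * A'\<^sup>T) = A' * (Kt * A\<^sup>T)" by (auto dest: arg_cong[of _ _ uminus])
qed

text \<open>The transpositions (1 2) and (1 3) act by 1 and - 1. Since (1 2)(1 3)(1 2) = (1 3)(1
  2)(1 3), where the left side acts by - 1 and the right side by 1, the value is its own
  negative.\<close>

lemma trilinear_zero:
  fixes t :: "'a \<Rightarrow> 'a \<Rightarrow> 'a \<Rightarrow> real"
  assumes "\<And>x y z. x \<in> V \<Longrightarrow> y \<in> V \<Longrightarrow> z \<in> V \<Longrightarrow> t x y z = t y x z"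
    and "\<And>x y z. x \<in> V \<Longrightarrow> y \<in> V \<Longrightarrow> z \<in> V \<Longrightarrow> t x y z = - t z y x"
    and "x \<in> V" "y \<in> V" "z \<in> V"
  shows "t x y z = 0"
  using assms(1)[OF assms(3,4,5)] assms(2)[OF assms(4,3,5)] assms(1)[OF assms(5,3,4)] assms(2)[OF assms(3,5,4)]
    assms(1)[OF assms(4,5,3)] assms(2)[OF assms(5,4,3)] by linarith

text \<open>Commutativity says that A K A'^T is unchanged when A and A' are exchanged. Entry (i, j),
  as a bilinear form in \<alpha> and \<alpha>', gives Q_i K Q_j^T = Q_j K Q_i^T. With Q_j the
  identity this is the symmetry of Q_i, and with it the general case becomes commutation.\<close>

lemma abelian_family:
  assumes Kt: "Kt \<in> sq_mats m" "Kt\<^sup>T = Kt" "invertible_mat Kt" and k: "1 \<le> k"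
    and Q: "\<And>i. i < k \<Longrightarrow> Q i \<in> sq_mats m" "Q 0 = 1\<^sub>m m"
    and ab: "\<And>X X'. X \<in> kravchuk_family k Kt Q \<Longrightarrow> X' \<in> kravchuk_family k Kt Q \<Longrightarrow> X * X' = X' * X"
    and ij: "i < k" "j < k"
  shows "Q i * Kt = Kt * (Q i)\<^sup>T" "Q i * Q j = Q j * Q i"
proof -
  have dK: "dim_row Kt = m" using Kt by simp
  have A: "rows_mat k Q \<alpha> * (Kt * (rows_mat k Q \<alpha>')\<^sup>T) = rows_mat k Q \<alpha>' * (Kt * (rows_mat k Q \<alpha>)\<^sup>T)"
    if h: "\<alpha> \<in> carrier_vec m" "\<alpha>' \<in> carrier_vec m" for \<alpha> \<alpha>'
  proof (rule kravchuk_commuteD(2)[OF Kt(1) rows_mat_carrier[OF h(1)] zero_carrier_mat zero_carrier_mat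
        rows_mat_carrier[OF h(2)] zero_carrier_mat zero_carrier_mat])
    show "kravchuk_mat Kt (rows_mat k Q \<alpha>) (0\<^sub>m m m) (0\<^sub>m k k) * kravchuk_mat Kt (rows_mat k Q \<alpha>') (0\<^sub>m m m) (0\<^sub>m k k) =
      kravchuk_mat Kt (rows_mat k Q \<alpha>') (0\<^sub>m m m) (0\<^sub>m k k) * kravchuk_mat Kt (rows_mat k Q \<alpha>) (0\<^sub>m m m) (0\<^sub>m k k)"
      by (rule ab) (use h skew_zero in \<open>auto simp: kravchuk_family_def dK\<close>)
  qed
  have sym: "Q i * (Kt * (Q j)\<^sup>T) = Q j * (Kt * (Q i)\<^sup>T)" if ij: "i < k" "j < k" for i j
  proof (rule mat_eqI_bilinear[of _ m m])
    fix v w :: "real vec" assume v: "v \<in> carrier_vec m" and w: "w \<in> carrier_vec m"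
    have Kc: "Kt *\<^sub>v x \<in> carrier_vec m" for x using Kt(1) by (auto intro!: carrier_vecI)
    have ent: "(rows_mat k Q a * (Kt * (rows_mat k Q b)\<^sup>T)) $$ (i, j) = a \<bullet> ((Q i * (Kt * (Q j)\<^sup>T)) *\<^sub>v b)"
      if ab: "a \<in> carrier_vec m" "b \<in> carrier_vec m" for a b
    proof -
      have "(rows_mat k Q a * (Kt * (rows_mat k Q b)\<^sup>T)) $$ (i, j) = row (rows_mat k Q a) i \<bullet> (Kt *\<^sub>v row (rows_mat k Q b) j)"
        using ij Kt(1) rows_mat_carrier[OF ab(1), of k Q] rows_mat_carrier[OF ab(2), of k Q]
        by (simp add: mult_mat_vec_def)
      also have "\<dots> = a \<bullet> (Q i *\<^sub>v (Kt *\<^sub>v ((Q j)\<^sup>T *\<^sub>v b)))"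
        unfolding rows_mat_row[where Q = Q, OF ab(1) ij(1) Q(1)[OF ij(1)]] rows_mat_row[where Q = Q, OF ab(2) ij(2) Q(1)[OF ij(2)]]
        using scalar_prod_mult_vec[OF Q(1)[OF ij(1)] ab(1) Kc] by simp
      also have "Q i *\<^sub>v (Kt *\<^sub>v ((Q j)\<^sup>T *\<^sub>v b)) = (Q i * (Kt * (Q j)\<^sup>T)) *\<^sub>v b"
        using Q(1)[OF ij(1)] Q(1)[OF ij(2)] Kt(1) ab by (simp add: mat_simps)
      finally show ?thesis .
    qed
    have "v \<bullet> ((Q i * (Kt * (Q j)\<^sup>T)) *\<^sub>v w) = w \<bullet> ((Q i * (Kt * (Q j)\<^sup>T)) *\<^sub>v v)"
      using arg_cong[OF A[OF v w], of "\<lambda>x. x $$ (i, j)"] ent[OF v w] ent[OF w v] by simp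
    also have "\<dots> = ((Q i * (Kt * (Q j)\<^sup>T))\<^sup>T *\<^sub>v w) \<bullet> v"
      using Q(1)[OF ij(1)] Q(1)[OF ij(2)] Kt(1) v w by (intro scalar_prod_mult_vec[of _ m m]) auto
    also have "(Q i * (Kt * (Q j)\<^sup>T))\<^sup>T = Q j * (Kt * (Q i)\<^sup>T)"
      using Q(1)[OF ij(1)] Q(1)[OF ij(2)] Kt(1,2) by (simp add: mat_simps)
    also have "((Q j * (Kt * (Q i)\<^sup>T)) *\<^sub>v w) \<bullet> v = v \<bullet> ((Q j * (Kt * (Q i)\<^sup>T)) *\<^sub>v w)"
      using Q(1)[OF ij(1)] Q(1)[OF ij(2)] Kt(1) v w by (intro comm_scalar_prod[of _ m]) (auto intro!: carrier_vecI)
    finally show "v \<bullet> ((Q i * (Kt * (Q j)\<^sup>T)) *\<^sub>v w) = v \<bullet> ((Q j * (Kt * (Q i)\<^sup>T)) *\<^sub>v w)" .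
  qed (use Q(1)[OF ij(1)] Q(1)[OF ij(2)] Kt(1) in auto)
  have s: "Q i * Kt = Kt * (Q i)\<^sup>T" if i: "i < k" for i
    using sym[OF i, of 0] k Q(2) Kt(1) Q(1)[OF i] by (simp add: mat_simps)
  show "Q i * Kt = Kt * (Q i)\<^sup>T" using s[OF ij(1)] .
  obtain L where L: "L \<in> sq_mats m" "Kt * L = 1\<^sub>m m" using Kt by (auto elim: invertible_matE)
  have QQ: "Q i * Q j * Kt = Q j * Q i * Kt"
    using sym[OF ij] s[OF ij(1)] s[OF ij(2)] Q(1)[OF ij(1)] Q(1)[OF ij(2)] Kt(1) by (simp add: mat_simps)
  have "Q i * Q j = Q i * Q j * (Kt * L)" "Q j * Q i = Q j * Q i * (Kt * L)"
    unfolding L(2) using Q(1)[OF ij(1)] Q(1)[OF ij(2)] by auto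
  moreover have "Q i * Q j * (Kt * L) = Q i * Q j * Kt * L" "Q j * Q i * (Kt * L) = Q j * Q i * Kt * L"
    using Q(1)[OF ij(1)] Q(1)[OF ij(2)] Kt(1) L(1) by (simp_all add: mat_simps)
  ultimately show "Q i * Q j = Q j * Q i" using QQ by simp
qed

lemma free_rowed_normal_family:
  assumes Kt: "Kt \<in> sq_mats m" "Kt\<^sup>T = Kt" "invertible_mat Kt" and k: "1 \<le> k"
    and N: "MASA (k + m + k) (o_alg (kravchuk_metric k Kt)) N" and nf: "free_rowed_normal_form k Kt N"
  shows "\<exists>Q. (\<forall>i<k. Q i \<in> sq_mats m) \<and> Q 0 = 1\<^sub>m m \<and> N = kravchuk_family k Kt Q"
proof -
  have dK: "dim_row Kt = m" using Kt by simp
  obtain Q T where Q: "\<forall>i<k. Q i \<in> sq_mats m" "Q 0 = 1\<^sub>m m"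
    and S': "\<forall>\<alpha>\<in>carrier_vec m. lin_comb_mat m m (vec_index \<alpha>) T \<in> o_alg Kt"
    and N1: "\<forall>X\<in>N. \<exists>\<alpha>\<in>carrier_vec m. \<exists>Y\<in>skew_mats k. X = kravchuk_mat Kt (rows_mat k Q \<alpha>) (lin_comb_mat m m (vec_index \<alpha>) T) Y"
    and N2: "\<forall>\<alpha>\<in>carrier_vec m. \<exists>Y\<in>skew_mats k. kravchuk_mat Kt (rows_mat k Q \<alpha>) (lin_comb_mat m m (vec_index \<alpha>) T) Y \<in> N"
    using nf unfolding free_rowed_normal_form_def Let_def dK by blast
  define S where "S \<alpha> = lin_comb_mat m m (vec_index \<alpha>) T" for \<alpha>
  note N1 = N1[folded S_def] and N2 = N2[folded S_def] and S' = S'[folded S_def]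
  have Sc: "S \<alpha> \<in> sq_mats m" for \<alpha> unfolding S_def by simp
  have Sv: "S \<alpha> *\<^sub>v x \<in> carrier_vec m" "(S \<alpha>)\<^sup>T *\<^sub>v x \<in> carrier_vec m" "Kt *\<^sub>v x \<in> carrier_vec m" for \<alpha> x
    using Sc[of \<alpha>] Kt(1) by (auto intro!: carrier_vecI)
  \<comment> \<open>The first row of A is \<alpha>, so the first row of the commutation relation A
    S' = A' S gives the symmetry in the first two arguments of the trilinear form.\<close>
  have row0: "(S \<alpha>')\<^sup>T *\<^sub>v \<alpha> = (S \<alpha>)\<^sup>T *\<^sub>v \<alpha>'" if h: "\<alpha> \<in> carrier_vec m" "\<alpha>' \<in> carrier_vec m" for \<alpha> \<alpha>'
  proof -
    obtain Y Y' where Y: "Y \<in> skew_mats k" "kravchuk_mat Kt (rows_mat k Q \<alpha>) (S \<alpha>) Y \<in> N"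
      "Y' \<in> skew_mats k" "kravchuk_mat Kt (rows_mat k Q \<alpha>') (S \<alpha>') Y' \<in> N" using N2 h by blast
    have e: "rows_mat k Q \<alpha> * S \<alpha>' = rows_mat k Q \<alpha>' * S \<alpha>"
      by (rule kravchuk_commuteD(1)[OF Kt(1) rows_mat_carrier[OF h(1)] Sc skew_carrier[OF Y(1)]
            rows_mat_carrier[OF h(2)] Sc skew_carrier[OF Y(3)] MASA_commute[OF N Y(2,4)]])
    have r: "row (rows_mat k Q a * B) 0 = B\<^sup>T *\<^sub>v a" if a: "a \<in> carrier_vec m" and B: "B \<in> sq_mats m" for a B
    proof -
      have "row (rows_mat k Q a) 0 = a" using rows_mat_row[OF a, of 0 k Q] k Q(2) a by (simp add: mat_dim_simps)
      then show ?thesis using row_mult_mat[OF rows_mat_carrier[OF a] B, of 0 k Q] k by simp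
    qed
    show ?thesis using arg_cong[OF e, of "\<lambda>x. row x 0"] r[OF h(1) Sc] r[OF h(2) Sc] by simp
  qed
  have S0: "S \<alpha> = 0\<^sub>m m m" if \<alpha>: "\<alpha> \<in> carrier_vec m" for \<alpha>
  proof -
    let ?t = "\<lambda>x y z. x \<bullet> (S y *\<^sub>v (Kt *\<^sub>v z))"
    have t: "?t x y z = ((S y)\<^sup>T *\<^sub>v x) \<bullet> (Kt *\<^sub>v z)" if "x \<in> carrier_vec m" "y \<in> carrier_vec m" "z \<in> carrier_vec m" for x y z
      by (rule scalar_prod_mult_vec[OF Sc that(1) Sv(3)])
    have "?t x \<alpha> z = 0" if "x \<in> carrier_vec m" "z \<in> carrier_vec m" for x z
    proof (rule trilinear_zero[where t = ?t and V = "carrier_vec m"])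
      fix x y z :: "real vec" assume h: "x \<in> carrier_vec m" "y \<in> carrier_vec m" "z \<in> carrier_vec m"
      show "?t x y z = ?t y x z" unfolding t[OF h] t[OF h(2,1,3)] row0[OF h(1,2)] ..
      \<comment> \<open>S lies in \<open>o_alg Kt\<close>, so S K is skew-symmetric; this is the
        antisymmetry in the outer arguments.\<close>
      have SK: "S y * Kt = - (Kt * (S y)\<^sup>T)" using S' h(2) o_alg_iff[OF Kt(1)] by blast
      have "S y *\<^sub>v (Kt *\<^sub>v z) = (S y * Kt) *\<^sub>v z" using Sc[of y] Kt(1) h by (simp add: mat_simps)
      also have "\<dots> = - (Kt *\<^sub>v ((S y)\<^sup>T *\<^sub>v z))" unfolding SK using Sc[of y] Kt(1) h by (simp add: mat_simps)
      finally have "?t x y z = - (x \<bullet> (Kt *\<^sub>v ((S y)\<^sup>T *\<^sub>v z)))" using h Sv[of y] Kt(1) by (simp add: dim_of_carrier)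
      also have "x \<bullet> (Kt *\<^sub>v ((S y)\<^sup>T *\<^sub>v z)) = (Kt *\<^sub>v x) \<bullet> ((S y)\<^sup>T *\<^sub>v z)"
        using scalar_prod_mult_vec[OF Kt(1) h(1) Sv(2)] Kt(2) by simp
      also have "\<dots> = ?t z y x" unfolding t[OF h(3,2,1)] by (rule comm_scalar_prod[OF Sv(3) Sv(2)])
      finally show "?t x y z = - ?t z y x" .
    qed (use that \<alpha> in auto)
    then have "S \<alpha> * Kt = 0\<^sub>m m m"
      by (intro mat_eqI_bilinear[of _ m m]) (use Sc[of \<alpha>] Kt(1) in \<open>auto simp: mat_simps\<close>)
    moreover obtain L where L: "L \<in> sq_mats m" "Kt * L = 1\<^sub>m m" using Kt by (auto elim: invertible_matE)
    moreover have "S \<alpha> * Kt * L = S \<alpha> * (Kt * L)" using Sc[of \<alpha>] Kt(1) L(1) by (simp add: mat_simps)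
    ultimately show ?thesis using Sc[of \<alpha>] by simp
  qed
  \<comment> \<open>Once S = 0, a matrix with only a Y-block has zero product with every member on
    either side, so maximality puts it into \<open>N\<close>.\<close>
  have central: "kravchuk_mat Kt (0\<^sub>m k m) (0\<^sub>m m m) Y \<in> N" if Y: "Y \<in> skew_mats k" for Y
  proof (rule MASA_maximal[OF N kravchuk_in_o_alg[OF Kt(1,2) zero_carrier_mat Y]])
    show "kravchuk_mat Kt (0\<^sub>m k m) (0\<^sub>m m m) Y \<in> sq_mats (k + m + k)"
      using kravchuk_carrier(1)[OF Kt(1) zero_carrier_mat zero_carrier_mat skew_carrier[OF Y]] .
    fix X assume "X \<in> N"
    then obtain \<alpha> Y' where X: "\<alpha> \<in> carrier_vec m" "Y' \<in> skew_mats k" "X = kravchuk_mat Kt (rows_mat k Q \<alpha>) (0\<^sub>m m m) Y'"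
      using N1 S0 by metis
    show "kravchuk_mat Kt (0\<^sub>m k m) (0\<^sub>m m m) Y * X = X * kravchuk_mat Kt (0\<^sub>m k m) (0\<^sub>m m m) Y"
      unfolding X(3) using Kt(1) rows_mat_carrier[OF X(1), of k Q] skew_carrier[OF X(2)] skew_carrier[OF Y]
      by (simp add: kravchuk_mult[of Kt m _ k] mat_simps)
  qed
  have "N = kravchuk_family k Kt Q"
  proof
    show "N \<subseteq> kravchuk_family k Kt Q" unfolding kravchuk_family_def dK using N1 S0 by fastforce
    show "kravchuk_family k Kt Q \<subseteq> N"
    proof
      fix X assume "X \<in> kravchuk_family k Kt Q"
      then obtain \<alpha> Y where X: "\<alpha> \<in> carrier_vec m" "Y \<in> skew_mats k" "X = kravchuk_mat Kt (rows_mat k Q \<alpha>) (0\<^sub>m m m) Y"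
        unfolding kravchuk_family_def dK by blast
      obtain Y' where Y': "Y' \<in> skew_mats k" "kravchuk_mat Kt (rows_mat k Q \<alpha>) (0\<^sub>m m m) Y' \<in> N" using N2 X(1) S0 by metis
      \<comment> \<open>Each \<alpha> comes with some Y'; adding the central element with block Y -
        Y' yields the prescribed Y.\<close>
      let ?D = "Y + (- 1) \<cdot>\<^sub>m Y'"
      have "kravchuk_mat Kt (rows_mat k Q \<alpha>) (0\<^sub>m m m) Y' + kravchuk_mat Kt (0\<^sub>m k m) (0\<^sub>m m m) ?D \<in> N"
        using N central[OF skew_add[OF X(2) skew_smult[OF Y'(1), of "- 1"]]] Y'(2) unfolding MASA_def mat_subspace_def by blast
      also have "kravchuk_mat Kt (rows_mat k Q \<alpha>) (0\<^sub>m m m) Y' + kravchuk_mat Kt (0\<^sub>m k m) (0\<^sub>m m m) ?D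
        = kravchuk_mat Kt (rows_mat k Q \<alpha> + 0\<^sub>m k m) (0\<^sub>m m m + 0\<^sub>m m m) (Y' + ?D)"
        by (rule kravchuk_add[OF Kt(1) rows_mat_carrier[OF X(1)]]) (use skew_carrier[OF X(2)] skew_carrier[OF Y'(1)] in auto)
      also have "Y' + ?D = Y" using skew_carrier[OF X(2)] skew_carrier[OF Y'(1)] by (intro eq_matI) auto
      finally show "X \<in> N" unfolding X(3) using rows_mat_carrier[OF X(1), of k Q] by simp
    qed
  qed
  then show ?thesis using Q by blast
qed

text \<open>If Q_2 were 0, diag(E, 0, - E^T) with E the elementary matrix E_12 would commute with
  the family: E A = 0 because the second row of A vanishes, and E Y + Y E^T = 0 for skew Y of size
  2. It is not a member of the family, against maximality.\<close>

lemma second_matrix_nonzero: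
  assumes Kt: "Kt \<in> sq_mats m" and Q: "\<And>i. i < 2 \<Longrightarrow> Q i \<in> sq_mats m"
    and N: "MASA (2 + m + 2) (o_alg (kravchuk_metric 2 Kt)) (kravchuk_family 2 Kt Q)"
  shows "Q 1 \<noteq> 0\<^sub>m m m"
proof
  assume Q1: "Q 1 = 0\<^sub>m m m"
  have dK: "dim_row Kt = m" using Kt by simp
  define E where "E = mat 2 2 (\<lambda>(i, j). if i = 0 \<and> j = 1 then 1 else 0 :: real)"
  have E: "E \<in> sq_mats 2" unfolding E_def by simp
  let ?Z = "mat3 2 m E (0\<^sub>m 2 m) (0\<^sub>m 2 2) (0\<^sub>m m 2) (0\<^sub>m m m) (0\<^sub>m m 2) (0\<^sub>m 2 2) (0\<^sub>m 2 m) (- E\<^sup>T)"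
  have "?Z * kravchuk_metric 2 Kt = - (kravchuk_metric 2 Kt * ?Z\<^sup>T)"
    unfolding kravchuk_metric3[OF Kt] using Kt E by (simp add: mat3_dim_simps mat_simps)
  then have Zo: "?Z \<in> o_alg (kravchuk_metric 2 Kt)"
    using Kt by (subst o_alg_iff[of _ "2 + m + 2"]) (auto simp: kravchuk_metric3)
  have "?Z \<in> kravchuk_family 2 Kt Q"
  proof (rule MASA_maximal[OF N Zo])
    fix X assume "X \<in> kravchuk_family 2 Kt Q"
    then obtain a Y where X: "a \<in> carrier_vec m" "Y \<in> skew_mats 2" "X = kravchuk_mat Kt (rows_mat 2 Q a) (0\<^sub>m m m) Y"
      unfolding kravchuk_family_def dK by blast
    let ?A = "rows_mat 2 Q a"
    have A: "?A \<in> carrier_mat 2 m" using rows_mat_carrier[OF X(1)] .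
    have Yc: "Y \<in> sq_mats 2" using skew_carrier[OF X(2)] .
    have "?A $$ (1, j) = 0" if "j < m" for j
    proof -
      have "?A $$ (1, j) = row ?A 1 $ j" using A that by simp
      also have "\<dots> = 0" using rows_mat_row[OF X(1), of 1 2 Q] Q1 that X(1) by (simp add: mat_simps)
      finally show ?thesis .
    qed
    then have EA: "E * ?A = 0\<^sub>m 2 m" using A unfolding E_def by (intro eq_matI) (auto simp: scalar_prod_def numeral_2_eq_2 less_Suc_eq)
    have skew: "Y $$ (i, j) = - Y $$ (j, i)" if "i < 2" "j < 2" for i j using X(2) that unfolding skew_mats_iff by blast
    have Y: "Y $$ (0, 0) = 0" "Y $$ (1, 1) = 0" "Y $$ (1, 0) = - Y $$ (0, 1)"
      using skew[of 0 0] skew[of 1 1] skew[of 1 0] by (linarith | simp)+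
    have EY: "E * Y = - (Y * E\<^sup>T)" using Yc Y unfolding E_def
      by (intro eq_matI) (auto simp: scalar_prod_def numeral_2_eq_2 less_Suc_eq)
    have AE: "?A\<^sup>T * E\<^sup>T = 0\<^sub>m m 2" using arg_cong[OF EA, of transpose_mat] transpose_mult[OF E A] by (simp add: mat_dim_simps)
    show "?Z * X = X * ?Z" unfolding X(3) kravchuk_mat3[OF Kt A zero_carrier_mat Yc]
      using Kt A Yc E EA EY AE by (simp add: mat3_dim_simps mat_simps)
  qed (rule mat3_carrier)
  then obtain a Y where X: "a \<in> carrier_vec m" "Y \<in> skew_mats 2" "?Z = kravchuk_mat Kt (rows_mat 2 Q a) (0\<^sub>m m m) Y"
    unfolding kravchuk_family_def dK by blast
  have "E = 0\<^sub>m 2 2" using X(3) unfolding kravchuk_mat3[OF Kt rows_mat_carrier[OF X(1)] zero_carrier_mat skew_carrier[OF X(2)]]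
    using Kt E rows_mat_carrier[OF X(1), of 2 Q] skew_carrier[OF X(2)] by (subst (asm) mat3_eq_iff) auto
  then have "E $$ (0, 1) = 0\<^sub>m 2 2 $$ (0, 1)" by simp
  then show False unfolding E_def by simp
qed


text \<open>By \<open>rank_normal_form\<close>, \<open>P * A\<close> is a rank matrix times an
  invertible matrix. Its first r rows are therefore independent, and the other rows vanish.\<close>

lemma row_reduction:
  assumes A: "(A :: real mat) \<in> carrier_mat nr nc"
  shows "\<exists>P r. P \<in> sq_mats nr \<and> invertible_mat P \<and> r \<le> nr \<and>
    (\<forall>c. (\<forall>x<nc. (\<Sum>i<r. c i * (P * A) $$ (i, x)) = 0) \<longrightarrow> (\<forall>i<r. c i = 0)) \<and>
    (\<forall>i x. r \<le> i \<and> i < nr \<and> x < nc \<longrightarrow> (P * A) $$ (i, x) = 0)"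
proof -
  obtain P R r where P: "P \<in> sq_mats nr" "invertible_mat P" and R: "R \<in> sq_mats nc" "invertible_mat R"
    and r: "r \<le> nr" "r \<le> nc" "P * A * R = rank_mat nr nc r"
    using rank_normal_form[OF A] by blast
  obtain R' where R': "R' \<in> sq_mats nc" "R * R' = 1\<^sub>m nc" using R by (auto elim: invertible_matE)
  have PA: "P * A \<in> carrier_mat nr nc" using P A by auto
  have ent: "(\<Sum>x<nc. (P * A) $$ (i, x) * R $$ (x, j)) = (if i = j \<and> i < r then 1 else 0)" if "i < nr" "j < nc" for i j
    using arg_cong[OF r(3), of "\<lambda>M. M $$ (i, j)"] that PA R(1)
    by (simp add: rank_mat_def index_mult_mat(1)[of i "P * A" j R] scalar_prod_def atLeast0LessThan del: index_mult_mat)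
  have "c j = 0" if c: "\<forall>x<nc. (\<Sum>i<r. c i * (P * A) $$ (i, x)) = 0" and j: "j < r" for c j
  proof -
    have "0 = (\<Sum>x<nc. (\<Sum>i<r. c i * (P * A) $$ (i, x)) * R $$ (x, j))" using c by simp
    also have "\<dots> = (\<Sum>x<nc. \<Sum>i<r. c i * ((P * A) $$ (i, x) * R $$ (x, j)))" by (simp only: sum_distrib_right mult.assoc)
    also have "\<dots> = (\<Sum>i<r. c i * (\<Sum>x<nc. (P * A) $$ (i, x) * R $$ (x, j)))" by (subst sum.swap) (simp only: sum_distrib_left)
    also have "\<dots> = (\<Sum>i<r. if i = j then c i else 0)"
      by (rule sum.cong) (use r(1,2) j in \<open>auto simp: ent simp del: index_mult_mat\<close>)
    also have "\<dots> = c j" using j by simp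
    finally show ?thesis by simp
  qed
  moreover have "(P * A) $$ (i, x) = 0" if h: "r \<le> i" "i < nr" "x < nc" for i x
  proof -
    have "P * A = P * A * R * R'" unfolding assoc_mult_mat[OF PA R(1) R'(1)] R'(2) right_mult_one_mat[OF PA] ..
    then have "(P * A) $$ (i, x) = (rank_mat nr nc r * R') $$ (i, x)" unfolding r(3) by simp
    also have "\<dots> = 0" using h R'(1) by (auto simp: rank_mat_def scalar_prod_def)
    finally show ?thesis .
  qed
  ultimately show ?thesis using P r(1) by (intro exI[of _ P] exI[of _ r]) blast
qed

text \<open>Gaussian elimination on the traceless parts of \<open>Q\<^sub>2, \<dots>, Q\<^sub>k\<close>.\<close>

lemma normalize_matrices:
  assumes Q: "\<And>i. i < Suc k \<Longrightarrow> Q i \<in> sq_mats m" "Q 0 = (1\<^sub>m m :: real mat)"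
  obtains G where "G \<in> sq_mats (Suc k)" "invertible_mat G"
    "lin_comb_mat m (Suc k) (vec_index (row G 0)) Q = 1\<^sub>m m"
    "\<And>i. 1 \<le> i \<Longrightarrow> i < Suc k \<Longrightarrow> (\<Sum>r<m. lin_comb_mat m (Suc k) (vec_index (row G i)) Q $$ (r, r)) = 0"
    "1 \<le> m \<Longrightarrow> \<exists>l. 1 \<le> l \<and> l \<le> Suc k \<and>
       (\<forall>c. lin_comb_mat m l c (\<lambda>i. lin_comb_mat m (Suc k) (vec_index (row G i)) Q) = 0\<^sub>m m m \<longrightarrow> (\<forall>i<l. c i = 0)) \<and>
       (\<forall>i. l \<le> i \<and> i < Suc k \<longrightarrow> lin_comb_mat m (Suc k) (vec_index (row G i)) Q = 0\<^sub>m m m)"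
proof -
  define t where "t i = (\<Sum>r<m. Q i $$ (r, r)) / real m" for i
  define R where "R i r s = Q (Suc i) $$ (r, s) - t (Suc i) * (if r = s then 1 else 0)" for i r s
  \<comment> \<open>The traceless parts, each flattened into a row of length m * m, so that
    independence of matrices becomes independence of rows.\<close>
  define A where "A = mat k (m * m) (\<lambda>(i, x). R i (x div m) (x mod m))"
  have A: "A \<in> carrier_mat k (m * m)" unfolding A_def by simp
  obtain P l where P: "P \<in> sq_mats k" "invertible_mat P" and l: "l \<le> k"
    and ind: "\<And>c. (\<forall>x<m * m. (\<Sum>i<l. c i * (P * A) $$ (i, x)) = 0) \<Longrightarrow> (\<forall>i<l. c i = 0)"
    and zero: "\<And>i x. l \<le> i \<Longrightarrow> i < k \<Longrightarrow> x < m * m \<Longrightarrow> (P * A) $$ (i, x) = 0"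
    using row_reduction[OF A] by blast
  \<comment> \<open>Coefficients of the identity matrix that subtract from each combination of the
    Q_i its scalar part.\<close>
  define W where "W = mat k 1 (\<lambda>(i, j). - (\<Sum>s<k. P $$ (i, s) * t (Suc s)))"
  define G where "G = four_block_mat (1\<^sub>m 1) (0\<^sub>m 1 k) W P"
  have W: "W \<in> carrier_mat k 1" unfolding W_def by simp
  have G: "G \<in> sq_mats (Suc k)" unfolding G_def using P W four_block_carrier_mat[of "1\<^sub>m 1" 1 1 P k k] by simp
  have "det G = det (1\<^sub>m 1) * det P" unfolding G_def
    by (rule det_four_block_mat_upper_right_zero[OF _ refl W P(1)]) simp
  then have inv: "invertible_mat G" using invertible_det_iff[OF G] invertible_det_iff[OF P(1)] P(2) by simp
  let ?Q = "\<lambda>i. lin_comb_mat m (Suc k) (vec_index (row G i)) Q"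
  have Q0: "?Q 0 = 1\<^sub>m m"
    unfolding lin_comb_mat_def using Q(2) G P(1) W by (intro eq_matI) (auto simp: sum.lessThan_Suc_shift G_def simp del: sum.lessThan_Suc)
  have QS: "?Q (Suc i) $$ (r, s) = (\<Sum>j<k. P $$ (i, j) * R j r s)" if i: "i < k" and rs: "r < m" "s < m" for i r s
  proof -
    have "?Q (Suc i) $$ (r, s) = G $$ (Suc i, 0) * Q 0 $$ (r, s) + (\<Sum>j<k. G $$ (Suc i, Suc j) * Q (Suc j) $$ (r, s))"
      unfolding lin_comb_mat_def using rs i G by (simp add: sum.lessThan_Suc_shift del: sum.lessThan_Suc)
    also have "G $$ (Suc i, 0) = - (\<Sum>j<k. P $$ (i, j) * t (Suc j))" unfolding G_def using i P(1) W by (simp add: W_def)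
    also have "(\<Sum>j<k. G $$ (Suc i, Suc j) * Q (Suc j) $$ (r, s)) = (\<Sum>j<k. P $$ (i, j) * Q (Suc j) $$ (r, s))"
      unfolding G_def using i P(1) W by (intro sum.cong) auto
    finally show ?thesis unfolding R_def using Q(2) rs
      by (simp add: sum_subtractf right_diff_distrib mult.assoc[symmetric] sum_distrib_right)
  qed
  have QP: "?Q (Suc i) $$ (r, s) = (P * A) $$ (i, r * m + s)" if i: "i < k" and rs: "r < m" "s < m" for i r s
  proof -
    have x: "r * m + s < m * m"
    proof -
      have "r * m + s < Suc r * m" using rs by simp
      also have "\<dots> \<le> m * m" using rs by (intro mult_le_mono1) simp
      finally show ?thesis .
    qed
    have "(P * A) $$ (i, r * m + s) = (\<Sum>j<k. P $$ (i, j) * R j r s)"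
      using i x P(1) A rs by (simp add: scalar_prod_def atLeast0LessThan) (simp add: A_def)
    then show ?thesis using QS[OF that] by simp
  qed
  have decode: "x div m < m \<and> x mod m < m \<and> x div m * m + x mod m = x" if "x < m * m" for x
    using that less_mult_imp_div_less[OF that] by (cases "m = 0") auto
  have tr: "(\<Sum>r<m. ?Q (Suc i) $$ (r, r)) = 0" if i: "i < k" for i
  proof -
    have "(\<Sum>r<m. ?Q (Suc i) $$ (r, r)) = (\<Sum>r<m. \<Sum>j<k. P $$ (i, j) * R j r r)" using QS[OF i] by simp
    also have "\<dots> = (\<Sum>j<k. P $$ (i, j) * (\<Sum>r<m. R j r r))" by (subst sum.swap) (simp only: sum_distrib_left)
    also have "\<dots> = 0" unfolding R_def t_def by (simp add: sum_subtractf)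
    finally show ?thesis .
  qed
  have indep: "\<forall>i<Suc l. c i = 0" if m: "1 \<le> m" and c: "lin_comb_mat m (Suc l) c ?Q = 0\<^sub>m m m" for c
  proof -
    have e: "c 0 * ?Q 0 $$ (r, s) + (\<Sum>i<l. c (Suc i) * ?Q (Suc i) $$ (r, s)) = 0" if "r < m" "s < m" for r s
      using arg_cong[OF c, of "\<lambda>M. M $$ (r, s)"] that
      by (simp add: lin_comb_mat_def[of m "Suc l"] sum.lessThan_Suc_shift del: sum.lessThan_Suc)
    \<comment> \<open>Taking the trace isolates the coefficient of the identity.\<close>
    have "(\<Sum>r<m. c 0 * ?Q 0 $$ (r, r) + (\<Sum>i<l. c (Suc i) * ?Q (Suc i) $$ (r, r))) = 0"
      by (intro sum.neutral ballI) (rule e, auto)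
    moreover have "(\<Sum>r<m. \<Sum>i<l. c (Suc i) * ?Q (Suc i) $$ (r, r)) = (\<Sum>i<l. c (Suc i) * (\<Sum>r<m. ?Q (Suc i) $$ (r, r)))"
      by (subst sum.swap) (simp only: sum_distrib_left)
    moreover have "\<dots> = 0" using tr l by (intro sum.neutral) auto
    moreover have "(\<Sum>r<m. c 0 * ?Q 0 $$ (r, r)) = c 0 * real m" unfolding Q0 by simp
    ultimately have c0: "c 0 = 0" using m by (simp add: sum.distrib)
    have "\<forall>i<l. c (Suc i) = 0"
    proof (rule ind, intro allI impI)
      fix x assume x: "x < m * m"
      have d: "x div m < m" "x mod m < m" "x div m * m + x mod m = x" using decode[OF x] by auto
      have "(\<Sum>i<l. c (Suc i) * (P * A) $$ (i, x)) = (\<Sum>i<l. c (Suc i) * ?Q (Suc i) $$ (x div m, x mod m))"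
      proof (rule sum.cong[OF refl])
        fix i assume "i \<in> {..<l}"
        then have "i < k" using l by simp
        from QP[OF this d(1,2)] show "c (Suc i) * (P * A) $$ (i, x) = c (Suc i) * ?Q (Suc i) $$ (x div m, x mod m)"
          unfolding d(3) by simp
      qed
      then show "(\<Sum>i<l. c (Suc i) * (P * A) $$ (i, x)) = 0" using e[OF d(1,2)] c0 by simp
    qed
    then show ?thesis using c0 less_Suc_eq_0_disj by auto
  qed
  have vanish: "?Q i = 0\<^sub>m m m" if "Suc l \<le> i" "i < Suc k" for i
  proof -
    obtain i' where i': "i = Suc i'" "l \<le> i'" "i' < k" using \<open>Suc l \<le> i\<close> \<open>i < Suc k\<close> by (cases i) auto
    have "?Q i $$ (r, s) = 0" if rs: "r < m" "s < m" for r s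
    proof -
      have "r * m + s < Suc r * m" using rs by simp
      also have "\<dots> \<le> m * m" using rs by (intro mult_le_mono1) simp
      finally show ?thesis unfolding i'(1) QP[OF i'(3) rs] using zero[OF i'(2,3)] by blast
    qed
    then show ?thesis by (intro eq_matI) auto
  qed
  have "(\<Sum>r<m. ?Q i $$ (r, r)) = 0" if "1 \<le> i" "i < Suc k" for i using tr[of "i - 1"] that by simp
  moreover have "\<exists>l. 1 \<le> l \<and> l \<le> Suc k \<and> (\<forall>c. lin_comb_mat m l c ?Q = 0\<^sub>m m m \<longrightarrow> (\<forall>i<l. c i = 0)) \<and>
       (\<forall>i. l \<le> i \<and> i < Suc k \<longrightarrow> ?Q i = 0\<^sub>m m m)" if "1 \<le> m"
  proof (rule exI[of _ "Suc l"], intro conjI allI impI)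
    fix c i assume "lin_comb_mat m (Suc l) c ?Q = 0\<^sub>m m m" "i < Suc l"
    then show "c i = 0" using indep[OF that] by blast
  qed (use l vanish in auto)
  ultimately show ?thesis using that[OF G inv Q0] by blast
qed

lemma rows_mat_left_mult:
  assumes a: "a \<in> carrier_vec m" and G: "G \<in> sq_mats k" and Q: "\<And>i. i < k \<Longrightarrow> Q i \<in> sq_mats m"
  shows "rows_mat k (\<lambda>i. lin_comb_mat m k (vec_index (row G i)) Q) a = G * rows_mat k Q a"
proof (rule rows_mat_eqI[OF a])
  have A: "rows_mat k Q a \<in> carrier_mat k m" using rows_mat_carrier[OF a] .
  show "G * rows_mat k Q a \<in> carrier_mat k m" using G A by auto
  fix i assume i: "i < k"
  have "row (G * rows_mat k Q a) i = (rows_mat k Q a)\<^sup>T *\<^sub>v row G i" by (rule row_mult_mat[OF G A i])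
  also have "\<dots> = (lin_comb_mat m k (vec_index (row G i)) Q)\<^sup>T *\<^sub>v a"
    by (rule rows_mat_transpose_mult[OF a Q]) (use G i in auto)
  finally show "row (G * rows_mat k Q a) i = (lin_comb_mat m k (vec_index (row G i)) Q)\<^sup>T *\<^sub>v a" .
qed simp

text \<open>Row operations on A come from a change of basis acting on the first and last blocks, so
  \<open>normalize_matrices\<close> can be realized inside the representation. Symmetry and
  commutation of the new matrices come from commutativity of the projection; for k = 2, Q_2 is not 0
  by its maximality.\<close>

lemma free_rowed_characterization:
  assumes K: "K \<in> sq_mats n" and M: "e_MASA K M" and N: "MASA n (o_alg K) (o_proj n M)"
    and sig: "has_signature Kt p\<^sub>0 q\<^sub>0" and m: "m = p\<^sub>0 + q\<^sub>0" and k: "1 \<le> k" and km: "\<not> (k = 1 \<and> m = 0)"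
    and Q: "\<And>i. i < k \<Longrightarrow> Q i \<in> sq_mats m" "Q 0 = 1\<^sub>m m"
    and lr: "linearly_represented K (o_proj n M) (kravchuk_metric k Kt) (kravchuk_family k Kt Q)"
  shows "\<exists>Q. characterizes K (o_proj n M) p\<^sub>0 q\<^sub>0 k Kt Q"
proof -
  have Kt: "Kt \<in> sq_mats m" "Kt\<^sup>T = Kt" using sig unfolding has_signature_def m by auto
  have Kti: "invertible_mat Kt" using has_signature_invertible[OF sig] .
  have dK: "dim_row Kt = m" using Kt by simp
  have n: "n = k + m + k" by (rule characterized_form(1)[where Q = Q, OF K M k km Kt(1) Kti Q lr])
  obtain \<beta> \<gamma> where C: "normal_cocycle k m Q \<beta> \<gamma>" and r: "represented K M (kravchuk_metric k Kt) (nonsplit_set k Kt Q \<beta> \<gamma>)"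
    using characterized_form(2)[where Q = Q, OF K M k km Kt(1) Kti Q lr] by blast
  obtain k' where k': "k = Suc k'" using k by (cases k) auto
  obtain G where G: "G \<in> sq_mats k" "invertible_mat G"
    and Q0: "lin_comb_mat m k (vec_index (row G 0)) Q = 1\<^sub>m m"
    and tr: "\<And>i. 1 \<le> i \<Longrightarrow> i < k \<Longrightarrow> (\<Sum>r<m. lin_comb_mat m k (vec_index (row G i)) Q $$ (r, r)) = 0"
    and li: "1 \<le> m \<Longrightarrow> \<exists>l. 1 \<le> l \<and> l \<le> k \<and>
       (\<forall>c. lin_comb_mat m l c (\<lambda>i. lin_comb_mat m k (vec_index (row G i)) Q) = 0\<^sub>m m m \<longrightarrow> (\<forall>i<l. c i = 0)) \<and>
       (\<forall>i. l \<le> i \<and> i < k \<longrightarrow> lin_comb_mat m k (vec_index (row G i)) Q = 0\<^sub>m m m)"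
    using normalize_matrices[of k' Q m, folded k', OF Q] by blast
  obtain H where H: "H \<in> sq_mats k" "G * H = 1\<^sub>m k" "H * G = 1\<^sub>m k" using G by (auto elim: invertible_matE)
  define Q' where "Q' i = lin_comb_mat m k (vec_index (row G i)) Q" for i
  \<comment> \<open>Pulled back along Y |-> G Y G^T, so that the requirements of
    \<open>nonsplit_transform\<close> hold by construction.\<close>
  define \<beta>' where "\<beta>' a Y = \<beta> a (H * Y * H\<^sup>T)" for a Y
  define \<gamma>' where "\<gamma>' a Y = H\<^sup>T *\<^sub>v \<gamma> a (H * Y * H\<^sup>T)" for a Y
  have one: "(1\<^sub>m m :: real mat) \<in> sq_mats m" "1\<^sub>m m * 1\<^sub>m m = (1\<^sub>m m :: real mat)" by auto
  have K1: "1\<^sub>m m * Kt * (1\<^sub>m m)\<^sup>T = Kt" using Kt(1) by simp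
  have car: "\<beta>' a Y \<in> carrier_vec m \<and> \<gamma>' a Y \<in> carrier_vec k" if h: "a \<in> carrier_vec m" "Y \<in> skew_mats k" for a Y
    using cocycleD(1)[OF C h(1) skew_congruence[OF H(1) h(2)]] H(1) unfolding \<beta>'_def \<gamma>'_def by (auto intro!: carrier_vecI)
  have GHY: "H * (G * Y * G\<^sup>T) * H\<^sup>T = Y" if Y: "Y \<in> sq_mats k" for Y
  proof -
    have "H * (G * Y * G\<^sup>T) * H\<^sup>T = H * (G * (Y * (G\<^sup>T * H\<^sup>T)))" using G(1) H(1) Y by (simp add: mat_simps)
    also have "G\<^sup>T * H\<^sup>T = 1\<^sub>m k" using transpose_inverse[OF H(1) G(1) H(3)] .
    also have "H * (G * (Y * 1\<^sub>m k)) = Y" using mult_cancel_left_inverse[OF H(3)] G(1) H(1) Y by (simp add: mat_simps)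
    finally show ?thesis .
  qed
  have "represented (kravchuk_metric k Kt) (nonsplit_set k Kt Q \<beta> \<gamma>)
     (kravchuk_metric k (1\<^sub>m m * Kt * (1\<^sub>m m)\<^sup>T)) (nonsplit_set k (1\<^sub>m m * Kt * (1\<^sub>m m)\<^sup>T) Q' \<beta>' \<gamma>')"
  proof (rule nonsplit_transform[where c = "0\<^sub>v k" and \<phi> = "\<lambda>a. a", OF Kt(1) G(1) H one(1,1,2,2)])
    fix a :: "real vec" assume a: "a \<in> carrier_vec m"
    have A: "rows_mat k Q a \<in> carrier_mat k m" using rows_mat_carrier[OF a] .
    show "rows_mat k Q' a = G * rows_mat k Q a * 1\<^sub>m m"
      unfolding Q'_def using rows_mat_left_mult[where Q = Q, OF a G(1) Q(1)] G(1) A by simp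
    fix Y assume Y: "Y \<in> skew_mats k"
    have GY: "H * (G * Y * G\<^sup>T) * H\<^sup>T = Y" by (rule GHY[OF skew_carrier[OF Y]])
    have b: "\<beta> a Y \<in> carrier_vec m" "\<gamma> a Y \<in> carrier_vec k" using cocycleD(1,2)[OF C a Y] by auto
    show "\<beta> a Y \<in> carrier_vec m \<and> \<gamma> a Y \<in> carrier_vec k" using b by simp
    show "\<beta>' a (G * Y * G\<^sup>T) = 1\<^sub>m m *\<^sub>v (\<beta> a Y - Kt *\<^sub>v ((rows_mat k Q a)\<^sup>T *\<^sub>v 0\<^sub>v k))"
      unfolding \<beta>'_def GY using b A Kt(1) by (simp add: mat_simps)
    show "\<gamma>' a (G * Y * G\<^sup>T) = H\<^sup>T *\<^sub>v \<gamma> a Y" unfolding \<gamma>'_def GY ..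
  qed auto
  then have r': "represented K M (kravchuk_metric k Kt) (nonsplit_set k Kt Q' \<beta>' \<gamma>')"
    unfolding K1 using represented_trans[OF K e_MASA_subset[OF K M] r] by blast
  have "o_proj n (nonsplit_set k Kt Q' \<beta>' \<gamma>') = kravchuk_family k Kt Q'"
    unfolding n by (rule nonsplit_set_pairs(3)[OF Kt(1)]) (rule car)
  then have lr': "linearly_represented K (o_proj n M) (kravchuk_metric k Kt) (kravchuk_family k Kt Q')"
    using represented_e_MASA(3)[OF K M r'] by simp
  have N': "MASA (k + m + k) (o_alg (kravchuk_metric k Kt)) (kravchuk_family k Kt Q')"
    using linearly_represented_MASA[OF K N lr'] unfolding n .
  have Q': "Q' i \<in> sq_mats m" "Q' 0 = 1\<^sub>m m" for i unfolding Q'_def Q0 by auto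
  note ab = abelian_family[where Q = Q', OF Kt Kti k Q' MASA_commute[OF N']]
  have "free_rowed_matrices k Kt Q'" unfolding free_rowed_matrices_def Let_def dK
  proof (intro conjI allI impI)
    fix i j assume "i < k" "j < k"
    then show "lie_bracket (Q' i) (Q' j) = 0\<^sub>m m m" using ab(2) bracket_zero_iff[OF Q'(1) Q'(1)] by blast
  next
    assume "k = 2 \<and> 2 \<le> m"
    then show "Q' 1 \<noteq> 0\<^sub>m m m" using second_matrix_nonzero[of Kt m Q'] Kt(1) Q'(1) N' by blast
  qed (use Q' ab(1) tr[folded Q'_def] li[folded Q'_def] in auto)
  then show ?thesis using sig lr' unfolding characterizes_def kravchuk_family_def by blast
qed


text \<open>For m at most 1 a row vector is a single number or empty, so the given set is the family
  with Q_1 the identity and Q_2 = 0.\<close>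

lemma degenerate_characterization:
  assumes sig: "has_signature Kt p\<^sub>0 q\<^sub>0" and m1: "p\<^sub>0 + q\<^sub>0 \<le> 1"
    and lr: "linearly_represented K N (kravchuk_metric 2 Kt)
      {kravchuk_mat Kt (mat 2 (p\<^sub>0 + q\<^sub>0) (\<lambda>(i, j). if i = 0 then a else 0)) (0\<^sub>m (p\<^sub>0 + q\<^sub>0) (p\<^sub>0 + q\<^sub>0)) Y | a Y. Y \<in> skew_mats 2}"
  shows "\<exists>Q. characterizes K N p\<^sub>0 q\<^sub>0 2 Kt Q"
proof -
  define m where "m = p\<^sub>0 + q\<^sub>0"
  have Kt: "Kt \<in> sq_mats m" using sig unfolding has_signature_def m_def by auto
  have dK: "dim_row Kt = m" using Kt by simp
  have m: "m \<le> 1" using m1 unfolding m_def .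
  define Q where "Q i = (if i = 0 then 1\<^sub>m m else 0\<^sub>m m m :: real mat)" for i :: nat
  have Q: "Q i \<in> sq_mats m" for i unfolding Q_def by simp
  have rows: "rows_mat 2 Q (vec m (\<lambda>_. a)) = mat 2 m (\<lambda>(i, j). if i = 0 then a else 0)" for a
    by (rule rows_mat_eqI) (use Q in \<open>auto simp: Q_def mat_dim_simps\<close>)
  \<comment> \<open>For m = 0 the value of \<open>\<alpha> $ 0\<close> is unspecified, but it then
    occurs only in an empty vector.\<close>
  have vec: "\<alpha> = vec m (\<lambda>_. \<alpha> $ 0)" if "\<alpha> \<in> carrier_vec m" for \<alpha> :: "real vec"
  proof (rule eq_vecI)
    fix i assume "i < dim_vec (vec m (\<lambda>_. \<alpha> $ 0))"
    then have "i = 0" "i < m" using m by auto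
    then show "\<alpha> $ i = vec m (\<lambda>_. \<alpha> $ 0) $ i" by simp
  qed (use that in simp)
  have "{kravchuk_mat Kt (mat 2 m (\<lambda>(i, j). if i = 0 then a else 0)) (0\<^sub>m m m) Y | a Y. Y \<in> skew_mats 2}
    = {kravchuk_mat Kt (rows_mat 2 Q \<alpha>) (0\<^sub>m m m) Y | \<alpha> Y. \<alpha> \<in> carrier_vec m \<and> Y \<in> skew_mats 2}" (is "?L = ?R")
  proof
    show "?L \<subseteq> ?R" unfolding rows[symmetric] using vec_carrier by blast
    show "?R \<subseteq> ?L"
    proof
      fix X assume "X \<in> ?R"
      then obtain \<alpha> Y where X: "\<alpha> \<in> carrier_vec m" "Y \<in> skew_mats 2" "X = kravchuk_mat Kt (rows_mat 2 Q \<alpha>) (0\<^sub>m m m) Y" by blast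
      have "rows_mat 2 Q \<alpha> = mat 2 m (\<lambda>(i, j). if i = 0 then \<alpha> $ 0 else 0)" using vec[OF X(1)] rows[of "\<alpha> $ 0"] by metis
      then show "X \<in> ?L" using X(2,3) unfolding mem_Collect_eq by (intro exI[of _ "\<alpha> $ 0"] exI[of _ Y]) simp
    qed
  qed
  then have lr': "linearly_represented K N (kravchuk_metric 2 Kt)
    {kravchuk_mat Kt (rows_mat 2 Q \<alpha>) (0\<^sub>m m m) Y | \<alpha> Y. \<alpha> \<in> carrier_vec m \<and> Y \<in> skew_mats 2}"
    using lr unfolding m_def by simp
  have "free_rowed_matrices 2 Kt Q" unfolding free_rowed_matrices_def Let_def dK
  proof (intro conjI allI impI)
    fix i j :: nat
    show "Q i \<in> sq_mats m" "Q i * Kt = Kt * (Q i)\<^sup>T" using Kt unfolding Q_def by (auto simp: mat_dim_simps)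
    show "lie_bracket (Q i) (Q j) = 0\<^sub>m m m" using bracket_zero_iff[OF Q Q, of i j] unfolding Q_def by auto
    show "Q 0 = 1\<^sub>m m" unfolding Q_def by simp
    show "(\<Sum>r<m. Q i $$ (r, r)) = 0" if "1 \<le> i \<and> i < 2" using that unfolding Q_def by simp
    show "\<exists>l. 1 \<le> l \<and> l \<le> 2 \<and> (\<forall>c. lin_comb_mat m l c Q = 0\<^sub>m m m \<longrightarrow> (\<forall>i<l. c i = 0)) \<and>
       (\<forall>i. l \<le> i \<and> i < 2 \<longrightarrow> Q i = 0\<^sub>m m m)" if "1 \<le> m"
    proof (intro exI[of _ 1] conjI allI impI)
      fix c :: "nat \<Rightarrow> real" and i :: nat assume c: "lin_comb_mat m 1 c Q = 0\<^sub>m m m" and i: "i < 1"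
      show "c i = 0" using arg_cong[OF c, of "\<lambda>x. x $$ (0, 0)"] that i unfolding lin_comb_mat_def Q_def by simp
    qed (auto simp: Q_def)
    show "Q 1 \<noteq> 0\<^sub>m m m" if "2 = (2::nat) \<and> 2 \<le> m" using that m by simp
  qed
  then show ?thesis using sig lr' unfolding characterizes_def dK by blast
qed

section \<open>Exclusion of k = 1, m = 0, and the classification\<close>

lemma o_proj_zero_splitting:
  assumes K: "K \<in> sq_mats n" and M: "e_MASA K M" and z: "o_proj n M \<subseteq> {0\<^sub>m n n}"
  shows "splitting K M"
proof (rule splittingI[OF K M zero_carrier_vec])
  fix X b assume "(X, b) \<in> pairs n M"
  then have "X = 0\<^sub>m n n" using z unfolding o_proj_pairs by force
  then show "(X, X *\<^sub>v 0\<^sub>v n) \<in> pairs n M" using e_MASA_pairs(3)[OF K M] by (simp add: mat_dim_simps)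
qed

text \<open>A has no entries and skew matrices of size 1 vanish, so the projection is zero and
  \<open>M\<close> consists of translations.\<close>

lemma no_rank_one_family:
  assumes K: "K \<in> sq_mats n" and M: "e_MASA K M" and Kt: "Kt \<in> sq_mats 0"
    and lr: "linearly_represented K (o_proj n M) (kravchuk_metric 1 Kt) (kravchuk_family 1 Kt Q)"
  shows "splitting K M"
proof (rule o_proj_zero_splitting[OF K M])
  obtain G where G: "G \<in> sq_mats n" "invertible_mat G" "kravchuk_metric 1 Kt = G * K * G\<^sup>T"
    "kravchuk_family 1 Kt Q = conj_set G (o_proj n M)" using lr K unfolding linearly_represented_def by auto
  obtain H where H: "H \<in> sq_mats n" "G * H = 1\<^sub>m n" "H * G = 1\<^sub>m n" "mat_inv G = H" using G by (auto elim: invertible_matE)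
  have dK: "dim_row Kt = 0" using Kt by simp
  show "o_proj n M \<subseteq> {0\<^sub>m n n}"
  proof
    fix X assume X: "X \<in> o_proj n M"
    then have Xc: "X \<in> sq_mats n" unfolding o_proj_def by blast
    have "G * X * H \<in> kravchuk_family 1 Kt Q" unfolding G(4) conj_set_def H(4) using X by blast
    then obtain a Y where e: "a \<in> carrier_vec 0" "Y \<in> skew_mats 1" "G * X * H = kravchuk_mat Kt (rows_mat 1 Q a) (0\<^sub>m 0 0) Y"
      unfolding kravchuk_family_def dK by blast
    have A: "rows_mat 1 Q a \<in> carrier_mat 1 0" using rows_mat_carrier[OF e(1)] .
    \<comment> \<open>Both parameters are unchanged under multiplication by 0, so the member equals
      0 times itself.\<close>
    have "0 \<cdot>\<^sub>m (G * X * H) = kravchuk_mat Kt (0 \<cdot>\<^sub>m rows_mat 1 Q a) (0 \<cdot>\<^sub>m 0\<^sub>m 0 0) (0 \<cdot>\<^sub>m Y)"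
      unfolding e(3) by (rule kravchuk_smult[OF Kt A zero_carrier_mat skew_carrier[OF e(2)]])
    also have "0 \<cdot>\<^sub>m rows_mat 1 Q a = rows_mat 1 Q a" using A by (intro eq_matI) auto
    also have "0 \<cdot>\<^sub>m Y = Y" using skew_one[OF e(2)] by (intro eq_matI) auto
    finally have "G * X * H = 0 \<cdot>\<^sub>m (G * X * H)" using e(3) by simp
    also have "\<dots> = 0\<^sub>m n n" using G(1) H(1) Xc by (intro eq_matI) auto
    also have "\<dots> = G * 0\<^sub>m n n * H" using G(1) H(1) by simp
    finally show "X \<in> {0\<^sub>m n n}" using conj_inj[OF G(1) H(1-3) Xc zero_carrier_mat] by blast
  qed
qed

text \<open>The degenerate sets for k = 2, m at most 1 are treated directly. In all other cases the
  normal form with S = 0 is reached first and the Q_i are normalized afterwards. The pair k = 1, m =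
  0 contradicts nonsplitting.\<close>

lemma free_rowed_characterized:
  assumes K: "K \<in> sq_mats n" and M: "e_MASA K M" and ns: "\<not> splitting K M" and k: "1 \<le> k"
    and fr: "free_rowed_MANS K (o_proj n M) p\<^sub>0 q\<^sub>0 k"
  shows "\<not> (k = 1 \<and> p\<^sub>0 + q\<^sub>0 = 0)" "\<exists>Kt Q. characterizes K (o_proj n M) p\<^sub>0 q\<^sub>0 k Kt Q"
proof -
  have dK: "dim_row K = n" using K by simp
  have *: "\<not> (k = 1 \<and> p\<^sub>0 + q\<^sub>0 = 0) \<and> (\<exists>Kt Q. characterizes K (o_proj n M) p\<^sub>0 q\<^sub>0 k Kt Q)"
  proof (cases "k = 2 \<and> p\<^sub>0 + q\<^sub>0 \<le> 1")
    case True
    then have "degenerate_MANS K (o_proj n M) p\<^sub>0 q\<^sub>0 k" using fr unfolding free_rowed_MANS_def by simp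
    then obtain Kt where "\<exists>Q. characterizes K (o_proj n M) p\<^sub>0 q\<^sub>0 2 Kt Q"
      unfolding degenerate_MANS_def using degenerate_characterization by blast
    then show ?thesis using True by auto
  next
    case False
    then obtain Kt N' where N: "MASA n (o_alg K) (o_proj n M)" and sig: "has_signature Kt p\<^sub>0 q\<^sub>0"
      and lr: "linearly_represented K (o_proj n M) (kravchuk_metric k Kt) N'" and nf: "free_rowed_normal_form k Kt N'"
      using fr unfolding free_rowed_MANS_def MANS_def dK by auto
    define m where "m = p\<^sub>0 + q\<^sub>0"
    have Kt: "Kt \<in> sq_mats m" "Kt\<^sup>T = Kt" using sig unfolding has_signature_def m_def by auto
    have Kti: "invertible_mat Kt" using has_signature_invertible[OF sig] .
    have "dim_row (kravchuk_metric k Kt) = n" using lr K unfolding linearly_represented_def by auto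
    then have n: "n = k + m + k" using kravchuk_metric3[OF Kt(1)] by simp
    have "MASA (k + m + k) (o_alg (kravchuk_metric k Kt)) N'" using linearly_represented_MASA[OF K N lr] unfolding n .
    from free_rowed_normal_family[OF Kt Kti k this nf] obtain Q where Q: "\<And>i. i < k \<Longrightarrow> Q i \<in> sq_mats m" "Q 0 = 1\<^sub>m m"
      "N' = kravchuk_family k Kt Q" by blast
    have km: "\<not> (k = 1 \<and> m = 0)"
    proof
      assume "k = 1 \<and> m = 0"
      then have "splitting K M" using no_rank_one_family[OF K M, of Kt Q] Kt(1) lr Q(3) by simp
      then show False using ns by simp
    qed
    show ?thesis using km free_rowed_characterization[where Q = Q, OF K M N sig m_def k km Q(1,2) lr[unfolded Q(3)]]
      unfolding m_def by blast
  qed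
  then show "\<not> (k = 1 \<and> p\<^sub>0 + q\<^sub>0 = 0)" "\<exists>Kt Q. characterizes K (o_proj n M) p\<^sub>0 q\<^sub>0 k Kt Q" by blast+
qed

lemma has_signature_square: "has_signature K p q \<Longrightarrow> K \<in> sq_mats (dim_row K)"
  unfolding has_signature_def by auto

lemma characterizesD:
  assumes "characterizes K N p\<^sub>0 q\<^sub>0 k Kt Q"
  shows "Kt \<in> sq_mats (p\<^sub>0 + q\<^sub>0)" "Kt\<^sup>T = Kt" "invertible_mat Kt" "has_signature Kt p\<^sub>0 q\<^sub>0"
    "free_rowed_matrices k Kt Q" "linearly_represented K N (kravchuk_metric k Kt) (kravchuk_family k Kt Q)"
  using assms has_signature_invertible[of Kt p\<^sub>0 q\<^sub>0] unfolding characterizes_def has_signature_def kravchuk_family_def by auto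

text \<open>Outside k = 2, \<mu> at least 2, the normal form holds for any characterizing
  \<open>Kt\<close> and \<open>Q\<close>. In that case the alternative depends on the shape of the
  second matrix, so \<open>Kt'\<close> and \<open>Q'\<close> are chosen together with
  \<Lambda>.\<close>

theorem theorem5p1:
  shows "
    (\<forall>p q K M p\<^sub>0 q\<^sub>0 k\<^sub>0 nb bs kp km.
       q \<le> p \<and> has_signature K p q \<and> e_MASA K M \<and> \<not> splitting K M \<and>
       canonical_form p q K M p\<^sub>0 q\<^sub>0 k\<^sub>0 nb bs kp km \<longrightarrow>
       (\<exists>K\<^sub>0 N. nb = Some (K\<^sub>0, N) \<and> MANS_block K\<^sub>0 N p\<^sub>0 q\<^sub>0 k\<^sub>0) \<and>
       1 \<le> k\<^sub>0 \<and> k\<^sub>0 \<le> q \<and> min (p\<^sub>0 + k\<^sub>0) (q\<^sub>0 + k\<^sub>0) \<ge> 1)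
    \<and>
    (\<forall>p\<^sub>0 q\<^sub>0 k\<^sub>0 \<mu> K M.
       1 \<le> k\<^sub>0 \<and> \<mu> = p\<^sub>0 + q\<^sub>0 \<and> has_signature K (p\<^sub>0 + k\<^sub>0) (q\<^sub>0 + k\<^sub>0) \<and>
       e_MASA K M \<and> \<not> splitting K M \<and>
       free_rowed_MANS K (o_proj (dim_row K) M) p\<^sub>0 q\<^sub>0 k\<^sub>0 \<longrightarrow>
       \<not> (k\<^sub>0 = 1 \<and> \<mu> = 0) \<and>
       (\<exists>Kt Q. characterizes K (o_proj (dim_row K) M) p\<^sub>0 q\<^sub>0 k\<^sub>0 Kt Q) \<and>
       (\<forall>Kt Q. characterizes K (o_proj (dim_row K) M) p\<^sub>0 q\<^sub>0 k\<^sub>0 Kt Q \<longrightarrow>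
          (k\<^sub>0 \<ge> 3 \<longrightarrow>
             (\<exists>\<Lambda>. Lambda_condition k\<^sub>0 Kt Q \<Lambda> \<and>
                represented K M (kravchuk_metric k\<^sub>0 Kt)
                  (nonsplit_set k\<^sub>0 Kt Q (\<lambda>\<alpha> Y. row_mult \<alpha> \<Lambda>) (\<lambda>\<alpha> Y. 0\<^sub>v k\<^sub>0)))) \<and>
          (k\<^sub>0 = 2 \<and> \<mu> \<ge> 2 \<longrightarrow>
             (\<exists>Kt' Q' \<Lambda>. characterizes K (o_proj (dim_row K) M) p\<^sub>0 q\<^sub>0 k\<^sub>0 Kt' Q' \<and>
                Lambda_condition k\<^sub>0 Kt' Q' \<Lambda> \<and>
                represented K M (kravchuk_metric k\<^sub>0 Kt')
                  (if special_Q p\<^sub>0 q\<^sub>0 Kt' (Q' 1)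
                   then nonsplit_set k\<^sub>0 Kt' Q'
                          (\<lambda>\<alpha> Y. row_mult \<alpha> \<Lambda> + Y $$ (0, 1) \<cdot>\<^sub>v unit_vec \<mu> 0)
                          (\<lambda>\<alpha> Y. vec_of_list [0, \<alpha> \<bullet> unit_vec \<mu> 0])
                   else nonsplit_set k\<^sub>0 Kt' Q' (\<lambda>\<alpha> Y. row_mult \<alpha> \<Lambda>) (\<lambda>\<alpha> Y. 0\<^sub>v 2)))) \<and>
          (k\<^sub>0 = 2 \<and> \<mu> = 1 \<longrightarrow>
             (\<exists>\<rho> p\<^sub>2. (\<rho>, p\<^sub>2) \<in> {(1, 0), (0, 1), (1, 1)} \<and>
                represented K M (kravchuk_metric k\<^sub>0 Kt)
                  (nonsplit_set k\<^sub>0 Kt Q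
                     (\<lambda>\<alpha> Y. vec_of_list [Y $$ (0, 1) * \<rho>])
                     (\<lambda>\<alpha> Y. vec_of_list [0, \<alpha> $ 0 * \<rho> + p\<^sub>2 * Y $$ (0, 1)])))) \<and>
          (k\<^sub>0 = 2 \<and> \<mu> = 0 \<longrightarrow>
             represented K M (kravchuk_metric k\<^sub>0 Kt)
               (nonsplit_set k\<^sub>0 Kt Q (\<lambda>\<alpha> Y. 0\<^sub>v 0) (\<lambda>\<alpha> Y. vec_of_list [Y $$ (0, 1), 0]))) \<and>
          (k\<^sub>0 = 1 \<and> \<mu> \<ge> 2 \<longrightarrow>
             (\<exists>\<Lambda>\<in>carrier_mat \<mu> \<mu>. \<Lambda> = \<Lambda>\<^sup>T \<and>
                represented K M (kravchuk_metric k\<^sub>0 Kt)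
                  (nonsplit_set k\<^sub>0 Kt Q (\<lambda>\<alpha> Y. row_mult \<alpha> \<Lambda>) (\<lambda>\<alpha> Y. 0\<^sub>v 1)))) \<and>
          (k\<^sub>0 = 1 \<and> \<mu> = 1 \<longrightarrow>
             represented K M (kravchuk_metric k\<^sub>0 Kt)
               (nonsplit_set k\<^sub>0 Kt Q (\<lambda>\<alpha> Y. 0\<^sub>v 1) (\<lambda>\<alpha> Y. vec_of_list [\<alpha> $ 0])))))
    \<and>
    (\<forall>p\<^sub>0 q\<^sub>0 k\<^sub>0 \<mu> Kt Q \<Lambda> \<Lambda>' g \<theta> G\<^sub>2.
       \<mu> = p\<^sub>0 + q\<^sub>0 \<and> (k\<^sub>0 \<ge> 3 \<or> k\<^sub>0 = 1 \<and> \<mu> \<ge> 2) \<and>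
       has_signature Kt p\<^sub>0 q\<^sub>0 \<and> free_rowed_matrices k\<^sub>0 Kt Q \<and>
       Lambda_condition k\<^sub>0 Kt Q \<Lambda> \<and> Lambda_condition k\<^sub>0 Kt Q \<Lambda>' \<and>
       e_MASA (kravchuk_metric k\<^sub>0 Kt) (Lambda_set k\<^sub>0 Kt Q \<Lambda>) \<and>
       \<not> splitting (kravchuk_metric k\<^sub>0 Kt) (Lambda_set k\<^sub>0 Kt Q \<Lambda>) \<and>
       e_MASA (kravchuk_metric k\<^sub>0 Kt) (Lambda_set k\<^sub>0 Kt Q \<Lambda>') \<and>
       \<not> splitting (kravchuk_metric k\<^sub>0 Kt) (Lambda_set k\<^sub>0 Kt Q \<Lambda>') \<and>
       (\<forall>j<k\<^sub>0. g j \<noteq> 0) \<and> G\<^sub>2 \<in> O_grp Kt \<and>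
       (\<forall>j<k\<^sub>0. Q j = (g j / g 0) \<cdot>\<^sub>m (G\<^sub>2 * Q j * mat_inv G\<^sub>2)) \<and>
       \<Lambda>' = (1 / g 0) \<cdot>\<^sub>m
              (G\<^sub>2 * (\<Lambda> - lin_comb_mat \<mu> k\<^sub>0 \<theta> (\<lambda>k. Q k * Kt)) * G\<^sub>2\<^sup>T) \<longrightarrow>
       E_conjugate (kravchuk_metric k\<^sub>0 Kt)
         (Lambda_set k\<^sub>0 Kt Q \<Lambda>) (Lambda_set k\<^sub>0 Kt Q \<Lambda>'))"
proof (rule conjI[OF _ conjI], goal_cases)
  case 1
  show ?case by (intro allI impI, elim conjE, rule nonsplitting_contains_MANS)
next
  case 2
  show ?case
  proof (intro allI impI, elim conjE, goal_cases)
    case (1 p\<^sub>0 q\<^sub>0 k\<^sub>0 \<mu> K M)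
    note k = 1(1) and \<mu> = 1(2) and ns = 1(5)
    have K: "K \<in> sq_mats (dim_row K)" "e_MASA K M" using 1 has_signature_square by blast+
    note F = free_rowed_characterized[OF K ns k 1(6)]
    show ?case unfolding \<mu>
    proof (intro conjI allI impI, goal_cases)
      \<comment> \<open>Goals 1 and 2 are the facts \<open>F\<close>; goals 3 to 8 are the six
        normal forms in the order of the statement.\<close>
      case (3 Kt Q)
      note C = characterizesD[OF 3(1)]
      show ?case by (rule nonsplit_large[OF K ns C(1-3) k F(1) C(5,6) 3(2)])
    next
      case (4 Kt Q)
      then have k2: "k\<^sub>0 = 2" and m: "2 \<le> p\<^sub>0 + q\<^sub>0" by auto
      note C = characterizesD[OF 4(1)[unfolded k2]]
      show ?case unfolding k2 characterizes_def kravchuk_family_def[symmetric]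
        using nonsplit_two_large[OF K C(4) m C(5,6)] by (simp only: conj_assoc)
    next
      case (5 Kt Q)
      note C = characterizesD[OF 5(1)]
      show ?case by (rule nonsplit_two_one[OF K ns C(1-3) k F(1) C(5,6)]) (use 5 in auto)
    next
      case (6 Kt Q)
      note C = characterizesD[OF 6(1)]
      show ?case by (rule nonsplit_two_zero[OF K ns C(1-3) k F(1) C(5,6)]) (use 6 in auto)
    next
      case (7 Kt Q)
      note C = characterizesD[OF 7(1)]
      show ?case by (rule nonsplit_one[OF K ns C(1-3) k F(1) C(5,6)]) (use 7 in auto)
    next
      case (8 Kt Q)
      note C = characterizesD[OF 8(1)]
      show ?case by (rule nonsplit_one_one[OF K ns C(1-3) k F(1) C(5,6)]) (use 8 in auto)
    qed (rule F)+
  qed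
next
  case 3
  show ?case
  proof (intro allI impI, goal_cases)
    case (1 p\<^sub>0 q\<^sub>0 k\<^sub>0 \<mu> Kt Q \<Lambda> \<Lambda>' g \<theta> G\<^sub>2)
    then have sig: "has_signature Kt p\<^sub>0 q\<^sub>0" and k: "1 \<le> k\<^sub>0" and Kt: "Kt \<in> sq_mats \<mu>" "Kt\<^sup>T = Kt"
      unfolding has_signature_def by auto
    have L: "\<Lambda> \<in> sq_mats \<mu>" using 1 Kt(1) unfolding Lambda_condition_def by auto
    show ?case by (rule Lambda_conjugation[where g = g and Q = Q, OF Kt k _ L _ _ has_signature_invertible[OF sig]]) (use 1 in auto)
  qed
qed

end
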